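(* Let $G$ be a connected graph $2$-cell embedded in a surface $\Sigma$, with at least one edge, represented by a band decomposition $N$ of $\Sigma$ with $0$-bands $\overline{c_v}$ ($v\in V(G)$), $1$-bands $\overline{q_e}$ ($e\in E(G)$) and $2$-bands $\overline{a_f}$ ($f\in F(G)$). Let $\Theta(N)$ be the embedded graph formed by the boundaries of the bands, and let $D\subseteq E(G)$. Then a band decomposition $N^D$ corresponding to the partial dual $G^D$ of $G$ with respect to $D$ may be constructed as follows. (1) Let $\Delta\subseteq\Sigma$ be the (possibly disconnected) union of $\overline{c_v}$ for all $v\in V(G)$ and $\overline{q_e}$ for all $e\in D$. Let the boundary of $\Delta$ be $C'=C'_1\cup C'_2\cup\dots\cup C'_k$, where each $C'_i$ is a simple closed curve, representing a cycle in $\Theta(N)$. (2) Let $P=E(G)-D$ and let $\Pi\subseteq\Sigma$ be the (possibly disconnected) union of $\overline{c_v}$ for all $v\in V(G)$ and $\overline{q_e}$ for all $e\in P$. Let the boundary of $\Pi$ be $A'=A'_1\cup A'_2\cup\dots\cup A'_\ell$, where each $A'_j$ is a simple closed curve, representing a cycle in $\Theta(N)$. (3) Delete from $N$ all $0$-band interiors $c_v$, $v\in V(G)$, and all $2$-band interiors $a_f$, $f\in F(G)$, leaving the union of $\Theta(N)$ and all $\overline{q_e}$, $e\in E(G)$. Glue on new $0$-bands $\overline{c'_i}$ with $\partial c'_i=C'_i$ for $i=1,\dots,k$, and new $2$-bands $\overline{a'_j}$ with $\partial a'_j=A'_j$ for $j=1,\dots,\ell$. The result is $N^D$.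
   Context: Graphs are finite and may have loops and multiple edges. A surface is a connected compact $2$-manifold without boundary. A graph embedding is $2$-cell if every face is an open disk; $V(G),E(G),F(G)$ denote the vertices, edges and faces of the embedding. Embeddings related by a homeomorphism of the surface are regarded as equivalent. $\overline{X}$ and $\partial X$ denote closure and boundary. Band decomposition: the vertices and edges of $G$ are fattened into closed disks, the $0$-bands $\overline{c_v}$ and the $1$-bands $\overline{q_e}$ respectively; the complement of these bands consists of open disks $a_f\subseteq f$, one per face $f$, whose closures $\overline{a_f}$ are the $2$-bands. Here $c_v,q_e,a_f$ are the interiors of the bands, which are pairwise disjoint, and the bands cover $\Sigma$. Each $1$-band is a quadrilateral whose boundary consists of four segments, alternately shared with $0$-bands (at the ends of $e$) and with $2$-bands (along the sides of $e$). $1$-bands of edges consecutive around a vertex are allowed either to be disjoint or to meet at a point (so a $1$-band may also touch itself, i.e. be a closed disk with one or two pairs of boundary points identified). $\Theta(N)$ is the embedded graph whose vertices are the points where one $0$-band, one $2$-band and one or two $1$-bands meet, whose edges are the boundary segments between these points, and whose faces are the interiors of the bands. A band decomposition determines the embedding: $0$-, $1$- and $2$-bands correspond to vertices, edges and faces. A ribbon graph $O$ of $G$ is obtained from a band decomposition (with, say, pairwise disjoint $1$-bands) by discarding the $2$-bands; the embedding is recovered by gluing a $2$-band (disk) along each boundary component. Partial dual $G^D$ (ribbon graph definition): given a ribbon graph $O$ of $G$ and $D\subseteq E(G)$, let $\Delta$ be the ribbon subgraph consisting of $\overline{c_v}$ for all $v\in V(G)$ and $\overline{q_e}$ for $e\in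 D$, and let its boundary components be the simple closed curves $C'_1,\dots,C'_k$. Add to $O$ a new $0$-band $\overline{c'_i}$ with boundary $C'_i$ for each $i$, and then remove every old $0$-band interior $c_v$, $v\in V(G)$. The result is a ribbon graph $O^D$ with $0$-bands $\overline{c'_i}$ and $1$-bands $\overline{q_e}$, and $G^D$ is the graph embedding represented by $O^D$. *)

theory Defs
  imports "HOL-Homology.Homology"
begin

section \<open>Surfaces and curves\<close>

abbreviation closed_disk :: "complex set" where "closed_disk \<equiv> cball 0 1"
abbreviation open_disk :: "complex set" where "open_disk \<equiv> ball 0 1"
abbreviation unit_circle :: "complex set" where "unit_circle \<equiv> sphere 0 1"

definition locally_planar_at :: "'a topology \<Rightarrow> 'a \<Rightarrow> bool" where
  "locally_planar_at X x \<longleftrightarrow>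
     (\<exists>U (W::complex set). openin X U \<and> x \<in> U \<and> open W \<and>
        subtopology X U homeomorphic_space top_of_set W)"

text \<open>Connected compact 2-manifolds without boundary. Second countability need not be
  required: it follows from compactness and local planarity.\<close>

definition surface :: "'a topology \<Rightarrow> bool" where
  "surface X \<longleftrightarrow> topspace X \<noteq> {} \<and> connected_space X \<and> compact_space X \<and> Hausdorff_space X \<and>
     (\<forall>x\<in>topspace X. locally_planar_at X x)"

text \<open>The intrinsic boundary of a 2-manifold with boundary (used for ribbon graphs, which are
  not given as subsets of a surface).\<close>

definition manifold_boundary :: "'a topology \<Rightarrow> 'a set" where
  "manifold_boundary T = {x \<in> topspace T. \<not> locally_planar_at T x}"

definition simple_closed_curve :: "'a topology \<Rightarrow> 'a set \<Rightarrow> bool" where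
  "simple_closed_curve X B \<longleftrightarrow> B \<subseteq> topspace X \<and>
     subtopology X B homeomorphic_space top_of_set unit_circle"

section \<open>Graph embeddings\<close>

text \<open>A graph (loops and multiple edges allowed) drawn in a space with points in \<open>'a\<close>:
  \<open>ends e\<close> is the set of the one or two ends of \<open>e\<close>, \<open>point v\<close> the point representing \<open>v\<close>,
  and \<open>curve e\<close>, restricted to the unit interval, the curve representing \<open>e\<close>.\<close>

record ('a, 'v, 'e) embedded_graph =
  verts :: "'v set"
  edges :: "'e set"
  ends :: "'e \<Rightarrow> 'v set"
  point :: "'v \<Rightarrow> 'a"
  curve :: "'e \<Rightarrow> real \<Rightarrow> 'a"

definition graph_embedding :: "'a topology \<Rightarrow> ('a, 'v, 'e) embedded_graph \<Rightarrow> bool" where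
  "graph_embedding X G \<longleftrightarrow>
     finite (verts G) \<and> finite (edges G) \<and> (\<forall>e\<in>edges G. ends G e \<subseteq> verts G) \<and>
     point G ` verts G \<subseteq> topspace X \<and> inj_on (point G) (verts G) \<and>
     (\<forall>e\<in>edges G. pathin X (curve G e) \<and>
        {curve G e 0, curve G e 1} = point G ` ends G e \<and>
        inj_on (curve G e) {0<..<1} \<and>
        curve G e ` {0<..<1} \<inter> point G ` verts G = {}) \<and>
     (\<forall>e\<in>edges G. \<forall>e'\<in>edges G. e \<noteq> e' \<longrightarrow>
        curve G e ` {0<..<1} \<inter> curve G e' ` {0<..<1} = {})"

definition connected_graph :: "('a, 'v, 'e) embedded_graph \<Rightarrow> bool" where
  "connected_graph G \<longleftrightarrow> verts G \<noteq> {} \<and>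
     (\<forall>u\<in>verts G. \<forall>w\<in>verts G. (u, w) \<in> {(x, y). \<exists>e\<in>edges G. ends G e = {x, y}}\<^sup>*)"

definition drawing :: "('a, 'v, 'e) embedded_graph \<Rightarrow> 'a set" where
  "drawing G = point G ` verts G \<union> (\<Union>e\<in>edges G. curve G e ` {0..1})"

definition faces :: "'a topology \<Rightarrow> ('a, 'v, 'e) embedded_graph \<Rightarrow> 'a set set" where
  "faces X G = connected_components_of (subtopology X (topspace X - drawing G))"

definition two_cell :: "'a topology \<Rightarrow> ('a, 'v, 'e) embedded_graph \<Rightarrow> bool" where
  "two_cell X G \<longleftrightarrow>
     (\<forall>f\<in>faces X G. subtopology X f homeomorphic_space top_of_set open_disk)"

section \<open>Band decompositions\<close>

text \<open>A band system records the \<^emph>\<open>interiors\<close> of the bands: \<open>zero_band N v\<close> and \<open>one_band N e\<close> for the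
  0- and 1-bands, and the set \<open>two_bands N\<close> of all interiors of 2-bands. The bands themselves are
  the closures.\<close>

record ('a, 'v, 'e) bands =
  zero_index :: "'v set"
  one_index :: "'e set"
  zero_band :: "'v \<Rightarrow> 'a set"
  one_band :: "'e \<Rightarrow> 'a set"
  two_bands :: "'a set set"

definition zero_closed :: "'a topology \<Rightarrow> ('a, 'v, 'e) bands \<Rightarrow> 'a set" where
  "zero_closed X N = (\<Union>v\<in>zero_index N. X closure_of zero_band N v)"

definition two_closed :: "'a topology \<Rightarrow> ('a, 'v, 'e) bands \<Rightarrow> 'a set" where
  "two_closed X N = (\<Union>A\<in>two_bands N. X closure_of A)"

definition disk_band :: "'a topology \<Rightarrow> 'a set \<Rightarrow> bool" where
  "disk_band X A \<longleftrightarrow> openin X A \<and> X interior_of (X closure_of A) = A \<and>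
     (\<exists>h. homeomorphic_map (top_of_set closed_disk) (subtopology X (X closure_of A)) h \<and>
          h ` open_disk = A)"

abbreviation square :: "(real \<times> real) set" where "square \<equiv> {0..1} \<times> {0..1}"
abbreviation corners :: "(real \<times> real) set" where "corners \<equiv> {0, 1} \<times> {0, 1}"

text \<open>\<open>\<phi> e\<close> exhibits the 1-band of \<open>e\<close> as a quadrilateral: the sides \<open>{0, 1} \<times> [0, 1]\<close> are the ends
  of the band, shared with 0-bands, and the sides \<open>[0, 1] \<times> {0, 1}\<close> run along \<open>e\<close> and are shared with
  2-bands. 1-bands meet one another, or themselves, only at corners, and at most two corners
  (of one or two 1-bands) meet at any point.\<close>

definition quadrilaterals ::
  "'a topology \<Rightarrow> ('a, 'v, 'e) bands \<Rightarrow> ('e \<Rightarrow> real \<times> real \<Rightarrow> 'a) \<Rightarrow> bool" where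
  "quadrilaterals X N \<phi> \<longleftrightarrow>
     (\<forall>e\<in>one_index N.
        openin X (one_band N e) \<and> X interior_of (X closure_of one_band N e) = one_band N e \<and>
        continuous_map (top_of_set square) X (\<phi> e) \<and>
        \<phi> e ` square = X closure_of one_band N e \<and>
        \<phi> e ` ({0<..<1} \<times> {0<..<1}) = one_band N e \<and>
        inj_on (\<phi> e) (square - corners) \<and>
        \<phi> e ` corners \<inter> \<phi> e ` (square - corners) = {} \<and>
        (X closure_of one_band N e) \<inter> zero_closed X N = \<phi> e ` ({0, 1} \<times> {0..1}) \<and>
        (X closure_of one_band N e) \<inter> two_closed X N = \<phi> e ` ({0..1} \<times> {0, 1})) \<and>
     (\<forall>e\<in>one_index N. \<forall>e'\<in>one_index N. e \<noteq> e' \<longrightarrow>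
        (X closure_of one_band N e) \<inter> (X closure_of one_band N e') \<subseteq> \<phi> e ` corners) \<and>
     (\<forall>p. card {(e, z). e \<in> one_index N \<and> z \<in> corners \<and> \<phi> e z = p} \<le> 2)"

definition band_decomposition :: "'a topology \<Rightarrow> ('a, 'v, 'e) bands \<Rightarrow> bool" where
  "band_decomposition X N \<longleftrightarrow>
     finite (zero_index N) \<and> finite (one_index N) \<and> finite (two_bands N) \<and>
     (\<forall>v\<in>zero_index N. disk_band X (zero_band N v)) \<and>
     (\<forall>A\<in>two_bands N. disk_band X A) \<and>
     (\<exists>\<phi>. quadrilaterals X N \<phi>) \<and>
     (\<forall>v\<in>zero_index N. \<forall>w\<in>zero_index N. v \<noteq> w \<longrightarrow>
        (X closure_of zero_band N v) \<inter> (X closure_of zero_band N w) = {}) \<and>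
     (\<forall>A\<in>two_bands N. \<forall>B\<in>two_bands N. A \<noteq> B \<longrightarrow> (X closure_of A) \<inter> (X closure_of B) = {}) \<and>
     (\<forall>e\<in>one_index N. \<forall>e'\<in>one_index N. e \<noteq> e' \<longrightarrow> one_band N e \<inter> one_band N e' = {}) \<and>
     (\<forall>v\<in>zero_index N. \<forall>e\<in>one_index N. zero_band N v \<inter> one_band N e = {}) \<and>
     (\<forall>v\<in>zero_index N. \<forall>A\<in>two_bands N. zero_band N v \<inter> A = {}) \<and>
     (\<forall>e\<in>one_index N. \<forall>A\<in>two_bands N. one_band N e \<inter> A = {}) \<and>
     topspace X = zero_closed X N \<union> (\<Union>e\<in>one_index N. X closure_of one_band N e) \<union> two_closed X N"

text \<open>\<open>N\<close> represents the embedded graph \<open>G\<close>: each vertex lies inside its 0-band; each edge leaves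
  the 0-band of one end through an end side of its 1-band, traverses the 1-band, and enters the
  0-band of its other end through the opposite side; and there is exactly one 2-band in each
  face.\<close>

definition represents ::
  "'a topology \<Rightarrow> ('a, 'v, 'e) bands \<Rightarrow> ('a, 'v, 'e) embedded_graph \<Rightarrow> bool" where
  "represents X N G \<longleftrightarrow>
     graph_embedding X G \<and> band_decomposition X N \<and>
     zero_index N = verts G \<and> one_index N = edges G \<and>
     (\<forall>v\<in>verts G. point G v \<in> zero_band N v) \<and>
     (\<exists>\<phi>. quadrilaterals X N \<phi> \<and>
        (\<forall>e\<in>edges G. \<exists>s t. 0 < s \<and> s < t \<and> t < 1 \<and>
           (\<exists>u\<in>verts G. curve G e ` {0..<s} \<subseteq> zero_band N u) \<and>
           curve G e s \<in> \<phi> e ` ({0} \<times> {0<..<1}) \<and>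
           curve G e ` {s<..<t} \<subseteq> one_band N e \<and>
           curve G e t \<in> \<phi> e ` ({1} \<times> {0<..<1}) \<and>
           (\<exists>w\<in>verts G. curve G e ` {t<..1} \<subseteq> zero_band N w))) \<and>
     (\<forall>f\<in>faces X G. \<exists>!A. A \<in> two_bands N \<and> A \<subseteq> f) \<and>
     (\<forall>A\<in>two_bands N. \<exists>f\<in>faces X G. A \<subseteq> f)"

section \<open>The graph formed by the boundaries of the bands\<close>

definition theta :: "'a topology \<Rightarrow> ('a, 'v, 'e) bands \<Rightarrow> 'a set" where
  "theta X N = (\<Union>v\<in>zero_index N. X frontier_of zero_band N v) \<union>
     (\<Union>e\<in>one_index N. X frontier_of one_band N e) \<union> (\<Union>A\<in>two_bands N. X frontier_of A)"

definition theta_verts :: "'a topology \<Rightarrow> ('a, 'v, 'e) bands \<Rightarrow> 'a set" where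
  "theta_verts X N =
     zero_closed X N \<inter> (\<Union>e\<in>one_index N. X closure_of one_band N e) \<inter> two_closed X N"

text \<open>The edges of \<open>\<Theta>(N)\<close>, as open segments.\<close>

definition theta_edges :: "'a topology \<Rightarrow> ('a, 'v, 'e) bands \<Rightarrow> 'a set set" where
  "theta_edges X N = connected_components_of (subtopology X (theta X N - theta_verts X N))"

text \<open>A cycle is a simple closed curve that is the union of a nonempty set of vertices
  and a set of whole edges.\<close>

definition theta_cycle :: "'a topology \<Rightarrow> ('a, 'v, 'e) bands \<Rightarrow> 'a set \<Rightarrow> bool" where
  "theta_cycle X N B \<longleftrightarrow> simple_closed_curve X B \<and>
     (\<exists>W S. W \<noteq> {} \<and> W \<subseteq> theta_verts X N \<and> S \<subseteq> theta_edges X N \<and> B = W \<union> \<Union>S)"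

section \<open>Gluing disks along curves\<close>

text \<open>The space obtained from \<open>T\<close> by attaching, for each \<open>i \<in> I\<close>, a copy of the closed unit disk
  along the map \<open>\<phi> i\<close> on the unit circle. Points of the interior of the \<open>i\<close>-th disk are
  \<open>Inr (i, z)\<close> with \<open>z\<close> in the open unit disk; points of \<open>T\<close> are \<open>Inl y\<close>. The topology is the
  quotient topology for the obvious map from the disjoint union of \<open>T\<close> and the disks.\<close>

definition attach_point :: "('i \<Rightarrow> complex \<Rightarrow> 'a) \<Rightarrow> 'i \<Rightarrow> complex \<Rightarrow> 'a + 'i \<times> complex" where
  "attach_point \<phi> i z = (if norm z = 1 then Inl (\<phi> i z) else Inr (i, z))"

definition attach_disks ::
  "'a topology \<Rightarrow> 'i set \<Rightarrow> ('i \<Rightarrow> complex \<Rightarrow> 'a) \<Rightarrow> ('a + 'i \<times> complex) topology" where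
  "attach_disks T I \<phi> = topology (\<lambda>U.
     U \<subseteq> Inl ` topspace T \<union> Inr ` (I \<times> open_disk) \<and>
     openin T {y \<in> topspace T. Inl y \<in> U} \<and>
     (\<forall>i\<in>I. openin (top_of_set closed_disk) {z \<in> closed_disk. attach_point \<phi> i z \<in> U}))"

lemma openin_attach_disks:
  "openin (attach_disks T I \<phi>) U \<longleftrightarrow>
     U \<subseteq> Inl ` topspace T \<union> Inr ` (I \<times> open_disk) \<and>
     openin T {y \<in> topspace T. Inl y \<in> U} \<and>
     (\<forall>i\<in>I. openin (top_of_set closed_disk) {z \<in> closed_disk. attach_point \<phi> i z \<in> U})"
  (is "_ \<longleftrightarrow> ?P U")
proof -
  have "istopology ?P"
    unfolding istopology_def
  proof (intro conjI allI impI)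
    fix S R assume S: "?P S" and R: "?P R"
    have 1: "{y \<in> topspace T. Inl y \<in> S \<inter> R} =
        {y \<in> topspace T. Inl y \<in> S} \<inter> {y \<in> topspace T. Inl y \<in> R}" by auto
    have 2: "{z \<in> closed_disk. attach_point \<phi> i z \<in> S \<inter> R} =
        {z \<in> closed_disk. attach_point \<phi> i z \<in> S} \<inter> {z \<in> closed_disk. attach_point \<phi> i z \<in> R}" for i
      by auto
    show "S \<inter> R \<subseteq> Inl ` topspace T \<union> Inr ` (I \<times> open_disk)" using S by auto
    show "openin T {y \<in> topspace T. Inl y \<in> S \<inter> R}"
      unfolding 1 using S R by (intro openin_Int) simp_all
    show "\<forall>i\<in>I. openin (top_of_set closed_disk) {z \<in> closed_disk. attach_point \<phi> i z \<in> S \<inter> R}"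
      unfolding 2 using S R by (intro ballI openin_Int) simp_all
  next
    fix K assume K: "\<forall>S\<in>K. ?P S"
    have 1: "{y \<in> topspace T. Inl y \<in> \<Union>K} = (\<Union>S\<in>K. {y \<in> topspace T. Inl y \<in> S})" by auto
    have 2: "{z \<in> closed_disk. attach_point \<phi> i z \<in> \<Union>K} =
        (\<Union>S\<in>K. {z \<in> closed_disk. attach_point \<phi> i z \<in> S})" for i by auto
    show "\<Union>K \<subseteq> Inl ` topspace T \<union> Inr ` (I \<times> open_disk)" using K by blast
    show "openin T {y \<in> topspace T. Inl y \<in> \<Union>K}"
      unfolding 1 using K by (intro openin_Union) auto
    show "\<forall>i\<in>I. openin (top_of_set closed_disk) {z \<in> closed_disk. attach_point \<phi> i z \<in> \<Union>K}"
      unfolding 2 using K by (intro ballI openin_Union) auto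
  qed
  then show ?thesis
    unfolding attach_disks_def by (simp add: topology_inverse')
qed

text \<open>The attaching maps must parametrise the curves homeomorphically.\<close>

definition parametrises :: "'a topology \<Rightarrow> 'a set set \<Rightarrow> ('a set \<Rightarrow> complex \<Rightarrow> 'a) \<Rightarrow> bool" where
  "parametrises T \<C> \<phi> \<longleftrightarrow>
     (\<forall>B\<in>\<C>. homeomorphic_map (top_of_set unit_circle) (subtopology T B) (\<phi> B))"

section \<open>Ribbon graphs and partial duals\<close>

text \<open>As for band decompositions, \<open>rzero\<close> and \<open>rone\<close> give the interiors of the bands.\<close>

record ('a, 'v, 'e) ribbon =
  rspace :: "'a topology"
  rverts :: "'v set"
  redges :: "'e set"
  rzero :: "'v \<Rightarrow> 'a set"
  rone :: "'e \<Rightarrow> 'a set"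

definition discard_two_bands :: "'a topology \<Rightarrow> ('a, 'v, 'e) bands \<Rightarrow> ('a, 'v, 'e) ribbon" where
  "discard_two_bands X N =
     \<lparr> rspace = subtopology X (zero_closed X N \<union> (\<Union>e\<in>one_index N. X closure_of one_band N e)),
       rverts = zero_index N, redges = one_index N, rzero = zero_band N, rone = one_band N \<rparr>"

text \<open>Homeomorphism of ribbon graphs: edges keep their names, vertices may be renamed.\<close>

definition ribbon_equiv :: "('a, 'v, 'e) ribbon \<Rightarrow> ('b, 'w, 'e) ribbon \<Rightarrow> bool" where
  "ribbon_equiv R R' \<longleftrightarrow> redges R = redges R' \<and>
     (\<exists>g h. bij_betw g (rverts R) (rverts R') \<and>
        homeomorphic_map (rspace R) (rspace R') h \<and>
        (\<forall>v\<in>rverts R. rzero R' (g v) = h ` rzero R v) \<and>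
        (\<forall>e\<in>redges R. rone R' e = h ` rone R e))"

text \<open>The boundary components of the ribbon subgraph with all 0-bands and the 1-bands in \<open>D\<close>.\<close>

definition ribbon_curves :: "('a, 'v, 'e) ribbon \<Rightarrow> 'e set \<Rightarrow> 'a set set" where
  "ribbon_curves R D =
     (let \<Delta> = (\<Union>v\<in>rverts R. rspace R closure_of rzero R v) \<union>
              (\<Union>e\<in>D. rspace R closure_of rone R e)
      in connected_components_of
           (subtopology (rspace R) (manifold_boundary (subtopology (rspace R) \<Delta>))))"

text \<open>The ribbon graph \<open>O\<^sup>D\<close>: a new 0-band is added along each of these curves and then the
  old 0-band interiors are removed. The vertices of the result are the curves.\<close>

definition ribbon_partial_dual ::
  "('a, 'v, 'e) ribbon \<Rightarrow> 'e set \<Rightarrow> ('a set \<Rightarrow> complex \<Rightarrow> 'a) \<Rightarrow>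
   ('a + 'a set \<times> complex, 'a set, 'e) ribbon" where
  "ribbon_partial_dual R D \<phi> =
     (let T = attach_disks (rspace R) (ribbon_curves R D) \<phi>
      in \<lparr> rspace = subtopology T (topspace T - Inl ` (\<Union>v\<in>rverts R. rzero R v)),
           rverts = ribbon_curves R D, redges = redges R,
           rzero = (\<lambda>B. Inr ` ({B} \<times> open_disk)), rone = (\<lambda>e. Inl ` rone R e) \<rparr>)"

text \<open>\<open>H\<close>, embedded in \<open>Y\<close>, is (up to homeomorphism) the partial dual of \<open>G\<close>, embedded in \<open>X\<close>, with
  respect to \<open>D\<close>: for a ribbon graph \<open>O\<close> of \<open>G\<close>, \<open>O\<^sup>D\<close> is a ribbon graph of \<open>H\<close>. Ribbon graphs whose
  1-bands touch at corners are admitted: at such a corner a ribbon graph still contains the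
  0-band between the touching 1-bands, so it is a surface with boundary there.\<close>

definition is_partial_dual ::
  "'a topology \<Rightarrow> ('a, 'v, 'e) embedded_graph \<Rightarrow> 'e set \<Rightarrow>
   'b topology \<Rightarrow> ('b, 'w, 'e) embedded_graph \<Rightarrow> bool" where
  "is_partial_dual X G D Y H \<longleftrightarrow>
     (\<exists>(N :: ('a, 'v, 'e) bands) (M :: ('b, 'w, 'e) bands) \<phi>.
        surface X \<and> represents X N G \<and> surface Y \<and> represents Y M H \<and>
        (let R = discard_two_bands X N
         in parametrises (rspace R) (ribbon_curves R D) \<phi> \<and>
            ribbon_equiv (discard_two_bands Y M) (ribbon_partial_dual R D \<phi>)))"

section \<open>The construction of the dual band decomposition\<close>

definition band_union :: "'a topology \<Rightarrow> ('a, 'v, 'e) bands \<Rightarrow> 'e set \<Rightarrow> 'a set" where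
  "band_union X N S = zero_closed X N \<union> (\<Union>e\<in>S. X closure_of one_band N e)"

definition boundary_curves :: "'a topology \<Rightarrow> ('a, 'v, 'e) bands \<Rightarrow> 'e set \<Rightarrow> 'a set set" where
  "boundary_curves X N S =
     connected_components_of (subtopology X (X frontier_of band_union X N S))"

definition skeleton :: "'a topology \<Rightarrow> ('a, 'v, 'e) bands \<Rightarrow> 'a set" where
  "skeleton X N = topspace X - (\<Union>v\<in>zero_index N. zero_band N v) - \<Union>(two_bands N)"

text \<open>Disks indexed by \<open>Inl B\<close> are the new 0-bands, those indexed by \<open>Inr B\<close> the new 2-bands.\<close>

definition dual_surface ::
  "'a topology \<Rightarrow> ('a, 'v, 'e) bands \<Rightarrow> 'e set \<Rightarrow>
   ('a set \<Rightarrow> complex \<Rightarrow> 'a) \<Rightarrow> ('a set \<Rightarrow> complex \<Rightarrow> 'a) \<Rightarrow>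
   ('a + ('a set + 'a set) \<times> complex) topology" where
  "dual_surface X N D \<gamma> \<alpha> =
     attach_disks (subtopology X (skeleton X N))
       (boundary_curves X N D <+> boundary_curves X N (one_index N - D)) (case_sum \<gamma> \<alpha>)"

definition dual_bands ::
  "'a topology \<Rightarrow> ('a, 'v, 'e) bands \<Rightarrow> 'e set \<Rightarrow>
   ('a + ('a set + 'a set) \<times> complex, 'a set, 'e) bands" where
  "dual_bands X N D =
     \<lparr> zero_index = boundary_curves X N D, one_index = one_index N,
       zero_band = (\<lambda>B. Inr ` ({Inl B} \<times> open_disk)), one_band = (\<lambda>e. Inl ` one_band N e),
       two_bands = (\<lambda>B. Inr ` ({Inr B} \<times> open_disk)) ` boundary_curves X N (one_index N - D) \<rparr>"

end

theory Submission
  imports Defs "HOL-Analysis.Abstract_Topological_Spaces" "HOL-Analysis.T1_Spaces"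
    "HOL-Analysis.Complex_Transcendental"
begin

text \<open>
  For a set \<open>S\<close> of edges, the boundary of the union of the 0-bands and the 1-bands of \<open>S\<close> is traced
  by a system of arcs with vertices those of \<open>\<Theta>(N)\<close>: the sides of the 1-bands in \<open>S\<close>, the ends of
  the others, and the arcs where a 0-band meets a 2-band. For \<open>S = {}\<close> these are the circles bounding
  the 0-bands, so every vertex has degree two; exchanging the two ends of one 1-band for its
  two sides preserves this, since ends and sides have the same four end points. Hence for every \<open>S\<close>
  the boundary is a disjoint union of simple closed curves.

  The dual surface is the skeleton of \<open>N\<close> with disks attached along the boundary curves of \<open>D\<close> and of
  \<open>E - D\<close>, whereas \<open>\<Sigma>\<close> is the skeleton with disks attached along those of \<open>{}\<close> and \<open>E\<close>. A local
  homeomorphism of the skeleton that takes one pair of curve systems to the other extends radially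
  to the disks, so the dual surface inherits local planarity from \<open>\<Sigma>\<close>. Near a point met only by
  edges in \<open>D\<close>, or only by edges outside \<open>D\<close>, the two pairs agree up to order; at a corner shared by
  one edge of each kind, reflecting one of the two quadrilaterals in its diagonal through the corner
  matches them.

  The dual graph has the centres of the new 0-bands as vertices, and its edges run radially to the
  1-bands and through them along a midline; its faces are the new 2-bands enlarged by the adjacent
  halves of the 1-bands and by the sectors of the new 0-bands next to these. The new 0-bands together with the 1-bands form
  the ribbon graph \<open>O\<^sup>D\<close>, because both are obtained by attaching the disks bounded by the
  boundary curves of \<open>D\<close> to compact Hausdorff spaces.
\<close>

section \<open>Local planarity\<close>

text \<open>The delicate points are the vertices of \<Theta>(N): different 1-bands, or two corners
  of the same one, may touch there, so neighbourhoods have no single normal form. The comparison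
  with \<Sigma> avoids describing them: at a point of the skeleton a chart is never built, only
  transported. This works because a neighbourhood in an attached space is determined by the traces
  of the attaching curves on the skeleton. Curves of one family are disjoint, so only the union of
  each family has to be matched. The reflection is possible because at most two corners meet at a
  point: where edges of both kinds meet, no third corner interferes. Plane topology enters only as
  invariance of domain, for arcs in arcs and for identifying the intrinsic boundary of a union of
  bands with its frontier. The boundary curves are defined as components of a frontier. That they
  are circles follows from a degree count, not from a local study. The count sees only circles that
  carry a vertex, and the existence of an edge guarantees one on every 0-band.\<close>

lemma locally_planar_at_shrink:
  assumes "locally_planar_at X x" "openin X V" "x \<in> V"
  obtains U g and W :: "complex set" where "openin X U" "x \<in> U" "U \<subseteq> V" "open W"
    "homeomorphic_map (subtopology X U) (top_of_set W) g"
proof -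
  obtain U g and W :: "complex set" where U: "openin X U" "x \<in> U" and W: "open W"
    and g: "homeomorphic_map (subtopology X U) (top_of_set W) g"
    using assms(1) unfolding locally_planar_at_def homeomorphic_space by blast
  have UX: "U \<subseteq> topspace X" using U(1) openin_subset by blast
  have o: "openin (subtopology X U) (U \<inter> V)"
    using assms(2) by (simp add: openin_subtopology_Int2)
  have *: "g ` (U \<inter> V) \<subseteq> W"
    using homeomorphic_imp_surjective_map[OF g] UX by auto
  have "openin (top_of_set W) (g ` (U \<inter> V))"
    using homeomorphic_imp_open_map[OF g] o unfolding open_map_def by blast
  then have "open (g ` (U \<inter> V))" using W openin_open_trans by blast
  moreover have "homeomorphic_map (subtopology X (U \<inter> V)) (top_of_set (g ` (U \<inter> V))) g"
    using homeomorphic_map_subtopologies[OF g, of V "g ` (U \<inter> V)"] UX *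
    by (simp add: subtopology_subtopology Int_absorb1 inf_absorb2 inf.commute)
       (metis Int_absorb1 Int_absorb2 inf_commute)
  ultimately show thesis
    using that[of "U \<inter> V" "g ` (U \<inter> V)" g] U assms by blast
qed

text \<open>The chart at \<open>f x\<close> is first shrunk into \<open>V\<close>, so that its
  composition with \<open>f\<close> is defined on an open neighbourhood of \<open>x\<close>. All
  transport of charts between attached spaces goes through this.\<close>

lemma locally_planar_at_transfer:
  assumes "locally_planar_at Y (f x)" "openin X U" "x \<in> U" "openin Y V"
    and f: "homeomorphic_map (subtopology X U) (subtopology Y V) f"
  shows "locally_planar_at X x"
proof -
  have UX: "U \<subseteq> topspace X" "V \<subseteq> topspace Y"
    using assms openin_subset by blast+
  have im: "f ` U = V"
    using homeomorphic_imp_surjective_map[OF f] UX by (simp add: inf_absorb2)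
  obtain U' g and W :: "complex set" where U': "openin Y U'" "f x \<in> U'" "U' \<subseteq> V" and W: "open W"
    and g: "homeomorphic_map (subtopology Y U') (top_of_set W) g"
    by (rule locally_planar_at_shrink[OF assms(1,4)]) (use im assms(3) in auto)
  define U0 where "U0 = {y \<in> U. f y \<in> U'}"
  have "openin (subtopology Y V) U'"
    using U' by (metis inf_absorb2 openin_subtopology_Int2)
  then have "openin (subtopology X U) {y \<in> topspace (subtopology X U). f y \<in> U'}"
    by (rule openin_continuous_map_preimage[OF homeomorphic_imp_continuous_map[OF f]])
  then have o: "openin X U0"
    using assms(2) UX unfolding U0_def by (simp add: inf_absorb2 openin_open_subtopology)
  have "homeomorphic_map (subtopology (subtopology X U) U0) (subtopology (subtopology Y V) U') f"
    by (rule homeomorphic_map_subtopologies[OF f]) (use im U' UX in \<open>auto simp: U0_def\<close>)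
  then have "homeomorphic_map (subtopology X U0) (subtopology Y U') f"
    using U'(3) by (simp add: subtopology_subtopology Int_absorb1 U0_def Collect_conj_eq Int_assoc[symmetric])
  then have "homeomorphic_map (subtopology X U0) (top_of_set W) (g \<circ> f)"
    using g homeomorphic_map_compose by blast
  then show ?thesis
    unfolding locally_planar_at_def homeomorphic_space
    using o W U' assms(3) by (intro exI[of _ U0] exI[of _ W]) (auto simp: U0_def)
qed

text \<open>Invariance of domain.\<close>

lemma locally_planar_subset_interior:
  assumes X: "locally_planar_at X x" and S: "S \<subseteq> topspace X"
    and *: "locally_planar_at (subtopology X S) x"
  shows "x \<in> X interior_of S"
proof -
  obtain U f and W :: "complex set" where U: "openin X U" "x \<in> U" and W: "open W"
    and f: "homeomorphic_map (subtopology X U) (top_of_set W) f"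
    using X unfolding locally_planar_at_def homeomorphic_space by blast
  have UX: "U \<subseteq> topspace X" using U(1) openin_subset by blast
  have xS: "x \<in> S" using * openin_subset unfolding locally_planar_at_def by fastforce
  have "openin (subtopology X S) (S \<inter> U)"
    using U by (simp add: openin_subtopology_Int2)
  then obtain U' g and W' :: "complex set" where U': "openin (subtopology X S) U'" "x \<in> U'"
      "U' \<subseteq> S \<inter> U" and W': "open W'"
    and g: "homeomorphic_map (subtopology (subtopology X S) U') (top_of_set W') g"
    by (rule locally_planar_at_shrink[OF *, of "S \<inter> U"]) (use xS U in auto)
  have g': "homeomorphic_map (subtopology X U') (top_of_set W') g"
    using g U'(3) by (simp add: subtopology_subtopology inf_absorb2)
  obtain k where k: "homeomorphic_maps (subtopology X U') (top_of_set W') g k"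
    using g' homeomorphic_map_maps by blast
  have U'X: "U' \<subseteq> topspace X" using U' UX by blast
  have kW: "k ` W' = U'"
    using homeomorphic_imp_surjective_map[of "top_of_set W'" "subtopology X U'" k] k U'X
    by (metis Int_absorb1 homeomorphic_maps_map topspace_euclidean_subtopology topspace_subtopology)
  have k': "continuous_map (top_of_set W') (subtopology X U') k"
    using k by (simp add: homeomorphic_maps_def)
  have kc: "continuous_map (top_of_set W') (subtopology X U) k"
    using k' U'(3) by (auto simp: continuous_map_in_subtopology)
  have "continuous_map (top_of_set W') (top_of_set W) (f \<circ> k)"
    using continuous_map_compose[OF kc homeomorphic_imp_continuous_map[OF f]] .
  then have c: "continuous_on W' (f \<circ> k)" by (simp add: continuous_map_in_subtopology)
  have "inj_on k W'"
    using k unfolding homeomorphic_maps_def by (metis inj_on_inverseI topspace_euclidean_subtopology)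
  moreover have "inj_on f U"
    using homeomorphic_imp_injective_map[OF f] UX by (simp add: inf_absorb2)
  ultimately have "inj_on (f \<circ> k) W'"
    using kW U'(3) by (meson comp_inj_on inj_on_subset le_inf_iff)
  \<comment> \<open>The inverse of a chart of the subspace followed by a chart of \<open>X\<close>
    is a continuous injection of a planar domain into the plane. Its image is open, which will make
    \<open>U'\<close> open in \<open>X\<close> and not merely in \<open>S\<close>.\<close>
  then have "open ((f \<circ> k) ` W')"
    using invariance_of_domain_gen[OF W' c] by simp
  moreover have "f ` U' \<subseteq> W"
    using U'(3) homeomorphic_imp_surjective_map[OF f] UX by auto
  ultimately have o: "openin (top_of_set W) (f ` U')"
    unfolding image_comp[symmetric] kW by (simp add: open_subset)
  have "openin (subtopology X U) {y \<in> topspace (subtopology X U). f y \<in> f ` U'}"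
    by (rule openin_continuous_map_preimage[OF homeomorphic_imp_continuous_map[OF f] o])
  moreover have "{y \<in> topspace (subtopology X U). f y \<in> f ` U'} = U'"
  proof (intro equalityI subsetI)
    fix y assume "y \<in> {y \<in> topspace (subtopology X U). f y \<in> f ` U'}"
    then obtain y' where "y \<in> U" "y' \<in> U'" "f y = f y'" by auto
    then show "y \<in> U'" using inj_onD[OF \<open>inj_on f U\<close>, of y y'] U'(3) by auto
  qed (use U'(3) UX in auto)
  ultimately have "openin (subtopology X U) U'" by simp
  then have "openin X U'"
    by (rule openin_trans_full[OF _ U(1)])
  then show ?thesis
    unfolding interior_of_def using U' by auto
qed

section \<open>Attaching disks\<close>

lemma circle_meets: "norm u = 1 \<Longrightarrow> f u \<in> U \<Longrightarrow> f ` unit_circle \<inter> U \<noteq> {}"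
  by (metis IntI empty_iff imageI mem_sphere_0)

text \<open>Continuity of the attaching maps suffices for the general topology of the attached
  space. That they are injective or embed the circle is assumed separately where it matters, in
  \<open>inj_pt\<close> and in the locale \<open>radial\<close>.\<close>

locale attachment =
  fixes T :: "'a topology" and I :: "'i set" and \<phi> :: "'i \<Rightarrow> complex \<Rightarrow> 'a"
  assumes attaching: "i \<in> I \<Longrightarrow> continuous_map (top_of_set unit_circle) T (\<phi> i)"
begin

abbreviation At where "At \<equiv> attach_disks T I \<phi>"
abbreviation pt where "pt \<equiv> attach_point \<phi>"

lemma attaching_in: "i \<in> I \<Longrightarrow> norm z = 1 \<Longrightarrow> \<phi> i z \<in> topspace T"
  using attaching continuous_map_image_subset_topspace by fastforce

lemma topspace_attach: "topspace At = Inl ` topspace T \<union> Inr ` (I \<times> open_disk)" (is "_ = ?R")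
proof
  show "topspace At \<subseteq> ?R"
    using openin_topspace[of At] unfolding openin_attach_disks by blast
  have "{y \<in> topspace T. Inl y \<in> ?R} = topspace T" by auto
  moreover have "{z \<in> closed_disk. pt i z \<in> ?R} = closed_disk" if "i \<in> I" for i
    using that attaching_in by (auto simp: attach_point_def)
  ultimately have "openin At ?R"
    unfolding openin_attach_disks by auto
  then show "?R \<subseteq> topspace At" by (rule openin_subset)
qed

text \<open>The universal property of the quotient in local form: over an open set the quotient map
  is still a quotient map. The local form is needed because radial extensions exist only near a
  point.\<close>

lemma continuous_map_from_attach:
  assumes W: "openin At W"
    and 1: "continuous_map (subtopology T {y \<in> topspace T. Inl y \<in> W}) Z (f \<circ> Inl)"
    and 2: "\<And>i. i \<in> I \<Longrightarrow> continuous_map (subtopology (top_of_set closed_disk) {z. pt i z \<in> W}) Z (f \<circ> pt i)"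
  shows "continuous_map (subtopology At W) Z f"
  unfolding continuous_map
proof (intro conjI allI impI)
  have WT: "W \<subseteq> Inl ` topspace T \<union> Inr ` (I \<times> open_disk)"
    using W unfolding openin_attach_disks by blast
  have "f w \<in> topspace Z" if "w \<in> W" for w
  proof -
    consider y where "w = Inl y" "y \<in> topspace T" | i z where "w = Inr (i, z)" "i \<in> I" "norm z < 1"
      using subsetD[OF WT \<open>w \<in> W\<close>] by auto
    then show ?thesis
    proof cases
      case 1
      then show ?thesis using continuous_map_image_subset_topspace[OF assms(2)] that by auto
    next
      case (2 i z)
      then have w: "pt i z = w" by (auto simp: attach_point_def)
      then have "z \<in> topspace (subtopology (top_of_set closed_disk) {z. pt i z \<in> W})"
        using 2 that by auto
      then have "(f \<circ> pt i) z \<in> topspace Z"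
        using continuous_map_image_subset_topspace[OF assms(3)[OF 2(2)]] by blast
      then show ?thesis using w by simp
    qed
  qed
  then show "f ` topspace (subtopology At W) \<subseteq> topspace Z" by auto
next
  fix U assume U: "openin Z U"
  have WT: "W \<subseteq> topspace At" using W openin_subset by blast
  let ?S = "{x \<in> topspace (subtopology At W). f x \<in> U}"
  have "openin At ?S"
    unfolding openin_attach_disks
  proof (intro conjI ballI)
    show "?S \<subseteq> Inl ` topspace T \<union> Inr ` (I \<times> open_disk)"
      using topspace_attach by auto
    have "openin (subtopology T {y \<in> topspace T. Inl y \<in> W}) {y \<in> topspace (subtopology T {y \<in> topspace T. Inl y \<in> W}). (f \<circ> Inl) y \<in> U}"
      by (rule openin_continuous_map_preimage[OF 1 U])
    moreover have "openin T {y \<in> topspace T. Inl y \<in> W}"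
      using W unfolding openin_attach_disks by blast
    ultimately have h1: "openin T {y \<in> topspace (subtopology T {y \<in> topspace T. Inl y \<in> W}). (f \<circ> Inl) y \<in> U}"
      by (rule openin_trans_full)
    have e1: "{y \<in> topspace (subtopology T {y \<in> topspace T. Inl y \<in> W}). (f \<circ> Inl) y \<in> U}
       = {y \<in> topspace T. Inl y \<in> ?S}"
      using WT by auto
    show "openin T {y \<in> topspace T. Inl y \<in> ?S}" by (rule back_subst[of "openin T", OF h1 e1])
    fix i assume i: "i \<in> I"
    let ?V = "{z \<in> closed_disk. pt i z \<in> W}"
    have e: "subtopology (top_of_set closed_disk) {z. pt i z \<in> W} = top_of_set ?V"
      unfolding subtopology_subtopology by (rule arg_cong[of _ _ top_of_set]) auto
    have "openin (top_of_set ?V) {z \<in> topspace (top_of_set ?V). (f \<circ> pt i) z \<in> U}"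
      by (rule openin_continuous_map_preimage[OF 2[OF i, unfolded e] U])
    moreover have "openin (top_of_set closed_disk) ?V"
      using W i unfolding openin_attach_disks by blast
    ultimately have h2: "openin (top_of_set closed_disk) {z \<in> topspace (top_of_set ?V). (f \<circ> pt i) z \<in> U}"
      by (rule openin_trans)
    have e2: "{z \<in> topspace (top_of_set ?V). (f \<circ> pt i) z \<in> U} = {z \<in> closed_disk. pt i z \<in> ?S}"
      using WT by auto
    show "openin (top_of_set closed_disk) {z \<in> closed_disk. pt i z \<in> ?S}"
      by (rule back_subst[of "openin (top_of_set closed_disk)", OF h2 e2])
  qed
  moreover have "?S \<subseteq> W" by auto
  ultimately show "openin (subtopology At W) ?S"
    using W by (simp only: openin_open_subtopology)
qed

lemma pt_in: "i \<in> I \<Longrightarrow> norm z \<le> 1 \<Longrightarrow> pt i z \<in> topspace At"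
  using attaching_in by (auto simp: attach_point_def topspace_attach)

lemma continuous_map_attach:
  assumes "continuous_map T Z (f \<circ> Inl)"
    and "\<And>i. i \<in> I \<Longrightarrow> continuous_map (top_of_set closed_disk) Z (f \<circ> pt i)"
  shows "continuous_map At Z f"
proof -
  have "continuous_map (subtopology At (topspace At)) Z f"
  proof (rule continuous_map_from_attach)
    show "continuous_map (subtopology T {y \<in> topspace T. Inl y \<in> topspace At}) Z (f \<circ> Inl)"
      using assms(1) by (rule continuous_map_from_subtopology)
    show "continuous_map (subtopology (top_of_set closed_disk) {z. pt i z \<in> topspace At}) Z (f \<circ> pt i)"
      if "i \<in> I" for i
      using assms(2)[OF that] by (rule continuous_map_from_subtopology)
  qed simp
  then show ?thesis by simp
qed

lemma continuous_map_Inl: "continuous_map T At Inl"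
  unfolding continuous_map
  using topspace_attach by (auto simp: openin_attach_disks)

lemma continuous_map_pt: "i \<in> I \<Longrightarrow> continuous_map (top_of_set closed_disk) At (pt i)"
  unfolding continuous_map
  using pt_in by (auto simp: openin_attach_disks)

lemma closedin_attach:
  "closedin At C \<longleftrightarrow> C \<subseteq> topspace At \<and> closedin T {y \<in> topspace T. Inl y \<in> C} \<and>
     (\<forall>i\<in>I. closedin (top_of_set closed_disk) {z \<in> closed_disk. pt i z \<in> C})"
proof -
  have 1: "{y \<in> topspace T. Inl y \<in> topspace At - C} = topspace T - {y \<in> topspace T. Inl y \<in> C}"
    using topspace_attach by auto
  have 2: "{z \<in> closed_disk. pt i z \<in> topspace At - C} = closed_disk - {z \<in> closed_disk. pt i z \<in> C}"
    if "i \<in> I" for i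
    using that pt_in by auto
  have 3: "topspace At - C \<subseteq> Inl ` topspace T \<union> Inr ` (I \<times> open_disk)"
    using topspace_attach by auto
  show ?thesis
    unfolding closedin_def[of At] openin_attach_disks 1 using 2 3
    by (auto simp: closedin_def[of T] closedin_def[of "top_of_set closed_disk"])
qed

lemma pt_preimage_disk:
  assumes "V \<subseteq> open_disk"
  shows "{z \<in> closed_disk. pt j z \<in> Inr ` ({i} \<times> V)} = (if j = i then V else {})"
proof -
  have "norm z < 1" if "z \<in> V" for z using assms that by auto
  then show ?thesis by (cases "j = i") (force simp: attach_point_def)+
qed

lemma openin_attach_disk:
  assumes "i \<in> I" "open V" "V \<subseteq> open_disk"
  shows "openin At (Inr ` ({i} \<times> V))"
  unfolding openin_attach_disks
proof (intro conjI ballI)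
  show "Inr ` ({i} \<times> V) \<subseteq> Inl ` topspace T \<union> Inr ` (I \<times> open_disk)"
    using assms by auto
  have e: "{y \<in> topspace T. Inl y \<in> Inr ` ({i} \<times> V)} = {}" by auto
  show "openin T {y \<in> topspace T. Inl y \<in> Inr ` ({i} \<times> V)}" unfolding e by (rule openin_empty)
  fix j
  have "V \<subseteq> closed_disk" using assms(3) ball_subset_cball by blast
  then show "openin (top_of_set closed_disk) {z \<in> closed_disk. pt j z \<in> Inr ` ({i} \<times> V)}"
    unfolding pt_preimage_disk[OF assms(3)] using assms
    by (cases "j = i") (simp_all add: open_subset)
qed

lemma openin_attach_Inl:
  assumes "openin T U" "\<And>i. i \<in> I \<Longrightarrow> \<phi> i ` unit_circle \<inter> U = {}"
  shows "openin At (Inl ` U)"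
  unfolding openin_attach_disks
proof (intro conjI ballI)
  show "Inl ` U \<subseteq> Inl ` topspace T \<union> Inr ` (I \<times> open_disk)"
    using openin_subset[OF assms(1)] by auto
  have e: "{y \<in> topspace T. Inl y \<in> Inl ` U} = U"
    using openin_subset[OF assms(1)] by auto
  show "openin T {y \<in> topspace T. Inl y \<in> Inl ` U}" unfolding e by (rule assms)
  fix j assume "j \<in> I"
  have "{z \<in> closed_disk. pt j z \<in> Inl ` U} = {}"
    using assms(2)[OF \<open>j \<in> I\<close>] unfolding disjoint_iff by (auto simp: attach_point_def split: if_splits)
  then show "openin (top_of_set closed_disk) {z \<in> closed_disk. pt j z \<in> Inl ` U}"
    by (metis openin_empty)
qed

text \<open>The set \<open>U\<close> together with all open radii that end in it. The centres of the
  disks are left out because they have no direction (\<open>sgn 0 = 0\<close>). Stars turn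
  neighbourhoods in \<open>T\<close> into neighbourhoods in the attached space.\<close>

definition star :: "'a set \<Rightarrow> ('a + 'i \<times> complex) set" where
  "star U = Inl ` U \<union> {Inr (i, z) | i z. i \<in> I \<and> norm z < 1 \<and> z \<noteq> 0 \<and> \<phi> i (sgn z) \<in> U}"

lemma pt_in_star:
  assumes "i \<in> I"  "norm z \<le> 1"
  shows "pt i z \<in> star U \<longleftrightarrow> z \<noteq> 0 \<and> \<phi> i (sgn z) \<in> U"
  using assms by (auto simp: attach_point_def star_def sgn_div_norm)

lemma continuous_sgn: "continuous_map (top_of_set (closed_disk - {0})) (top_of_set unit_circle) sgn"
proof -
  have "continuous_on (closed_disk - {0}) (sgn :: complex \<Rightarrow> complex)"
    by (intro continuous_intros) auto
  then show ?thesis by (auto simp: norm_sgn)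
qed

lemma openin_star:
  assumes U: "openin T U"
  shows "openin At (star U)"
  unfolding openin_attach_disks
proof (intro conjI ballI)
  show "star U \<subseteq> Inl ` topspace T \<union> Inr ` (I \<times> open_disk)"
    using openin_subset[OF U] by (auto simp: star_def)
  have "{y \<in> topspace T. Inl y \<in> star U} = U"
    using openin_subset[OF U] by (auto simp: star_def)
  then show "openin T {y \<in> topspace T. Inl y \<in> star U}" using U by simp
  fix i assume i: "i \<in> I"
  have "continuous_map (top_of_set (closed_disk - {0})) T (\<phi> i \<circ> sgn)"
    using continuous_map_compose[OF continuous_sgn attaching[OF i]] .
  then have "openin (top_of_set (closed_disk - {0})) {z \<in> closed_disk - {0}. (\<phi> i \<circ> sgn) z \<in> U}"
    using openin_continuous_map_preimage[OF _ U] by fastforce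
  moreover have "openin (top_of_set closed_disk) (closed_disk - {0 :: complex})"
    by (metis Diff_eq open_Compl closed_singleton openin_open_Int)
  ultimately have "openin (top_of_set closed_disk) {z \<in> closed_disk - {0}. (\<phi> i \<circ> sgn) z \<in> U}"
    using openin_trans by blast
  moreover have "{z \<in> closed_disk - {0}. (\<phi> i \<circ> sgn) z \<in> U} = {z \<in> closed_disk. pt i z \<in> star U}"
    using pt_in_star[OF i] by auto
  ultimately show "openin (top_of_set closed_disk) {z \<in> closed_disk. pt i z \<in> star U}"
    by simp
qed

text \<open>Disjoint open sets of \<open>T\<close> have disjoint stars, which separates points of
  \<open>T\<close>. A point inside a disk is separated from \<open>T\<close> by an intermediate
  circle, and from other such points within the open disks.\<close>

lemma Hausdorff_attach:
  assumes "Hausdorff_space T"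
  shows "Hausdorff_space At"
proof -
  define sep where "sep x y \<longleftrightarrow> (\<exists>U V. openin At U \<and> openin At V \<and> x \<in> U \<and> y \<in> V \<and> disjnt U V)" for x y
  have sym: "sep x y \<Longrightarrow> sep y x" for x y unfolding sep_def using disjnt_sym by blast
  have ll: "sep (Inl x) (Inl y)" if xy: "x \<in> topspace T" "y \<in> topspace T" "x \<noteq> y" for x y
  proof -
    have "\<exists>U V. openin T U \<and> openin T V \<and> x \<in> U \<and> y \<in> V \<and> disjnt U V"
      using assms unfolding Hausdorff_space_def by (elim allE impE) (use xy in auto)
    then obtain U V where U: "openin T U" "openin T V" "x \<in> U" "y \<in> V" "disjnt U V"
      by (elim exE conjE)
    have "openin At (star U)" "openin At (star V)" using U openin_star by auto
    moreover have "Inl x \<in> star U" "Inl y \<in> star V" "disjnt (star U) (star V)"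
      using U by (auto simp: star_def disjnt_iff)
    ultimately show ?thesis unfolding sep_def by blast
  qed
  have lr: "sep (Inl x) (Inr (i, z))" if x: "x \<in> topspace T" "i \<in> I" "norm z < 1" for x i z
  proof -
    \<comment> \<open>Halfway between \<open>z\<close> and the boundary circle: the open ball of
      this radius contains \<open>z\<close>, and the complement of the closed ball contains all of
      \<open>T\<close>.\<close>
    define r where "r = (1 + norm z) / 2"
    have r: "norm z < r" "r < 1" using x unfolding r_def by auto
    have o1: "openin At (Inr ` ({i} \<times> ball 0 r))"
      using r x by (intro openin_attach_disk) auto
    have c: "closedin At (Inr ` ({i} \<times> cball 0 r))"
      unfolding closedin_attach
    proof (intro conjI ballI)
      show "Inr ` ({i} \<times> cball 0 r) \<subseteq> topspace At"
        using r x by (auto simp: topspace_attach)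
      have e: "{y \<in> topspace T. Inl y \<in> Inr ` ({i} \<times> cball 0 r)} = {}" by auto
      show "closedin T {y \<in> topspace T. Inl y \<in> Inr ` ({i} \<times> cball 0 r)}"
        unfolding e by (rule closedin_empty)
      fix j
      have cb: "cball (0::complex) r \<subseteq> closed_disk" using r by auto
      have "cball 0 r \<subseteq> open_disk" using r by auto
      note e = pt_preimage_disk[OF this, of j i]
      show "closedin (top_of_set closed_disk) {w \<in> closed_disk. pt j w \<in> Inr ` ({i} \<times> cball 0 r)}"
        unfolding e using closed_subset[OF cb closed_cball] by (cases "j = i") simp_all
    qed
    have o2: "openin At (topspace At - Inr ` ({i} \<times> cball 0 r))"
      using c by (metis openin_diff openin_topspace)
    show ?thesis
      unfolding sep_def
      by (rule exI[of _ "topspace At - Inr ` ({i} \<times> cball 0 r)"], rule exI[of _ "Inr ` ({i} \<times> ball 0 r)"])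
        (use o1 o2 x r in \<open>auto simp: topspace_attach disjnt_iff image_iff\<close>)
  qed
  have rr: "sep (Inr (i, z)) (Inr (j, w))" if x: "i \<in> I" "norm z < 1" "j \<in> I" "norm w < 1" "(i, z) \<noteq> (j, w)" for i z j w
  proof (cases "i = j")
    case True
    then have "z \<noteq> w" using x by auto
    then obtain U V where U: "open U" "open V" "z \<in> U" "w \<in> V" "U \<inter> V = {}"
      using hausdorff by metis
    then have o: "openin At (Inr ` ({i} \<times> (U \<inter> open_disk)))" "openin At (Inr ` ({j} \<times> (V \<inter> open_disk)))"
      using x by (auto intro!: openin_attach_disk)
    show ?thesis unfolding sep_def
      by (rule exI[of _ "Inr ` ({i} \<times> (U \<inter> open_disk))"], rule exI[of _ "Inr ` ({j} \<times> (V \<inter> open_disk))"])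
        (use o U x in \<open>auto simp: disjnt_iff\<close>)
  next
    case False
    have o: "openin At (Inr ` ({i} \<times> open_disk))" "openin At (Inr ` ({j} \<times> open_disk))"
      using x by (auto intro!: openin_attach_disk)
    show ?thesis unfolding sep_def
      by (rule exI[of _ "Inr ` ({i} \<times> open_disk)"], rule exI[of _ "Inr ` ({j} \<times> open_disk)"])
        (use o False x in \<open>auto simp: disjnt_iff\<close>)
  qed
  have "sep x y" if xy: "x \<in> topspace At" "y \<in> topspace At" "x \<noteq> y" for x y
  proof -
    consider a where "x = Inl a" "a \<in> topspace T" | i z where "x = Inr (i, z)" "i \<in> I" "norm z < 1"
      using xy(1) unfolding topspace_attach by auto
    then show ?thesis
    proof cases
      case (1 a)
      consider b where "y = Inl b" "b \<in> topspace T" | j w where "y = Inr (j, w)" "j \<in> I" "norm w < 1"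
        using xy(2) unfolding topspace_attach by auto
      then show ?thesis using 1 xy(3) by cases (simp_all add: ll lr)
    next
      case (2 i z)
      consider b where "y = Inl b" "b \<in> topspace T" | j w where "y = Inr (j, w)" "j \<in> I" "norm w < 1"
        using xy(2) unfolding topspace_attach by auto
      then show ?thesis using 2 xy(3) by cases (simp_all add: sym[OF lr] rr)
    qed
  qed
  then show ?thesis unfolding Hausdorff_space_def sep_def by blast
qed

lemma topspace_attach': "topspace At = Inl ` topspace T \<union> (\<Union>i\<in>I. pt i ` closed_disk)"
proof -
  have "Inr ` (I \<times> open_disk) \<subseteq> (\<Union>i\<in>I. pt i ` closed_disk)"
  proof clarsimp
    fix i z assume "i \<in> I" "cmod z < 1"
    then show "\<exists>j\<in>I. Inr (i, z) \<in> pt j ` closed_disk"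
      by (intro bexI[of _ i] image_eqI[of _ _ z]) (auto simp: attach_point_def)
  qed
  moreover have "(\<Union>i\<in>I. pt i ` closed_disk) \<subseteq> topspace At" using pt_in by auto
  ultimately show ?thesis unfolding topspace_attach by blast
qed

lemma compact_attach:
  assumes "compact_space T" "finite I"
  shows "compact_space At"
proof -
  have "compactin At (Inl ` topspace T)"
    using assms continuous_map_Inl compact_space_def image_compactin by blast
  moreover have "compactin At (pt i ` closed_disk)" if "i \<in> I" for i
    using image_compactin[OF _ continuous_map_pt[OF that], of closed_disk]
    by (simp add: compactin_subtopology)
  ultimately show ?thesis
    unfolding compact_space_def topspace_attach'
    using assms(2) by (intro compactin_Un compactin_Union) auto
qed

lemma connected_attach:
  assumes "connected_space T"
  shows "connected_space At"
proof (cases "topspace T = {}")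
  case True
  \<comment> \<open>A disk would have its boundary in \<open>T\<close>, so nothing can be attached
    to the empty space.\<close>
  then have "I = {}" using attaching_in[of _ 1] by auto
  then show ?thesis using True topspace_attach by (simp add: connected_space_def)
next
  case False
  let ?\<U> = "(\<lambda>i. Inl ` topspace T \<union> pt i ` closed_disk) ` I"
  have c1: "connectedin At (Inl ` topspace T)"
    using connectedin_continuous_map_image[OF continuous_map_Inl] assms connectedin_topspace by blast
  have *: "connectedin At (Inl ` topspace T \<union> pt i ` closed_disk)" if "i \<in> I" for i
  proof (rule connectedin_Un[OF c1])
    show "connectedin At (pt i ` closed_disk)"
      by (rule connectedin_continuous_map_image[OF continuous_map_pt[OF that]])
        (simp add: connectedin_subtopology)
    have "pt i 1 \<in> Inl ` topspace T" using attaching_in[OF that] by (auto simp: attach_point_def)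
    then show "Inl ` topspace T \<inter> pt i ` closed_disk \<noteq> {}" by force
  qed
  show ?thesis
  proof (cases "I = {}")
    case True
    then show ?thesis using c1 topspace_attach by (simp add: connectedin_topspace[symmetric])
  next
    case I: False
    have "connectedin At (\<Union>?\<U>)"
      by (rule connectedin_Union) (use * False I in auto)
    moreover have "\<Union>?\<U> = topspace At" unfolding topspace_attach' using I by auto
    ultimately show ?thesis by (metis connectedin_topspace)
  qed
qed

text \<open>A clopen set of \<open>T\<close> extends to a clopen set of the attached space: the
  circle is connected, so each attaching curve lies on one side, and its disk is put on the same
  side.\<close>

lemma connected_of_attach:
  assumes "connected_space At"
  shows "connected_space T"
  unfolding connected_space_clopen_in
proof (intro allI impI, elim conjE)
  fix U assume U: "openin T U" "closedin T U"
  define J where "J = {i \<in> I. \<phi> i ` unit_circle \<subseteq> U}"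
  define W where "W = Inl ` U \<union> Inr ` (J \<times> open_disk)"
  have UT: "U \<subseteq> topspace T" using U openin_subset by blast
  have J: "\<phi> i ` unit_circle \<inter> U = {}" if "i \<in> I" "i \<notin> J" for i
  proof -
    have "connectedin T (\<phi> i ` unit_circle)"
      by (rule connectedin_continuous_map_image[OF attaching[OF that(1)]])
        (simp add: connectedin_subtopology connected_sphere)
    then have "\<phi> i ` unit_circle \<subseteq> U \<or> disjnt (\<phi> i ` unit_circle) U"
      using U by (metis connectedin_clopen_cases)
    then show ?thesis using that unfolding J_def disjnt_def by blast
  qed
  have d: "{z \<in> closed_disk. pt i z \<in> W} = (if i \<in> J then closed_disk else {})" if "i \<in> I" for i
  proof (cases "i \<in> J")
    case True
    then have "\<phi> i z \<in> U" if "norm z = 1" for z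
      using that unfolding J_def by auto
    then show ?thesis using True by (auto simp: W_def attach_point_def)
  next
    case False
    then have "\<phi> i z \<notin> U" if "norm z = 1" for z
      using that J[OF \<open>i \<in> I\<close> False] unfolding disjoint_iff by auto
    then show ?thesis using False by (auto simp: W_def attach_point_def)
  qed
  have y: "{y \<in> topspace T. Inl y \<in> W} = U" using UT by (auto simp: W_def)
  have s: "W \<subseteq> topspace At" using UT by (auto simp: W_def topspace_attach J_def)
  have "openin At W"
    unfolding openin_attach_disks using d s y U by (auto simp: topspace_attach)
  moreover have "closedin At W"
    unfolding closedin_attach using d s y U by auto
  ultimately have "W = {} \<or> W = topspace At" using assms unfolding connected_space_clopen_in by blast
  then show "U = {} \<or> U = topspace T"
    using UT unfolding W_def topspace_attach by blast
qed

lemma locally_planar_attach_disk: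
  assumes "i \<in> I" "norm z < 1"
  shows "locally_planar_at At (Inr (i, z))"
proof -
  have c: "continuous_map (top_of_set open_disk) At (\<lambda>z. Inr (i, z))"
  proof (rule continuous_map_eq)
    show "continuous_map (top_of_set open_disk) At (pt i)"
      by (rule continuous_map_from_subtopology_mono[OF continuous_map_pt[OF assms(1)]]) auto
  qed (auto simp: attach_point_def)
  have o: "open_map (top_of_set open_disk) At (\<lambda>z. Inr (i, z))"
    unfolding open_map_def
  proof (intro allI impI)
    fix V :: "complex set" assume "openin (top_of_set open_disk) V"
    then have "open V" "V \<subseteq> open_disk"
      using openin_open_trans by (auto dest: openin_imp_subset)
    moreover have e: "(\<lambda>z. Inr (i, z)) ` V = Inr ` ({i} \<times> V)" by auto
    ultimately show "openin At ((\<lambda>z. Inr (i, z)) ` V)"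
      unfolding e using openin_attach_disk[OF assms(1)] by blast
  qed
  have "embedding_map (top_of_set open_disk) At (\<lambda>z. Inr (i, z))"
    by (rule injective_open_imp_embedding_map[OF c o]) (auto simp: inj_on_def)
  then have "top_of_set open_disk homeomorphic_space subtopology At ((\<lambda>z. Inr (i, z)) ` open_disk)"
    using embedding_map_imp_homeomorphic_space by fastforce
  moreover have "(\<lambda>z. Inr (i, z)) ` open_disk = Inr ` ({i} \<times> open_disk)" by auto
  ultimately have "subtopology At (Inr ` ({i} \<times> open_disk)) homeomorphic_space top_of_set open_disk"
    using homeomorphic_space_sym by metis
  then show ?thesis
    unfolding locally_planar_at_def
    using openin_attach_disk[OF assms(1) open_ball order_refl] assms(2)
    by (intro exI[of _ "Inr ` ({i} \<times> open_disk)"] exI[of _ open_disk]) auto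
qed

text \<open>The open disk is dense in the closed one. Hence points of an attaching curve are limits
  of interior points of the disk. This gives the closures of cells, and it shows that such points
  are not interior to a set that misses the disk.\<close>

lemma disk_near_circle:
  assumes "openin At G" "i \<in> I" "norm u = 1" "Inl (\<phi> i u) \<in> G"
  obtains z where "norm z < 1" "Inr (i, z) \<in> G"
proof -
  have "openin (top_of_set closed_disk) {z \<in> closed_disk. pt i z \<in> G}"
    using assms(1,2) unfolding openin_attach_disks by blast
  then obtain V where V: "open V" "{z \<in> closed_disk. pt i z \<in> G} = closed_disk \<inter> V"
    by (auto simp: openin_open)
  have "u \<in> {z \<in> closed_disk. pt i z \<in> G}"
    using assms(3,4) by (simp add: attach_point_def)
  then have "u \<in> V" unfolding V(2) by blast
  moreover have "u \<in> closure open_disk" using assms(3) by simp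
  ultimately obtain z where z: "z \<in> open_disk" "z \<in> V"
    using open_Int_closure_eq_empty[OF V(1), of open_disk] by blast
  then have "z \<in> {z \<in> closed_disk. pt i z \<in> G}" unfolding V(2) by auto
  then have "pt i z \<in> G" by blast
  then show thesis using that[of z] z by (auto simp: attach_point_def)
qed

lemma pt_image: "pt i ` closed_disk = Inl ` \<phi> i ` unit_circle \<union> Inr ` ({i} \<times> open_disk)"
proof -
  have "pt i ` closed_disk = pt i ` unit_circle \<union> pt i ` open_disk"
    unfolding image_Un[symmetric] by (rule arg_cong[of _ _ "(`) (pt i)"]) auto
  moreover have "pt i ` unit_circle = Inl ` \<phi> i ` unit_circle"
    unfolding image_image by (rule image_cong) (auto simp: attach_point_def)
  moreover have "pt i ` open_disk = Inr ` Pair i ` open_disk"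
    unfolding image_image by (rule image_cong) (auto simp: attach_point_def)
  ultimately show ?thesis by auto
qed

lemma inj_pt:
  assumes "inj_on (\<phi> i) unit_circle"
  shows "inj_on (pt i) closed_disk"
  using assms by (auto simp: inj_on_def attach_point_def)

lemma closure_attach_disk:
  assumes "i \<in> I" "Hausdorff_space T"
  shows "At closure_of (Inr ` ({i} \<times> open_disk)) = Inl ` \<phi> i ` unit_circle \<union> Inr ` ({i} \<times> open_disk)" (is "_ = ?R")
proof
  have "compactin At (pt i ` closed_disk)"
    by (rule image_compactin[OF _ continuous_map_pt[OF assms(1)]]) (simp add: compactin_subtopology)
  then have "closedin At (pt i ` closed_disk)"
    using Hausdorff_attach[OF assms(2)] compactin_imp_closedin by blast
  then show "At closure_of (Inr ` ({i} \<times> open_disk)) \<subseteq> ?R"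
    unfolding pt_image by (rule closure_of_minimal[rotated]) auto
  have "Inl (\<phi> i u) \<in> At closure_of (Inr ` ({i} \<times> open_disk))" if u: "norm u = 1" for u
    unfolding in_closure_of
  proof (intro conjI allI impI)
    show "Inl (\<phi> i u) \<in> topspace At" using attaching_in[OF assms(1) u] by (auto simp: topspace_attach)
    fix G assume G: "Inl (\<phi> i u) \<in> G \<and> openin At G"
    then obtain z where "norm z < 1" "Inr (i, z) \<in> G"
      using disk_near_circle[OF _ assms(1) u] by blast
    then show "\<exists>y. y \<in> Inr ` ({i} \<times> open_disk) \<and> y \<in> G" by auto
  qed
  moreover have "Inr ` ({i} \<times> open_disk) \<subseteq> At closure_of (Inr ` ({i} \<times> open_disk))"
    using assms(1) by (intro closure_of_subset) (auto simp: topspace_attach)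
  ultimately show "?R \<subseteq> At closure_of (Inr ` ({i} \<times> open_disk))" by auto
qed

end

text \<open>The radial extension \<open>r u \<mapsto> r f u\<close> of a map between neighbourhoods in the
  two spaces to which disks are attached.\<close>

definition radial_extension ::
  "('a \<Rightarrow> 'b) \<Rightarrow> ('i \<Rightarrow> 'j) \<Rightarrow> ('i \<Rightarrow> complex \<Rightarrow> 'a) \<Rightarrow> ('j \<Rightarrow> complex \<Rightarrow> 'b) \<Rightarrow> 'a + 'i \<times> complex \<Rightarrow> 'b + 'j \<times> complex"
  where "radial_extension \<sigma> \<tau> \<phi> \<psi> w = (case w of Inl x \<Rightarrow> Inl (\<sigma> x) | Inr (i, z) \<Rightarrow>
     Inr (\<tau> i, norm z *\<^sub>R inv_into unit_circle (\<psi> (\<tau> i)) (\<sigma> (\<phi> i (sgn z)))))"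

text \<open>\<open>\<tau>\<close> and \<open>\<tau>'\<close> pair the disks whose boundaries meet
  \<open>U\<close> with those whose boundaries meet \<open>U'\<close>; the stars do not reach the
  other disks, which stay unconstrained. The trace of each curve must go exactly onto the trace of
  its partner, so that directions correspond.\<close>

locale radial = A: attachment T I \<phi> + B: attachment T' J \<psi>
  for T :: "'a topology" and I :: "'i set" and \<phi> and T' :: "'b topology" and J :: "'j set" and \<psi> +
  fixes \<sigma> :: "'a \<Rightarrow> 'b" and \<sigma>' :: "'b \<Rightarrow> 'a" and \<tau> :: "'i \<Rightarrow> 'j" and \<tau>' :: "'j \<Rightarrow> 'i" and U U'
  assumes embA: "i \<in> I \<Longrightarrow> homeomorphic_map (top_of_set unit_circle) (subtopology T (\<phi> i ` unit_circle)) (\<phi> i)"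
    and embB: "j \<in> J \<Longrightarrow> homeomorphic_map (top_of_set unit_circle) (subtopology T' (\<psi> j ` unit_circle)) (\<psi> j)"
    and U: "openin T U" "openin T' U'"
    and \<sigma>: "homeomorphic_maps (subtopology T U) (subtopology T' U') \<sigma> \<sigma>'"
    and \<tau>: "i \<in> I \<Longrightarrow> \<phi> i ` unit_circle \<inter> U \<noteq> {} \<Longrightarrow> \<tau> i \<in> J \<and> \<tau>' (\<tau> i) = i \<and>
         \<sigma> ` (\<phi> i ` unit_circle \<inter> U) = \<psi> (\<tau> i) ` unit_circle \<inter> U'"
    and \<tau>': "j \<in> J \<Longrightarrow> \<psi> j ` unit_circle \<inter> U' \<noteq> {} \<Longrightarrow> \<tau>' j \<in> I \<and> \<tau> (\<tau>' j) = j \<and>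
         \<sigma>' ` (\<psi> j ` unit_circle \<inter> U') = \<phi> (\<tau>' j) ` unit_circle \<inter> U"
begin

lemma sub: "U \<subseteq> topspace T" "U' \<subseteq> topspace T'"
  using U openin_subset by blast+

lemma \<sigma>_in: "x \<in> U \<Longrightarrow> \<sigma> x \<in> U'" "x \<in> U \<Longrightarrow> \<sigma>' (\<sigma> x) = x"
  using \<sigma> sub unfolding homeomorphic_maps_def continuous_map_def by auto

abbreviation ext where "ext \<equiv> radial_extension \<sigma> \<tau> \<phi> \<psi>"
abbreviation bd where "bd i u \<equiv> inv_into unit_circle (\<psi> (\<tau> i)) (\<sigma> (\<phi> i u))"

lemma bd:
  assumes "i \<in> I" "norm u = 1" "\<phi> i u \<in> U"
  shows "norm (bd i u) = 1" "\<psi> (\<tau> i) (bd i u) = \<sigma> (\<phi> i u)" "\<tau> i \<in> J"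
proof -
  have "\<phi> i ` unit_circle \<inter> U \<noteq> {}" using assms circle_meets by metis
  note t = \<tau>[OF assms(1) this]
  then show "\<tau> i \<in> J" by blast
  have "\<sigma> (\<phi> i u) \<in> \<sigma> ` (\<phi> i ` unit_circle \<inter> U)" using assms by auto
  then have *: "\<sigma> (\<phi> i u) \<in> \<psi> (\<tau> i) ` unit_circle" using t by auto
  from inv_into_into[OF *] show "norm (bd i u) = 1" by simp
  from f_inv_into_f[OF *] show "\<psi> (\<tau> i) (bd i u) = \<sigma> (\<phi> i u)" .
qed

text \<open>\<open>inv_into\<close> is by itself only a choice of preimages. It is continuous here
  because on the curve it agrees with the inverse of the homeomorphism
  \<open>\<psi> (\<tau> i)\<close>.\<close>

lemma continuous_bd:
  assumes "i \<in> I"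
  shows "continuous_map (top_of_set {u. norm u = 1 \<and> \<phi> i u \<in> U}) (top_of_set unit_circle) (bd i)"
proof (cases "{u. norm u = 1 \<and> \<phi> i u \<in> U} = {}")
  case False
  then obtain u where u: "norm u = 1" "\<phi> i u \<in> U" by blast
  then have "\<phi> i ` unit_circle \<inter> U \<noteq> {}" using circle_meets by metis
  note t = \<tau>[OF assms this]
  let ?V = "{u. norm u = 1 \<and> \<phi> i u \<in> U}"
  let ?C = "\<psi> (\<tau> i) ` unit_circle"
  have V: "?V \<subseteq> unit_circle" by auto
  have "continuous_map (top_of_set ?V) T (\<phi> i)"
    by (rule continuous_map_from_subtopology_mono[OF A.attaching[OF assms] V])
  then have "continuous_map (top_of_set ?V) (subtopology T U) (\<phi> i)"
    by (auto simp: continuous_map_in_subtopology)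
  moreover have "continuous_map (subtopology T U) (subtopology T' U') \<sigma>"
    using \<sigma> unfolding homeomorphic_maps_def by blast
  ultimately have "continuous_map (top_of_set ?V) (subtopology T' U') (\<sigma> \<circ> \<phi> i)"
    by (rule continuous_map_compose)
  then have c: "continuous_map (top_of_set ?V) (subtopology T' ?C) (\<sigma> \<circ> \<phi> i)"
    using t by (auto simp: continuous_map_in_subtopology)
  obtain g where g: "homeomorphic_maps (top_of_set unit_circle) (subtopology T' ?C) (\<psi> (\<tau> i)) g"
    using embB[of "\<tau> i"] t unfolding homeomorphic_map_maps by blast
  have "continuous_map (top_of_set ?V) (top_of_set unit_circle) (g \<circ> (\<sigma> \<circ> \<phi> i))"
    by (rule continuous_map_compose[OF c]) (use g in \<open>simp add: homeomorphic_maps_def\<close>)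
  then show ?thesis
  proof (rule continuous_map_eq)
    fix x assume "x \<in> topspace (top_of_set ?V)"
    then have x: "norm x = 1" "\<phi> i x \<in> U" by auto
    have "g (\<psi> (\<tau> i) (bd i x)) = bd i x"
      using g bd(1)[OF assms x] unfolding homeomorphic_maps_def by auto
    then show "(g \<circ> (\<sigma> \<circ> \<phi> i)) x = bd i x" using bd(2)[OF assms x] by simp
  qed
next
  \<comment> \<open>With no direction into \<open>U\<close>, nothing is known about
    \<open>\<tau> i\<close>, but then the domain is empty.\<close>
  case True
  show ?thesis unfolding True by simp
qed

text \<open>On the boundary circle the radial formula gives back \<open>\<sigma>\<close>. This
  agreement lets the part on \<open>T\<close> and the part on the disks fit together
  continuously.\<close>

lemma ext_pt:
  assumes "i \<in> I" "norm z \<le> 1" "z \<noteq> 0" "\<phi> i (sgn z) \<in> U"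
  shows "ext (A.pt i z) = B.pt (\<tau> i) (norm z *\<^sub>R bd i (sgn z))"
proof -
  have s: "norm (sgn z) = 1" using assms by (simp add: norm_sgn)
  note c = bd[OF assms(1) s assms(4)]
  show ?thesis
  proof (cases "norm z = 1")
    case True
    then have "sgn z = z" by (simp add: sgn_div_norm)
    then show ?thesis using True c by (simp add: attach_point_def radial_extension_def)
  next
    case False
    then show ?thesis using c by (simp add: attach_point_def radial_extension_def)
  qed
qed

lemma ext_star: "w \<in> A.star U \<Longrightarrow> ext w \<in> B.star U'"
proof -
  assume "w \<in> A.star U"
  then consider x where "w = Inl x" "x \<in> U"
    | i z where "w = Inr (i, z)" "i \<in> I" "norm z < 1" "z \<noteq> 0" "\<phi> i (sgn z) \<in> U"
    by (auto simp: A.star_def)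
  then show ?thesis
  proof cases
    case 1
    then show ?thesis using \<sigma>_in by (auto simp: B.star_def radial_extension_def)
  next
    case (2 i z)
    have s: "norm (sgn z) = 1" using 2 by (simp add: norm_sgn)
    note c = bd[OF 2(2) s 2(5)]
    have "sgn (norm z *\<^sub>R bd i (sgn z)) = bd i (sgn z)"
      using c 2 by (simp add: sgn_div_norm)
    moreover have "bd i (sgn z) \<noteq> 0" using c(1) by auto
    ultimately show ?thesis using c 2 \<sigma>_in
      by (simp add: B.star_def radial_extension_def)
  qed
qed

lemma continuous_ext: "continuous_map (subtopology A.At (A.star U)) (subtopology B.At (B.star U')) ext"
proof -
  have "continuous_map (subtopology A.At (A.star U)) B.At ext"
  proof (rule A.continuous_map_from_attach[OF A.openin_star[OF U(1)]])
    have e: "{y \<in> topspace T. Inl y \<in> A.star U} = U" using sub by (auto simp: A.star_def)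
    have "continuous_map (subtopology T U) T' \<sigma>"
      using \<sigma> unfolding homeomorphic_maps_def continuous_map_in_subtopology by blast
    then have "continuous_map (subtopology T U) B.At (Inl \<circ> \<sigma>)"
      by (rule continuous_map_compose[OF _ B.continuous_map_Inl])
    moreover have "ext \<circ> Inl = Inl \<circ> \<sigma>" by (auto simp: radial_extension_def)
    ultimately show "continuous_map (subtopology T {y \<in> topspace T. Inl y \<in> A.star U}) B.At (ext \<circ> Inl)"
      unfolding e by simp
    fix i assume i: "i \<in> I"
    define S where "S = {z. norm z \<le> 1 \<and> z \<noteq> 0 \<and> \<phi> i (sgn z) \<in> U}"
    have S: "subtopology (top_of_set closed_disk) {z. A.pt i z \<in> A.star U} = top_of_set S"
      unfolding subtopology_subtopology S_def
      by (rule arg_cong[of _ _ top_of_set]) (use A.pt_in_star[OF i] in auto)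
    show "continuous_map (subtopology (top_of_set closed_disk) {z. A.pt i z \<in> A.star U}) B.At (ext \<circ> A.pt i)"
      unfolding S
    proof (cases "S = {}")
      case False
      then obtain z where z: "norm z \<le> 1" "z \<noteq> 0" "\<phi> i (sgn z) \<in> U" unfolding S_def by blast
      have j: "\<tau> i \<in> J" using bd(3)[OF i _ z(3)] z by (simp add: norm_sgn)
      have "continuous_map (top_of_set S) (top_of_set unit_circle) sgn"
        by (rule continuous_map_from_subtopology_mono[OF A.continuous_sgn]) (auto simp: S_def)
      then have "continuous_map (top_of_set S) (top_of_set {u. norm u = 1 \<and> \<phi> i u \<in> U}) sgn"
        by (auto simp: continuous_map_in_subtopology S_def norm_sgn)
      then have "continuous_map (top_of_set S) (top_of_set unit_circle) (bd i \<circ> sgn)"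
        by (rule continuous_map_compose[OF _ continuous_bd[OF i]])
      then have c1: "continuous_on S (bd i \<circ> sgn)" and c2: "\<And>z. z \<in> S \<Longrightarrow> norm (bd i (sgn z)) = 1"
        by (auto simp: continuous_map_in_subtopology)
      have "continuous_on S (\<lambda>z. norm z *\<^sub>R (bd i \<circ> sgn) z)"
        by (intro continuous_intros c1)
      then have "continuous_map (top_of_set S) (top_of_set closed_disk) (\<lambda>z. norm z *\<^sub>R (bd i \<circ> sgn) z)"
        using c2 by (auto simp: S_def)
      then have "continuous_map (top_of_set S) B.At (B.pt (\<tau> i) \<circ> (\<lambda>z. norm z *\<^sub>R (bd i \<circ> sgn) z))"
        by (rule continuous_map_compose[OF _ B.continuous_map_pt[OF j]])
      then show "continuous_map (top_of_set S) B.At (ext \<circ> A.pt i)"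
        by (rule continuous_map_eq) (use ext_pt[OF i] in \<open>simp add: S_def\<close>)
    qed simp
  qed
  then show ?thesis using ext_star by (auto simp: continuous_map_in_subtopology)
qed

lemma ext_inverse:
  assumes "w \<in> A.star U"
  shows "radial_extension \<sigma>' \<tau>' \<psi> \<phi> (ext w) = w"
proof -
  consider x where "w = Inl x" "x \<in> U"
    | i z where "w = Inr (i, z)" "i \<in> I" "norm z < 1" "z \<noteq> 0" "\<phi> i (sgn z) \<in> U"
    using assms by (auto simp: A.star_def)
  then show ?thesis
  proof cases
    case 1
    then show ?thesis using \<sigma>_in by (auto simp: radial_extension_def)
  next
    case (2 i z)
    have s: "norm (sgn z) = 1" using 2 by (simp add: norm_sgn)
    note c = bd[OF 2(2) s 2(5)]
    have "sgn (norm z *\<^sub>R bd i (sgn z)) = bd i (sgn z)"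
      using c 2 by (simp add: sgn_div_norm)
    moreover have "\<phi> i ` unit_circle \<inter> U \<noteq> {}" using s 2 circle_meets by metis
    moreover note \<tau>[OF 2(2) this]
    moreover have "inj_on (\<phi> i) unit_circle"
      using homeomorphic_imp_injective_map[OF embA[OF 2(2)]] by simp
    then have "inv_into unit_circle (\<phi> i) (\<phi> i (sgn z)) = sgn z"
      using s by (simp add: inv_into_f_f)
    ultimately show ?thesis using 2 c \<sigma>_in
      by (simp add: radial_extension_def) (simp add: sgn_div_norm)
  qed
qed

end

text \<open>The assumptions are symmetric in the two sides, so the inverse of a radial extension is
  again one, and its continuity needs no separate argument.\<close>

lemma radial_sym:
  assumes "radial T I \<phi> T' J \<psi> \<sigma> \<sigma>' \<tau> \<tau>' U U'"
  shows "radial T' J \<psi> T I \<phi> \<sigma>' \<sigma> \<tau>' \<tau> U' U"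
proof -
  interpret radial T I \<phi> T' J \<psi> \<sigma> \<sigma>' \<tau> \<tau>' U U' by fact
  show ?thesis
    by unfold_locales (fact embB embA U homeomorphic_maps_sym[THEN iffD1, OF \<sigma>] \<tau>' \<tau>)+
qed

lemma (in radial) locally_planar_transfer:
  assumes "x \<in> U" "locally_planar_at B.At (Inl (\<sigma> x))"
  shows "locally_planar_at A.At (Inl x)"
proof (rule locally_planar_at_transfer)
  interpret R: radial T' J \<psi> T I \<phi> \<sigma>' \<sigma> \<tau>' \<tau> U' U
    by (rule radial_sym) unfold_locales
  have "homeomorphic_maps (subtopology A.At (A.star U)) (subtopology B.At (B.star U')) ext R.ext"
    unfolding homeomorphic_maps_def
    using continuous_ext R.continuous_ext ext_inverse R.ext_inverse by auto
  then show "homeomorphic_map (subtopology A.At (A.star U)) (subtopology B.At (B.star U')) ext"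
    using homeomorphic_map_maps by blast
  show "openin A.At (A.star U)" "openin B.At (B.star U')" using U A.openin_star B.openin_star by auto
  show "Inl x \<in> A.star U" using assms by (simp add: A.star_def)
  show "locally_planar_at B.At (ext (Inl x))" using assms by (simp add: radial_extension_def)
qed

section \<open>Arcs and simple closed curves\<close>

lemma pathin_reparametrise:
  assumes "pathin X g" "continuous_on {0..1} h" "h ` {0..1} \<subseteq> {0..1}"
  shows "pathin X (g \<circ> h)"
proof -
  have "continuous_map (top_of_set {0..1}) (top_of_set {0..1}) h"
    using assms by auto
  then show ?thesis
    using assms(1) unfolding pathin_def by (rule continuous_map_compose)
qed

text \<open>\<open>A\<close> is the open arc. Only the open interval has to be embedded, so the two
  ends may coincide and loops are included.\<close>

definition arc_between :: "'a topology \<Rightarrow> 'a set \<Rightarrow> 'a \<Rightarrow> 'a \<Rightarrow> bool" where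
  "arc_between X A a b \<longleftrightarrow> (\<exists>g. pathin X g \<and> inj_on g {0<..<1} \<and> A = g ` {0<..<1} \<and>
     g 0 = a \<and> g 1 = b \<and> a \<notin> A \<and> b \<notin> A)"

lemma arc_betweenE:
  assumes "arc_between X A a b"
  obtains g where "pathin X g" "inj_on g {0<..<1}" "A = g ` {0<..<1}" "g 0 = a" "g 1 = b"
    "a \<notin> A" "b \<notin> A" "g ` {0..1} = insert a (insert b A)"
proof -
  obtain g where g: "pathin X g" "inj_on g {0<..<1}" "A = g ` {0<..<1}" "g 0 = a" "g 1 = b"
    "a \<notin> A" "b \<notin> A"
    using assms unfolding arc_between_def by blast
  have "{0..1::real} = insert 0 (insert 1 {0<..<1})" by auto
  then have "g ` {0..1} = insert a (insert b A)" using g by simp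
  then show thesis using that g by blast
qed

lemma arc_between_sym:
  assumes "arc_between X A a b"
  shows "arc_between X A b a"
proof -
  obtain g where g: "pathin X g" "inj_on g {0<..<1}" "A = g ` {0<..<1}" "g 0 = a" "g 1 = b"
    "a \<notin> A" "b \<notin> A" using arc_betweenE[OF assms] by metis
  let ?r = "\<lambda>t::real. 1 - t"
  have im: "?r ` {0<..<1} = {0<..<1}"
    by (auto intro!: image_eqI[of _ _ "1 - _"])
  have "pathin X (g \<circ> ?r)"
    by (rule pathin_reparametrise[OF g(1)]) (auto intro!: continuous_intros)
  moreover have "inj_on (g \<circ> ?r) {0<..<1}"
    by (rule comp_inj_on) (use g(2) im in \<open>auto simp: inj_on_def\<close>)
  moreover have "(g \<circ> ?r) ` {0<..<1} = A" unfolding image_comp[symmetric] im using g by simp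
  ultimately show ?thesis
    unfolding arc_between_def using g by (intro exI[of _ "g \<circ> ?r"]) auto
qed

lemma pathin_compactin: "pathin X g \<Longrightarrow> compactin X (g ` {0..1})"
  unfolding pathin_def by (erule image_compactin[rotated]) (simp add: compactin_subtopology)

lemma arc_between_properties:
  assumes "arc_between X A a b"
  shows "A \<subseteq> topspace X" "a \<in> topspace X" "b \<in> topspace X" "connectedin X A" "A \<noteq> {}"
    "compactin X (insert a (insert b A))" "a \<notin> A" "b \<notin> A"
proof -
  obtain g where g: "pathin X g" "inj_on g {0<..<1}" "A = g ` {0<..<1}" "g 0 = a" "g 1 = b"
    "a \<notin> A" "b \<notin> A" "g ` {0..1} = insert a (insert b A)" using arc_betweenE[OF assms] by metis
  show c: "compactin X (insert a (insert b A))"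
    using pathin_compactin[OF g(1)] g by simp
  then show "A \<subseteq> topspace X" "a \<in> topspace X" "b \<in> topspace X"
    using compactin_subset_topspace by blast+
  show "connectedin X A"
    unfolding g(3) using g(1) unfolding pathin_def
    by (rule connectedin_continuous_map_image) (auto simp: connectedin_subtopology)
  show "A \<noteq> {}" unfolding g(3) by auto
  show "a \<notin> A" "b \<notin> A" using g by auto
qed

text \<open>The closed arc is compact, hence closed, and the ends are limits of the open interval.
  Thus the bare set determines its end points up to order, on which \<open>arc_degree\<close>
  relies.\<close>

lemma arc_between_closure:
  assumes "Hausdorff_space X" "arc_between X A a b"
  shows "X closure_of A = insert a (insert b A)"
proof
  obtain g where g: "pathin X g" "inj_on g {0<..<1}" "A = g ` {0<..<1}" "g 0 = a" "g 1 = b"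
    "a \<notin> A" "b \<notin> A" "g ` {0..1} = insert a (insert b A)" using arc_betweenE[OF assms(2)] by metis
  have "closedin X (insert a (insert b A))"
    using compactin_imp_closedin[OF assms(1) arc_between_properties(6)[OF assms(2)]] .
  then show "X closure_of A \<subseteq> insert a (insert b A)"
    by (rule closure_of_minimal[rotated]) auto
  have "(top_of_set {0..1}) closure_of {0<..<1::real} = {0..1}"
    unfolding closure_of_subtopology by (simp add: Int_absorb1 greaterThanLessThan_subseteq_atLeastAtMost_iff)
  then show "insert a (insert b A) \<subseteq> X closure_of A"
    using continuous_map_image_closure_subset[of "top_of_set {0..1}" X g "{0<..<1}"] g
    unfolding pathin_def by auto
qed

text \<open>The number of ends of \<open>A\<close> at \<open>p\<close>; a loop has two ends at its base point.\<close>

definition arc_degree :: "'a topology \<Rightarrow> 'a set \<Rightarrow> 'a \<Rightarrow> nat" where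
  "arc_degree X A p =
     (if p \<in> X closure_of A - A then if X closure_of A - A = {p} then 2 else 1 else 0)"

lemma arc_degree:
  assumes "Hausdorff_space X" "arc_between X A a b"
  shows "arc_degree X A p = of_bool (a = p) + of_bool (b = p)"
proof -
  have "X closure_of A - A = {a, b}"
    using arc_between_closure[OF assms] arc_between_properties(7,8)[OF assms(2)] by auto
  then show ?thesis unfolding arc_degree_def by auto
qed

text \<open>The outer ends \<open>a\<close> and \<open>c\<close> may coincide: joining two arcs with
  the same pair of ends closes them to a loop.\<close>

lemma arc_join:
  assumes "arc_between X A a b" "arc_between X B b c" "A \<inter> B = {}" "a \<notin> B" "c \<notin> A" "a \<noteq> b" "b \<noteq> c"
  shows "arc_between X (insert b (A \<union> B)) a c"
proof -
  obtain g where g: "pathin X g" "inj_on g {0<..<1}" "A = g ` {0<..<1}" "g 0 = a" "g 1 = b"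
    "a \<notin> A" "b \<notin> A" using arc_betweenE[OF assms(1)] by metis
  obtain h where h: "pathin X h" "inj_on h {0<..<1}" "B = h ` {0<..<1}" "h 0 = b" "h 1 = c"
    "b \<notin> B" "c \<notin> B" using arc_betweenE[OF assms(2)] by metis
  define k where "k t = (if t \<le> 1/2 then g (2 * t) else h (2 * t - 1))" for t :: real
  have "pathin X k"
    unfolding pathin_def k_def
  proof (rule continuous_map_cases_le)
    let ?L = "{x \<in> topspace (top_of_set {0..1}). x \<le> 1/2}" and ?R = "{x \<in> topspace (top_of_set {0..1}). 1/2 \<le> x}"
    have "continuous_map (subtopology (top_of_set {0..1}) ?L) (top_of_set {0..1}) (\<lambda>t::real. 2 * t)"
      by (auto simp: subtopology_subtopology intro!: continuous_intros)
    then have "continuous_map (subtopology (top_of_set {0..1}) ?L) X (g \<circ> (\<lambda>t. 2 * t))"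
      using g(1) unfolding pathin_def by (rule continuous_map_compose)
    then show "continuous_map (subtopology (top_of_set {0..1}) ?L) X (\<lambda>x. g (2 * x))" by (simp add: o_def)
    have "continuous_map (subtopology (top_of_set {0..1}) ?R) (top_of_set {0..1}) (\<lambda>t::real. 2 * t - 1)"
      by (auto simp: subtopology_subtopology intro!: continuous_intros)
    then have "continuous_map (subtopology (top_of_set {0..1}) ?R) X (h \<circ> (\<lambda>t. 2 * t - 1))"
      using h(1) unfolding pathin_def by (rule continuous_map_compose)
    then show "continuous_map (subtopology (top_of_set {0..1}) ?R) X (\<lambda>x. h (2 * x - 1))" by (simp add: o_def)
    fix x :: real assume "x = 1/2"
    then have "2 * x = 1" "2 * x - 1 = 0" by auto
    then show "g (2 * x) = h (2 * x - 1)" using g h by simp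
  qed (auto intro!: continuous_intros)
  moreover have inj: "inj_on k {0<..<1}"
  proof (rule inj_onI)
    have *: False if t: "t \<in> {0<..<1}" "s \<in> {0<..<1}" "k t = k s" "t \<le> 1/2" "\<not> s \<le> 1/2" for t s
    proof -
      have s: "k s \<in> B" using t h(3) by (auto simp: k_def)
      show False
      proof (cases "t = 1/2")
        case True
        then have "2 * t = 1" by simp
        then have "k t = b" using g t(4) by (simp add: k_def)
        then show False using t s h by simp
      next
        case False
        then have "2 * t \<in> {0<..<1}" "k t = g (2 * t)" using t by (auto simp: k_def)
        then have "k t \<in> A" using g(3) by simp
        then show False using s t assms(3) by auto
      qed
    qed
    have l: "t = s" if t: "t \<in> {0<..<1}" "s \<in> {0<..<1}" "k t = k s" "t \<le> 1/2" "s < 1/2" for t s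
    proof -
      have s: "k s \<in> A" using t g(3) by (auto simp: k_def)
      have "t \<noteq> 1/2"
      proof
        assume "t = 1/2"
        then have "2 * t = 1" by simp
        then have "k t = b" using g t(4) by (simp add: k_def)
        then show False using s g t(3) by simp
      qed
      then show ?thesis using inj_onD[OF g(2), of "2 * t" "2 * s"] t by (auto simp: k_def)
    qed
    fix t s assume t: "t \<in> {0<..<1}" "s \<in> {0<..<1}" "k t = k s"
    consider "t \<le> 1/2" "s < 1/2" | "t < 1/2" "s = 1/2" | "t = 1/2" "s = 1/2" | "t \<le> 1/2" "\<not> s \<le> 1/2"
      | "\<not> t \<le> 1/2" "s \<le> 1/2" | "t > 1/2" "s > 1/2" by linarith
    then show "t = s"
    proof cases
      case 1 then show ?thesis using l t by blast
    next
      case 2 then show ?thesis using l[of s t] t by simp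
    next
      case 4 then show ?thesis using *[of t s] t by blast
    next
      case 5 then show ?thesis using *[of s t] t by simp
    next
      case 6 then show ?thesis using inj_onD[OF h(2), of "2 * t - 1" "2 * s - 1"] t by (auto simp: k_def)
    qed simp
  qed
  moreover have "k ` {0<..<1} = insert b (A \<union> B)"
  proof (intro equalityI subsetI)
    fix x assume "x \<in> k ` {0<..<1}"
    then obtain t where t: "0 < t" "t < 1" "x = k t" by auto
    consider "t < 1/2" | "t = 1/2" | "t > 1/2" by linarith
    then show "x \<in> insert b (A \<union> B)"
    proof cases
      case 2
      then have "2 * t = 1" by simp
      then show ?thesis using g(5) t(3) 2 by (simp add: k_def)
    qed (use t g(3) h(3) in \<open>auto simp: k_def\<close>)
  next
    fix x assume "x \<in> insert b (A \<union> B)"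
    then consider "x = b" | "x \<in> A" | "x \<in> B" by blast
    then show "x \<in> k ` {0<..<1}"
    proof cases
      case 1
      then show ?thesis using g by (intro image_eqI[of _ _ "1/2"]) (auto simp: k_def)
    next
      case 2
      then obtain t where "0 < t" "t < 1" "x = g t" using g by auto
      then show ?thesis by (intro image_eqI[of _ _ "t/2"]) (auto simp: k_def)
    next
      case 3
      then obtain t where "0 < t" "t < 1" "x = h t" using h by auto
      then show ?thesis by (intro image_eqI[of _ _ "(t+1)/2"]) (auto simp: k_def field_simps)
    qed
  qed
  moreover have "k 0 = a" "k 1 = c" using g h by (auto simp: k_def)
  ultimately show ?thesis unfolding arc_between_def using assms g h by (intro exI[of _ k]) auto
qed

lemma arc_split:
  assumes "arc_between X A a b" "q \<in> A"
  obtains B C where "arc_between X B a q" "arc_between X C q b" "B \<inter> C = {}" "q \<notin> B \<union> C"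
    "A = insert q (B \<union> C)"
proof -
  obtain g where g: "pathin X g" "inj_on g {0<..<1}" "A = g ` {0<..<1}" "g 0 = a" "g 1 = b"
    "a \<notin> A" "b \<notin> A" using arc_betweenE[OF assms(1)] by metis
  obtain s where s: "0 < s" "s < 1" "q = g s" using assms(2) g(3) by auto
  define h k where "h t = s * t" and "k t = s + (1 - s) * t" for t :: real
  have hr: "0 < h t" "h t < s" "h t < 1" if "0 < t" "t < 1" for t
    using that s by (auto simp: h_def) (metis mult_strict_mono' mult_1 less_imp_le)
  have kr: "s < k t" "k t < 1" "0 < k t" if "0 < t" "t < 1" for t
  proof -
    show "s < k t" using that s by (auto simp: k_def)
    then show "0 < k t" using s by simp
    have "(1 - s) * t < (1 - s) * 1" using that s by (intro mult_strict_left_mono) auto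
    then show "k t < 1" by (simp add: k_def)
  qed
  have hi: "h ` {0<..<1} = {0<..<s}"
  proof (intro equalityI subsetI)
    fix x assume "x \<in> {0<..<s}"
    then show "x \<in> h ` {0<..<1}" using s by (intro image_eqI[of _ _ "x / s"]) (auto simp: h_def)
  qed (use hr in auto)
  have ki: "k ` {0<..<1} = {s<..<1}"
  proof (intro equalityI subsetI)
    fix x assume "x \<in> {s<..<1}"
    then show "x \<in> k ` {0<..<1}" using s
      by (intro image_eqI[of _ _ "(x - s) / (1 - s)"]) (auto simp: k_def)
  qed (use kr in auto)
  have B: "g ` {0<..<s} = (g \<circ> h) ` {0<..<1}" and C: "g ` {s<..<1} = (g \<circ> k) ` {0<..<1}"
    unfolding image_comp[symmetric] hi ki by auto
  have split: "{0<..<1} = insert s ({0<..<s} \<union> {s<..<1})" using s by auto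
  have q: "q \<notin> g ` {0<..<s} \<union> g ` {s<..<1}"
  proof
    assume "q \<in> g ` {0<..<s} \<union> g ` {s<..<1}"
    then have "\<exists>t\<in>{0<..<s} \<union> {s<..<1}. q = g t" by blast
    then obtain t where "t \<in> {0<..<s} \<union> {s<..<1}" "g t = g s" using s(3) by metis
    then have t: "t \<in> {0<..<1}" "t \<noteq> s" "g t = g s" using s by auto
    then show False using inj_onD[OF g(2), of t s] s by auto
  qed
  have nin: "a \<notin> g ` {0<..<s}" "b \<notin> g ` {s<..<1}"
    using g(3,6,7) s by auto
  have qs: "q \<notin> g ` {0<..<s}" "q \<notin> g ` {s<..<1}" using q by blast+
  have ends: "(g \<circ> h) 0 = a" "(g \<circ> h) 1 = q" "(g \<circ> k) 0 = q" "(g \<circ> k) 1 = b"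
    using g s by (simp_all add: h_def k_def)
  show thesis
  proof (rule that)
    show "arc_between X (g ` {0<..<s}) a q"
      unfolding arc_between_def
    proof (intro exI conjI)
      show "pathin X (g \<circ> h)"
        by (rule pathin_reparametrise[OF g(1)])
          (use s in \<open>auto simp: h_def mult_le_one intro!: continuous_intros\<close>)
      show "inj_on (g \<circ> h) {0<..<1}"
      proof (rule comp_inj_on)
        show "inj_on h {0<..<1}" using s by (auto simp: h_def inj_on_def)
        show "inj_on g (h ` {0<..<1})" unfolding hi using g(2) by (rule inj_on_subset) (use s in auto)
      qed
    qed (fact B nin qs ends)+
    show "arc_between X (g ` {s<..<1}) q b"
      unfolding arc_between_def
    proof (intro exI conjI)
      have "k t \<in> {0..1}" if "t \<in> {0..1}" for t
      proof -
        have "1 - k t = (1 - s) * (1 - t)" by (simp add: k_def algebra_simps)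
        then have "k t \<le> 1" using that s by (smt (verit) atLeastAtMost_iff mult_nonneg_nonneg)
        moreover have "0 \<le> k t" using that s by (auto simp: k_def)
        ultimately show ?thesis by simp
      qed
      then have "k ` {0..1} \<subseteq> {0..1}" by (rule image_subsetI)
      moreover have "continuous_on {0..1} k" unfolding k_def by (intro continuous_intros)
      ultimately show "pathin X (g \<circ> k)" by (intro pathin_reparametrise[OF g(1)])
      show "inj_on (g \<circ> k) {0<..<1}"
      proof (rule comp_inj_on)
        show "inj_on k {0<..<1}" using s by (auto simp: k_def inj_on_def)
        show "inj_on g (k ` {0<..<1})" unfolding ki using g(2) by (rule inj_on_subset) (use s in auto)
      qed
    qed (fact C nin qs ends)+
    show "g ` {0<..<s} \<inter> g ` {s<..<1} = {}"
    proof -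
      have "g x \<noteq> g y" if "x \<in> {0<..<s}" "y \<in> {s<..<1}" for x y
        using inj_onD[OF g(2), of x y] that s by auto
      then show ?thesis by blast
    qed
    show "q \<notin> g ` {0<..<s} \<union> g ` {s<..<1}" by (rule q)
    show "A = insert q (g ` {0<..<s} \<union> g ` {s<..<1})"
      unfolding g(3) split using s by auto
  qed
qed

section \<open>The circle as an interval with its ends identified\<close>

definition turn :: "real \<Rightarrow> complex" where "turn t = exp (2 * of_real pi * of_real t * \<i>)"

lemma norm_turn [simp]: "norm (turn t) = 1"
  unfolding turn_def by (simp add: norm_exp_eq_Re)

lemma turn_01 [simp]: "turn 0 = 1" "turn 1 = 1"
  by (auto simp: turn_def exp_eq_1)

lemma turn_eq: "turn s = turn t \<longleftrightarrow> s - t \<in> \<int>"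
proof -
  have "turn s = turn t \<longleftrightarrow> (\<exists>n::int. 2 * of_real pi * of_real s * \<i> = 2 * of_real pi * of_real t * \<i> + (of_int (2 * n) * of_real pi) * \<i>)"
    unfolding turn_def exp_eq by simp
  also have "\<dots> \<longleftrightarrow> (\<exists>n::int. s - t = of_int n)"
  proof (rule arg_cong[of _ _ Ex], rule ext)
    fix n :: int
    have "(2 * of_real pi * of_real s * \<i> = 2 * of_real pi * of_real t * \<i> + (of_int (2 * n) * of_real pi) * \<i>) \<longleftrightarrow>
       2 * pi * s = 2 * pi * t + 2 * of_int n * pi"
      by (simp add: complex_eq_iff)
    also have "\<dots> \<longleftrightarrow> 2 * pi * (s - t - of_int n) = 0" by (auto simp: algebra_simps)
    finally show "(2 * of_real pi * of_real s * \<i> = 2 * of_real pi * of_real t * \<i> + (of_int (2 * n) * of_real pi) * \<i>) \<longleftrightarrow> s - t = of_int n"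
      by simp
  qed
  also have "\<dots> \<longleftrightarrow> s - t \<in> \<int>" by (auto simp: Ints_def)
  finally show ?thesis .
qed

lemma turn_eq_unit:
  assumes "s \<in> {0..1}" "t \<in> {0..1}" "turn s = turn t"
  shows "s = t \<or> {s, t} = {0, 1}"
proof -
  obtain n :: int where n: "s - t = of_int n" using assms(3) unfolding turn_eq by (auto elim: Ints_cases)
  moreover have "-1 \<le> s - t" "s - t \<le> 1" using assms(1,2) by auto
  ultimately have "-1 \<le> n" "n \<le> 1" by linarith+
  then consider "n = -1" | "n = 0" | "n = 1" by linarith
  then show ?thesis by cases (use n assms in auto)
qed

lemma turn_image: "turn ` {0..<1} = unit_circle"
proof (intro equalityI subsetI)
  fix z :: complex assume "z \<in> unit_circle"
  then have z: "norm z = 1" by simp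
  have a: "0 \<le> Arg2pi z" "Arg2pi z < 2 * pi" "z = exp (\<i> * of_real (Arg2pi z))"
    using Arg2pi[of z] z by (auto simp: is_Arg_def)
  then have "z = turn (Arg2pi z / (2 * pi))" by (simp add: turn_def mult.commute)
  then show "z \<in> turn ` {0..<1}" using a by (intro image_eqI) auto
qed auto

lemma turn_image': "turn ` {0..1} = unit_circle"
proof -
  have "{0..1::real} = insert 1 {0..<1}" by auto
  then show ?thesis using turn_image by (simp add: insert_absorb)
qed

lemma continuous_turn: "continuous_on S turn"
  unfolding turn_def by (intro continuous_intros)

text \<open>The circle is the quotient of the interval by its ends, so the loop factors through
  \<open>turn\<close>. The factor is injective, and compactness makes it an embedding.\<close>

lemma loop_simple_closed_curve:
  assumes X: "Hausdorff_space X" and A: "arc_between X A a a"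
  shows "simple_closed_curve X (insert a A)"
proof -
  obtain g where g: "pathin X g" "inj_on g {0<..<1}" "A = g ` {0<..<1}" "g 0 = a" "g 1 = a"
    "a \<notin> A" "g ` {0..1} = insert a A" using arc_betweenE[OF A] by (metis insert_absorb2)
  have "quotient_map (top_of_set {0..1}) (top_of_set unit_circle) turn"
  proof (rule continuous_imp_quotient_map)
    show "continuous_map (top_of_set {0..1}) (top_of_set unit_circle) turn"
      using continuous_turn by auto
    show "compact_space (top_of_set {0..1::real})" by (simp add: compact_space_subtopology)
    show "Hausdorff_space (top_of_set unit_circle)" by (simp add: Hausdorff_space_subtopology)
  qed (use turn_image' in auto)
  moreover have "continuous_map (top_of_set {0..1}) X g" using g(1) unfolding pathin_def .
  ultimately obtain h where h: "continuous_map (top_of_set unit_circle) X h"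
      "h ` unit_circle = g ` {0..1}" "\<And>t. t \<in> {0..1} \<Longrightarrow> h (turn t) = g t"
  proof (rule quotient_map_lift_exists)
    fix s t :: real assume "s \<in> topspace (top_of_set {0..1})" "t \<in> topspace (top_of_set {0..1})" "turn s = turn t"
    then show "g s = g t" using turn_eq_unit[of s t] g(4,5) by (auto simp: doubleton_eq_iff)
  qed (use that in auto)
  have "inj_on h unit_circle"
  proof (rule inj_onI)
    fix u v assume "u \<in> unit_circle" "v \<in> unit_circle" and uv: "h u = h v"
    then obtain s t where st: "s \<in> {0..<1}" "t \<in> {0..<1}" "u = turn s" "v = turn t"
      using turn_image by (metis imageE)
    then have eq: "g s = g t" using h(3) uv by auto
    show "u = v"
    proof (cases "s = 0 \<or> t = 0")
      case True
      then have "s = 0 \<and> t = 0" using eq st g(3,4,6)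
        by (metis atLeastLessThan_iff greaterThanLessThan_iff image_eqI order_le_less)
      then show ?thesis using st by simp
    next
      case False
      then show ?thesis using inj_onD[OF g(2) eq] st by auto
    qed
  qed
  then have "embedding_map (top_of_set unit_circle) X h"
    by (intro continuous_imp_embedding_map[OF h(1) _ X]) (simp_all add: compact_space_subtopology)
  then have "top_of_set unit_circle homeomorphic_space subtopology X (insert a A)"
    using embedding_map_imp_homeomorphic_space h(2) g(7) by fastforce
  then show ?thesis
    unfolding simple_closed_curve_def
    using arc_between_properties(1,2)[OF A] homeomorphic_space_sym by blast
qed

lemma simple_closed_curve_loop:
  assumes C: "simple_closed_curve X C" and p: "p \<in> C"
  shows "arc_between X (C - {p}) p p"
proof -
  have CX: "C \<subseteq> topspace X" using C unfolding simple_closed_curve_def by blast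
  have "top_of_set unit_circle homeomorphic_space subtopology X C"
    using C homeomorphic_space_sym unfolding simple_closed_curve_def by blast
  then obtain h where h: "homeomorphic_map (top_of_set unit_circle) (subtopology X C) h"
    unfolding homeomorphic_space by blast
  have hC: "h ` unit_circle = C" "inj_on h unit_circle"
    using homeomorphic_imp_surjective_map[OF h] homeomorphic_imp_injective_map[OF h] CX
    by (auto simp: Int_absorb1)
  obtain u where u: "norm u = 1" "h u = p" using hC(1) p by auto
  \<comment> \<open>Multiplication by \<open>u\<close> rotates the parametrisation so that it starts
    and ends at \<open>p\<close>.\<close>
  define g where "g t = h (u * turn t)" for t
  have "continuous_map (top_of_set {0..1}) (top_of_set unit_circle) (\<lambda>t. u * turn t)"
    using u(1) continuous_turn by (auto intro!: continuous_intros simp: norm_mult)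
  moreover have "continuous_map (top_of_set unit_circle) X h"
    using homeomorphic_imp_continuous_map[OF h] by (simp add: continuous_map_in_subtopology)
  ultimately have "continuous_map (top_of_set {0..1}) X (h \<circ> (\<lambda>t. u * turn t))"
    by (rule continuous_map_compose)
  then have "pathin X g" unfolding pathin_def g_def by (simp add: o_def)
  moreover have geq: "s = t \<or> {s, t} = {0, 1}" if "s \<in> {0..1}" "t \<in> {0..1}" "g s = g t" for s t
  proof -
    have "u * turn s = u * turn t"
      using inj_onD[OF hC(2), of "u * turn s" "u * turn t"] that u by (auto simp: g_def norm_mult)
    then have "turn s = turn t" using u by auto
    then show ?thesis using turn_eq_unit that by blast
  qed
  then have "inj_on g {0<..<1}"
  proof (intro inj_onI)
    fix s t :: real assume "s \<in> {0<..<1}" "t \<in> {0<..<1}" "g s = g t"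
    then show "s = t" using geq[of s t] by (auto simp: doubleton_eq_iff)
  qed
  moreover have "g ` {0..1} = C"
  proof -
    have "(\<lambda>t. u * turn t) ` {0..1} = unit_circle"
    proof (intro equalityI subsetI)
      fix z assume "z \<in> unit_circle"
      then have "z / u \<in> turn ` {0..1}" unfolding turn_image' using u by (simp add: norm_divide)
      then obtain t where "t \<in> {0..1}" "z / u = turn t" by blast
      moreover have "u \<noteq> 0" using u by auto
      ultimately have "z = u * turn t" by (simp add: field_simps)
      then show "z \<in> (\<lambda>t. u * turn t) ` {0..1}" using \<open>t \<in> {0..1}\<close> by blast
    qed (use u in \<open>auto simp: norm_mult\<close>)
    then have "h ` (\<lambda>t. u * turn t) ` {0..1} = C" using hC by simp
    then show ?thesis unfolding image_image g_def .
  qed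
  then have "C - {p} = g ` {0<..<1}"
  proof -
    assume C: "g ` {0..1} = C"
    have e: "g 0 = p" "g 1 = p" using u by (auto simp: g_def)
    have "{0..1::real} = insert 0 (insert 1 {0<..<1})" by auto
    then have "C = insert p (g ` {0<..<1})" using C e by auto
    moreover have "p \<notin> g ` {0<..<1}"
    proof
      assume "p \<in> g ` {0<..<1}"
      then obtain t where "0 < t" "t < 1" "g t = g 0" using e by auto
      then show False using geq[of t 0] by (auto simp: doubleton_eq_iff)
    qed
    ultimately show ?thesis by auto
  qed
  moreover have "g 0 = p" "g 1 = p" using u by (auto simp: g_def)
  ultimately show ?thesis unfolding arc_between_def by (intro exI[of _ g]) auto
qed

section \<open>Arc systems in which every vertex has degree two\<close>

text \<open>A 2-regular graph drawn in \<open>X\<close>. Disjointness is asked of the open arcs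
  only, so arcs may share ends in \<open>V\<close>. A loop contributes two to the degree of its base
  point.\<close>

definition regular_arcs :: "'a topology \<Rightarrow> 'a set \<Rightarrow> 'a set set \<Rightarrow> bool" where
  "regular_arcs X V \<A> \<longleftrightarrow> finite V \<and> finite \<A> \<and> pairwise disjnt \<A> \<and>
     (\<forall>A\<in>\<A>. A \<inter> V = {} \<and> (\<exists>a\<in>V. \<exists>b\<in>V. arc_between X A a b)) \<and>
     (\<forall>p\<in>V. (\<Sum>A\<in>\<A>. arc_degree X A p) = 2)"

text \<open>A loop uses up the whole degree of its base point. Distinct loops therefore have
  distinct base points, and degree two leaves no vertex without a loop.\<close>

lemma regular_arcs_loops:
  assumes X: "Hausdorff_space X" and R: "regular_arcs X V \<A>"
    and L: "\<And>A a b. A \<in> \<A> \<Longrightarrow> arc_between X A a b \<Longrightarrow> a = b"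
  shows "\<exists>\<C>. finite \<C> \<and> pairwise disjnt \<C> \<and> \<Union>\<C> = V \<union> \<Union>\<A> \<and>
    (\<forall>C\<in>\<C>. simple_closed_curve X C \<and> C \<inter> V \<noteq> {})"
proof -
  have fin: "finite \<A>" and dj: "pairwise disjnt \<A>" and AV: "\<And>A. A \<in> \<A> \<Longrightarrow> A \<inter> V = {}"
    and deg: "\<And>p. p \<in> V \<Longrightarrow> (\<Sum>A\<in>\<A>. arc_degree X A p) = 2"
    using R unfolding regular_arcs_def by auto
  have "\<forall>A\<in>\<A>. \<exists>a\<in>V. arc_between X A a a"
    using R L unfolding regular_arcs_def by metis
  then obtain b where b: "\<And>A. A \<in> \<A> \<Longrightarrow> b A \<in> V \<and> arc_between X A (b A) (b A)" by metis
  have bdeg: "arc_degree X A p = (if b A = p then 2 else 0)" if "A \<in> \<A>" for A p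
    using arc_degree[OF X] b[OF that] by auto
  have neq: "b A \<noteq> b B" if AB: "A \<in> \<A>" "B \<in> \<A>" "A \<noteq> B" for A B
  proof
    assume e: "b A = b B"
    have "(\<Sum>C\<in>{A, B}. arc_degree X C (b A)) \<le> (\<Sum>C\<in>\<A>. arc_degree X C (b A))"
      by (rule sum_mono2[OF fin]) (use AB in auto)
    then show False using deg[of "b A"] b[OF AB(1)] bdeg AB e by auto
  qed
  let ?\<C> = "(\<lambda>A. insert (b A) A) ` \<A>"
  have "pairwise disjnt ?\<C>"
  proof (rule pairwiseI)
    fix C D assume "C \<in> ?\<C>" "D \<in> ?\<C>" "C \<noteq> D"
    then obtain A B where AB: "A \<in> \<A>" "B \<in> \<A>" "A \<noteq> B" "C = insert (b A) A" "D = insert (b B) B" by auto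
    have "disjnt A B" using dj AB unfolding pairwise_def by blast
    moreover have "b A \<notin> B" "b B \<notin> A" using AV AB b by blast+
    ultimately show "disjnt C D" using AB neq[OF AB(1-3)] by (auto simp: disjnt_iff)
  qed
  moreover have "\<Union>?\<C> = V \<union> \<Union>\<A>"
  proof -
    have "V \<subseteq> b ` \<A>"
    proof
      fix p assume "p \<in> V"
      then have "(\<Sum>A\<in>\<A>. arc_degree X A p) \<noteq> 0" using deg by simp
      then obtain A where A: "A \<in> \<A>" "arc_degree X A p \<noteq> 0" by (meson sum.neutral)
      then have "b A = p" using bdeg[OF A(1), of p] by (auto split: if_splits)
      then show "p \<in> b ` \<A>" using A by auto
    qed
    moreover have "b ` \<A> \<subseteq> V" using b by auto
    ultimately show ?thesis by auto
  qed
  moreover have "\<forall>C\<in>?\<C>. simple_closed_curve X C \<and> C \<inter> V \<noteq> {}"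
    using loop_simple_closed_curve[OF X] b by auto
  ultimately show ?thesis using fin by blast
qed

text \<open>The non-loop \<open>A\<close> contributes one to the degree two of \<open>b\<close>, so
  exactly one other arc ends there, and with one end only. Joining the two removes the vertex
  \<open>b\<close> and changes neither the other degrees nor the union.\<close>

lemma regular_arcs_merge:
  assumes X: "Hausdorff_space X" and R: "regular_arcs X V \<A>"
    and A: "A \<in> \<A>" "arc_between X A a b" "a \<noteq> b"
  obtains \<B> where "b \<in> V" "regular_arcs X (V - {b}) \<B>" "(V - {b}) \<union> \<Union>\<B> = V \<union> \<Union>\<A>"
proof -
  have fV: "finite V" and fin: "finite \<A>" and dj: "pairwise disjnt \<A>"
    and AV: "\<And>A. A \<in> \<A> \<Longrightarrow> A \<inter> V = {}"
    and arcs: "\<And>A. A \<in> \<A> \<Longrightarrow> \<exists>a\<in>V. \<exists>b\<in>V. arc_between X A a b"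
    and deg: "\<And>p. p \<in> V \<Longrightarrow> (\<Sum>A\<in>\<A>. arc_degree X A p) = 2"
    using R unfolding regular_arcs_def by auto
  obtain a' b' where ab': "a' \<in> V" "b' \<in> V" "arc_between X A a' b'" using arcs[OF A(1)] by blast
  \<comment> \<open>The given ends \<open>a\<close>, \<open>b\<close> need not come with the
    information that they lie in \<open>V\<close>. The closure of the arc shows that they are the
    pair that the system provides.\<close>
  have cl: "insert a (insert b A) = insert a' (insert b' A)"
    using arc_between_closure[OF X] A(2) ab'(3) by metis
  have abV: "a \<in> V" "b \<in> V"
    using cl ab' arc_between_properties(7,8)[OF A(2)] arc_between_properties(7,8)[OF ab'(3)] by auto
  have "arc_degree X A b = 1" using arc_degree[OF X A(2)] A(3) by simp
  then have "(\<Sum>B\<in>\<A> - {A}. arc_degree X B b) = 1"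
    using deg[OF abV(2)] sum.remove[OF fin A(1), of "\<lambda>B. arc_degree X B b"] by simp
  then obtain B where B: "B \<in> \<A>" "B \<noteq> A" "arc_degree X B b = 1"
    and oth: "\<And>D. D \<in> \<A> - {A} \<Longrightarrow> B \<noteq> D \<Longrightarrow> arc_degree X D b = 0"
    using iffD1[OF sum_eq_1_iff[of "\<A> - {A}" "\<lambda>B. arc_degree X B b"]] fin by blast
  obtain x y where xy: "x \<in> V" "y \<in> V" "arc_between X B x y" using arcs[OF B(1)] by blast
  have "of_bool (x = b) + of_bool (y = b) = (1::nat)" using arc_degree[OF X xy(3)] B(3) by simp
  then have "\<exists>c. c \<noteq> b \<and> c \<in> V \<and> arc_between X B b c"
    using xy arc_between_sym[OF xy(3)] by (cases "x = b"; cases "y = b") auto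
  then obtain c where c: "c \<noteq> b" "c \<in> V" "arc_between X B b c" by blast
  have dAB: "A \<inter> B = {}" using dj A(1) B(1,2) unfolding pairwise_def disjnt_def by metis
  define M where "M = insert b (A \<union> B)"
  have M: "arc_between X M a c"
    unfolding M_def by (rule arc_join[OF A(2) c(3) dAB]) (use AV A B abV c in auto)
  let ?\<B> = "insert M (\<A> - {A, B})"
  have dM: "disjnt M D" if D: "D \<in> \<A> - {A, B}" for D
  proof -
    have "disjnt A D" "disjnt B D" using dj D A B unfolding pairwise_def by blast+
    moreover have "b \<notin> D" using AV D abV by blast
    ultimately show ?thesis unfolding M_def by (auto simp: disjnt_iff)
  qed
  have MA: "M \<notin> \<A> - {A, B}" using dM[of M] M_def by auto
  have Mdeg: "arc_degree X M p = arc_degree X A p + arc_degree X B p" if "p \<noteq> b" for p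
    using arc_degree[OF X] M A(2) c(3) that by auto
  have "regular_arcs X (V - {b}) ?\<B>"
    unfolding regular_arcs_def
  proof (intro conjI ballI)
    show "pairwise disjnt ?\<B>"
      unfolding pairwise_insert using dM dj
      by (auto simp: pairwise_def disjnt_sym)
    fix D assume D: "D \<in> ?\<B>"
    show "D \<inter> (V - {b}) = {}" using D AV A B M_def by auto
    show "\<exists>a\<in>V - {b}. \<exists>b\<in>V - {b}. arc_between X D a b"
    proof (cases "D = M")
      case True
      then show ?thesis using M A(3) abV c by auto
    next
      case False
      then have D': "D \<in> \<A>" "D \<noteq> A" "D \<noteq> B" using D by auto
      then obtain x y where xy: "x \<in> V" "y \<in> V" "arc_between X D x y" using arcs by blast
      have "x \<noteq> b" "y \<noteq> b" using oth[of D] D' arc_degree[OF X xy(3), of b] by auto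
      then show ?thesis using xy by auto
    qed
  next
    fix p assume p: "p \<in> V - {b}"
    have "(\<Sum>D\<in>?\<B>. arc_degree X D p) = arc_degree X M p + (\<Sum>D\<in>\<A> - {A, B}. arc_degree X D p)"
      using MA fin by simp
    also have "\<dots> = arc_degree X A p + (arc_degree X B p + (\<Sum>D\<in>\<A> - {A} - {B}. arc_degree X D p))"
      using Mdeg p by (simp add: Diff_insert2[symmetric] insert_commute)
    also have "\<dots> = (\<Sum>D\<in>\<A>. arc_degree X D p)"
      using sum.remove[OF fin A(1), of "\<lambda>D. arc_degree X D p"]
        sum.remove[of "\<A> - {A}" B "\<lambda>D. arc_degree X D p"] fin B by simp
    finally show "(\<Sum>D\<in>?\<B>. arc_degree X D p) = 2" using deg p by simp
  qed (use fV fin in auto)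
  moreover have "(V - {b}) \<union> \<Union>?\<B> = V \<union> \<Union>\<A>" using A B abV M_def by auto
  ultimately show thesis using that abV by blast
qed

text \<open>Merging lowers the number of vertices, keeps the union, and stops when only loops are
  left. A vertex of the reduced system is one of the original system, so every curve still carries a
  vertex.\<close>

lemma regular_arcs_cycles:
  assumes X: "Hausdorff_space X" and R: "regular_arcs X V \<A>"
  shows "\<exists>\<C>. finite \<C> \<and> pairwise disjnt \<C> \<and> \<Union>\<C> = V \<union> \<Union>\<A> \<and>
    (\<forall>C\<in>\<C>. simple_closed_curve X C \<and> C \<inter> V \<noteq> {})"
  using R
proof (induction "card V" arbitrary: V \<A> rule: less_induct)
  case less
  have fV: "finite V" using less.prems unfolding regular_arcs_def by blast
  show ?case
  proof (cases "\<exists>A a b. A \<in> \<A> \<and> arc_between X A a b \<and> a \<noteq> b")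
    case True
    then obtain A a b where "A \<in> \<A>" "arc_between X A a b" "a \<noteq> b" by blast
    then obtain \<B> where B: "b \<in> V" "regular_arcs X (V - {b}) \<B>" "(V - {b}) \<union> \<Union>\<B> = V \<union> \<Union>\<A>"
      using regular_arcs_merge[OF X less.prems] by metis
    have "card (V - {b}) < card V" using B(1) fV by (rule card_Diff1_less[rotated])
    from less.hyps[OF this B(2)] obtain \<C> where C: "finite \<C>" "pairwise disjnt \<C>"
        "\<Union>\<C> = V \<union> \<Union>\<A>" "\<And>C. C \<in> \<C> \<Longrightarrow> simple_closed_curve X C \<and> C \<inter> (V - {b}) \<noteq> {}"
      unfolding B(3) by metis
    then have "simple_closed_curve X C \<and> C \<inter> V \<noteq> {}" if "C \<in> \<C>" for C
      using C(4)[OF that] by auto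
    then show ?thesis using C(1-3) by metis
  next
    case False
    then have "A \<in> \<A> \<Longrightarrow> arc_between X A a b \<Longrightarrow> a = b" for A a b by metis
    then show ?thesis by (rule regular_arcs_loops[OF X less.prems])
  qed
qed

text \<open>A first point turns the circle into a loop. Each further point splits the arc that
  contains it and becomes a vertex of degree two.\<close>

lemma regular_arcs_circle:
  assumes X: "Hausdorff_space X" and C: "simple_closed_curve X C"
    and P: "finite P" "P \<noteq> {}" "P \<subseteq> C"
  shows "\<exists>\<A>. regular_arcs X P \<A> \<and> P \<union> \<Union>\<A> = C"
  using P
proof (induction rule: finite_ne_induct)
  case (singleton p)
  then have p: "p \<in> C" by auto
  have arc: "arc_between X (C - {p}) p p" using simple_closed_curve_loop[OF C p] .
  have "regular_arcs X {p} {C - {p}}"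
    unfolding regular_arcs_def using arc arc_degree[OF X arc] by auto
  then show ?case using p by (intro exI[of _ "{C - {p}}"]) auto
next
  case (insert q P)
  then obtain \<A> where R: "regular_arcs X P \<A>" and un: "P \<union> \<Union>\<A> = C" by auto
  have fin: "finite \<A>" and dj: "pairwise disjnt \<A>"
    and AV: "\<And>A. A \<in> \<A> \<Longrightarrow> A \<inter> P = {}"
    and arcs: "\<And>A. A \<in> \<A> \<Longrightarrow> \<exists>a\<in>P. \<exists>b\<in>P. arc_between X A a b"
    and deg: "\<And>p. p \<in> P \<Longrightarrow> (\<Sum>A\<in>\<A>. arc_degree X A p) = 2"
    using R unfolding regular_arcs_def by auto
  obtain A where A: "A \<in> \<A>" "q \<in> A" using insert un by blast
  obtain a b where ab: "a \<in> P" "b \<in> P" "arc_between X A a b" using arcs[OF A(1)] by blast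
  obtain B D where BD: "arc_between X B a q" "arc_between X D q b" "B \<inter> D = {}" "q \<notin> B \<union> D"
    "A = insert q (B \<union> D)" using arc_split[OF ab(3) A(2)] by metis
  have ne: "B \<noteq> {}" "D \<noteq> {}" using arc_between_properties(5) BD by metis+
  have "B \<noteq> D" using BD(3) ne by auto
  have dA: "disjnt A E" if "E \<in> \<A> - {A}" for E using dj that A unfolding pairwise_def by blast
  then have dBD: "disjnt B E \<and> disjnt D E" if "E \<in> \<A> - {A}" for E using that BD(5) by (auto simp: disjnt_iff)
  then have nin: "B \<notin> \<A> - {A}" "D \<notin> \<A> - {A}" using ne by (metis disjnt_self_iff_empty)+
  let ?\<B> = "insert B (insert D (\<A> - {A}))"
  have "regular_arcs X (insert q P) ?\<B>"
    unfolding regular_arcs_def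
  proof (intro conjI ballI)
    show "pairwise disjnt ?\<B>"
      unfolding pairwise_insert using dBD dj BD(3)
      by (auto simp: pairwise_def disjnt_def)
    fix E assume E: "E \<in> ?\<B>"
    have "q \<notin> E'" if "E' \<in> \<A> - {A}" for E' using dA[OF that] A by (auto simp: disjnt_iff)
    then show "E \<inter> insert q P = {}" using E AV A BD by auto
    show "\<exists>a\<in>insert q P. \<exists>b\<in>insert q P. arc_between X E a b"
      using E BD ab arcs by blast
  next
    fix p assume p: "p \<in> insert q P"
    have s: "(\<Sum>E\<in>?\<B>. arc_degree X E p) = arc_degree X B p + (arc_degree X D p + (\<Sum>E\<in>\<A> - {A}. arc_degree X E p))"
      using nin \<open>B \<noteq> D\<close> fin by simp
    show "(\<Sum>E\<in>?\<B>. arc_degree X E p) = 2"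
    proof (cases "p = q")
      case True
      have "arc_degree X E p = 0" if E: "E \<in> \<A> - {A}" for E
      proof -
        obtain x y where "x \<in> P" "y \<in> P" "arc_between X E x y" using arcs E by blast
        then show ?thesis using arc_degree[OF X] True insert by auto
      qed
      moreover have "a \<noteq> q" "b \<noteq> q" using ab insert by auto
      ultimately show ?thesis unfolding s using arc_degree[OF X BD(1)] arc_degree[OF X BD(2)] True by simp
    next
      case False
      then have "arc_degree X A p = arc_degree X B p + arc_degree X D p"
        using arc_degree[OF X] ab(3) BD by auto
      then show ?thesis unfolding s using deg[of p] p False sum.remove[OF fin A(1), of "\<lambda>D. arc_degree X D p"] by simp
    qed
  qed (use insert fin in auto)
  moreover have "insert q P \<union> \<Union>?\<B> = C" unfolding un[symmetric] using A BD by auto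
  ultimately show ?case by blast
qed

text \<open>An arc inside another one with the same kind of ends exhausts it: in the parameter interval it
  is open by invariance of domain and closed by compactness.\<close>

lemma arc_between_subset_eq:
  assumes X: "Hausdorff_space X" and A: "arc_between X A a b" and E: "arc_between X E x y"
    and EA: "E \<subseteq> A" and xy: "x \<notin> A" "y \<notin> A"
  shows "E = A"
proof -
  obtain g where g: "pathin X g" "inj_on g {0<..<1}" "A = g ` {0<..<1}" "g 0 = a" "g 1 = b"
    "a \<notin> A" "b \<notin> A" using arc_betweenE[OF A] by metis
  obtain h where h: "pathin X h" "inj_on h {0<..<1}" "E = h ` {0<..<1}" "h 0 = x" "h 1 = y"
    using arc_betweenE[OF E] by metis
  let ?I = "{0<..<1::real}"
  have gin: "g t \<in> A \<longleftrightarrow> t \<in> ?I" if "t \<in> {0..1}" for t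
  proof
    assume "g t \<in> A"
    then show "t \<in> ?I" using that g(4-7) by (cases "t = 0"; cases "t = 1") auto
  qed (use g(3) in auto)
  \<comment> \<open>\<open>g\<close> is closed on the compact interval, and the open interval is the
    full preimage of \<open>A\<close>; hence \<open>g\<close> restricts to a homeomorphism onto
    \<open>A\<close>. In its coordinates the inner arc becomes an injective path on the
    line.\<close>
  have "closed_map (top_of_set {0..1}) X g"
    using g(1) unfolding pathin_def
    by (rule continuous_imp_closed_map[OF _ _ X]) (simp add: compact_space_subtopology)
  then have "closed_map (subtopology (top_of_set {0..1}) ?I) (subtopology X A) g"
    by (rule closed_map_restriction) (use gin in auto)
  moreover have sI: "subtopology (top_of_set {0..1}) ?I = top_of_set ?I"
    unfolding subtopology_subtopology by (rule arg_cong[of _ _ top_of_set]) auto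
  ultimately have cm: "closed_map (top_of_set ?I) (subtopology X A) g" by simp
  have "continuous_map (top_of_set ?I) X g"
    using g(1) unfolding pathin_def by (rule continuous_map_from_subtopology_mono) auto
  then have cg: "continuous_map (top_of_set ?I) (subtopology X A) g"
    using g(3) by (auto simp: continuous_map_in_subtopology)
  have AX: "A \<subseteq> topspace X" using arc_between_properties(1)[OF A] .
  have "homeomorphic_map (top_of_set ?I) (subtopology X A) g"
    by (rule bijective_closed_imp_homeomorphic_map[OF cg cm]) (use g AX in auto)
  then obtain k where k: "homeomorphic_maps (top_of_set ?I) (subtopology X A) g k"
    unfolding homeomorphic_map_maps by blast
  have kg: "k (g t) = t" if "t \<in> ?I" for t using k that unfolding homeomorphic_maps_def by auto
  have gk: "g (k p) = p" "k p \<in> ?I" if "p \<in> A" for p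
    using k that AX unfolding homeomorphic_maps_def continuous_map_def by auto
  have "continuous_map (top_of_set ?I) X h"
    using h(1) unfolding pathin_def by (rule continuous_map_from_subtopology_mono) auto
  then have "continuous_map (top_of_set ?I) (subtopology X A) h"
    using h(3) EA by (auto simp: continuous_map_in_subtopology)
  then have "continuous_map (top_of_set ?I) (top_of_set ?I) (k \<circ> h)"
    by (rule continuous_map_compose) (use k in \<open>simp add: homeomorphic_maps_def\<close>)
  then have c: "continuous_on ?I (k \<circ> h)" by simp
  have "inj_on (k \<circ> h) ?I"
  proof (rule inj_onI)
    fix s t assume st: "s \<in> ?I" "t \<in> ?I" "(k \<circ> h) s = (k \<circ> h) t"
    then have "h s \<in> A" "h t \<in> A" using h(3) EA by auto
    then have "h s = h t" using gk st by (metis comp_apply)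
    then show "s = t" using inj_onD[OF h(2)] st by blast
  qed
  then have "open ((k \<circ> h) ` ?I)"
    using invariance_of_domain_gen[OF _ c] by simp
  moreover have kE: "(k \<circ> h) ` ?I = k ` E" unfolding h(3) by auto
  ultimately have o: "open (k ` E)" by simp
  have kEI: "k ` E \<subseteq> ?I" using gk EA by auto
  have "closedin X (insert x (insert y E))"
    using compactin_imp_closedin[OF X arc_between_properties(6)[OF E]] .
  then have "closedin (subtopology X A) (A \<inter> insert x (insert y E))"
    by (rule closedin_subtopology_Int_closed)
  \<comment> \<open>Passing from \<open>E\<close> to its closure adds only \<open>x\<close> and
    \<open>y\<close>, which lie outside \<open>A\<close>; so \<open>E\<close> is closed in
    \<open>A\<close>.\<close>
  moreover have "A \<inter> insert x (insert y E) = E" using EA xy by auto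
  ultimately have "closedin (subtopology X A) E" by simp
  then have "closedin (top_of_set ?I) {t \<in> topspace (top_of_set ?I). g t \<in> E}"
    by (rule closedin_continuous_map_preimage[OF cg])
  moreover have "{t \<in> topspace (top_of_set ?I). g t \<in> E} = k ` E"
  proof (intro equalityI subsetI)
    fix t assume "t \<in> {t \<in> topspace (top_of_set ?I). g t \<in> E}"
    then show "t \<in> k ` E" using kg by (intro image_eqI[of _ _ "g t"]) auto
  next
    fix t assume "t \<in> k ` E"
    then obtain p where "p \<in> E" "t = k p" by blast
    then show "t \<in> {t \<in> topspace (top_of_set ?I). g t \<in> E}" using gk EA by auto
  qed
  ultimately have c: "closedin (top_of_set ?I) (k ` E)" by simp
  have "openin (top_of_set ?I) (k ` E)" using o kEI by (simp add: open_subset)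
  moreover have "\<forall>T. openin (top_of_set ?I) T \<and> closedin (top_of_set ?I) T \<longrightarrow> T = {} \<or> T = ?I"
    using connected_clopen[of ?I] connected_Ioo by blast
  ultimately have "k ` E = {} \<or> k ` E = ?I" using c by blast
  then have "k ` E = ?I" using arc_between_properties(5)[OF E] by auto
  have "p \<in> E" if p: "p \<in> A" for p
  proof -
    obtain e where e: "e \<in> E" "k p = k e" using gk(2)[OF p] \<open>k ` E = ?I\<close> by (metis imageE)
    then have "p = e" using gk(1)[OF p] gk(1)[of e] EA by auto
    then show ?thesis using e by simp
  qed
  then show ?thesis using EA by blast
qed

text \<open>The closure of an arc of the system adds only vertices, so a connected set that avoids
  the vertices stays in a single arc; having its ends at vertices, it exhausts that arc. This
  recognises a geometrically given arc in a system obtained abstractly by subdivision.\<close>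

lemma regular_arcs_member:
  assumes X: "Hausdorff_space X" and R: "regular_arcs X V \<A>" and E: "arc_between X E x y"
    and xy: "x \<in> V" "y \<in> V" and EV: "E \<inter> V = {}" "E \<subseteq> \<Union>\<A>"
  shows "E \<in> \<A>"
proof -
  have fin: "finite \<A>" and dj: "pairwise disjnt \<A>"
    and AV: "\<And>A. A \<in> \<A> \<Longrightarrow> A \<inter> V = {}"
    and arcs: "\<And>A. A \<in> \<A> \<Longrightarrow> \<exists>a\<in>V. \<exists>b\<in>V. arc_between X A a b"
    using R unfolding regular_arcs_def by auto
  have cl: "X closure_of A \<subseteq> A \<union> V" if "A \<in> \<A>" for A
  proof -
    obtain a b where "a \<in> V" "b \<in> V" "arc_between X A a b" using arcs[OF \<open>A \<in> \<A>\<close>] by blast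
    then show ?thesis using arc_between_closure[OF X] by auto
  qed
  obtain p A where p: "p \<in> E" "A \<in> \<A>" "p \<in> A" using arc_between_properties(5)[OF E] EV by blast
  have EX: "E \<subseteq> topspace X" using arc_between_properties[OF E] by blast
  let ?E = "subtopology X E"
  have "closedin ?E (E \<inter> X closure_of B)" for B
    by (intro closedin_subtopology_Int_closed) simp
  moreover have eq: "E \<inter> X closure_of B = E \<inter> B" if "B \<in> \<A>" for B
  proof -
    obtain a b where "arc_between X B a b" using arcs[OF \<open>B \<in> \<A>\<close>] by blast
    then have "B \<subseteq> X closure_of B" using closure_of_subset arc_between_properties(1) by metis
    then show ?thesis using cl[OF \<open>B \<in> \<A>\<close>] EV(1) by blast
  qed
  ultimately have c: "closedin ?E (E \<inter> B)" if "B \<in> \<A>" for B using that by metis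
  have "closedin ?E (\<Union>B\<in>\<A> - {A}. E \<inter> B)" using c fin by (intro closedin_Union) auto
  moreover have "(\<Union>B\<in>\<A> - {A}. E \<inter> B) = E - (E \<inter> A)"
  proof -
    have "B \<inter> A = {}" if "B \<in> \<A> - {A}" for B using dj that p(2) unfolding pairwise_def disjnt_def by blast
    then show ?thesis using EV(2) p(2) by blast
  qed
  moreover have "topspace ?E = E" using EX by auto
  ultimately have "openin ?E (E \<inter> A)" unfolding openin_closedin_eq by auto
  moreover have "connected_space ?E" using arc_between_properties(4)[OF E] connectedin_def by blast
  ultimately have "E \<inter> A = {} \<or> E \<inter> A = E"
    using c[OF p(2)] \<open>topspace ?E = E\<close> unfolding connected_space_clopen_in by metis
  then have EA: "E \<subseteq> A" using p by blast
  obtain a b where "arc_between X A a b" using arcs[OF p(2)] by blast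
  then have "E = A"
    using arc_between_subset_eq[OF X _ E EA] xy AV[OF p(2)] by blast
  then show ?thesis using p by simp
qed

lemma regular_arcs_Union:
  assumes X: "Hausdorff_space X" and K: "finite K"
    and R: "\<And>k. k \<in> K \<Longrightarrow> regular_arcs X (P k) (\<A> k)"
    and dj: "\<And>k l. k \<in> K \<Longrightarrow> l \<in> K \<Longrightarrow> k \<noteq> l \<Longrightarrow> (P k \<union> \<Union>(\<A> k)) \<inter> (P l \<union> \<Union>(\<A> l)) = {}"
  shows "regular_arcs X (\<Union>k\<in>K. P k) (\<Union>k\<in>K. \<A> k)"
proof -
  have fin: "\<And>k. k \<in> K \<Longrightarrow> finite (\<A> k)" and fP: "\<And>k. k \<in> K \<Longrightarrow> finite (P k)"
    and djA: "\<And>k. k \<in> K \<Longrightarrow> pairwise disjnt (\<A> k)"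
    and AV: "\<And>k A. k \<in> K \<Longrightarrow> A \<in> \<A> k \<Longrightarrow> A \<inter> P k = {}"
    and arcs: "\<And>k A. k \<in> K \<Longrightarrow> A \<in> \<A> k \<Longrightarrow> \<exists>a\<in>P k. \<exists>b\<in>P k. arc_between X A a b"
    and deg: "\<And>k p. k \<in> K \<Longrightarrow> p \<in> P k \<Longrightarrow> (\<Sum>A\<in>\<A> k. arc_degree X A p) = 2"
    using R unfolding regular_arcs_def by auto
  have ne: "A \<noteq> {}" if A: "k \<in> K" "A \<in> \<A> k" for k A
  proof -
    obtain a b where "arc_between X A a b" using arcs[OF A] by blast
    then show ?thesis by (rule arc_between_properties(5))
  qed
  have AA: "A \<inter> B = {}" if "k \<in> K" "l \<in> K" "k \<noteq> l" "A \<in> \<A> k" "B \<in> \<A> l" for k l A B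
    using dj[OF that(1-3)] that(4,5) by blast
  show ?thesis unfolding regular_arcs_def
  proof (intro conjI ballI)
    show "finite (\<Union>k\<in>K. P k)" "finite (\<Union>k\<in>K. \<A> k)" using K fin fP by auto
    show "pairwise disjnt (\<Union>k\<in>K. \<A> k)"
    proof (rule pairwiseI)
      fix A B assume "A \<in> (\<Union>k\<in>K. \<A> k)" "B \<in> (\<Union>k\<in>K. \<A> k)" "A \<noteq> B"
      then obtain k l where "k \<in> K" "l \<in> K" "A \<in> \<A> k" "B \<in> \<A> l" by blast
      then show "disjnt A B" using AA[of k l A B] djA[of k] \<open>A \<noteq> B\<close>
        by (cases "k = l") (auto simp: pairwise_def disjnt_def)
    qed
    fix A assume "A \<in> (\<Union>k\<in>K. \<A> k)"
    then obtain k where k: "k \<in> K" "A \<in> \<A> k" by blast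
    then have "A \<inter> P l = {}" if "l \<in> K" for l
      using dj[of k l] AV[of k A] that by (cases "k = l") blast+
    then show "A \<inter> (\<Union>k\<in>K. P k) = {}" by blast
    show "\<exists>a\<in>\<Union>k\<in>K. P k. \<exists>b\<in>\<Union>k\<in>K. P k. arc_between X A a b" using arcs[OF k] k by blast
  next
    fix p assume "p \<in> (\<Union>k\<in>K. P k)"
    then obtain k0 where k0: "k0 \<in> K" "p \<in> P k0" by blast
    have "(\<Sum>A\<in>(\<Union>k\<in>K. \<A> k). arc_degree X A p) = (\<Sum>k\<in>K. \<Sum>A\<in>\<A> k. arc_degree X A p)"
    proof (rule sum.UNION_disjoint[OF K])
      show "\<forall>k\<in>K. finite (\<A> k)" using fin by blast
      show "\<forall>k\<in>K. \<forall>l\<in>K. k \<noteq> l \<longrightarrow> \<A> k \<inter> \<A> l = {}" using AA ne by (metis Int_absorb disjoint_iff)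
    qed
    also have "\<dots> = (\<Sum>k\<in>K. if k = k0 then 2 else 0)"
    proof (rule sum.cong[OF refl])
      fix k assume k: "k \<in> K"
      show "(\<Sum>A\<in>\<A> k. arc_degree X A p) = (if k = k0 then 2 else 0)"
      proof (cases "k = k0")
        case False
        have "arc_degree X A p = 0" if A: "A \<in> \<A> k" for A
        proof -
          obtain a b where ab: "a \<in> P k" "b \<in> P k" "arc_between X A a b" using arcs[OF k A] by blast
          moreover have "p \<notin> P k" using dj[OF k k0(1) False] k0(2) by blast
          ultimately have "a \<noteq> p" "b \<noteq> p" by auto
          then show ?thesis using arc_degree[OF X ab(3)] by simp
        qed
        then show ?thesis using False by simp
      qed (use deg k0 in auto)
    qed
    also have "\<dots> = 2" using K k0 by simp
    finally show "(\<Sum>A\<in>(\<Union>k\<in>K. \<A> k). arc_degree X A p) = 2" .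
  qed
qed

text \<open>Degrees are compared only in total over \<open>K\<close>, not index by index: a single
  end and a single side of a 1-band do not run between the same corners, but the two ends together
  use the same corners as the two sides.\<close>

lemma regular_arcs_exchange:
  assumes X: "Hausdorff_space X" and R: "regular_arcs X V \<A>" and K: "finite K"
    and E: "inj_on E K" "E ` K \<subseteq> \<A>"
    and S: "\<And>k. k \<in> K \<Longrightarrow> S k \<inter> V = {} \<and> (\<exists>a\<in>V. \<exists>b\<in>V. arc_between X (S k) a b)"
    and dS: "\<And>k l. k \<in> K \<Longrightarrow> l \<in> K \<Longrightarrow> k \<noteq> l \<Longrightarrow> disjnt (S k) (S l)"
    and dA: "\<And>k A. k \<in> K \<Longrightarrow> A \<in> \<A> \<Longrightarrow> disjnt (S k) A"
    and deg: "\<And>p. p \<in> V \<Longrightarrow> (\<Sum>k\<in>K. arc_degree X (E k) p) = (\<Sum>k\<in>K. arc_degree X (S k) p)"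
  shows "regular_arcs X V ((\<A> - E ` K) \<union> S ` K)"
proof -
  have fV: "finite V" and fin: "finite \<A>" and dj: "pairwise disjnt \<A>"
    and AV: "\<And>A. A \<in> \<A> \<Longrightarrow> A \<inter> V = {}"
    and arcs: "\<And>A. A \<in> \<A> \<Longrightarrow> \<exists>a\<in>V. \<exists>b\<in>V. arc_between X A a b"
    and deg2: "\<And>p. p \<in> V \<Longrightarrow> (\<Sum>A\<in>\<A>. arc_degree X A p) = 2"
    using R unfolding regular_arcs_def by auto
  have ne: "S k \<noteq> {}" if k: "k \<in> K" for k
  proof -
    obtain a b where "arc_between X (S k) a b" using S[OF k] by blast
    then show ?thesis by (rule arc_between_properties(5))
  qed
  have inj: "inj_on S K" using dS ne by (auto simp: inj_on_def) (metis disjnt_self_iff_empty)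
  have nin: "S k \<notin> \<A>" if "k \<in> K" for k using dA[OF that, of "S k"] ne[OF that] by auto
  show ?thesis unfolding regular_arcs_def
  proof (intro conjI ballI)
    show "pairwise disjnt ((\<A> - E ` K) \<union> S ` K)"
    proof (rule pairwiseI)
      fix A B assume "A \<in> (\<A> - E ` K) \<union> S ` K" "B \<in> (\<A> - E ` K) \<union> S ` K" "A \<noteq> B"
      then consider "A \<in> \<A>" "B \<in> \<A>" | k where "k \<in> K" "A = S k" "B \<in> \<A>"
        | k where "k \<in> K" "B = S k" "A \<in> \<A>" | k l where "k \<in> K" "A = S k" "l \<in> K" "B = S l" by blast
      then show "disjnt A B"
      proof cases
        case 1 then show ?thesis using dj \<open>A \<noteq> B\<close> unfolding pairwise_def by blast
      next
        case 2 then show ?thesis using dA by blast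
      next
        case 3 then show ?thesis using dA disjnt_sym by blast
      next
        case (4 k l) then show ?thesis using dS[of k l] \<open>A \<noteq> B\<close> by auto
      qed
    qed
    fix A assume "A \<in> (\<A> - E ` K) \<union> S ` K"
    then show "A \<inter> V = {}" "\<exists>a\<in>V. \<exists>b\<in>V. arc_between X A a b" using AV arcs S by blast+
  next
    fix p assume p: "p \<in> V"
    have "(\<Sum>A\<in>(\<A> - E ` K) \<union> S ` K. arc_degree X A p)
        = (\<Sum>A\<in>\<A> - E ` K. arc_degree X A p) + (\<Sum>A\<in>S ` K. arc_degree X A p)"
      by (rule sum.union_disjoint) (use fin K nin in auto)
    also have "(\<Sum>A\<in>S ` K. arc_degree X A p) = (\<Sum>A\<in>E ` K. arc_degree X A p)"
      unfolding sum.reindex[OF inj] sum.reindex[OF E(1)] o_def using deg[OF p] by simp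
    also have "(\<Sum>A\<in>\<A> - E ` K. arc_degree X A p) + \<dots> = (\<Sum>A\<in>\<A>. arc_degree X A p)"
      using sum.subset_diff[OF E(2) fin] by metis
    finally show "(\<Sum>A\<in>(\<A> - E ` K) \<union> S ` K. arc_degree X A p) = 2" using deg2[OF p] by simp
  qed (use fV fin K in auto)
qed

text \<open>Finitely many disjoint closed sets are also open in their union, so a component cannot
  leave the set in which it starts.\<close>

lemma connected_components_of_disjoint_closed:
  assumes fin: "finite \<C>" and dj: "pairwise disjnt \<C>"
    and C: "\<And>C. C \<in> \<C> \<Longrightarrow> closedin X C \<and> connectedin X C \<and> C \<noteq> {}"
  shows "connected_components_of (subtopology X (\<Union>\<C>)) = \<C>"
proof -
  let ?Y = "subtopology X (\<Union>\<C>)"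
  have top: "topspace ?Y = \<Union>\<C>" using C closedin_subset by fastforce
  have comp: "connected_component_of_set ?Y x = C" if xC: "C \<in> \<C>" "x \<in> C" for x C
  proof
    have c: "closedin ?Y D" if "D \<in> \<C>" for D
      using C[OF that] that by (metis Sup_upper closedin_subset_topspace)
    have "closedin ?Y (\<Union>(\<C> - {C}))" using c fin by (intro closedin_Union) auto
    moreover have "\<Union>(\<C> - {C}) = topspace ?Y - C"
    proof -
      have "D \<inter> C = {}" if "D \<in> \<C> - {C}" for D using dj that xC unfolding pairwise_def disjnt_def by blast
      then show ?thesis unfolding top using xC by blast
    qed
    ultimately have "openin ?Y C" unfolding openin_closedin_eq using top xC by auto
    then have "connected_component_of_set ?Y x \<subseteq> C \<or> disjnt (connected_component_of_set ?Y x) C"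
      using connectedin_clopen_cases[OF connectedin_connected_component_of c[OF xC(1)]] by blast
    moreover have "x \<in> connected_component_of_set ?Y x"
      using xC top connected_component_of_refl[of ?Y x] by auto
    ultimately show "connected_component_of_set ?Y x \<subseteq> C" using xC by (auto simp: disjnt_iff)
    have "connectedin ?Y C" using C[OF xC(1)] xC by (auto simp: connectedin_subtopology)
    then show "C \<subseteq> connected_component_of_set ?Y x" using connected_component_of_maximal xC by metis
  qed
  have "connected_components_of ?Y = (\<lambda>x. connected_component_of_set ?Y x) ` \<Union>\<C>"
    unfolding connected_components_of_def top ..
  also have "\<dots> = \<C>"
  proof (intro equalityI subsetI)
    fix D assume D: "D \<in> \<C>"
    then obtain x where "x \<in> D" using C by blast
    then show "D \<in> (\<lambda>x. connected_component_of_set ?Y x) ` \<Union>\<C>" using comp[OF D] D by blast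
  qed (use comp in auto)
  finally show ?thesis .
qed

section \<open>The geometry of a band decomposition\<close>

lemma disk_band_parametrisation:
  assumes "disk_band X A"
  obtains h where "homeomorphic_map (top_of_set closed_disk) (subtopology X (X closure_of A)) h"
    "h ` open_disk = A" "h ` unit_circle = X closure_of A - A"
    "homeomorphic_map (top_of_set unit_circle) (subtopology X (X closure_of A - A)) h"
proof -
  obtain h where h: "homeomorphic_map (top_of_set closed_disk) (subtopology X (X closure_of A)) h"
    and hA: "h ` open_disk = A"
    using assms unfolding disk_band_def by blast
  have im: "h ` closed_disk = X closure_of A" and inj: "inj_on h closed_disk"
    using homeomorphic_imp_surjective_map[OF h] homeomorphic_imp_injective_map[OF h]
      closure_of_subset_topspace[of X A] by (auto simp: inf_absorb2)
  have "unit_circle = closed_disk - (open_disk :: complex set)" by auto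
  then have hS: "h ` unit_circle = X closure_of A - A"
    using inj_on_image_set_diff[OF inj, of closed_disk open_disk] im hA by auto
  have "homeomorphic_map (subtopology (top_of_set closed_disk) unit_circle)
      (subtopology (subtopology X (X closure_of A)) (X closure_of A - A)) h"
    by (rule homeomorphic_map_subtopologies[OF h])
      (use hS closure_of_subset_topspace[of X A] sphere_cball[of "0::complex" 1] in \<open>auto simp: Int_absorb1 Int_absorb2 inf_absorb2\<close>)
  moreover have "subtopology (top_of_set closed_disk) unit_circle = top_of_set (unit_circle :: complex set)"
    unfolding subtopology_subtopology by (rule arg_cong[of _ _ top_of_set]) auto
  moreover have "subtopology (subtopology X (X closure_of A)) (X closure_of A - A) = subtopology X (X closure_of A - A)"
    unfolding subtopology_subtopology by (rule arg_cong[of _ _ "subtopology X"]) auto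
  ultimately show thesis using that h hA hS by metis
qed

lemma disk_band_boundary:
  assumes "disk_band X A"
  shows "simple_closed_curve X (X closure_of A - A)"
proof -
  obtain h where "homeomorphic_map (top_of_set unit_circle) (subtopology X (X closure_of A - A)) h"
    using disk_band_parametrisation[OF assms] by metis
  then have "subtopology X (X closure_of A - A) homeomorphic_space top_of_set unit_circle"
    using homeomorphic_map_imp_homeomorphic_space homeomorphic_space_sym by metis
  then show ?thesis unfolding simple_closed_curve_def using closure_of_subset_topspace[of X A] by blast
qed

lemma simple_closed_curve_closed:
  assumes "Hausdorff_space X" "simple_closed_curve X C"
  shows "closedin X C" "connectedin X C" "C \<noteq> {}"
proof -
  have CX: "C \<subseteq> topspace X" and h: "subtopology X C homeomorphic_space top_of_set unit_circle"
    using assms(2) unfolding simple_closed_curve_def by auto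
  have "compact_space (subtopology X C)"
    using homeomorphic_compact_space[OF h] by (simp add: compact_space_subtopology)
  then have "compactin X C" using CX by (simp add: compactin_subspace)
  then show "closedin X C" using compactin_imp_closedin assms(1) by blast
  have "connected_space (subtopology X C)"
    using homeomorphic_connected_space[OF h] connected_sphere[of "0::complex" 1]
    by (simp add: connectedin_def[symmetric] connected_space_subtopology)
  then show "connectedin X C" using CX by (simp add: connectedin_def)
  obtain f where "homeomorphic_map (top_of_set unit_circle) (subtopology X C) f"
    using h homeomorphic_space homeomorphic_space_sym by metis
  then have "f ` unit_circle = topspace (subtopology X C)"
    using homeomorphic_imp_surjective_map by fastforce
  then have "f 1 \<in> C" using CX by (metis IntD2 imageI mem_sphere_0 norm_one topspace_subtopology)
  then show "C \<noteq> {}" by blast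
qed

locale band_structure =
  fixes X :: "'a topology" and N :: "('a, 'v, 'e) bands" and \<phi> :: "'e \<Rightarrow> real \<times> real \<Rightarrow> 'a"
  assumes surface: "surface X" and decomposition: "band_decomposition X N"
    and quadrilaterals: "quadrilaterals X N \<phi>" and edges_nonempty: "one_index N \<noteq> {}"
begin

abbreviation E where "E \<equiv> one_index N"
abbreviation c where "c \<equiv> zero_band N"
abbreviation q where "q \<equiv> one_band N"
abbreviation C where "C v \<equiv> X closure_of zero_band N v"
abbreviation Q where "Q e \<equiv> X closure_of one_band N e"
abbreviation Z where "Z \<equiv> zero_closed X N"
abbreviation T where "T \<equiv> two_closed X N"
definition ends_of where "ends_of e = \<phi> e ` ({0, 1} \<times> {0..1})"
definition sides_of where "sides_of e = \<phi> e ` ({0..1} \<times> {0, 1})"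
definition vertex_points where "vertex_points = (\<Union>e\<in>E. \<phi> e ` corners)"
text \<open>The part of \<Theta>(N) along which 0-bands and 2-bands meet directly. By
  \<open>corners_in\<close> it also contains all vertices.\<close>

definition seam where "seam = Z \<inter> T"
definition fr where "fr S = seam \<union> (\<Union>e\<in>S. sides_of e) \<union> (\<Union>e\<in>E - S. ends_of e)"

lemma X: "Hausdorff_space X" "compact_space X" "connected_space X"
  using surface unfolding surface_def by auto

lemma finite_bands: "finite (zero_index N)" "finite E" "finite (two_bands N)"
  using decomposition unfolding band_decomposition_def by auto

lemma disk_bands: "v \<in> zero_index N \<Longrightarrow> disk_band X (c v)" "A \<in> two_bands N \<Longrightarrow> disk_band X A"
  using decomposition unfolding band_decomposition_def by auto

lemma open_bands: "v \<in> zero_index N \<Longrightarrow> openin X (c v)" "A \<in> two_bands N \<Longrightarrow> openin X A"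
    "e \<in> E \<Longrightarrow> openin X (q e)"
  using disk_bands quadrilaterals unfolding disk_band_def quadrilaterals_def by auto

lemma closed_disjoint:
  "v \<in> zero_index N \<Longrightarrow> w \<in> zero_index N \<Longrightarrow> v \<noteq> w \<Longrightarrow> C v \<inter> C w = {}"
  "A \<in> two_bands N \<Longrightarrow> B \<in> two_bands N \<Longrightarrow> A \<noteq> B \<Longrightarrow> X closure_of A \<inter> X closure_of B = {}"
  using decomposition unfolding band_decomposition_def by auto

lemma topspace_bands: "topspace X = Z \<union> (\<Union>e\<in>E. Q e) \<union> T"
  using decomposition unfolding band_decomposition_def by blast

lemma band_subset_closure: "v \<in> zero_index N \<Longrightarrow> c v \<subseteq> C v" "A \<in> two_bands N \<Longrightarrow> A \<subseteq> X closure_of A"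
    "e \<in> E \<Longrightarrow> q e \<subseteq> Q e"
  using open_bands openin_subset closure_of_subset by metis+

text \<open>An open set that misses a set also misses its closure. In this way the disjointness of
  the interiors of bands passes to closed bands.\<close>

lemma zero_disjoint:
  assumes v: "v \<in> zero_index N"
  shows "e \<in> E \<Longrightarrow> c v \<inter> Q e = {}" "c v \<inter> T = {}"
proof -
  have d: "\<And>e. e \<in> E \<Longrightarrow> c v \<inter> q e = {}" "\<And>A. A \<in> two_bands N \<Longrightarrow> c v \<inter> A = {}"
    using decomposition v unfolding band_decomposition_def by auto
  show "c v \<inter> Q e = {}" if "e \<in> E"
    using openin_Int_closure_of_eq_empty[OF open_bands(1)[OF v], of "q e"] d(1)[OF that] by blast
  have "c v \<inter> X closure_of A = {}" if "A \<in> two_bands N" for A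
    using openin_Int_closure_of_eq_empty[OF open_bands(1)[OF v], of A] d(2)[OF that] by blast
  then show "c v \<inter> T = {}" unfolding two_closed_def by blast
qed

lemma two_disjoint:
  assumes A: "A \<in> two_bands N"
  shows "e \<in> E \<Longrightarrow> A \<inter> Q e = {}" "A \<inter> Z = {}"
proof -
  have d: "\<And>e. e \<in> E \<Longrightarrow> A \<inter> q e = {}" "\<And>v. v \<in> zero_index N \<Longrightarrow> A \<inter> c v = {}"
    using decomposition A unfolding band_decomposition_def by (auto simp: Int_commute)
  show "A \<inter> Q e = {}" if "e \<in> E"
    using openin_Int_closure_of_eq_empty[OF open_bands(2)[OF A], of "q e"] d(1)[OF that] by blast
  have "A \<inter> C v = {}" if "v \<in> zero_index N" for v
    using openin_Int_closure_of_eq_empty[OF open_bands(2)[OF A], of "c v"] d(2)[OF that] by blast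
  then show "A \<inter> Z = {}" unfolding zero_closed_def by blast
qed

lemma closed_bands: "closedin X Z" "closedin X T" "closedin X (Q e)"
  unfolding zero_closed_def two_closed_def using finite_bands by (auto intro!: closedin_Union)

lemma quad:
  assumes "e \<in> E"
  shows "continuous_map (top_of_set square) X (\<phi> e)" "\<phi> e ` square = Q e"
    "\<phi> e ` ({0<..<1} \<times> {0<..<1}) = q e" "inj_on (\<phi> e) (square - corners)"
    "\<phi> e ` corners \<inter> \<phi> e ` (square - corners) = {}" "X interior_of (Q e) = q e"
    "Q e \<inter> Z = ends_of e" "Q e \<inter> T = sides_of e"
proof -
  note * = bspec[OF conjunct1[OF quadrilaterals[unfolded quadrilaterals_def]] assms]
  show "continuous_map (top_of_set square) X (\<phi> e)" using * by (elim conjE)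
  show "\<phi> e ` square = Q e" using * by (elim conjE)
  show "\<phi> e ` ({0<..<1} \<times> {0<..<1}) = q e" using * by (elim conjE)
  show "inj_on (\<phi> e) (square - corners)" using * by (elim conjE)
  show "\<phi> e ` corners \<inter> \<phi> e ` (square - corners) = {}" using * by (elim conjE)
  show "X interior_of (Q e) = q e" using * by (elim conjE)
  show "Q e \<inter> Z = ends_of e" unfolding ends_of_def using * by (elim conjE)
  show "Q e \<inter> T = sides_of e" unfolding sides_of_def using * by (elim conjE)
qed

text \<open>A quadrilateral can be pinched only at its corners, and a pinch identifies corners with
  corners. Injectivity and the separation of the corners from the rest are combined here into one
  usable statement.\<close>

lemma quad_eq:
  assumes e: "e \<in> E" and z: "z \<in> square" "w \<in> square" "\<phi> e z = \<phi> e w"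
  shows "z = w \<or> z \<in> corners \<and> w \<in> corners"
proof -
  have aux: False if "a \<in> corners" "b \<in> square" "b \<notin> corners" "\<phi> e a = \<phi> e b" for a b
  proof -
    have "\<phi> e a \<in> \<phi> e ` corners" using that(1) by (rule imageI)
    moreover have "\<phi> e b \<in> \<phi> e ` (square - corners)" using that(2,3) by (intro imageI DiffI)
    ultimately show False using quad(5)[OF e] that(4) by (metis disjoint_iff)
  qed
  show ?thesis
  proof (cases "z \<in> corners \<or> w \<in> corners")
    case True
    then show ?thesis using aux[of z w] aux[of w z] z by metis
  next
    case False
    then show ?thesis using inj_onD[OF quad(4)[OF e] z(3)] z(1,2) by (metis DiffI)
  qed
qed

lemma quad_inter:
  assumes "e \<in> E" "e' \<in> E" "e \<noteq> e'"
  shows "Q e \<inter> Q e' \<subseteq> \<phi> e ` corners"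
  using quadrilaterals assms unfolding quadrilaterals_def by blast

lemma quad_closed:
  assumes e: "e \<in> E" and S: "S \<subseteq> square" "closed S"
  shows "closedin X (\<phi> e ` S)"
proof -
  have "compact (square \<inter> S)" using S by (intro compact_Int_closed compact_Times) auto
  then have "compact S" using S(1) by (simp add: inf_absorb2)
  then have "compactin X (\<phi> e ` S)"
    by (intro image_compactin[OF _ quad(1)[OF e]]) (use S in \<open>simp add: compactin_subtopology\<close>)
  then show ?thesis using compactin_imp_closedin X by blast
qed

lemma ends_sides_closed: "e \<in> E \<Longrightarrow> closedin X (ends_of e)" "e \<in> E \<Longrightarrow> closedin X (sides_of e)"
proof -
  assume e: "e \<in> E"
  have "closed ({0, 1::real} \<times> {0..1::real})" "closed ({0..1::real} \<times> {0, 1::real})"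
    by (rule closed_Times; simp add: finite_imp_closed)+
  then show "closedin X (ends_of e)" "closedin X (sides_of e)"
    unfolding ends_of_def sides_of_def by (auto intro!: quad_closed[OF e])
qed

lemma Q_split:
  assumes "e \<in> E"
  shows "Q e = q e \<union> ends_of e \<union> sides_of e"
proof -
  have "square = {0<..<1} \<times> {0<..<1} \<union> {0, 1} \<times> {0..1} \<union> {0..1} \<times> {0, 1::real}" by auto
  then have "Q e = \<phi> e ` ({0<..<1} \<times> {0<..<1} \<union> {0, 1} \<times> {0..1} \<union> {0..1} \<times> {0, 1})"
    using quad(2)[OF assms] by argo
  then show ?thesis using quad(3)[OF assms] unfolding image_Un ends_of_def sides_of_def by argo
qed

lemma q_disjoint:
  assumes e: "e \<in> E"
  shows "q e \<inter> Z = {}" "q e \<inter> T = {}"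
proof -
  have "q e \<inter> C v = {}" if "v \<in> zero_index N" for v
    using openin_Int_closure_of_eq_empty[OF open_bands(3)[OF e], of "c v"]
      zero_disjoint(1)[OF that e] band_subset_closure(3)[OF e] by blast
  then show "q e \<inter> Z = {}" unfolding zero_closed_def by blast
  have "q e \<inter> X closure_of A = {}" if "A \<in> two_bands N" for A
    using openin_Int_closure_of_eq_empty[OF open_bands(3)[OF e], of A]
      two_disjoint(1)[OF that e] band_subset_closure(3)[OF e] by blast
  then show "q e \<inter> T = {}" unfolding two_closed_def by blast
qed

lemma corners_in:
  assumes e: "e \<in> E"
  shows "\<phi> e ` corners \<subseteq> seam" "Q e \<inter> seam = \<phi> e ` corners" "ends_of e \<inter> sides_of e = \<phi> e ` corners"
proof -
  have 1: "\<phi> e ` corners \<subseteq> ends_of e" "\<phi> e ` corners \<subseteq> sides_of e"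
    unfolding ends_of_def sides_of_def by (rule image_mono, auto)+
  have 2: "ends_of e \<inter> sides_of e \<subseteq> \<phi> e ` corners"
  proof
    fix x assume "x \<in> ends_of e \<inter> sides_of e"
    then obtain z w where zw: "z \<in> {0, 1} \<times> {0..1}" "w \<in> {0..1} \<times> {0, 1}" "x = \<phi> e z" "x = \<phi> e w"
      unfolding ends_of_def sides_of_def by blast
    then have "z = w \<or> z \<in> corners \<and> w \<in> corners" by (intro quad_eq[OF e]) auto
    then have "z \<in> corners" using zw by auto
    then show "x \<in> \<phi> e ` corners" using zw by blast
  qed
  show 3: "ends_of e \<inter> sides_of e = \<phi> e ` corners" using 1 2 by blast
  then show 4: "Q e \<inter> seam = \<phi> e ` corners" unfolding seam_def using quad(7,8)[OF e] by blast
  then show "\<phi> e ` corners \<subseteq> seam" by blast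
qed

lemma vertex_points_seam: "vertex_points \<subseteq> seam"
  unfolding vertex_points_def using corners_in(1) by blast

lemma corner_vertex: "e \<in> E \<Longrightarrow> \<phi> e ` corners \<subseteq> vertex_points"
  unfolding vertex_points_def by (rule UN_upper)

lemma Q_inter_vertex: "e \<in> E \<Longrightarrow> e' \<in> E \<Longrightarrow> e \<noteq> e' \<Longrightarrow> Q e \<inter> Q e' \<subseteq> vertex_points"
  using quad_inter[of e e'] corner_vertex[of e] by blast

lemma Q_seam_vertex: "e \<in> E \<Longrightarrow> Q e \<inter> seam \<subseteq> vertex_points"
  using corners_in(2)[of e] corner_vertex[of e] by blast

lemma ends_sides_vertex: "e \<in> E \<Longrightarrow> ends_of e \<inter> sides_of e \<subseteq> vertex_points"
  using corners_in(3)[of e] corner_vertex[of e] by blast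

lemma vertex_in_Q: "e \<in> E \<Longrightarrow> vertex_points \<inter> Q e = \<phi> e ` corners"
  using vertex_points_seam corners_in(2)[of e] corner_vertex[of e] by blast

lemma finite_vertex_points: "finite vertex_points"
  unfolding vertex_points_def using finite_bands by auto

lemma ends_sides_Q: "e \<in> E \<Longrightarrow> ends_of e \<subseteq> Q e" "e \<in> E \<Longrightarrow> sides_of e \<subseteq> Q e"
  "e \<in> E \<Longrightarrow> ends_of e \<subseteq> Z" "e \<in> E \<Longrightarrow> sides_of e \<subseteq> T"
  using quad(7,8) by blast+

lemma Z_T_Q:
  "e \<in> E \<Longrightarrow> x \<in> Q e \<Longrightarrow> x \<in> Z \<longleftrightarrow> x \<in> ends_of e"
  "e \<in> E \<Longrightarrow> x \<in> Q e \<Longrightarrow> x \<in> T \<longleftrightarrow> x \<in> sides_of e"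
  using quad(7,8) by blast+

text \<open>The closure of the complement is the union of the remaining closed bands, because each
  remaining open band lies in the complement. The frontier is thus an intersection of two unions of
  closed bands, which is evaluated pair by pair.\<close>

lemma frontier_band_union:
  assumes S: "S \<subseteq> E"
  shows "X frontier_of band_union X N S = fr S"
proof -
  let ?D = "band_union X N S"
  let ?R = "T \<union> (\<Union>e\<in>E - S. Q e)"
  have fin: "finite S" "finite (E - S)" using S finite_bands(2) finite_subset by auto
  have cD: "closedin X ?D" unfolding band_union_def using closed_bands fin
    by (intro closedin_Un closedin_Union) auto
  have cR: "closedin X ?R" using closed_bands fin by (intro closedin_Un closedin_Union) auto
  have "topspace X - ?D \<subseteq> ?R" unfolding topspace_bands band_union_def by blast
  then have 1: "X closure_of (topspace X - ?D) \<subseteq> ?R" using cR by (rule closure_of_minimal)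
  have A: "A \<subseteq> topspace X - ?D" if A: "A \<in> two_bands N" for A
    using two_disjoint[OF A] openin_subset[OF open_bands(2)[OF A]] S unfolding band_union_def by blast
  have qe: "q e \<subseteq> topspace X - ?D" if e: "e \<in> E - S" for e
  proof -
    have e': "e \<in> E" using e by blast
    have "q e \<inter> Q e' = {}" if "e' \<in> S" for e'
    proof -
      have "q e \<inter> Q e' \<subseteq> seam" using Q_inter_vertex[OF e', of e'] that e S
          vertex_points_seam band_subset_closure(3)[OF e'] by blast
      then show ?thesis using q_disjoint[OF e'] unfolding seam_def by blast
    qed
    then show ?thesis using q_disjoint[OF e'] openin_subset[OF open_bands(3)[OF e']]
      unfolding band_union_def by blast
  qed
  have 2: "?R \<subseteq> X closure_of (topspace X - ?D)"
  proof -
    have "X closure_of A \<subseteq> X closure_of (topspace X - ?D)" if "A \<in> two_bands N" for A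
      by (rule closure_of_mono[OF A[OF that]])
    moreover have "Q e \<subseteq> X closure_of (topspace X - ?D)" if "e \<in> E - S" for e
      by (rule closure_of_mono[OF qe[OF that]])
    ultimately show ?thesis unfolding two_closed_def by blast
  qed
  have "X frontier_of ?D = ?D \<inter> ?R"
    unfolding frontier_of_closures closure_of_closedin[OF cD] using 1 2 by blast
  also have "\<dots> = fr S"
  proof (intro equalityI subsetI)
    fix x assume x: "x \<in> ?D \<inter> ?R"
    then consider "x \<in> Z" "x \<in> T" | e where "x \<in> Z" "e \<in> E - S" "x \<in> Q e"
      | e where "x \<in> T" "e \<in> S" "x \<in> Q e" | e e' where "e \<in> S" "e' \<in> E - S" "x \<in> Q e" "x \<in> Q e'"
      unfolding band_union_def by blast
    then show "x \<in> fr S"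
    proof cases
      case 1 then show ?thesis unfolding fr_def seam_def by blast
    next
      case 2 then show ?thesis using Z_T_Q(1)[of e x] unfolding fr_def by blast
    next
      case 3 then show ?thesis using Z_T_Q(2)[of e x] S unfolding fr_def by blast
    next
      \<comment> \<open>A 1-band inside and a 1-band outside meet only in corners, and these already
        lie on the seam.\<close>
      case (4 e e')
      then have "x \<in> seam" using Q_inter_vertex[of e e'] S vertex_points_seam by blast
      then show ?thesis unfolding fr_def by blast
    qed
  next
    fix x assume "x \<in> fr S"
    then consider "x \<in> Z" "x \<in> T" | e where "e \<in> S" "x \<in> sides_of e" | e where "e \<in> E - S" "x \<in> ends_of e"
      unfolding fr_def seam_def by blast
    then show "x \<in> ?D \<inter> ?R"
    proof cases
      case 1 then show ?thesis unfolding band_union_def by blast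
    next
      case 2 then show ?thesis using ends_sides_Q[of e] S unfolding band_union_def by blast
    next
      case 3 then show ?thesis using ends_sides_Q[of e] unfolding band_union_def by blast
    qed
  qed
  finally show ?thesis .
qed

text \<open>A boundary point of a 0-band away from all 1-bands and 2-bands would be interior to the
  closed 0-band. The condition in \<open>disk_band\<close> that a band is the interior of its
  closure excludes this.\<close>

lemma fr_empty: "fr {} = (\<Union>v\<in>zero_index N. C v - c v)"
proof (intro equalityI subsetI)
  fix x assume "x \<in> fr {}"
  then have "x \<in> Z \<and> (x \<in> T \<or> (\<exists>e\<in>E. x \<in> Q e))"
    unfolding fr_def seam_def using ends_sides_Q by blast
  then obtain v where "v \<in> zero_index N" "x \<in> C v" "x \<in> T \<or> (\<exists>e\<in>E. x \<in> Q e)"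
    unfolding zero_closed_def by blast
  then show "x \<in> (\<Union>v\<in>zero_index N. C v - c v)" using zero_disjoint[of v] by blast
next
  fix x assume "x \<in> (\<Union>v\<in>zero_index N. C v - c v)"
  then obtain v where v: "v \<in> zero_index N" "x \<in> C v" "x \<notin> c v" by blast
  let ?R = "T \<union> (\<Union>e\<in>E. Q e) \<union> (\<Union>w\<in>zero_index N - {v}. C w)"
  have "x \<in> T \<or> (\<exists>e\<in>E. x \<in> Q e)"
  proof (rule ccontr)
    assume "\<not> ?thesis"
    then have xR: "x \<in> topspace X - ?R" using v closed_disjoint(1) closure_of_subset_topspace[of X "c v"] by blast
    have "closedin X ?R" using closed_bands finite_bands by (intro closedin_Un closedin_Union) auto
    then have "openin X (topspace X - ?R)" by (simp add: openin_diff)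
    moreover have "topspace X - ?R \<subseteq> C v" unfolding topspace_bands zero_closed_def by blast
    ultimately have "x \<in> X interior_of C v" using xR unfolding interior_of_def by blast
    then show False using v disk_bands(1)[OF v(1)] unfolding disk_band_def by blast
  qed
  moreover have "x \<in> Z" using v unfolding zero_closed_def by blast
  ultimately show "x \<in> fr {}" unfolding fr_def seam_def using Z_T_Q(1) by blast
qed

text \<open>The mirror image of \<open>fr_empty\<close>: 0-bands and 2-bands exchange their roles,
  and so do ends and sides.\<close>

lemma fr_all: "fr E = (\<Union>A\<in>two_bands N. X closure_of A - A)"
proof (intro equalityI subsetI)
  fix x assume "x \<in> fr E"
  then have "x \<in> T \<and> (x \<in> Z \<or> (\<exists>e\<in>E. x \<in> Q e))"
    unfolding fr_def seam_def using ends_sides_Q by blast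
  then obtain A where "A \<in> two_bands N" "x \<in> X closure_of A" "x \<in> Z \<or> (\<exists>e\<in>E. x \<in> Q e)"
    unfolding two_closed_def by blast
  then show "x \<in> (\<Union>A\<in>two_bands N. X closure_of A - A)" using two_disjoint[of A] by blast
next
  fix x assume "x \<in> (\<Union>A\<in>two_bands N. X closure_of A - A)"
  then obtain A where A: "A \<in> two_bands N" "x \<in> X closure_of A" "x \<notin> A" by blast
  let ?R = "Z \<union> (\<Union>e\<in>E. Q e) \<union> (\<Union>B\<in>two_bands N - {A}. X closure_of B)"
  have "x \<in> Z \<or> (\<exists>e\<in>E. x \<in> Q e)"
  proof (rule ccontr)
    assume "\<not> ?thesis"
    then have xR: "x \<in> topspace X - ?R" using A closed_disjoint(2) closure_of_subset_topspace[of X A] by blast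
    have "closedin X ?R" using closed_bands finite_bands by (intro closedin_Un closedin_Union) auto
    then have "openin X (topspace X - ?R)" by (simp add: openin_diff)
    moreover have "topspace X - ?R \<subseteq> X closure_of A" unfolding topspace_bands two_closed_def by blast
    ultimately have "x \<in> X interior_of (X closure_of A)" using xR unfolding interior_of_def by blast
    then show False using A disk_bands(2)[OF A(1)] unfolding disk_band_def by blast
  qed
  moreover have "x \<in> T" using A unfolding two_closed_def by blast
  ultimately show "x \<in> fr E" unfolding fr_def seam_def using Z_T_Q(2) by blast
qed

section \<open>The skeleton and the graph of band boundaries\<close>

abbreviation K where "K \<equiv> skeleton X N"

lemma skeleton_eq: "K = seam \<union> (\<Union>e\<in>E. Q e)"
proof (intro equalityI subsetI)
  fix x assume x: "x \<in> K"
  then have x': "x \<in> topspace X" "\<And>v. v \<in> zero_index N \<Longrightarrow> x \<notin> c v" "\<And>A. A \<in> two_bands N \<Longrightarrow> x \<notin> A"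
    unfolding skeleton_def by auto
  then consider "x \<in> Z" | "x \<in> T" | e where "e \<in> E" "x \<in> Q e" unfolding topspace_bands by blast
  then show "x \<in> seam \<union> (\<Union>e\<in>E. Q e)"
  proof cases
    case 1
    then have "x \<in> fr {}" unfolding fr_empty zero_closed_def using x' by blast
    then show ?thesis unfolding fr_def using ends_sides_Q by blast
  next
    case 2
    then have "x \<in> fr E" unfolding fr_all two_closed_def using x' by blast
    then show ?thesis unfolding fr_def using ends_sides_Q by blast
  qed blast
next
  fix x assume "x \<in> seam \<union> (\<Union>e\<in>E. Q e)"
  then have "x \<in> topspace X" "\<And>v. v \<in> zero_index N \<Longrightarrow> x \<notin> c v" "\<And>A. A \<in> two_bands N \<Longrightarrow> x \<notin> A"
    unfolding topspace_bands seam_def using zero_disjoint two_disjoint by blast+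
  then show "x \<in> K" unfolding skeleton_def by blast
qed

lemma frontier_one:
  assumes "e \<in> E"
  shows "X frontier_of q e = ends_of e \<union> sides_of e"
proof -
  have "X frontier_of q e = Q e - q e"
    unfolding frontier_of_def using open_bands(3)[OF assms] by (simp add: interior_of_openin)
  then show ?thesis using Q_split[OF assms] q_disjoint[OF assms] ends_sides_Q[OF assms] by blast
qed

lemma theta_eq: "theta X N = seam \<union> (\<Union>e\<in>E. ends_of e \<union> sides_of e)"
proof -
  have 1: "X frontier_of c v = C v - c v" if "v \<in> zero_index N" for v
    unfolding frontier_of_def using open_bands(1)[OF that] by (simp add: interior_of_openin)
  have 2: "X frontier_of A = X closure_of A - A" if "A \<in> two_bands N" for A
    unfolding frontier_of_def using open_bands(2)[OF that] by (simp add: interior_of_openin)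
  have "theta X N = fr {} \<union> (\<Union>e\<in>E. ends_of e \<union> sides_of e) \<union> fr E"
    unfolding theta_def fr_empty fr_all using 1 2 frontier_one by auto
  moreover have "fr {} = seam \<union> (\<Union>e\<in>E. ends_of e)" "fr E = seam \<union> (\<Union>e\<in>E. sides_of e)"
    unfolding fr_def by auto
  ultimately show ?thesis by auto
qed

lemma skeleton_theta: "K = theta X N \<union> (\<Union>e\<in>E. Q e)"
  unfolding skeleton_eq theta_eq using ends_sides_Q by blast

lemma theta_verts_eq: "theta_verts X N = vertex_points"
proof -
  have "theta_verts X N = (\<Union>e\<in>E. Q e \<inter> seam)" unfolding theta_verts_def seam_def by blast
  then show ?thesis unfolding vertex_points_def using corners_in(2) by auto
qed

lemma skeleton_closed: "closedin X K"
  unfolding skeleton_eq seam_def using closed_bands finite_bands(2)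
  by (intro closedin_Un closedin_Int closedin_Union) auto

end

lemma connectedin_closed_cases:
  assumes "connectedin X S" "closedin X A" "closedin X B" "S \<subseteq> A \<union> B" "A \<inter> B = {}" "S \<inter> A \<noteq> {}"
  shows "S \<subseteq> A"
proof (rule ccontr)
  assume "\<not> S \<subseteq> A"
  then have "B \<inter> S \<noteq> {}" using assms(4) by blast
  moreover have "A \<inter> S \<noteq> {}" "A \<inter> B \<inter> S = {}" using assms by blast+
  ultimately show False using assms(1-4) unfolding connectedin_closedin by metis
qed

context band_structure
begin

section \<open>The boundary curves\<close>

definition end_arc where "end_arc k = (case k of (e, b) \<Rightarrow> \<phi> e ` ({b} \<times> {0<..<1}))"
definition side_arc where "side_arc k = (case k of (e, b) \<Rightarrow> \<phi> e ` ({0<..<1} \<times> {b}))"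

text \<open>Between two corners the path stays where the quadrilateral is injective. If the two
  corners are identified in \<open>X\<close>, the resulting arc is a loop.\<close>

lemma quad_arc:
  assumes e: "e \<in> E" and h: "continuous_on {0..1::real} h" "\<And>t. t \<in> {0..1} \<Longrightarrow> h t \<in> square"
    "inj_on h {0<..<1}" "\<And>t. t \<in> {0<..<1} \<Longrightarrow> h t \<notin> corners" "h 0 \<in> corners" "h 1 \<in> corners"
  shows "arc_between X (\<phi> e ` h ` {0<..<1}) (\<phi> e (h 0)) (\<phi> e (h 1))"
proof -
  have "continuous_map (top_of_set {0..1}) (top_of_set square) h" using h by auto
  then have "pathin X (\<phi> e \<circ> h)"
    unfolding pathin_def by (rule continuous_map_compose) (rule quad(1)[OF e])
  moreover have "inj_on (\<phi> e \<circ> h) {0<..<1}"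
  proof (rule comp_inj_on[OF h(3)])
    show "inj_on (\<phi> e) (h ` {0<..<1})"
    proof (rule inj_on_subset[OF quad(4)[OF e]], rule image_subsetI)
      fix t :: real assume "t \<in> {0<..<1}"
      then have "t \<in> {0..1}" "h t \<notin> corners" using h(4) by auto
      then show "h t \<in> square - corners" using h(2)[of t] by blast
    qed
  qed
  moreover have "\<phi> e w \<notin> \<phi> e ` h ` {0<..<1}" if "w \<in> corners" for w
  proof
    assume "\<phi> e w \<in> \<phi> e ` h ` {0<..<1}"
    then obtain t where t: "t \<in> {0<..<1}" "\<phi> e w = \<phi> e (h t)" by blast
    have "w \<in> square" "h t \<in> square" using that h(2)[of t] t by auto
    then show False using quad_eq[OF e _ _ t(2)] h(4)[OF t(1)] that by metis
  qed
  ultimately show ?thesis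
    unfolding arc_between_def using h(5,6) by (intro exI[of _ "\<phi> e \<circ> h"]) (auto simp: image_comp)
qed

lemma end_arc:
  assumes "e \<in> E" "b \<in> {0, 1}"
  shows "arc_between X (end_arc (e, b)) (\<phi> e (b, 0)) (\<phi> e (b, 1))"
proof -
  have "(\<lambda>t::real. (b, t)) ` {0<..<1} = {b} \<times> {0<..<1}" by auto
  moreover have "arc_between X (\<phi> e ` (\<lambda>t. (b, t)) ` {0<..<1}) (\<phi> e ((\<lambda>t. (b, t)) 0)) (\<phi> e ((\<lambda>t. (b, t)) 1))"
  proof (rule quad_arc[OF assms(1)])
    show "continuous_on {0..1} (\<lambda>t. (b, t))" by (intro continuous_intros)
  qed (use assms(2) in \<open>auto simp: inj_on_def\<close>)
  ultimately show ?thesis unfolding end_arc_def prod.case by simp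
qed

lemma side_arc:
  assumes "e \<in> E" "b \<in> {0, 1}"
  shows "arc_between X (side_arc (e, b)) (\<phi> e (0, b)) (\<phi> e (1, b))"
proof -
  have "(\<lambda>t::real. (t, b)) ` {0<..<1} = {0<..<1} \<times> {b}" by auto
  moreover have "arc_between X (\<phi> e ` (\<lambda>t. (t, b)) ` {0<..<1}) (\<phi> e ((\<lambda>t. (t, b)) 0)) (\<phi> e ((\<lambda>t. (t, b)) 1))"
  proof (rule quad_arc[OF assms(1)])
    show "continuous_on {0..1} (\<lambda>t. (t, b))" by (intro continuous_intros)
  qed (use assms(2) in \<open>auto simp: inj_on_def\<close>)
  ultimately show ?thesis unfolding side_arc_def prod.case by simp
qed

lemma ends_of_arcs: "ends_of e = end_arc (e, 0) \<union> end_arc (e, 1) \<union> \<phi> e ` corners"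
proof -
  have "{0, 1} \<times> {0..1::real} = {0} \<times> {0<..<1} \<union> {1::real} \<times> {0<..<1} \<union> corners" by auto
  then show ?thesis unfolding ends_of_def end_arc_def prod.case by (simp only: image_Un)
qed

lemma sides_of_arcs: "sides_of e = side_arc (e, 0) \<union> side_arc (e, 1) \<union> \<phi> e ` corners"
proof -
  have "{0..1::real} \<times> {0, 1} = {0<..<1} \<times> {0} \<union> {0<..<1} \<times> {1::real} \<union> corners" by auto
  then show ?thesis unfolding sides_of_def side_arc_def prod.case by (simp only: image_Un)
qed

lemma image_disjoint_of:
  assumes e: "e \<in> E" and S: "S \<subseteq> square - corners" "S' \<subseteq> square" "S \<inter> S' = {}"
  shows "\<phi> e ` S \<inter> \<phi> e ` S' = {}"
proof -
  have "\<phi> e z \<noteq> \<phi> e w" if "z \<in> S" "w \<in> S'" for z w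
  proof
    assume "\<phi> e z = \<phi> e w"
    moreover have "z \<in> square" "z \<notin> corners" "w \<in> square" "z \<noteq> w" using that S by blast+
    ultimately show False using quad_eq[OF e, of z w] by blast
  qed
  then show ?thesis by blast
qed

lemma arc_vertex_disjoint:
  assumes e: "e \<in> E" and S: "S \<subseteq> square - corners"
  shows "\<phi> e ` S \<inter> vertex_points = {}"
proof -
  have "\<phi> e ` S \<inter> \<phi> e ` corners = {}"
    by (rule image_disjoint_of[OF e S]) (use S in auto)
  moreover have "\<phi> e ` S \<subseteq> Q e" using quad(2)[OF e] S by blast
  ultimately show ?thesis using vertex_in_Q[OF e] by blast
qed

lemma arcs_vertex_disjoint:
  assumes "e \<in> E" "b \<in> {0, 1}"
  shows "end_arc (e, b) \<inter> vertex_points = {}" "side_arc (e, b) \<inter> vertex_points = {}"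
  unfolding end_arc_def side_arc_def prod.case
  by (rule arc_vertex_disjoint[OF assms(1)]; use assms(2) in auto)+

lemma arcs_in:
  assumes "e \<in> E" "b \<in> {0, 1}"
  shows "end_arc (e, b) \<subseteq> ends_of e" "side_arc (e, b) \<subseteq> sides_of e"
  using assms unfolding ends_of_arcs sides_of_arcs by blast+

lemma arcs_Q:
  assumes "e \<in> E" "b \<in> {0, 1}"
  shows "end_arc (e, b) \<subseteq> Q e" "side_arc (e, b) \<subseteq> Q e"
  using arcs_in[OF assms] ends_sides_Q(1,2)[OF assms(1)] by auto

lemma arcs_disjoint_same:
  assumes e: "e \<in> E" and b: "b \<in> {0, 1}" "b' \<in> {0, 1}" "b \<noteq> b'"
  shows "end_arc (e, b) \<inter> end_arc (e, b') = {}" "side_arc (e, b) \<inter> side_arc (e, b') = {}"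
  unfolding end_arc_def side_arc_def prod.case
  by (rule image_disjoint_of[OF e]; use b in auto)+

lemma arcs_disjoint:
  assumes "e \<in> E" "b \<in> {0, 1}" "e' \<in> E" "b' \<in> {0, 1}" "(e, b) \<noteq> (e', b')"
  shows "end_arc (e, b) \<inter> end_arc (e', b') = {}" "side_arc (e, b) \<inter> side_arc (e', b') = {}"
proof -
  note 1 = arcs_Q[OF assms(1,2)] arcs_Q[OF assms(3,4)]
  show "end_arc (e, b) \<inter> end_arc (e', b') = {}"
  proof (cases "e = e'")
    case True
    then show ?thesis using arcs_disjoint_same(1)[OF assms(1), of b b'] assms by blast
  next
    case False
    then show ?thesis using Q_inter_vertex[OF assms(1,3)] 1 arcs_vertex_disjoint(1)[OF assms(1,2)] by blast
  qed
  show "side_arc (e, b) \<inter> side_arc (e', b') = {}"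
  proof (cases "e = e'")
    case True
    then show ?thesis using arcs_disjoint_same(2)[OF assms(1), of b b'] assms by blast
  next
    case False
    then show ?thesis using Q_inter_vertex[OF assms(1,3)] 1 arcs_vertex_disjoint(2)[OF assms(1,2)] by blast
  qed
qed

lemma side_arc_Z:
  assumes "e \<in> E" "b \<in> {0, 1}"
  shows "side_arc (e, b) \<inter> Z = {}" "end_arc (e, b) \<inter> T = {}"
proof -
  show "side_arc (e, b) \<inter> Z = {}"
    using Z_T_Q(1)[OF assms(1)] arcs_in(2)[OF assms] ends_sides_Q(2)[OF assms(1)]
      ends_sides_vertex[OF assms(1)] arcs_vertex_disjoint(2)[OF assms] by blast
  show "end_arc (e, b) \<inter> T = {}"
    using Z_T_Q(2)[OF assms(1)] arcs_in(1)[OF assms] ends_sides_Q(1)[OF assms(1)]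
      ends_sides_vertex[OF assms(1)] arcs_vertex_disjoint(1)[OF assms] by blast
qed

lemma circles:
  assumes "v \<in> zero_index N"
  shows "closedin X (C v - c v)" "connectedin X (C v - c v)" "C v - c v \<noteq> {}"
  using simple_closed_curve_closed[OF X(1) disk_band_boundary[OF disk_bands(1)[OF assms]]] .

text \<open>Otherwise that 0-band would be surrounded by a single 2-band and these would fill the surface.\<close>

lemma circle_meets_vertex:
  assumes v: "v \<in> zero_index N"
  shows "(C v - c v) \<inter> vertex_points \<noteq> {}"
proof
  assume no: "(C v - c v) \<inter> vertex_points = {}"
  let ?B = "C v - c v"
  \<comment> \<open>A 1-band that touches this 0-band does so along an end. That whole end is
    connected, so it lies in the same 0-band, and its corners would be vertices on the
    circle.\<close>
  have noQ: "C v \<inter> Q e = {}" if e: "e \<in> E" for e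
  proof (rule ccontr)
    assume "C v \<inter> Q e \<noteq> {}"
    then obtain x where x: "x \<in> C v" "x \<in> Q e" by blast
    then have "x \<in> ends_of e" using Z_T_Q(1)[OF e] v unfolding zero_closed_def by blast
    then obtain b where b: "b \<in> {0, 1}" "x \<in> \<phi> e ` ({b} \<times> {0..1})"
      unfolding ends_of_def by blast
    let ?L = "\<phi> e ` ({b} \<times> {0..1})"
    have "connectedin X ?L"
    proof (rule connectedin_continuous_map_image[OF quad(1)[OF e]])
      have "connected ({b} \<times> {0..1::real})" by (simp add: connected_Times)
      then show "connectedin (top_of_set square) ({b} \<times> {0..1})"
        using b by (auto simp: connectedin_subtopology)
    qed
    have LZ: "?L \<subseteq> Z"
    proof -
      have "?L \<subseteq> ends_of e" unfolding ends_of_def using b by (intro image_mono) auto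
      then show ?thesis using ends_sides_Q(3)[OF e] by blast
    qed
    have cl: "closedin X (C w)" for w by simp
    have "?L \<subseteq> C v"
    proof (rule ccontr)
      assume "\<not> ?L \<subseteq> C v"
      have "closedin X (\<Union>w\<in>zero_index N - {v}. C w)"
        using finite_bands by (intro closedin_Union) auto
      moreover have "C v \<inter> (\<Union>w\<in>zero_index N - {v}. C w) = {}"
        using closed_disjoint(1)[OF v] by blast
      moreover have "?L \<subseteq> C v \<union> (\<Union>w\<in>zero_index N - {v}. C w)"
        using LZ unfolding zero_closed_def by blast
      moreover have "?L \<inter> C v \<noteq> {}" using x(1) b(2) by blast
      ultimately have "?L \<subseteq> C v"
        by - (rule connectedin_closed_cases[OF \<open>connectedin X ?L\<close> cl[of v]], assumption+)
      then show False using \<open>\<not> ?L \<subseteq> C v\<close> by contradiction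
    qed
    moreover have "\<phi> e (b, 0) \<in> ?L" by (rule imageI) auto
    ultimately have "\<phi> e (b, 0) \<in> C v" by blast
    moreover have "\<phi> e (b, 0) \<in> \<phi> e ` corners" using b by (intro imageI) auto
    moreover have "\<phi> e ` corners \<subseteq> Q e" using corners_in(2)[OF e] by blast
    ultimately show False using no zero_disjoint(1)[OF v e] corner_vertex[OF e] by blast
  qed
  have BT: "?B \<subseteq> T"
  proof
    fix x assume "x \<in> ?B"
    then have "x \<in> fr {}" "x \<in> C v" using v unfolding fr_empty by blast+
    then show "x \<in> T" unfolding fr_def seam_def using ends_sides_Q(1) noQ by blast
  qed
  obtain x0 where x0: "x0 \<in> ?B" using circles(3)[OF v] by blast
  then obtain A where A: "A \<in> two_bands N" "x0 \<in> X closure_of A" using BT unfolding two_closed_def by blast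
  let ?A = "X closure_of A"
  let ?TT = "\<Union>B\<in>two_bands N - {A}. X closure_of B"
  have cT: "closedin X ?TT" using finite_bands by (intro closedin_Union) auto
  have "?B \<subseteq> ?A"
  proof (rule ccontr)
    assume n: "\<not> ?B \<subseteq> ?A"
    have "?B \<subseteq> ?A \<union> ?TT" using BT unfolding two_closed_def by blast
    moreover have "?A \<inter> ?TT = {}" using closed_disjoint(2)[OF A(1)] by blast
    moreover have "closedin X ?A" by simp
    moreover have "?B \<inter> ?A \<noteq> {}" using x0 A(2) by blast
    ultimately have "?B \<subseteq> ?A" by - (rule connectedin_closed_cases[OF circles(2)[OF v] _ cT], simp, assumption+)
    then show False using n by contradiction
  qed
  let ?ZZ = "(\<Union>w\<in>zero_index N - {v}. C w) \<union> (\<Union>e\<in>E. Q e)"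
  have cZ: "closedin X ?ZZ" using finite_bands by (intro closedin_Un closedin_Union) auto
  let ?DA = "?A - A"
  have scDA: "closedin X ?DA" "connectedin X ?DA"
    using simple_closed_curve_closed[OF X(1) disk_band_boundary[OF disk_bands(2)[OF A(1)]]] by auto
  have cvA: "c v \<inter> ?A = {}" using zero_disjoint(2)[OF v] A(1) unfolding two_closed_def by blast
  have AC: "A \<inter> C v = {}" using two_disjoint(2)[OF A(1)] v unfolding zero_closed_def by blast
  have DA: "?DA \<subseteq> C v \<union> ?ZZ"
  proof
    fix x assume "x \<in> ?DA"
    then have "x \<in> fr E" using A unfolding fr_all by blast
    then show "x \<in> C v \<union> ?ZZ" unfolding fr_def seam_def zero_closed_def using ends_sides_Q(2) by blast
  qed
  have CZ: "C v \<inter> ?ZZ = {}" using noQ closed_disjoint(1)[OF v] by blast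
  \<comment> \<open>The boundary of the 2-band is connected and meets \<open>C v\<close> at
    \<open>x0\<close>, so it stays in \<open>C v\<close>. The two closed bands together then miss
    all other bands.\<close>
  have DAC: "?DA \<subseteq> C v"
  proof (rule ccontr)
    assume n: "\<not> ?DA \<subseteq> C v"
    have "?DA \<inter> C v \<noteq> {}" using x0 A AC by blast
    moreover have "closedin X (C v)" by simp
    ultimately have "?DA \<subseteq> C v" by - (rule connectedin_closed_cases[OF scDA(2) _ cZ DA CZ], simp, assumption+)
    then show False using n by contradiction
  qed
  let ?R = "?ZZ \<union> ?TT"
  have cR: "closedin X ?R" using cZ cT by (rule closedin_Un)
  have full: "topspace X = (C v \<union> ?A) \<union> ?R"
  proof -
    have 1: "Z = C v \<union> (\<Union>w\<in>zero_index N - {v}. C w)" using v unfolding zero_closed_def by blast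
    have 2: "T = ?A \<union> ?TT" using A unfolding two_closed_def by blast
    show ?thesis unfolding topspace_bands 1 2 by (simp only: Un_ac)
  qed
  have dj: "(C v \<union> ?A) \<inter> ?R = {}"
  proof -
    have ab: "(A \<union> B) \<inter> (R \<union> S) = {}" if "A \<inter> R = {}" "A \<inter> S = {}" "B \<inter> R = {}" "B \<inter> S = {}"
      for A B R S :: "'a set" using that by blast
    have "C v \<inter> ?TT = {}"
    proof -
      have "C v \<inter> ?TT \<subseteq> ?B" using zero_disjoint(2)[OF v] unfolding two_closed_def by blast
      then show ?thesis using \<open>?B \<subseteq> ?A\<close> closed_disjoint(2)[OF A(1)] by blast
    qed
    have "A \<inter> ?ZZ = {}" using two_disjoint[OF A(1)] unfolding zero_closed_def by blast
    then have "?A \<inter> ?ZZ = {}" using DAC CZ by blast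
    have "?A \<inter> ?TT = {}" using closed_disjoint(2)[OF A(1)] by blast
    show ?thesis by (rule ab) fact+
  qed
  \<comment> \<open>An edge exists, so some closed band is left over, which contradicts the
    connectedness of the surface.\<close>
  have neR: "?R \<noteq> {}"
  proof -
    obtain e where e: "e \<in> E" using edges_nonempty by blast
    have "\<phi> e (0, 0) \<in> Q e" unfolding quad(2)[OF e, symmetric] by (rule imageI) auto
    then show ?thesis using e by blast
  qed
  have cA: "closedin X (C v \<union> ?A)" by (intro closedin_Un) auto
  have "x0 \<in> topspace X" using x0 full by blast
  have "topspace X \<subseteq> C v \<union> ?A"
  proof (rule connectedin_closed_cases[OF _ cA cR _ dj])
    show "connectedin X (topspace X)" using X(3) by (simp add: connectedin_topspace)
    show "topspace X \<subseteq> C v \<union> ?A \<union> ?R" using full by (rule equalityD1)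
    show "topspace X \<inter> (C v \<union> ?A) \<noteq> {}" using x0 \<open>x0 \<in> topspace X\<close> by blast
  qed
  moreover have "?R \<subseteq> topspace X" using cR by (rule closedin_subset)
  ultimately have "?R \<subseteq> C v \<union> ?A" by (rule order_trans[rotated])
  then have "?R \<subseteq> (C v \<union> ?A) \<inter> ?R" by (rule Int_greatest) (rule order_refl)
  then show False using dj neR by (simp only: subset_empty)
qed

lemma fr_empty_regular: "\<exists>\<A>. regular_arcs X vertex_points \<A> \<and> vertex_points \<union> \<Union>\<A> = fr {}"
proof -
  let ?P = "\<lambda>v. (C v - c v) \<inter> vertex_points"
  have "\<forall>v\<in>zero_index N. \<exists>\<A>. regular_arcs X (?P v) \<A> \<and> ?P v \<union> \<Union>\<A> = C v - c v"
    by (intro ballI regular_arcs_circle[OF X(1) disk_band_boundary])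
      (use disk_bands(1) finite_vertex_points circle_meets_vertex in auto)
  then obtain \<A> where A: "\<And>v. v \<in> zero_index N \<Longrightarrow> regular_arcs X (?P v) (\<A> v)"
      "\<And>v. v \<in> zero_index N \<Longrightarrow> ?P v \<union> \<Union>(\<A> v) = C v - c v" by metis
  have reg: "regular_arcs X (\<Union>v\<in>zero_index N. ?P v) (\<Union>v\<in>zero_index N. \<A> v)"
  proof (rule regular_arcs_Union[OF X(1) finite_bands(1) A(1)])
    fix v w assume vw: "v \<in> zero_index N" "w \<in> zero_index N" "v \<noteq> w"
    show "(?P v \<union> \<Union>(\<A> v)) \<inter> (?P w \<union> \<Union>(\<A> w)) = {}"
      unfolding A(2)[OF vw(1)] A(2)[OF vw(2)] using closed_disjoint(1)[OF vw] by blast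
  qed
  have Pv: "(\<Union>v\<in>zero_index N. ?P v) = vertex_points"
    using vertex_points_seam fr_empty unfolding fr_def by auto
  have "vertex_points \<union> \<Union>(\<Union>v\<in>zero_index N. \<A> v) = fr {}"
  proof -
    have "\<Union>(\<Union>v\<in>zero_index N. \<A> v) \<union> (\<Union>v\<in>zero_index N. ?P v) = (\<Union>v\<in>zero_index N. ?P v \<union> \<Union>(\<A> v))" by blast
    also have "\<dots> = fr {}" unfolding fr_empty using A(2) by auto
    finally show ?thesis unfolding Pv by (simp add: Un_commute)
  qed
  then show ?thesis using reg unfolding Pv by blast
qed

text \<open>Only ends of bands in \<open>S\<close> are exchanged, indexed by \<open>(e, b)\<close>
  with \<open>b\<close> the constant coordinate of the arc. The arcs along the seam are kept as the
  subdivided circles provide them and never have to be named.\<close>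

lemma fr_regular:
  assumes S: "S \<subseteq> E"
  shows "\<exists>\<A>. regular_arcs X vertex_points \<A> \<and> vertex_points \<union> \<Union>\<A> = fr S"
proof -
  obtain \<A> where R: "regular_arcs X vertex_points \<A>" and un: "vertex_points \<union> \<Union>\<A> = fr {}"
    using fr_empty_regular by blast
  have AV: "A \<inter> vertex_points = {}" if "A \<in> \<A>" for A using R that unfolding regular_arcs_def by blast
  have djA: "pairwise disjnt \<A>" using R unfolding regular_arcs_def by blast
  define J where "J = S \<times> {0, 1::real}"
  have J: "finite J" unfolding J_def using S finite_bands(2) finite_subset by auto
  have JE: "fst k \<in> E" "snd k \<in> {0, 1}" if "k \<in> J" for k using that S unfolding J_def by auto
  have corner: "\<phi> e (a, b) \<in> vertex_points" if "e \<in> E" "a \<in> {0, 1}" "b \<in> {0, 1}" for e a b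
    using corner_vertex[OF that(1)] that(2,3) by blast
  \<comment> \<open>The arcs of \<open>\<A>\<close> come from subdividing circles and are otherwise
    unknown. The ends of 1-bands must be recognised among them before they can be exchanged.\<close>
  have end_in: "end_arc (e, b) \<in> \<A>" if e: "e \<in> E" "b \<in> {0, 1}" for e b
  proof (rule regular_arcs_member[OF X(1) R end_arc[OF e]])
    show "\<phi> e (b, 0) \<in> vertex_points" "\<phi> e (b, 1) \<in> vertex_points" using corner e by auto
    show "end_arc (e, b) \<inter> vertex_points = {}" using arcs_vertex_disjoint e by blast
    have "end_arc (e, b) \<subseteq> fr {}" using arcs_in(1)[OF e] e unfolding fr_def by blast
    then show "end_arc (e, b) \<subseteq> \<Union>\<A>" using un \<open>end_arc (e, b) \<inter> vertex_points = {}\<close> by blast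
  qed
  have ne: "end_arc (e, b) \<noteq> {}" if "e \<in> E" "b \<in> {0, 1}" for e b
    using arc_between_properties(5)[OF end_arc[OF that]] .
  have A_Z: "A \<subseteq> Z" if "A \<in> \<A>" for A
  proof -
    have "A \<subseteq> fr {}" using un that by blast
    then show ?thesis unfolding fr_empty zero_closed_def by blast
  qed
  have dk: "end_arc k \<inter> end_arc l = {}" "side_arc k \<inter> side_arc l = {}" if "k \<in> J" "l \<in> J" "k \<noteq> l" for k l
    using arcs_disjoint[of "fst k" "snd k" "fst l" "snd l"] JE that by (simp_all add: prod_eq_iff)
  let ?\<B> = "(\<A> - end_arc ` J) \<union> side_arc ` J"
  have "regular_arcs X vertex_points ?\<B>"
  proof (rule regular_arcs_exchange[OF X(1) R J])
    show "inj_on end_arc J"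
    proof (rule inj_onI)
      fix k l assume kl: "k \<in> J" "l \<in> J" "end_arc k = end_arc l"
      then have "end_arc k \<noteq> {}" using ne[of "fst k" "snd k"] JE by simp
      then show "k = l" using dk(1)[of k l] kl by auto
    qed
    show "end_arc ` J \<subseteq> \<A>"
    proof (rule image_subsetI)
      fix k assume "k \<in> J"
      then show "end_arc k \<in> \<A>" using end_in[of "fst k" "snd k"] JE by simp
    qed
    fix k assume k: "k \<in> J"
    then obtain e b where kb: "k = (e, b)" "e \<in> E" "b \<in> {0, 1}" using JE by (metis prod.collapse)
    show "side_arc k \<inter> vertex_points = {} \<and> (\<exists>a\<in>vertex_points. \<exists>b\<in>vertex_points. arc_between X (side_arc k) a b)"
    proof
      show "side_arc k \<inter> vertex_points = {}" using arcs_vertex_disjoint kb by blast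
      have "\<phi> e (0, b) \<in> vertex_points" "\<phi> e (1, b) \<in> vertex_points" using corner kb by auto
      then show "\<exists>a\<in>vertex_points. \<exists>b\<in>vertex_points. arc_between X (side_arc k) a b"
        unfolding kb(1) using side_arc[OF kb(2,3)] by blast
    qed
    show "disjnt (side_arc k) A" if "A \<in> \<A>" for A
      using side_arc_Z(1)[OF kb(2,3)] A_Z[OF that] kb(1) unfolding disjnt_def by blast
    show "disjnt (side_arc k) (side_arc l)" if "l \<in> J" "k \<noteq> l" for l
      using dk(2)[OF k that] unfolding disjnt_def .
  next
    fix p
    \<comment> \<open>Both sums count each of the four corners of the band once.\<close>
    have b: "(\<Sum>b\<in>{0, 1}. arc_degree X (end_arc (e, b)) p) = (\<Sum>b\<in>{0, 1}. arc_degree X (side_arc (e, b)) p)"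
      if "e \<in> S" for e
    proof -
      have e: "e \<in> E" using that S by blast
      show ?thesis
        using arc_degree[OF X(1) end_arc[OF e, of 0]] arc_degree[OF X(1) end_arc[OF e, of 1]]
          arc_degree[OF X(1) side_arc[OF e, of 0]] arc_degree[OF X(1) side_arc[OF e, of 1]] by simp
    qed
    have "(\<Sum>k\<in>J. arc_degree X (end_arc k) p) = (\<Sum>e\<in>S. \<Sum>b\<in>{0, 1}. arc_degree X (end_arc (e, b)) p)"
      unfolding J_def sum.cartesian_product by (rule sum.cong) auto
    also have "\<dots> = (\<Sum>e\<in>S. \<Sum>b\<in>{0, 1}. arc_degree X (side_arc (e, b)) p)"
      by (rule sum.cong[OF refl b])
    also have "\<dots> = (\<Sum>k\<in>J. arc_degree X (side_arc k) p)"
      unfolding J_def sum.cartesian_product by (rule sum.cong) auto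
    finally show "(\<Sum>k\<in>J. arc_degree X (end_arc k) p) = (\<Sum>k\<in>J. arc_degree X (side_arc k) p)" .
  qed
  moreover have "vertex_points \<union> \<Union>?\<B> = fr S"
  proof (intro equalityI subsetI)
    fix x assume "x \<in> vertex_points \<union> \<Union>?\<B>"
    then consider "x \<in> vertex_points" | A where "A \<in> \<A>" "A \<notin> end_arc ` J" "x \<in> A" "x \<notin> vertex_points"
      | k where "k \<in> J" "x \<in> side_arc k" by blast
    then show "x \<in> fr S"
    proof cases
      case 1
      then show ?thesis using vertex_points_seam unfolding fr_def by blast
    next
      case 2
      then have "x \<in> fr {}" using un by blast
      then consider "x \<in> seam" | e where "e \<in> E" "x \<in> ends_of e" unfolding fr_def by blast
      then show ?thesis
      proof cases
        case (2 e)
        have "e \<notin> S"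
        proof
          assume eS: "e \<in> S"
          obtain b where b: "b \<in> {0, 1}" "x \<in> end_arc (e, b)"
            using 2 \<open>x \<notin> vertex_points\<close> corner_vertex[OF 2(1)] unfolding ends_of_arcs by blast
          then have "end_arc (e, b) \<in> \<A>" "end_arc (e, b) \<in> end_arc ` J"
            using end_in 2 eS unfolding J_def by auto
          then have "A = end_arc (e, b)"
            using djA \<open>A \<in> \<A>\<close> b(2) \<open>x \<in> A\<close> unfolding pairwise_def disjnt_def by blast
          then show False using \<open>A \<notin> end_arc ` J\<close> \<open>end_arc (e, b) \<in> end_arc ` J\<close> by simp
        qed
        then show ?thesis using 2 unfolding fr_def by blast
      qed (auto simp: fr_def)
    next
      case (3 k)
      then obtain e b where kb: "k = (e, b)" "e \<in> S" "b \<in> {0, 1}" unfolding J_def by blast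
      then have "x \<in> sides_of e" using arcs_in(2)[of e b] 3 S by blast
      then show ?thesis using kb unfolding fr_def by blast
    qed
  next
    fix x assume x: "x \<in> fr S"
    show "x \<in> vertex_points \<union> \<Union>?\<B>"
    proof (cases "x \<in> vertex_points")
      case nv: False
      consider "x \<in> seam" | e where "e \<in> S" "x \<in> sides_of e" | e where "e \<in> E - S" "x \<in> ends_of e"
        using x unfolding fr_def by blast
      then show ?thesis
      proof cases
        case 1
        then have "x \<in> fr {}" unfolding fr_def by blast
        then obtain A where A: "A \<in> \<A>" "x \<in> A" using un nv by blast
        have "A \<notin> end_arc ` J"
        proof
          assume "A \<in> end_arc ` J"
          then obtain e b where "e \<in> E" "b \<in> {0, 1}" "A = end_arc (e, b)" using JE by (metis imageE prod.collapse)
          then show False using side_arc_Z(2)[of e b] A(2) 1 unfolding seam_def by blast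
        qed
        then show ?thesis using A by blast
      next
        case (2 e)
        then obtain b where b: "b \<in> {0, 1}" "x \<in> side_arc (e, b)"
          using nv corner_vertex[of e] S unfolding sides_of_arcs by blast
        then have "(e, b) \<in> J" using 2 unfolding J_def by blast
        then show ?thesis using b by blast
      next
        case (3 e)
        then obtain b where b: "b \<in> {0, 1}" "x \<in> end_arc (e, b)"
          using nv corner_vertex[of e] unfolding ends_of_arcs by blast
        have "end_arc (e, b) \<notin> end_arc ` J"
        proof
          assume "end_arc (e, b) \<in> end_arc ` J"
          then obtain e' b' where e': "e' \<in> S" "b' \<in> {0, 1}" "end_arc (e, b) = end_arc (e', b')"
            unfolding J_def by blast
          then have "(e, b) \<noteq> (e', b')" "e' \<in> E" using 3 S by auto
          then show False using arcs_disjoint(1)[of e b e' b'] 3 b e' by auto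
        qed
        then show ?thesis using end_in[of e b] 3 b by blast
      qed
    qed blast
  qed
  ultimately show ?thesis by blast
qed

abbreviation curves where "curves \<equiv> boundary_curves X N"

text \<open>The circles into which the arc system decomposes are finitely many, disjoint, closed and
  connected. They are therefore the components of the frontier, which is how the curves are
  defined.\<close>

theorem boundary_curves:
  assumes S: "S \<subseteq> E"
  shows "finite (curves S)" "pairwise disjnt (curves S)" "\<Union>(curves S) = fr S"
    "\<And>B. B \<in> curves S \<Longrightarrow> simple_closed_curve X B" "\<And>B. B \<in> curves S \<Longrightarrow> B \<inter> vertex_points \<noteq> {}"
proof -
  obtain \<A> where "regular_arcs X vertex_points \<A>" and un: "vertex_points \<union> \<Union>\<A> = fr S"
    using fr_regular[OF S] by blast
  then obtain \<C> where \<C>: "finite \<C>" "pairwise disjnt \<C>" "\<Union>\<C> = fr S"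
      "\<And>B. B \<in> \<C> \<Longrightarrow> simple_closed_curve X B \<and> B \<inter> vertex_points \<noteq> {}"
    using regular_arcs_cycles[OF X(1)] unfolding un[symmetric] by metis
  have "curves S = \<C>"
    unfolding boundary_curves_def frontier_band_union[OF S] \<C>(3)[symmetric]
    by (rule connected_components_of_disjoint_closed[OF \<C>(1,2)])
      (use \<C>(4) simple_closed_curve_closed[OF X(1)] in blast)
  then show "finite (curves S)" "pairwise disjnt (curves S)" "\<Union>(curves S) = fr S"
    "\<And>B. B \<in> curves S \<Longrightarrow> simple_closed_curve X B" "\<And>B. B \<in> curves S \<Longrightarrow> B \<inter> vertex_points \<noteq> {}"
    using \<C> by auto
qed

lemma boundary_curve_closed:
  assumes "S \<subseteq> E" "B \<in> curves S"
  shows "closedin X B" "connectedin X B" "B \<subseteq> fr S"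
  using simple_closed_curve_closed[OF X(1) boundary_curves(4)[OF assms]] boundary_curves(3)[OF assms(1)] assms(2)
  by auto

lemma boundary_curves_disjoint:
  "S \<subseteq> E \<Longrightarrow> B \<in> curves S \<Longrightarrow> B' \<in> curves S \<Longrightarrow> B \<noteq> B' \<Longrightarrow> B \<inter> B' = {}"
  using boundary_curves(2) unfolding pairwise_def disjnt_def by blast

text \<open>Away from the vertices, \<open>B\<close> is a union of components of \<open>\<Theta>(N)\<close> because it is clopen there.\<close>

lemma theta_cycle_boundary_curve:
  assumes S: "S \<subseteq> E" and B: "B \<in> curves S"
  shows "theta_cycle X N B"
proof -
  let ?Y = "subtopology X (theta X N - theta_verts X N)"
  let ?B = "B - vertex_points"
  \<comment> \<open>The other boundary curves and those ends and sides of 1-bands that are not on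
    the frontier: a closed remainder of \<Theta>(N) that meets \<open>B\<close> only at
    vertices.\<close>
  let ?R = "\<Union>(curves S - {B}) \<union> (\<Union>e\<in>S. ends_of e) \<union> (\<Union>e\<in>E - S. sides_of e)"
  have fin: "finite S" "finite (E - S)" using S finite_bands(2) finite_subset by auto
  have set_eq: "(Th - V) \<inter> R = Th - V - (B' - V)" if "Th \<subseteq> B' \<union> R" "B' \<inter> R \<subseteq> V" for Th V R B' :: "'a set"
    using that by blast
  have BX: "closedin X B" using boundary_curve_closed[OF S B] by blast
  have frth: "fr S \<subseteq> theta X N" unfolding fr_def theta_eq using S by blast
  have Bth: "?B \<subseteq> theta X N - vertex_points" using boundary_curve_closed(3)[OF S B] frth by blast
  have thX: "theta X N \<subseteq> topspace X"
    using skeleton_theta skeleton_closed closedin_subset by blast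
  then have top: "topspace ?Y = theta X N - vertex_points" unfolding theta_verts_eq by auto
  have "closedin ?Y ((theta X N - theta_verts X N) \<inter> B)"
    by (rule closedin_subtopology_Int_closed[OF BX])
  moreover have "(theta X N - theta_verts X N) \<inter> B = ?B" unfolding theta_verts_eq using Bth by blast
  ultimately have cB: "closedin ?Y ?B" by simp
  have "closedin X ?R"
    using fin boundary_curves(1)[OF S] boundary_curve_closed(1)[OF S] ends_sides_closed S
    by (intro closedin_Un closedin_Union) auto
  then have "closedin ?Y ((theta X N - theta_verts X N) \<inter> ?R)"
    by (rule closedin_subtopology_Int_closed)
  moreover have "(theta X N - theta_verts X N) \<inter> ?R = topspace ?Y - ?B"
  proof -
    have 1: "theta X N \<subseteq> B \<union> ?R"
    proof
      fix x assume "x \<in> theta X N"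
      then consider "x \<in> fr S" | e where "e \<in> S" "x \<in> ends_of e" | e where "e \<in> E - S" "x \<in> sides_of e"
        unfolding theta_eq fr_def by blast
      then show "x \<in> B \<union> ?R" using boundary_curves(3)[OF S] by cases blast+
    qed
    have 2: "ends_of e \<inter> fr S \<subseteq> vertex_points" if e: "e \<in> S" for e
    proof
      fix x assume x: "x \<in> ends_of e \<inter> fr S"
      have e': "e \<in> E" using e S by blast
      have xQ: "x \<in> Q e" using ends_sides_Q(1)[OF e'] x by blast
      consider "x \<in> seam" | e'' where "e'' \<in> S" "x \<in> sides_of e''" | e'' where "e'' \<in> E - S" "x \<in> ends_of e''"
        using x unfolding fr_def by blast
      then show "x \<in> vertex_points"
      proof cases
        case 1
        then show ?thesis using Q_seam_vertex[OF e'] xQ by blast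
      next
        case (2 e'')
        then have "e'' \<in> E" using S by blast
        then show ?thesis using ends_sides_vertex[OF e'] Q_inter_vertex[OF e', of e'']
            ends_sides_Q(2)[of e''] x 2 xQ by (cases "e'' = e") blast+
      next
        case (3 e'')
        then show ?thesis using Q_inter_vertex[OF e', of e''] ends_sides_Q(1)[of e''] e xQ by blast
      qed
    qed
    have 3: "sides_of e \<inter> fr S \<subseteq> vertex_points" if e: "e \<in> E - S" for e
    proof
      fix x assume x: "x \<in> sides_of e \<inter> fr S"
      have e': "e \<in> E" using e by blast
      have xQ: "x \<in> Q e" using ends_sides_Q(2)[OF e'] x by blast
      consider "x \<in> seam" | e'' where "e'' \<in> S" "x \<in> sides_of e''" | e'' where "e'' \<in> E - S" "x \<in> ends_of e''"
        using x unfolding fr_def by blast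
      then show "x \<in> vertex_points"
      proof cases
        case 1
        then show ?thesis using Q_seam_vertex[OF e'] xQ by blast
      next
        case (3 e'')
        then have "e'' \<in> E" by blast
        then show ?thesis using ends_sides_vertex[OF e'] Q_inter_vertex[OF e', of e'']
            ends_sides_Q(1)[of e''] x 3 xQ by (cases "e'' = e") blast+
      next
        case (2 e'')
        then have "e'' \<in> E" "e'' \<noteq> e" using S e by blast+
        then show ?thesis using Q_inter_vertex[OF e', of e''] ends_sides_Q(2)[of e''] 2 xQ by blast
      qed
    qed
    have BfS: "B \<subseteq> fr S" using boundary_curve_closed(3)[OF S B] .
    have 4: "B \<inter> \<Union>(curves S - {B}) = {}" using boundary_curves_disjoint[OF S B] by blast
    have "B \<inter> ?R \<subseteq> vertex_points" using 2 3 4 BfS by blast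
    then show ?thesis unfolding top unfolding theta_verts_eq by (rule set_eq[OF 1])
  qed
  ultimately have oB: "openin ?Y ?B" unfolding openin_closedin_eq using top Bth by auto
  let ?S = "{D \<in> theta_edges X N. D \<subseteq> ?B}"
  have "?B \<subseteq> \<Union>?S"
  proof
    fix x assume x: "x \<in> ?B"
    let ?D = "connected_component_of_set ?Y x"
    have xY: "x \<in> topspace ?Y" using x top Bth by blast
    then have "x \<in> ?D" using connected_component_of_refl[of ?Y x] by simp
    moreover have "?D \<subseteq> ?B"
      using connectedin_clopen_cases[OF connectedin_connected_component_of[of ?Y x] cB oB] x \<open>x \<in> ?D\<close>
      by (auto simp: disjnt_iff)
    moreover have "?D \<in> theta_edges X N"
      unfolding theta_edges_def using xY by (simp add: connected_component_in_connected_components_of)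
    ultimately show "x \<in> \<Union>?S" by blast
  qed
  then have "B = (B \<inter> vertex_points) \<union> \<Union>?S" by blast
  moreover have "?S \<subseteq> theta_edges X N" by blast
  moreover have "B \<inter> vertex_points \<noteq> {}" "B \<inter> vertex_points \<subseteq> theta_verts X N"
    using boundary_curves(5)[OF S B] unfolding theta_verts_eq by auto
  ultimately show ?thesis
    unfolding theta_cycle_def using boundary_curves(4)[OF S B] by metis
qed

end

section \<open>Comparing two spaces with attached disks\<close>

text \<open>Every set that meets \<open>U\<close> passes through \<open>p\<close>, and the sets of
  one family are disjoint, so at most one of them meets \<open>U\<close>. Matching the unions then
  amounts to matching single sets.\<close>

lemma layer_match:
  fixes a :: "'i \<Rightarrow> 'a set" and b :: "'j \<Rightarrow> 'b set"
  assumes p: "p \<in> U" and i: "i \<in> I" "a i \<inter> U \<noteq> {}"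
    and ia: "\<And>i. i \<in> I \<Longrightarrow> a i \<inter> U \<noteq> {} \<Longrightarrow> p \<in> a i"
    and jb: "\<And>j. j \<in> J \<Longrightarrow> b j \<inter> U' \<noteq> {} \<Longrightarrow> \<sigma> p \<in> b j"
    and da: "\<And>i i'. i \<in> I \<Longrightarrow> i' \<in> I \<Longrightarrow> i \<noteq> i' \<Longrightarrow> a i \<inter> a i' = {}"
    and db: "\<And>j j'. j \<in> J \<Longrightarrow> j' \<in> J \<Longrightarrow> j \<noteq> j' \<Longrightarrow> b j \<inter> b j' = {}"
    and im: "\<sigma> ` (U \<inter> (\<Union>i\<in>I. a i)) = U' \<inter> (\<Union>j\<in>J. b j)"
  shows "\<exists>j\<in>J. \<sigma> p \<in> b j \<and> (\<forall>j'\<in>J. \<sigma> p \<in> b j' \<longrightarrow> j' = j) \<and> \<sigma> ` (a i \<inter> U) = b j \<inter> U'"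
proof -
  have pi: "p \<in> a i" using ia i by blast
  then have "\<sigma> p \<in> \<sigma> ` (U \<inter> (\<Union>i\<in>I. a i))" using p i by blast
  then obtain j where j: "j \<in> J" "\<sigma> p \<in> b j" unfolding im by blast
  have "\<And>j'. j' \<in> J \<Longrightarrow> \<sigma> p \<in> b j' \<Longrightarrow> j' = j" using db j by blast
  moreover have "U \<inter> (\<Union>i\<in>I. a i) = a i \<inter> U"
  proof (intro equalityI subsetI)
    fix x assume "x \<in> U \<inter> (\<Union>i\<in>I. a i)"
    then obtain i' where i': "i' \<in> I" "x \<in> a i'" "x \<in> U" by blast
    then have "p \<in> a i'" using ia by blast
    then have "i' = i" using da i' i pi by blast
    then show "x \<in> a i \<inter> U" using i' by blast
  qed (use i in blast)
  moreover have "U' \<inter> (\<Union>j\<in>J. b j) = b j \<inter> U'"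
  proof (intro equalityI subsetI)
    fix x assume "x \<in> U' \<inter> (\<Union>j\<in>J. b j)"
    then obtain j' where j': "j' \<in> J" "x \<in> b j'" "x \<in> U'" by blast
    then have "\<sigma> p \<in> b j'" using jb by blast
    then have "j' = j" using db j' j by blast
    then show "x \<in> b j \<inter> U'" using j' by blast
  qed (use j in blast)
  ultimately have "\<sigma> ` (a i \<inter> U) = b j \<inter> U'" "\<forall>j'\<in>J. \<sigma> p \<in> b j' \<longrightarrow> j' = j"
    using im by auto
  then show ?thesis using j by blast
qed

text \<open>The curves form two families, each disjoint within itself, while curves of different
  families may meet. Once all curves that avoid the point are removed from the neighbourhood, each
  family has at most one curve left there. The pairing of disks that a radial extension requires can
  then be read off from the unions.\<close>

lemma two_layer_transfer:
  fixes T :: "'a topology" and T' :: "'b topology" and \<phi> :: "'i \<Rightarrow> complex \<Rightarrow> 'a" and \<psi> :: "'j \<Rightarrow> complex \<Rightarrow> 'b"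
  defines "a \<equiv> \<lambda>i. \<phi> i ` unit_circle" and "b \<equiv> \<lambda>j. \<psi> j ` unit_circle"
  assumes A: "attachment T (I1 \<union> I2) \<phi>" and B: "attachment T' (J1 \<union> J2) \<psi>"
    and embA: "\<And>i. i \<in> I1 \<union> I2 \<Longrightarrow> homeomorphic_map (top_of_set unit_circle) (subtopology T (a i)) (\<phi> i)"
    and embB: "\<And>j. j \<in> J1 \<union> J2 \<Longrightarrow> homeomorphic_map (top_of_set unit_circle) (subtopology T' (b j)) (\<psi> j)"
    and H: "Hausdorff_space T" "Hausdorff_space T'"
    and fin: "finite (I1 \<union> I2)" "finite (J1 \<union> J2)" and dI: "I1 \<inter> I2 = {}" and dJ: "J1 \<inter> J2 = {}"
    and d1: "\<And>i i'. i \<in> I1 \<Longrightarrow> i' \<in> I1 \<Longrightarrow> i \<noteq> i' \<Longrightarrow> a i \<inter> a i' = {}"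
    and d2: "\<And>i i'. i \<in> I2 \<Longrightarrow> i' \<in> I2 \<Longrightarrow> i \<noteq> i' \<Longrightarrow> a i \<inter> a i' = {}"
    and e1: "\<And>j j'. j \<in> J1 \<Longrightarrow> j' \<in> J1 \<Longrightarrow> j \<noteq> j' \<Longrightarrow> b j \<inter> b j' = {}"
    and e2: "\<And>j j'. j \<in> J2 \<Longrightarrow> j' \<in> J2 \<Longrightarrow> j \<noteq> j' \<Longrightarrow> b j \<inter> b j' = {}"
    and U: "openin T U" "openin T' U'" and p: "p \<in> U"
    and \<sigma>: "homeomorphic_maps (subtopology T U) (subtopology T' U') \<sigma> \<sigma>'"
    and im1: "\<And>x. x \<in> U \<Longrightarrow> x \<in> (\<Union>i\<in>I1. a i) \<longleftrightarrow> \<sigma> x \<in> (\<Union>j\<in>J1. b j)"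
    and im2: "\<And>x. x \<in> U \<Longrightarrow> x \<in> (\<Union>i\<in>I2. a i) \<longleftrightarrow> \<sigma> x \<in> (\<Union>j\<in>J2. b j)"
    and planar: "locally_planar_at (attach_disks T' (J1 \<union> J2) \<psi>) (Inl (\<sigma> p))"
  shows "locally_planar_at (attach_disks T (I1 \<union> I2) \<phi>) (Inl p)"
proof -
  interpret A: attachment T "I1 \<union> I2" \<phi> by fact
  interpret B: attachment T' "J1 \<union> J2" \<psi> by fact
  have ca: "closedin T (a i)" if "i \<in> I1 \<union> I2" for i
  proof -
    have "compactin T (a i)" unfolding a_def
      by (rule image_compactin[OF _ A.attaching[OF that]]) (simp add: compactin_subtopology)
    then show ?thesis using compactin_imp_closedin H by blast
  qed
  have cb: "closedin T' (b j)" if "j \<in> J1 \<union> J2" for j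
  proof -
    have "compactin T' (b j)" unfolding b_def
      by (rule image_compactin[OF _ B.attaching[OF that]]) (simp add: compactin_subtopology)
    then show ?thesis using compactin_imp_closedin H by blast
  qed
  have sub: "U \<subseteq> topspace T" "U' \<subseteq> topspace T'" using U openin_subset by auto
  have cont: "continuous_map (subtopology T U) (subtopology T' U') \<sigma>"
    "continuous_map (subtopology T' U') (subtopology T U) \<sigma>'"
    and inv: "\<And>x. x \<in> U \<Longrightarrow> \<sigma>' (\<sigma> x) = x" "\<And>y. y \<in> U' \<Longrightarrow> \<sigma> (\<sigma>' y) = y"
    using \<sigma> sub unfolding homeomorphic_maps_def by auto
  have into: "\<And>x. x \<in> U \<Longrightarrow> \<sigma> x \<in> U'" "\<And>y. y \<in> U' \<Longrightarrow> \<sigma>' y \<in> U"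
    using cont sub unfolding continuous_map_def by auto
  \<comment> \<open>The curves that avoid the point. There are finitely many and each is closed, so
    the neighbourhood can be shrunk away from them.\<close>
  define FA where "FA = (\<Union>i\<in>{i \<in> I1 \<union> I2. p \<notin> a i}. a i)"
  define FB where "FB = (\<Union>j\<in>{j \<in> J1 \<union> J2. \<sigma> p \<notin> b j}. b j)"
  have cF: "closedin T FA" "closedin T' FB"
    unfolding FA_def FB_def using fin ca cb by (auto intro!: closedin_Union)
  define V where "V = {x \<in> U. x \<notin> FA \<and> \<sigma> x \<notin> FB}"
  define V' where "V' = {y \<in> U'. y \<notin> FB \<and> \<sigma>' y \<notin> FA}"
  have "openin (subtopology T U) {x \<in> topspace (subtopology T U). \<sigma> x \<in> U' - FB}"
    using cF(2) U(2) by (intro openin_continuous_map_preimage[OF cont(1)])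
      (simp add: openin_diff openin_open_subtopology)
  moreover have "openin (subtopology T U) (U - FA)"
    using cF(1) U(1) by (simp add: openin_diff openin_open_subtopology)
  ultimately have "openin (subtopology T U) ({x \<in> topspace (subtopology T U). \<sigma> x \<in> U' - FB} \<inter> (U - FA))"
    by (rule openin_Int)
  moreover have "{x \<in> topspace (subtopology T U). \<sigma> x \<in> U' - FB} \<inter> (U - FA) = V"
    unfolding V_def using sub into by auto
  ultimately have oV: "openin T V" using openin_trans_full U(1) by fastforce
  have "openin (subtopology T' U') {x \<in> topspace (subtopology T' U'). \<sigma>' x \<in> U - FA}"
    using cF(1) U(1) by (intro openin_continuous_map_preimage[OF cont(2)])
      (simp add: openin_diff openin_open_subtopology)
  moreover have "openin (subtopology T' U') (U' - FB)"
    using cF(2) U(2) by (simp add: openin_diff openin_open_subtopology)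
  ultimately have "openin (subtopology T' U') ({x \<in> topspace (subtopology T' U'). \<sigma>' x \<in> U - FA} \<inter> (U' - FB))"
    by (rule openin_Int)
  moreover have "{x \<in> topspace (subtopology T' U'). \<sigma>' x \<in> U - FA} \<inter> (U' - FB) = V'"
    unfolding V'_def using sub into by auto
  ultimately have oV': "openin T' V'" using openin_trans_full U(2) by fastforce
  have VU: "V \<subseteq> U" "V' \<subseteq> U'" unfolding V_def V'_def by auto
  have V_in: "\<sigma> x \<in> V'" if "x \<in> V" for x using that into inv unfolding V_def V'_def by auto
  have V'_in: "\<sigma>' x \<in> V" if "x \<in> V'" for x using that into inv unfolding V_def V'_def by auto
  have "homeomorphic_maps (subtopology (subtopology T U) V) (subtopology (subtopology T' U') V') \<sigma> \<sigma>'"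
    by (rule homeomorphic_maps_subtopologies_alt[OF \<sigma>]) (use V_in V'_in in auto)
  then have \<sigma>V: "homeomorphic_maps (subtopology T V) (subtopology T' V') \<sigma> \<sigma>'"
    using VU by (simp add: subtopology_subtopology inf_absorb2)
  have pV: "p \<in> V" using p unfolding V_def FA_def FB_def by auto
  have ia: "p \<in> a i" if "i \<in> I1 \<union> I2" "a i \<inter> V \<noteq> {}" for i
    using that unfolding V_def FA_def by blast
  have jb: "\<sigma> p \<in> b j" if "j \<in> J1 \<union> J2" "b j \<inter> V' \<noteq> {}" for j
    using that unfolding V'_def FB_def by blast
  have imV: "\<sigma> ` (V \<inter> S) = V' \<inter> S'" "\<sigma>' ` (V' \<inter> S') = V \<inter> S"
    if "\<And>x. x \<in> U \<Longrightarrow> x \<in> S \<longleftrightarrow> \<sigma> x \<in> S'" for S S'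
  proof -
    show "\<sigma> ` (V \<inter> S) = V' \<inter> S'"
    proof (intro equalityI subsetI)
      fix y assume y: "y \<in> V' \<inter> S'"
      then have "y = \<sigma> (\<sigma>' y)" "\<sigma>' y \<in> V" using inv(2) VU V'_in by auto
      then show "y \<in> \<sigma> ` (V \<inter> S)" using that[of "\<sigma>' y"] y VU by (metis IntD2 IntI imageI subsetD)
    qed (use that VU V_in in blast)
    show "\<sigma>' ` (V' \<inter> S') = V \<inter> S"
    proof (intro equalityI subsetI)
      fix x assume x: "x \<in> V \<inter> S"
      then have "x = \<sigma>' (\<sigma> x)" "\<sigma> x \<in> V'" "\<sigma> x \<in> S'" using inv(1) VU V_in that[of x] by auto
      then show "x \<in> \<sigma>' ` (V' \<inter> S')" by blast
    next
      fix x assume "x \<in> \<sigma>' ` (V' \<inter> S')"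
      then obtain y where y: "y \<in> V'" "y \<in> S'" "x = \<sigma>' y" by blast
      then have "\<sigma> x = y" "x \<in> V" using inv(2) VU V'_in by auto
      then show "x \<in> V \<inter> S" using that[of x] y VU by blast
    qed
  qed
  \<comment> \<open>The partner of a curve is the curve of the corresponding family through the
    corresponding point, unique by disjointness. For curves that do not reach the neighbourhood the
    value is immaterial, since \<open>radial\<close> asks nothing of them.\<close>
  define \<tau> where "\<tau> i = (THE j. (i \<in> I1 \<and> j \<in> J1 \<or> i \<in> I2 \<and> j \<in> J2) \<and> \<sigma> p \<in> b j)" for i
  define \<tau>' where "\<tau>' j = (THE i. (i \<in> I1 \<and> j \<in> J1 \<or> i \<in> I2 \<and> j \<in> J2) \<and> p \<in> a i)" for j
  have inv_p: "\<sigma>' (\<sigma> p) = p" using inv p by blast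
  have \<sigma>pV: "\<sigma> p \<in> V'" using V_in pV by blast
  have t1: "\<tau> i \<in> J1 \<and> \<sigma> p \<in> b (\<tau> i) \<and> \<sigma> ` (a i \<inter> V) = b (\<tau> i) \<inter> V'" if i: "i \<in> I1" "a i \<inter> V \<noteq> {}" for i
  proof -
    obtain j where j: "j \<in> J1" "\<sigma> p \<in> b j" "\<forall>j'\<in>J1. \<sigma> p \<in> b j' \<longrightarrow> j' = j" "\<sigma> ` (a i \<inter> V) = b j \<inter> V'"
      using layer_match[where \<sigma>=\<sigma>, OF pV i _ _ d1 e1 imV(1)[OF im1]] ia jb by blast
    have "\<tau> i = j" unfolding \<tau>_def by (rule the_equality; use i(1) j dI in blast)
    then show ?thesis using j by blast
  qed
  have t2: "\<tau> i \<in> J2 \<and> \<sigma> p \<in> b (\<tau> i) \<and> \<sigma> ` (a i \<inter> V) = b (\<tau> i) \<inter> V'" if i: "i \<in> I2" "a i \<inter> V \<noteq> {}" for i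
  proof -
    obtain j where j: "j \<in> J2" "\<sigma> p \<in> b j" "\<forall>j'\<in>J2. \<sigma> p \<in> b j' \<longrightarrow> j' = j" "\<sigma> ` (a i \<inter> V) = b j \<inter> V'"
      using layer_match[where \<sigma>=\<sigma>, OF pV i _ _ d2 e2 imV(1)[OF im2]] ia jb by blast
    have "\<tau> i = j" unfolding \<tau>_def by (rule the_equality; use i(1) j dI in blast)
    then show ?thesis using j by blast
  qed
  have s1: "\<tau>' j \<in> I1 \<and> p \<in> a (\<tau>' j) \<and> \<sigma>' ` (b j \<inter> V') = a (\<tau>' j) \<inter> V" if j: "j \<in> J1" "b j \<inter> V' \<noteq> {}" for j
  proof -
    obtain i where i: "i \<in> I1" "p \<in> a i" "\<forall>i'\<in>I1. p \<in> a i' \<longrightarrow> i' = i" "\<sigma>' ` (b j \<inter> V') = a i \<inter> V"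
      using layer_match[where \<sigma>=\<sigma>', OF \<sigma>pV j _ _ e1 d1 imV(2)[OF im1]] ia jb unfolding inv_p by blast
    have "\<tau>' j = i" unfolding \<tau>'_def by (rule the_equality; use j(1) i dJ in blast)
    then show ?thesis using i by blast
  qed
  have s2: "\<tau>' j \<in> I2 \<and> p \<in> a (\<tau>' j) \<and> \<sigma>' ` (b j \<inter> V') = a (\<tau>' j) \<inter> V" if j: "j \<in> J2" "b j \<inter> V' \<noteq> {}" for j
  proof -
    obtain i where i: "i \<in> I2" "p \<in> a i" "\<forall>i'\<in>I2. p \<in> a i' \<longrightarrow> i' = i" "\<sigma>' ` (b j \<inter> V') = a i \<inter> V"
      using layer_match[where \<sigma>=\<sigma>', OF \<sigma>pV j _ _ e2 d2 imV(2)[OF im2]] ia jb unfolding inv_p by blast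
    have "\<tau>' j = i" unfolding \<tau>'_def by (rule the_equality; use j(1) i dJ in blast)
    then show ?thesis using i by blast
  qed
  have uI: "i = i'" if "i \<in> I1 \<and> i' \<in> I1 \<or> i \<in> I2 \<and> i' \<in> I2" "p \<in> a i" "p \<in> a i'" for i i'
    using that d1[of i i'] d2[of i i'] by blast
  have uJ: "j = j'" if "j \<in> J1 \<and> j' \<in> J1 \<or> j \<in> J2 \<and> j' \<in> J2" "\<sigma> p \<in> b j" "\<sigma> p \<in> b j'" for j j'
    using that e1[of j j'] e2[of j j'] by blast
  interpret radial T "I1 \<union> I2" \<phi> T' "J1 \<union> J2" \<psi> \<sigma> \<sigma>' \<tau> \<tau>' V V'
  proof (unfold_locales)
    show "openin T V" "openin T' V'" by fact+
    show "homeomorphic_maps (subtopology T V) (subtopology T' V') \<sigma> \<sigma>'" by fact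
    show "homeomorphic_map (top_of_set unit_circle) (subtopology T (\<phi> i ` unit_circle)) (\<phi> i)" if "i \<in> I1 \<union> I2" for i
      using embA[OF that] unfolding a_def .
    show "homeomorphic_map (top_of_set unit_circle) (subtopology T' (\<psi> i ` unit_circle)) (\<psi> i)" if "i \<in> J1 \<union> J2" for i
      using embB[OF that] unfolding b_def .
    fix i assume i: "i \<in> I1 \<union> I2" "\<phi> i ` unit_circle \<inter> V \<noteq> {}"
    have ai: "a i \<inter> V \<noteq> {}" using i(2) unfolding a_def .
    have pa: "p \<in> a i" using ia i(1) ai by blast
    have ti: "(i \<in> I1 \<and> \<tau> i \<in> J1 \<or> i \<in> I2 \<and> \<tau> i \<in> J2) \<and> \<sigma> p \<in> b (\<tau> i) \<and> \<sigma> ` (a i \<inter> V) = b (\<tau> i) \<inter> V'"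
      using i(1) t1[OF _ ai] t2[OF _ ai] by blast
    then have bt: "b (\<tau> i) \<inter> V' \<noteq> {}" using \<sigma>pV by blast
    have "\<tau>' (\<tau> i) = i"
    proof (rule uI)
      show "\<tau>' (\<tau> i) \<in> I1 \<and> i \<in> I1 \<or> \<tau>' (\<tau> i) \<in> I2 \<and> i \<in> I2" using ti s1[OF _ bt] s2[OF _ bt] by blast
      show "p \<in> a (\<tau>' (\<tau> i))" using ti s1[OF _ bt] s2[OF _ bt] by blast
    qed (rule pa)
    then show "\<tau> i \<in> J1 \<union> J2 \<and> \<tau>' (\<tau> i) = i \<and> \<sigma> ` (\<phi> i ` unit_circle \<inter> V) = \<psi> (\<tau> i) ` unit_circle \<inter> V'"
      using ti unfolding a_def b_def by blast
  next
    fix j assume j: "j \<in> J1 \<union> J2" "\<psi> j ` unit_circle \<inter> V' \<noteq> {}"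
    have bj: "b j \<inter> V' \<noteq> {}" using j(2) unfolding b_def .
    have pb: "\<sigma> p \<in> b j" using jb j(1) bj by blast
    have tj: "(j \<in> J1 \<and> \<tau>' j \<in> I1 \<or> j \<in> J2 \<and> \<tau>' j \<in> I2) \<and> p \<in> a (\<tau>' j) \<and> \<sigma>' ` (b j \<inter> V') = a (\<tau>' j) \<inter> V"
      using j(1) s1[OF _ bj] s2[OF _ bj] by blast
    then have at: "a (\<tau>' j) \<inter> V \<noteq> {}" using pV by blast
    have "\<tau> (\<tau>' j) = j"
    proof (rule uJ)
      show "\<tau> (\<tau>' j) \<in> J1 \<and> j \<in> J1 \<or> \<tau> (\<tau>' j) \<in> J2 \<and> j \<in> J2" using tj t1[OF _ at] t2[OF _ at] by blast
      show "\<sigma> p \<in> b (\<tau> (\<tau>' j))" using tj t1[OF _ at] t2[OF _ at] by blast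
    qed (rule pb)
    then show "\<tau>' j \<in> I1 \<union> I2 \<and> \<tau> (\<tau>' j) = j \<and> \<sigma>' ` (\<psi> j ` unit_circle \<inter> V') = \<phi> (\<tau>' j) ` unit_circle \<inter> V"
      using tj unfolding a_def b_def by blast
  qed
  show ?thesis by (rule locally_planar_transfer[OF pV planar])
qed

section \<open>The surface recovered from its skeleton\<close>

context band_structure
begin

text \<open>Other 1-bands and the seam meet this band only in corners, which are on ends and sides
  alike. So inside one closed 1-band the frontier depends on \<open>S\<close> only through whether
  \<open>S\<close> contains \<open>e\<close>.\<close>

lemma fr_Q:
  assumes e: "e \<in> E" and x: "x \<in> Q e" and S: "S \<subseteq> E"
  shows "x \<in> fr S \<longleftrightarrow> (if e \<in> S then x \<in> sides_of e else x \<in> ends_of e)"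
proof -
  have v: "x \<in> \<phi> e ` corners \<Longrightarrow> x \<in> sides_of e \<and> x \<in> ends_of e" using corners_in(3)[OF e] by blast
  have "x \<in> \<phi> e ` corners" if "e' \<in> E" "e' \<noteq> e" "x \<in> Q e'" for e'
    using quad_inter[OF e that(1)] that x by blast
  moreover have "x \<in> \<phi> e ` corners" if "x \<in> seam" using corners_in(2)[OF e] that x by blast
  ultimately have *: "x \<in> sides_of e \<and> x \<in> ends_of e" if "x \<in> seam \<or> (\<exists>e'\<in>E. e' \<noteq> e \<and> x \<in> Q e')"
    using that v by blast
  show ?thesis
  proof
    assume "x \<in> fr S"
    then consider "x \<in> seam" | e' where "e' \<in> S" "x \<in> sides_of e'" | e' where "e' \<in> E - S" "x \<in> ends_of e'"
      unfolding fr_def by blast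
    then show "if e \<in> S then x \<in> sides_of e else x \<in> ends_of e"
    proof cases
      case 1
      then show ?thesis using * by simp
    next
      case (2 e')
      have "e' \<in> E" "x \<in> Q e'" using 2 S ends_sides_Q(2)[of e'] by blast+
      then show ?thesis using * 2 by (cases "e' = e") auto
    next
      case (3 e')
      have "e' \<in> E" "x \<in> Q e'" using 3 ends_sides_Q(1)[of e'] by blast+
      then show ?thesis using * 3 by (cases "e' = e") auto
    qed
  next
    assume "if e \<in> S then x \<in> sides_of e else x \<in> ends_of e"
    then show "x \<in> fr S" using e unfolding fr_def by (auto split: if_splits)
  qed
qed

lemma fr_not_Q:
  assumes "\<And>e. e \<in> E \<Longrightarrow> x \<notin> Q e" "S \<subseteq> E"
  shows "x \<in> fr S \<longleftrightarrow> x \<in> seam"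
  unfolding fr_def using assms ends_sides_Q by blast

lemma fr_K: "S \<subseteq> E \<Longrightarrow> fr S \<subseteq> K"
  unfolding fr_def skeleton_eq using ends_sides_Q(1,2) by blast

abbreviation Kt where "Kt \<equiv> subtopology X K"

lemma Kt: "topspace Kt = K" "compact_space Kt" "Hausdorff_space Kt"
proof -
  show "topspace Kt = K" using skeleton_closed closedin_subset by (metis topspace_subtopology_subset)
  show "compact_space Kt" using X(2) skeleton_closed closedin_compact_space compact_space_subtopology by blast
  show "Hausdorff_space Kt" using X(1) Hausdorff_space_subtopology by blast
qed

definition disk_param where "disk_param A = (SOME h.
  homeomorphic_map (top_of_set closed_disk) (subtopology X (X closure_of A)) h \<and>
    h ` open_disk = A \<and> h ` unit_circle = X closure_of A - A \<and>
    homeomorphic_map (top_of_set unit_circle) (subtopology X (X closure_of A - A)) h)"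

lemma disk_param:
  assumes "disk_band X A"
  shows "homeomorphic_map (top_of_set closed_disk) (subtopology X (X closure_of A)) (disk_param A)"
    "disk_param A ` open_disk = A" "disk_param A ` unit_circle = X closure_of A - A"
    "homeomorphic_map (top_of_set unit_circle) (subtopology X (X closure_of A - A)) (disk_param A)"
proof -
  have "\<exists>h. homeomorphic_map (top_of_set closed_disk) (subtopology X (X closure_of A)) h \<and>
    h ` open_disk = A \<and> h ` unit_circle = X closure_of A - A \<and>
    homeomorphic_map (top_of_set unit_circle) (subtopology X (X closure_of A - A)) h"
    using disk_band_parametrisation[OF assms] by metis
  from someI_ex[OF this, folded disk_param_def] show
    "homeomorphic_map (top_of_set closed_disk) (subtopology X (X closure_of A)) (disk_param A)"
    "disk_param A ` open_disk = A" "disk_param A ` unit_circle = X closure_of A - A"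
    "homeomorphic_map (top_of_set unit_circle) (subtopology X (X closure_of A - A)) (disk_param A)" by auto
qed

text \<open>The sum type allows 0-bands and 2-bands to be attached at once while it keeps the two
  families apart.\<close>

definition band where "band = case_sum c (\<lambda>A. A)"
abbreviation J0 where "J0 \<equiv> Inl ` zero_index N \<union> Inr ` two_bands N"
definition \<psi> where "\<psi> j = disk_param (band j)"

lemma band_cases:
  assumes "j \<in> J0"
  shows "disk_band X (band j)" "band j \<inter> K = {}" "X closure_of band j - band j \<subseteq> K"
    "openin X (band j)"
proof -
  show d: "disk_band X (band j)" using assms disk_bands unfolding band_def by auto
  then show "openin X (band j)" unfolding disk_band_def by blast
  show "band j \<inter> K = {}" using assms unfolding band_def skeleton_def by auto
  have "X closure_of band j - band j \<subseteq> fr {} \<union> fr E"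
    using assms unfolding band_def fr_empty fr_all by auto
  then show "X closure_of band j - band j \<subseteq> K" using fr_K[of "{}"] fr_K[of E] by blast
qed

lemma \<psi>:
  assumes j: "j \<in> J0"
  shows "homeomorphic_map (top_of_set unit_circle) (subtopology Kt (\<psi> j ` unit_circle)) (\<psi> j)"
    "\<psi> j ` unit_circle = X closure_of band j - band j" "\<psi> j ` open_disk = band j"
    "continuous_map (top_of_set unit_circle) Kt (\<psi> j)"
proof -
  note d = disk_param[OF band_cases(1)[OF j], folded \<psi>_def]
  show im: "\<psi> j ` unit_circle = X closure_of band j - band j" "\<psi> j ` open_disk = band j" using d by auto
  have "subtopology Kt (\<psi> j ` unit_circle) = subtopology X (X closure_of band j - band j)"
    unfolding subtopology_subtopology im using band_cases(3)[OF j] by (simp add: inf_absorb2)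
  then show h: "homeomorphic_map (top_of_set unit_circle) (subtopology Kt (\<psi> j ` unit_circle)) (\<psi> j)"
    using d by simp
  show "continuous_map (top_of_set unit_circle) Kt (\<psi> j)"
    using homeomorphic_imp_continuous_map[OF h] by (simp add: continuous_map_in_subtopology)
qed

lemma attachment_\<psi>: "attachment Kt J0 \<psi>"
  by unfold_locales (rule \<psi>(4))

lemma band_inj: "j \<in> J0 \<Longrightarrow> j' \<in> J0 \<Longrightarrow> j \<noteq> j' \<Longrightarrow> band j \<inter> band j' = {}"
proof -
  assume j: "j \<in> J0" "j' \<in> J0" "j \<noteq> j'"
  have z: "c v \<inter> c w = {}" if "v \<in> zero_index N" "w \<in> zero_index N" "v \<noteq> w" for v w
    using closed_disjoint(1)[OF that] band_subset_closure(1) that by blast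
  have t: "A \<inter> B = {}" if "A \<in> two_bands N" "B \<in> two_bands N" "A \<noteq> B" for A B
    using closed_disjoint(2)[OF that] band_subset_closure(2) that by blast
  have m: "c v \<inter> A = {}" if "v \<in> zero_index N" "A \<in> two_bands N" for v A
    using zero_disjoint(2)[OF that(1)] band_subset_closure(2)[OF that(2)] that unfolding two_closed_def by blast
  consider v w where "j = Inl v" "j' = Inl w" "v \<in> zero_index N" "w \<in> zero_index N"
    | v A where "j = Inl v" "j' = Inr A" "v \<in> zero_index N" "A \<in> two_bands N"
    | v A where "j' = Inl v" "j = Inr A" "v \<in> zero_index N" "A \<in> two_bands N"
    | A B where "j = Inr A" "j' = Inr B" "A \<in> two_bands N" "B \<in> two_bands N" using j(1,2) by blast
  then show "band j \<inter> band j' = {}"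
  proof cases
    case 3
    then show ?thesis using m unfolding band_def by (simp add: Int_commute)
  qed (use j(3) z t m in \<open>simp_all add: band_def\<close>)
qed

text \<open>The map is the inclusion on the skeleton and the parametrisation of each band on its
  disk: a continuous bijection from a compact space onto a Hausdorff space.\<close>

lemma homeomorphic_attach:
  "homeomorphic_map (attach_disks Kt J0 \<psi>) X (case_sum (\<lambda>x. x) (\<lambda>(j, z). \<psi> j z))" (is "homeomorphic_map ?A X ?F")
proof -
  interpret A: attachment Kt J0 \<psi> by (rule attachment_\<psi>)
  have inj: "inj_on (\<psi> j) closed_disk" if "j \<in> J0" for j
    using homeomorphic_imp_injective_map[OF disk_param(1)[OF band_cases(1)[OF that]]] unfolding \<psi>_def by simp
  show ?thesis
  proof (rule continuous_imp_homeomorphic_map)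
    show "continuous_map A.At X ?F"
    proof (rule A.continuous_map_attach)
      show "continuous_map Kt X (?F \<circ> Inl)" by (simp add: o_def)
      fix j assume j: "j \<in> J0"
      have "?F \<circ> A.pt j = \<psi> j" by (auto simp: attach_point_def)
      moreover have "continuous_map (top_of_set closed_disk) X (\<psi> j)"
        using homeomorphic_imp_continuous_map[OF disk_param(1)[OF band_cases(1)[OF j]]]
        unfolding \<psi>_def by (simp add: continuous_map_in_subtopology)
      ultimately show "continuous_map (top_of_set closed_disk) X (?F \<circ> A.pt j)" by simp
    qed
    show "compact_space A.At" using A.compact_attach Kt finite_bands by simp
    show "Hausdorff_space X" by (rule X)
    have "?F ` topspace A.At = K \<union> (\<Union>j\<in>J0. \<psi> j ` open_disk)"
    proof -
      have "(\<lambda>(j, z). \<psi> j z) ` (S \<times> open_disk) = (\<Union>j\<in>S. \<psi> j ` open_disk)" for S by auto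
      then show ?thesis unfolding A.topspace_attach Kt image_Un image_image sum.case by simp
    qed
    also have "\<dots> = K \<union> (\<Union>j\<in>J0. band j)" using \<psi>(3) by auto
    also have "\<dots> = topspace X"
    proof -
      have "(\<Union>j\<in>J0. band j) = (\<Union>v\<in>zero_index N. c v) \<union> \<Union>(two_bands N)" unfolding band_def by auto
      moreover have "\<dots> \<subseteq> topspace X" using open_bands(1,2) openin_subset by blast
      ultimately show ?thesis unfolding skeleton_def by blast
    qed
    finally show "?F ` topspace A.At = topspace X" .
    show "inj_on ?F (topspace A.At)"
    proof (rule inj_onI)
      fix s t assume st: "s \<in> topspace A.At" "t \<in> topspace A.At" "?F s = ?F t"
      have in_band: "\<psi> j z \<in> band j" if "j \<in> J0" "norm z < 1" for j z
        using \<psi>(3)[OF that(1)] that(2) by auto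
      consider (ll) x y where "s = Inl x" "t = Inl y"
        | (lr) x j z where "s = Inl x" "x \<in> K" "t = Inr (j, z)" "j \<in> J0" "norm z < 1"
        | (rl) x j z where "t = Inl x" "x \<in> K" "s = Inr (j, z)" "j \<in> J0" "norm z < 1"
        | (rr) j z j' z' where "s = Inr (j, z)" "j \<in> J0" "norm z < 1" "t = Inr (j', z')" "j' \<in> J0" "norm z' < 1"
        using st(1,2) unfolding A.topspace_attach Kt by auto
      then show "s = t"
      proof cases
        case ll then show ?thesis using st by simp
      next
        case lr
        then have "x \<in> band j" using st(3) in_band by auto
        then show ?thesis using lr band_cases(2)[OF lr(4)] by blast
      next
        case rl
        then have "x \<in> band j" using st(3) in_band by auto
        then show ?thesis using rl band_cases(2)[OF rl(4)] by blast
      next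
        case rr
        then have "\<psi> j z = \<psi> j' z'" using st(3) by simp
        then have "j = j'" using in_band[OF rr(2,3)] in_band[OF rr(5,6)] band_inj[OF rr(2,5)] by auto
        then show ?thesis using inj_onD[OF inj[OF rr(2)], of z z'] rr \<open>\<psi> j z = \<psi> j' z'\<close> by simp
      qed
    qed
  qed
qed

text \<open>Attaching disks cannot join separate pieces, and the connected surface is the skeleton
  with disks attached. The dual surface obtains its connectedness from here.\<close>

lemma Kt_connected: "connected_space Kt"
proof -
  interpret A: attachment Kt J0 \<psi> by (rule attachment_\<psi>)
  have "A.At homeomorphic_space X"
    using homeomorphic_attach homeomorphic_map_imp_homeomorphic_space by blast
  then have "connected_space A.At" using X(3) homeomorphic_connected_space by blast
  then show ?thesis by (rule A.connected_of_attach)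
qed

lemma locally_planar_attach_\<psi>:
  assumes "x \<in> K"
  shows "locally_planar_at (attach_disks Kt J0 \<psi>) (Inl x)"
proof (rule locally_planar_at_transfer)
  interpret A: attachment Kt J0 \<psi> by (rule attachment_\<psi>)
  let ?F = "case_sum (\<lambda>x. x) (\<lambda>(j, z). \<psi> j z)"
  show "homeomorphic_map (subtopology A.At (topspace A.At)) (subtopology X (topspace X)) ?F"
    using homeomorphic_attach by simp
  have "x \<in> topspace X" using assms unfolding skeleton_def by blast
  then show "locally_planar_at X (?F (Inl x))" using surface unfolding surface_def by simp
  show "Inl x \<in> topspace A.At" using assms A.topspace_attach Kt by simp
qed auto

end

section \<open>The dual surface\<close>

text \<open>The reflection of the unit square that fixes its corner \<open>z\<close> and exchanges the two sides there.\<close>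

definition flip :: "real \<times> real \<Rightarrow> real \<times> real \<Rightarrow> real \<times> real" where
  "flip z w = (if fst z = snd z then (snd w, fst w) else (1 - snd w, 1 - fst w))"

text \<open>The bound 1/2 gives a neighbourhood of the corner that contains no other corner, so
  identifications between corners of the same quadrilateral do not occur inside it.\<close>

definition corner_box :: "real \<times> real \<Rightarrow> (real \<times> real) set" where
  "corner_box z = {w \<in> square. \<bar>fst w - fst z\<bar> < 1/2 \<and> \<bar>snd w - snd z\<bar> < 1/2}"

lemma flip_flip [simp]: "flip z (flip z w) = w"
  by (simp add: flip_def)

lemma flip_corner: "z \<in> corners \<Longrightarrow> flip z z = z"
  by (auto simp: flip_def)

lemma flip_box: "z \<in> corners \<Longrightarrow> w \<in> corner_box z \<Longrightarrow> flip z w \<in> corner_box z"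
  by (cases w) (auto simp: flip_def corner_box_def)

lemma flip_sides:
  assumes "z \<in> corners" "w \<in> square"
  shows "flip z w \<in> {0, 1} \<times> {0..1} \<longleftrightarrow> w \<in> {0..1} \<times> {0, 1}" "flip z w \<in> {0..1} \<times> {0, 1} \<longleftrightarrow> w \<in> {0, 1} \<times> {0..1}"
  using assms by (cases w; auto simp: flip_def)+

lemma corner_box_corner: "z \<in> corners \<Longrightarrow> z \<in> corner_box z"
  "z \<in> corners \<Longrightarrow> w \<in> corner_box z \<Longrightarrow> w \<in> corners \<Longrightarrow> w = z"
  by (auto simp: corner_box_def)

lemma continuous_flip: "continuous_on S (flip z)"
  unfolding flip_def by (cases "fst z = snd z") (auto intro!: continuous_intros)

section \<open>Reflection at a corner shared by two edges\<close>

context band_structure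
begin

text \<open>Corners of two different edges already exhaust the two incidences allowed at a point. In
  particular neither of the two bands touches itself there.\<close>

lemma corner_incidence:
  assumes "e \<in> E" "e' \<in> E" "e \<noteq> e'" "z \<in> corners" "z' \<in> corners" "\<phi> e z = \<phi> e' z'"
    and "e'' \<in> E" "z'' \<in> corners" "\<phi> e'' z'' = \<phi> e z"
  shows "(e'', z'') = (e, z) \<or> (e'', z'') = (e', z')"
proof (rule ccontr)
  assume n: "\<not> ?thesis"
  let ?S = "{(d, w). d \<in> E \<and> w \<in> corners \<and> \<phi> d w = \<phi> e z}"
  have "?S \<subseteq> E \<times> corners" by auto
  moreover have "finite (E \<times> corners)" using finite_bands by simp
  ultimately have "finite ?S" by (rule finite_subset)
  moreover have "{(e, z), (e', z'), (e'', z'')} \<subseteq> ?S" using assms by auto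
  ultimately have "card {(e, z), (e', z'), (e'', z'')} \<le> card ?S" by (rule card_mono)
  moreover have "card ?S \<le> 2" using quadrilaterals unfolding quadrilaterals_def by blast
  moreover have "card {(e, z), (e', z'), (e'', z'')} = 3" using assms(3) n by auto
  ultimately show False by linarith
qed

lemma ends_sides_mem:
  assumes e: "e \<in> E" and w: "w \<in> square"
  shows "\<phi> e w \<in> ends_of e \<longleftrightarrow> w \<in> {0, 1} \<times> {0..1}" "\<phi> e w \<in> sides_of e \<longleftrightarrow> w \<in> {0..1} \<times> {0, 1}"
proof -
  show "\<phi> e w \<in> ends_of e \<longleftrightarrow> w \<in> {0, 1} \<times> {0..1}"
  proof
    assume "\<phi> e w \<in> ends_of e"
    then obtain w' where w': "w' \<in> {0, 1} \<times> {0..1}" "\<phi> e w = \<phi> e w'" unfolding ends_of_def by blast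
    have "w' \<in> square" using w'(1) by auto
    then have "w = w' \<or> w \<in> corners \<and> w' \<in> corners" by (rule quad_eq[OF e w _ w'(2)])
    then show "w \<in> {0, 1} \<times> {0..1}" using w'(1) by auto
  qed (auto simp: ends_of_def)
  show "\<phi> e w \<in> sides_of e \<longleftrightarrow> w \<in> {0..1} \<times> {0, 1}"
  proof
    assume "\<phi> e w \<in> sides_of e"
    then obtain w' where w': "w' \<in> {0..1} \<times> {0, 1}" "\<phi> e w = \<phi> e w'" unfolding sides_of_def by blast
    have "w' \<in> square" using w'(1) by auto
    then have "w = w' \<or> w \<in> corners \<and> w' \<in> corners" by (rule quad_eq[OF e w _ w'(2)])
    then show "w \<in> {0..1} \<times> {0, 1}" using w'(1) by auto
  qed (auto simp: sides_of_def)
qed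

text \<open>\<open>\<phi> e\<close> is closed on the compact square, and \<open>B\<close> is the
  full preimage of its image. Hence the restriction is closed too, even if corners outside
  \<open>B\<close> are identified with each other.\<close>

lemma box_homeomorphic:
  assumes e: "e \<in> E" and B: "B \<subseteq> square" "\<phi> e ` B \<inter> \<phi> e ` (square - B) = {}" "inj_on (\<phi> e) B"
  shows "homeomorphic_map (top_of_set B) (subtopology X (\<phi> e ` B)) (\<phi> e)"
proof -
  have sub: "subtopology (top_of_set square) B = top_of_set B"
    using B(1) by (simp add: subtopology_subtopology inf_absorb2)
  have "compact_space (top_of_set square)"
    by (simp add: compact_space_subtopology compact_Times)
  then have "closed_map (top_of_set square) X (\<phi> e)"
    by (intro continuous_imp_closed_map[OF quad(1)[OF e] _ X(1)])
  then have "closed_map (subtopology (top_of_set square) B) (subtopology X (\<phi> e ` B)) (\<phi> e)"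
  proof (rule closed_map_restriction)
    show "{w \<in> topspace (top_of_set square). \<phi> e w \<in> \<phi> e ` B} = B"
      using B(1,2) by (simp only: topspace_euclidean_subtopology) blast
  qed
  then have cl: "closed_map (top_of_set B) (subtopology X (\<phi> e ` B)) (\<phi> e)" unfolding sub .
  have "continuous_map (top_of_set B) X (\<phi> e)"
    by (rule continuous_map_from_subtopology_mono[OF quad(1)[OF e] B(1)])
  then have c: "continuous_map (top_of_set B) (subtopology X (\<phi> e ` B)) (\<phi> e)"
    by (simp add: continuous_map_in_subtopology)
  have im: "\<phi> e ` B \<subseteq> topspace X"
    using continuous_map_image_subset_topspace[OF \<open>continuous_map (top_of_set B) X (\<phi> e)\<close>] by simp
  show ?thesis
    by (rule bijective_closed_imp_homeomorphic_map[OF c cl]) (use B(3) im in \<open>simp_all add: inf_absorb2\<close>)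
qed

text \<open>At a corner shared by an edge in \<open>S\<close> and an edge outside \<open>S\<close>, reflecting the former at the corner
  turns the pair \<open>fr S\<close>, \<open>fr (E - S)\<close> into the pair \<open>fr {}\<close>, \<open>fr E\<close>.\<close>

lemma flip_corner_homeomorphism:
  assumes e: "e \<in> E" "e' \<in> E" "e \<noteq> e'" and z: "z \<in> corners" "z' \<in> corners" "\<phi> e z = \<phi> e' z'"
    and S: "S \<subseteq> E" "e \<in> S" "e' \<notin> S"
  shows "\<exists>U \<sigma>. openin Kt U \<and> \<phi> e z \<in> U \<and> homeomorphic_maps (subtopology Kt U) (subtopology Kt U) \<sigma> \<sigma> \<and>
     (\<forall>y\<in>U. (y \<in> fr S \<longleftrightarrow> \<sigma> y \<in> fr {}) \<and> (y \<in> fr (E - S) \<longleftrightarrow> \<sigma> y \<in> fr E))"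
proof -
  let ?x = "\<phi> e z"
  define B where "B = corner_box z"
  \<comment> \<open>What the neighbourhood must avoid: the quadrilateral of \<open>e\<close> outside
    the box at \<open>z\<close>, and every 1-band other than those of \<open>e\<close> and
    \<open>e'\<close>.\<close>
  define far where "far = \<phi> e ` (square - B) \<union> (\<Union>d\<in>E - {e, e'}. Q d)"
  define U where "U = K - far"
  note inc = corner_incidence[OF e z]
  have zB: "z \<in> B" and Bz: "\<And>w. w \<in> B \<Longrightarrow> w \<in> corners \<Longrightarrow> w = z" and Bsq: "B \<subseteq> square"
    using corner_box_corner z(1) unfolding B_def by (auto simp: corner_box_def)
  have zsq: "z \<in> square" using Bsq zB by blast
  \<comment> \<open>The two incidences at this point are taken by \<open>e\<close> and
    \<open>e'\<close>, so no second corner of \<open>e\<close> is identified with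
    \<open>z\<close>.\<close>
  have only: "\<phi> e w = ?x \<Longrightarrow> w \<in> square \<Longrightarrow> w = z" for w
  proof -
    assume w: "\<phi> e w = ?x" "w \<in> square"
    then have "w = z \<or> w \<in> corners" using quad_eq[OF e(1) w(2) zsq w(1)] by blast
    then show "w = z" using inc[OF e(1) _ w(1)] e(3) by auto
  qed
  have sep: "\<phi> e ` B \<inter> \<phi> e ` (square - B) = {}"
  proof -
    have "\<phi> e w \<noteq> \<phi> e w'" if w: "w \<in> B" "w' \<in> square" "w' \<notin> B" for w w'
    proof
      assume eq: "\<phi> e w = \<phi> e w'"
      have "w \<in> square" using w Bsq by blast
      then have "w \<in> corners \<and> w' \<in> corners" using quad_eq[OF e(1) _ w(2) eq] w by blast
      then have "w = z" using Bz w(1) by blast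
      then have "w' = z" using only[of w'] eq w by simp
      then show False using zB w by blast
    qed
    then show ?thesis by blast
  qed
  have injB: "inj_on (\<phi> e) B"
  proof (rule inj_onI)
    fix w w' assume w: "w \<in> B" "w' \<in> B" "\<phi> e w = \<phi> e w'"
    then have "w \<in> square" "w' \<in> square" using Bsq by blast+
    then have "w = w' \<or> w \<in> corners \<and> w' \<in> corners" using quad_eq[OF e(1)] w(3) by blast
    then show "w = w'" using Bz w(1,2) by metis
  qed
  have xd: "?x \<notin> Q d" if d: "d \<in> E - {e, e'}" for d
  proof
    assume xQ: "?x \<in> Q d"
    have "?x \<in> vertex_points" using corner_vertex[OF e(1)] z(1) by blast
    then have "?x \<in> \<phi> d ` corners" using vertex_in_Q[of d] xQ d by blast
    then obtain w where "?x = \<phi> d w" "w \<in> corners" by (rule imageE)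
    then have "w \<in> corners" "\<phi> d w = ?x" by simp_all
    then show False using inc[of d w] d by blast
  qed
  have QeK: "Q e \<subseteq> K" using e(1) unfolding skeleton_eq by blast
  have BQ: "\<phi> e ` B \<subseteq> Q e" using quad(2)[OF e(1)] Bsq by blast
  have QU: "Q e \<inter> U = \<phi> e ` B"
  proof (intro equalityI subsetI)
    fix y assume "y \<in> Q e \<inter> U"
    then have "y \<in> \<phi> e ` square" "y \<notin> \<phi> e ` (square - B)" using quad(2)[OF e(1)] unfolding U_def far_def by blast+
    then show "y \<in> \<phi> e ` B" by blast
  next
    fix y assume y: "y \<in> \<phi> e ` B"
    then obtain w where w: "w \<in> B" "y = \<phi> e w" by blast
    have "y \<notin> Q d" if d: "d \<in> E - {e, e'}" for d
    proof
      assume "y \<in> Q d"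
      moreover have "y \<in> Q e" using y BQ by blast
      ultimately have "y \<in> \<phi> e ` corners" using quad_inter[of e d] e d by blast
      then obtain w' where w': "w' \<in> corners" "y = \<phi> e w'" by blast
      have "w \<in> square" "w' \<in> square" using w Bsq w'(1) by auto
      then have "w = w' \<or> w \<in> corners \<and> w' \<in> corners" using quad_eq[OF e(1)] w w' by metis
      then have "w = z" using Bz w(1) w'(1) by metis
      then show False using xd[OF d] \<open>y \<in> Q d\<close> w by simp
    qed
    then show "y \<in> Q e \<inter> U" using y sep BQ QeK unfolding U_def far_def by blast
  qed
  have xU: "?x \<in> U" using QU zB by blast
  have UK: "U \<subseteq> K" unfolding U_def by blast
  have "closedin X far"
  proof -
    have o: "open {w::real \<times> real. \<bar>fst w - fst z\<bar> < 1/2 \<and> \<bar>snd w - snd z\<bar> < 1/2}"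
      by (intro open_Collect_conj open_Collect_less continuous_intros)
    have "square - B = square \<inter> - {w. \<bar>fst w - fst z\<bar> < 1/2 \<and> \<bar>snd w - snd z\<bar> < 1/2}"
      unfolding B_def corner_box_def by blast
    moreover have "closed (square \<inter> - {w. \<bar>fst w - fst z\<bar> < 1/2 \<and> \<bar>snd w - snd z\<bar> < 1/2})"
      by (intro closed_Int closed_Times closed_atLeastAtMost closed_Compl o)
    ultimately have "closed (square - B)" by (simp only:)
    then have "closedin X (\<phi> e ` (square - B))" by (intro quad_closed[OF e(1)]) auto
    then show ?thesis unfolding far_def using finite_bands by (intro closedin_Un closedin_Union) auto
  qed
  then have "closedin Kt (K \<inter> far)" by (rule closedin_subtopology_Int_closed)
  then have "openin Kt (topspace Kt - K \<inter> far)" by (rule openin_diff[OF openin_topspace])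
  then have oU: "openin Kt U"
    unfolding U_def Kt(1) by (simp add: Diff_Int)
  define k where "k = inv_into B (\<phi> e)"
  define \<sigma> where "\<sigma> y = (if y \<in> Q e then \<phi> e (flip z (k y)) else y)" for y
  have flB: "flip z w \<in> B" if "w \<in> B" for w using flip_box z(1) that unfolding B_def by blast
  have \<sigma>B: "\<sigma> (\<phi> e w) = \<phi> e (flip z w)" if "w \<in> B" for w
  proof -
    have "\<phi> e w \<in> Q e" using that BQ by blast
    then show ?thesis unfolding \<sigma>_def k_def using inv_into_f_f[OF injB that] by simp
  qed
  define R where "R = seam \<union> Q e'"
  \<comment> \<open>Within \<open>U\<close> the reflected band meets the rest of the skeleton only
    in the corner, which the reflection fixes. This is why the two parts of \<open>\<sigma>\<close>
    can be pasted.\<close>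
  have ver: "y = ?x" if y: "y \<in> U" "y \<in> Q e" "y \<in> R" for y
  proof -
    have "y \<in> \<phi> e ` corners"
      using y corners_in(2)[OF e(1)] quad_inter[OF e] unfolding R_def by blast
    then obtain w' where w': "w' \<in> corners" "y = \<phi> e w'" by blast
    obtain w where w: "w \<in> B" "y = \<phi> e w" using QU y by blast
    have "w \<in> square" "w' \<in> square" using w Bsq w'(1) by auto
    then have "w = w' \<or> w \<in> corners \<and> w' \<in> corners" using quad_eq[OF e(1)] w w' by metis
    then have "w = z" using Bz w(1) w'(1) by metis
    then show ?thesis using w by simp
  qed
  have \<sigma>R: "\<sigma> y = y" if y: "y \<in> U" "y \<in> R" for y
  proof (cases "y \<in> Q e")
    case True
    then have "y = ?x" using ver y by blast
    then show ?thesis using \<sigma>B[OF zB] flip_corner[OF z(1)] by simp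
  qed (simp add: \<sigma>_def)
  have UQR: "y \<in> Q e \<or> y \<in> R" if "y \<in> U" for y
    using that unfolding U_def far_def R_def skeleton_eq by blast
  have \<sigma>U: "\<sigma> y \<in> U \<and> \<sigma> (\<sigma> y) = y" if y: "y \<in> U" for y
  proof (cases "y \<in> Q e")
    case True
    then obtain w where w: "w \<in> B" "y = \<phi> e w" using QU y by blast
    have "\<phi> e (flip z w) \<in> U" using QU flB[OF w(1)] by blast
    then show ?thesis using \<sigma>B[OF w(1)] \<sigma>B[OF flB[OF w(1)]] w by simp
  next
    case False
    then show ?thesis using UQR[OF y] \<sigma>R[OF y] y by simp
  qed
  have UX: "U \<subseteq> topspace X" using UK Kt(1) by (metis closedin_subset order_trans skeleton_closed)
  have sU: "subtopology Kt U = subtopology X U" using UK by (simp add: subtopology_subtopology inf_absorb2)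
  have "continuous_map (subtopology X U) X \<sigma>"
  proof (rule pasting_lemma_closed[of "{True, False}" _ "\<lambda>b. if b then U \<inter> Q e else U \<inter> R" _ "\<lambda>b. if b then \<phi> e \<circ> flip z \<circ> k else id"])
    have "closedin X R" unfolding R_def seam_def using closed_bands by (intro closedin_Un closedin_Int) auto
    then show "closedin (subtopology X U) (if b then U \<inter> Q e else U \<inter> R)" for b
      by (auto intro!: closedin_subtopology_Int_closed)
    fix b :: bool
    show "continuous_map (subtopology (subtopology X U) (if b then U \<inter> Q e else U \<inter> R)) X (if b then \<phi> e \<circ> flip z \<circ> k else id)"
    proof (cases b)
      case True
      obtain k' where k': "homeomorphic_maps (top_of_set B) (subtopology X (\<phi> e ` B)) (\<phi> e) k'"
        using box_homeomorphic[OF e(1) Bsq sep injB] unfolding homeomorphic_map_maps by blast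
      have "continuous_map (subtopology X (\<phi> e ` B)) (top_of_set B) k'"
        using k' unfolding homeomorphic_maps_def by blast
      moreover have "continuous_map (top_of_set B) (top_of_set square) (flip z)"
        using continuous_flip flB Bsq by auto
      ultimately have "continuous_map (subtopology X (\<phi> e ` B)) X (\<phi> e \<circ> (flip z \<circ> k'))"
        by (rule continuous_map_compose[OF continuous_map_compose quad(1)[OF e(1)]])
      moreover have "(\<phi> e \<circ> (flip z \<circ> k')) y = (\<phi> e \<circ> flip z \<circ> k) y" if y: "y \<in> topspace (subtopology X (\<phi> e ` B))" for y
      proof -
        obtain w where w: "w \<in> B" "y = \<phi> e w" using y by auto
        have "k' y = w" using k' w unfolding homeomorphic_maps_def by auto
        moreover have "k y = w" unfolding k_def w(2) by (rule inv_into_f_f[OF injB w(1)])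
        ultimately show ?thesis by simp
      qed
      ultimately have "continuous_map (subtopology X (\<phi> e ` B)) X (\<phi> e \<circ> flip z \<circ> k)"
        by (rule continuous_map_eq)
      moreover have "subtopology (subtopology X U) (U \<inter> Q e) = subtopology X (\<phi> e ` B)"
        unfolding subtopology_subtopology QU[symmetric] by (rule arg_cong[of _ _ "subtopology X"]) blast
      ultimately show ?thesis using True by simp
    next
      case False
      then show ?thesis by (simp add: subtopology_subtopology)
    qed
  next
    fix y assume y: "y \<in> topspace (subtopology X U)"
    then have yU: "y \<in> U" by auto
    show "\<exists>b. b \<in> {True, False} \<and> y \<in> (if b then U \<inter> Q e else U \<inter> R) \<and> \<sigma> y = (if b then \<phi> e \<circ> flip z \<circ> k else id) y"
    proof (cases "y \<in> Q e")
      case True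
      then show ?thesis using yU by (intro exI[of _ True]) (simp add: \<sigma>_def)
    next
      case False
      then show ?thesis using UQR[OF yU] yU by (intro exI[of _ False]) (simp add: \<sigma>_def)
    qed
  next
    fix b b' y assume by': "y \<in> topspace (subtopology X U) \<inter> (if b then U \<inter> Q e else U \<inter> R) \<inter> (if b' then U \<inter> Q e else U \<inter> R)"
    have "\<phi> e (flip z (k y)) = y" if "y \<in> U" "y \<in> Q e" "y \<in> R"
      using \<sigma>R[OF that(1,3)] that(2) unfolding \<sigma>_def by simp
    then show "(if b then \<phi> e \<circ> flip z \<circ> k else id) y = (if b' then \<phi> e \<circ> flip z \<circ> k else id) y"
      using by' by (cases b; cases b') auto
  qed simp
  then have "continuous_map (subtopology X U) (subtopology X U) \<sigma>"
    using \<sigma>U UX by (auto simp: continuous_map_in_subtopology)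
  then have hom: "homeomorphic_maps (subtopology Kt U) (subtopology Kt U) \<sigma> \<sigma>"
    unfolding sU by (rule homeomorphic_maps_involution) (use \<sigma>U in auto)
  \<comment> \<open>On the band of \<open>e\<close> the reflection exchanges sides and ends, so the
    edge in \<open>S\<close> looks like one outside \<open>S\<close>. Elsewhere in \<open>U\<close>
    there are only the band of \<open>e'\<close>, which is not in \<open>S\<close>, and the seam,
    where nothing has to change.\<close>
  have lay: "(y \<in> fr S \<longleftrightarrow> \<sigma> y \<in> fr {}) \<and> (y \<in> fr (E - S) \<longleftrightarrow> \<sigma> y \<in> fr E)" if y: "y \<in> U" for y
  proof (cases "y \<in> Q e")
    case True
    then obtain w where w: "w \<in> B" "y = \<phi> e w" using QU y by blast
    have sq: "w \<in> square" "flip z w \<in> square" using Bsq w flB by blast+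
    have s: "\<sigma> y = \<phi> e (flip z w)" using \<sigma>B w by simp
    have yQ: "\<sigma> y \<in> Q e" unfolding s using BQ flB[OF w(1)] by blast
    have "e \<notin> E - S" using S by blast
    then show ?thesis
      using fr_Q[OF e(1) True, of S] fr_Q[OF e(1) True, of "E - S"] fr_Q[OF e(1) yQ, of "{}"] fr_Q[OF e(1) yQ, of E] S e(1)
        ends_sides_mem[OF e(1) sq(1)] ends_sides_mem[OF e(1) sq(2)] flip_sides[OF z(1) sq(1)]
      unfolding s unfolding w(2) by simp
  next
    case False
    then have s: "\<sigma> y = y" using UQR[OF y] \<sigma>R[OF y] by blast
    show ?thesis
    proof (cases "y \<in> Q e'")
      case True
      then show ?thesis unfolding s
        using fr_Q[OF e(2) True, of S] fr_Q[OF e(2) True, of "E - S"] fr_Q[OF e(2) True, of "{}"] fr_Q[OF e(2) True, of E] S e(2) by simp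
    next
      case F: False
      then have "y \<notin> Q d" if "d \<in> E" for d using y False that unfolding U_def far_def by blast
      then show ?thesis unfolding s using fr_not_Q[of y] S by simp
    qed
  qed
  show ?thesis using oU xU hom lay by blast
qed

end

locale dual_structure = band_structure +
  fixes D and \<gamma> \<alpha>
  assumes D: "D \<subseteq> E" and \<gamma>: "parametrises X (curves D) \<gamma>" and \<alpha>: "parametrises X (curves (E - D)) \<alpha>"
begin

abbreviation I1 where "I1 \<equiv> Inl ` curves D"
abbreviation I2 where "I2 \<equiv> Inr ` curves (E - D)"
abbreviation glue where "glue \<equiv> case_sum \<gamma> \<alpha>"
abbreviation Y where "Y \<equiv> dual_surface X N D \<gamma> \<alpha>"

lemma Y: "Y = attach_disks Kt (I1 \<union> I2) glue"
  unfolding dual_surface_def Plus_def ..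

lemma ED: "E - D \<subseteq> E" "E - (E - D) = D" using D by auto

lemma glue_image:
  "B \<in> curves D \<Longrightarrow> glue (Inl B) ` unit_circle = B" "B \<in> curves (E - D) \<Longrightarrow> glue (Inr B) ` unit_circle = B"
proof -
  show "glue (Inl B) ` unit_circle = B" if "B \<in> curves D"
    using \<gamma> that homeomorphic_imp_surjective_map[of "top_of_set unit_circle" "subtopology X B" "\<gamma> B"]
      closedin_subset[OF boundary_curve_closed(1)[OF D that]]
    unfolding parametrises_def by (simp add: inf_absorb2)
  show "glue (Inr B) ` unit_circle = B" if "B \<in> curves (E - D)"
    using \<alpha> that homeomorphic_imp_surjective_map[of "top_of_set unit_circle" "subtopology X B" "\<alpha> B"]
      closedin_subset[OF boundary_curve_closed(1)[OF ED(1) that]]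
    unfolding parametrises_def by (simp add: inf_absorb2)
qed

lemma curve_K: "B \<in> curves D \<Longrightarrow> B \<subseteq> K" "B \<in> curves (E - D) \<Longrightarrow> B \<subseteq> K"
  using boundary_curve_closed(3) fr_K D ED by (metis order_trans)+

lemma glue_embedding:
  assumes "i \<in> I1 \<union> I2"
  shows "homeomorphic_map (top_of_set unit_circle) (subtopology Kt (glue i ` unit_circle)) (glue i)"
proof -
  consider B where "i = Inl B" "B \<in> curves D" | B where "i = Inr B" "B \<in> curves (E - D)" using assms by blast
  then show ?thesis
  proof cases
    case (1 B)
    then show ?thesis using \<gamma> glue_image(1)[OF 1(2)] curve_K(1)[OF 1(2)]
      unfolding parametrises_def by (simp add: subtopology_subtopology inf_absorb2)
  next
    case (2 B)
    then show ?thesis using \<alpha> glue_image(2)[OF 2(2)] curve_K(2)[OF 2(2)]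
      unfolding parametrises_def by (simp add: subtopology_subtopology inf_absorb2)
  qed
qed

sublocale Y: attachment Kt "I1 \<union> I2" glue
proof
  show "continuous_map (top_of_set unit_circle) Kt (glue i)" if "i \<in> I1 \<union> I2" for i
    using homeomorphic_imp_continuous_map[OF glue_embedding[OF that]] by (simp only: continuous_map_in_subtopology)
qed

lemma finite_I: "finite (I1 \<union> I2)"
  using boundary_curves(1) D ED by auto

lemma Un_glue: "(\<Union>i\<in>I1. glue i ` unit_circle) = fr D" "(\<Union>i\<in>I2. glue i ` unit_circle) = fr (E - D)"
proof -
  have "(\<Union>i\<in>I1. glue i ` unit_circle) = (\<Union>B\<in>curves D. B)" using glue_image(1) by auto
  then show "(\<Union>i\<in>I1. glue i ` unit_circle) = fr D" using boundary_curves(3)[OF D] by simp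
  have "(\<Union>i\<in>I2. glue i ` unit_circle) = (\<Union>B\<in>curves (E - D). B)" using glue_image(2) by auto
  then show "(\<Union>i\<in>I2. glue i ` unit_circle) = fr (E - D)" using boundary_curves(3)[OF ED(1)] by simp
qed

text \<open>Topologically a 0-band and a 2-band are both just disks. The comparison with \<Sigma>
  may therefore also exchange the two families, which is the second alternative.\<close>

lemma planar_via:
  assumes U: "openin Kt U" "x \<in> U" and \<sigma>: "homeomorphic_maps (subtopology Kt U) (subtopology Kt U) \<sigma> \<sigma>"
    and L: "(\<forall>y\<in>U. (y \<in> fr D \<longleftrightarrow> \<sigma> y \<in> fr {}) \<and> (y \<in> fr (E - D) \<longleftrightarrow> \<sigma> y \<in> fr E)) \<or>
      (\<forall>y\<in>U. (y \<in> fr D \<longleftrightarrow> \<sigma> y \<in> fr E) \<and> (y \<in> fr (E - D) \<longleftrightarrow> \<sigma> y \<in> fr {}))"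
  shows "locally_planar_at Y.At (Inl x)"
proof -
  let ?J1 = "Inl ` zero_index N" and ?J2 = "Inr ` two_bands N"
  have UJ: "(\<Union>j\<in>?J1. \<psi> j ` unit_circle) = fr {}" "(\<Union>j\<in>?J2. \<psi> j ` unit_circle) = fr E"
    unfolding fr_empty fr_all using \<psi>(2) by (auto simp: band_def)
  have UK: "U \<subseteq> K" using openin_subset[OF U(1)] Kt(1) by simp
  have "\<sigma> x \<in> U" using \<sigma> U(2) UK Kt(1) unfolding homeomorphic_maps_def continuous_map_def by (auto simp: inf_absorb2)
  then have planar: "locally_planar_at (attach_disks Kt J0 \<psi>) (Inl (\<sigma> x))"
    using locally_planar_attach_\<psi> UK by blast
  have d1: "glue i ` unit_circle \<inter> glue i' ` unit_circle = {}" if ii: "i \<in> I1" "i' \<in> I1" "i \<noteq> i'" for i i'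
  proof -
    obtain B B' where B: "i = Inl B" "i' = Inl B'" "B \<in> curves D" "B' \<in> curves D" "B \<noteq> B'" using ii by blast
    show ?thesis unfolding B(1,2) glue_image(1)[OF B(3)] glue_image(1)[OF B(4)]
      by (rule boundary_curves_disjoint[OF D B(3-5)])
  qed
  have d2: "glue i ` unit_circle \<inter> glue i' ` unit_circle = {}" if ii: "i \<in> I2" "i' \<in> I2" "i \<noteq> i'" for i i'
  proof -
    obtain B B' where B: "i = Inr B" "i' = Inr B'" "B \<in> curves (E - D)" "B' \<in> curves (E - D)" "B \<noteq> B'" using ii by blast
    show ?thesis unfolding B(1,2) glue_image(2)[OF B(3)] glue_image(2)[OF B(4)]
      by (rule boundary_curves_disjoint[OF ED(1) B(3-5)])
  qed
  have e1: "\<psi> j ` unit_circle \<inter> \<psi> j' ` unit_circle = {}" if jj: "j \<in> ?J1" "j' \<in> ?J1" "j \<noteq> j'" for j j'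
  proof -
    obtain v w where "j = Inl v" "j' = Inl w" "v \<in> zero_index N" "w \<in> zero_index N" "v \<noteq> w" using jj by blast
    then show ?thesis using \<psi>(2)[of j] \<psi>(2)[of j'] closed_disjoint(1)[of v w] by (auto simp: band_def)
  qed
  have e2: "\<psi> j ` unit_circle \<inter> \<psi> j' ` unit_circle = {}" if jj: "j \<in> ?J2" "j' \<in> ?J2" "j \<noteq> j'" for j j'
  proof -
    obtain v w where "j = Inr v" "j' = Inr w" "v \<in> two_bands N" "w \<in> two_bands N" "v \<noteq> w" using jj by blast
    then show ?thesis using \<psi>(2)[of j] \<psi>(2)[of j'] closed_disjoint(2)[of v w] by (auto simp: band_def)
  qed
  have fin: "finite J0" using finite_bands by simp
  have ps: "\<psi> j ` unit_circle = \<psi> j ` unit_circle" for j ..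
  from L show ?thesis
  proof
    assume L: "\<forall>y\<in>U. (y \<in> fr D \<longleftrightarrow> \<sigma> y \<in> fr {}) \<and> (y \<in> fr (E - D) \<longleftrightarrow> \<sigma> y \<in> fr E)"
    show ?thesis
      by (rule two_layer_transfer[where ?I1.0 = I1 and ?I2.0 = I2 and ?J1.0 = ?J1 and ?J2.0 = ?J2 and \<psi> = \<psi>,
          OF Y.attachment_axioms attachment_\<psi> glue_embedding \<psi>(1) Kt(3) Kt(3) finite_I fin _ _ d1 d2 e1 e2 U(1) U(1) U(2) \<sigma> _ _ planar])
        (use L in \<open>auto simp only: Un_glue UJ\<close>)
  next
    assume L: "\<forall>y\<in>U. (y \<in> fr D \<longleftrightarrow> \<sigma> y \<in> fr E) \<and> (y \<in> fr (E - D) \<longleftrightarrow> \<sigma> y \<in> fr {})"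
    have c: "J0 = ?J2 \<union> ?J1" by (rule Un_commute)
    show ?thesis
      by (rule two_layer_transfer[where ?I1.0 = I1 and ?I2.0 = I2 and ?J1.0 = ?J2 and ?J2.0 = ?J1 and \<psi> = \<psi>,
          OF Y.attachment_axioms attachment_\<psi>[unfolded c] glue_embedding \<psi>(1)[unfolded c] Kt(3) Kt(3) finite_I fin[unfolded c] _ _ d1 d2 e2 e1 U(1) U(1) U(2) \<sigma> _ _ planar[unfolded c]])
        (use L in \<open>auto simp only: Un_glue UJ\<close>)
  qed
qed

lemma locally_planar_skeleton:
  assumes x: "x \<in> K"
  shows "locally_planar_at Y.At (Inl x)"
proof -
  have id: "homeomorphic_maps (subtopology Kt U) (subtopology Kt U) (\<lambda>x. x) (\<lambda>x. x)" for U
    unfolding homeomorphic_maps_def by simp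
  have oU: "openin Kt (K - (\<Union>e\<in>S. Q e))" if "S \<subseteq> E" for S
  proof -
    have "finite S" using that finite_bands(2) finite_subset by blast
    then have "closedin X (\<Union>e\<in>S. Q e)" by (intro closedin_Union) auto
    then have "closedin Kt (K \<inter> (\<Union>e\<in>S. Q e))" by (rule closedin_subtopology_Int_closed)
    then have "openin Kt (topspace Kt - K \<inter> (\<Union>e\<in>S. Q e))" by (rule openin_diff[OF openin_topspace])
    then show ?thesis unfolding Kt(1) by (simp add: Diff_Int)
  qed
  \<comment> \<open>Whether a point is on a frontier depends only on which of the 1-bands through it
    belong to the set. This makes the identity a valid comparison away from the bands of one
    kind.\<close>
  have frU: "y \<in> fr S \<longleftrightarrow> y \<in> fr S'" if S: "S \<subseteq> E" "S' \<subseteq> E" "\<And>e. e \<in> E \<Longrightarrow> y \<in> Q e \<Longrightarrow> e \<in> S \<longleftrightarrow> e \<in> S'" for y S S'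
  proof (cases "\<exists>e\<in>E. y \<in> Q e")
    case True
    then obtain e where "e \<in> E" "y \<in> Q e" by blast
    then show ?thesis using fr_Q[of e y S] fr_Q[of e y S'] S by simp
  next
    case False
    then show ?thesis using fr_not_Q[of y] S by simp
  qed
  consider "\<And>e. e \<in> D \<Longrightarrow> x \<notin> Q e" | "\<And>e. e \<in> E - D \<Longrightarrow> x \<notin> Q e"
    | e e' where "e \<in> D" "e' \<in> E - D" "x \<in> Q e" "x \<in> Q e'" by blast
  then show ?thesis
  proof cases
    case 1
    show ?thesis
    proof (rule planar_via[OF oU[OF D] _ id], goal_cases)
      case 2
      have "(y \<in> fr D \<longleftrightarrow> y \<in> fr {}) \<and> (y \<in> fr (E - D) \<longleftrightarrow> y \<in> fr E)" if "y \<in> K - (\<Union>e\<in>D. Q e)" for y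
        using frU[of D "{}" y] frU[of "E - D" E y] D that by blast
      then show ?case by blast
    qed (use 1 x in blast)
  next
    case 2
    show ?thesis
    proof (rule planar_via[OF oU[OF ED(1)] _ id], goal_cases)
      case 2
      have "(y \<in> fr D \<longleftrightarrow> y \<in> fr E) \<and> (y \<in> fr (E - D) \<longleftrightarrow> y \<in> fr {})" if "y \<in> K - (\<Union>e\<in>E - D. Q e)" for y
        using frU[of D E y] frU[of "E - D" "{}" y] D that by blast
      then show ?case by blast
    qed (use 2 x in blast)
  next
    case (3 e e')
    have ee: "e \<in> E" "e' \<in> E" "e \<noteq> e'" "e' \<notin> D" using 3 D by blast+
    have "x \<in> \<phi> e ` corners" using quad_inter[of e e'] ee 3 by blast
    then obtain z where z1: "x = \<phi> e z" "z \<in> corners" by (rule imageE)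
    have "x \<in> \<phi> e' ` corners" using quad_inter[of e' e] ee 3 by blast
    then obtain z' where z2: "x = \<phi> e' z'" "z' \<in> corners" by (rule imageE)
    note z = z1(2) z2(2) z1(1) trans[OF z1(1)[symmetric] z2(1)]
    obtain U \<sigma> where "openin Kt U" "\<phi> e z \<in> U" "homeomorphic_maps (subtopology Kt U) (subtopology Kt U) \<sigma> \<sigma>"
     "\<forall>y\<in>U. (y \<in> fr D \<longleftrightarrow> \<sigma> y \<in> fr {}) \<and> (y \<in> fr (E - D) \<longleftrightarrow> \<sigma> y \<in> fr E)"
      using flip_corner_homeomorphism[OF ee(1-3) z(1,2,4) D 3(1) ee(4)] by metis
    then show ?thesis unfolding z(3) by (intro planar_via disjI1)
  qed
qed

theorem surface_dual: "surface Y"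
  unfolding surface_def Y
proof (intro conjI ballI)
  obtain e where e: "e \<in> E" using edges_nonempty by blast
  have "\<phi> e (0, 0) \<in> Q e" unfolding quad(2)[OF e, symmetric] by (rule imageI) auto
  then have "\<phi> e (0, 0) \<in> K" using e unfolding skeleton_eq by blast
  then show "topspace Y.At \<noteq> {}" unfolding Y.topspace_attach Kt by blast
  show "connected_space Y.At" by (rule Y.connected_attach[OF Kt_connected])
  show "compact_space Y.At" by (rule Y.compact_attach[OF Kt(2) finite_I])
  show "Hausdorff_space Y.At" by (rule Y.Hausdorff_attach[OF Kt(3)])
  fix p assume "p \<in> topspace Y.At"
  then consider x where "p = Inl x" "x \<in> K" | i z where "p = Inr (i, z)" "i \<in> I1 \<union> I2" "norm z < 1"
    unfolding Y.topspace_attach Kt by auto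
  then show "locally_planar_at Y.At p"
    by cases (use locally_planar_skeleton Y.locally_planar_attach_disk in auto)
qed

section \<open>The dual band decomposition\<close>

abbreviation M where "M \<equiv> dual_bands X N D"
abbreviation cell :: "'a set + 'a set \<Rightarrow> ('a + ('a set + 'a set) \<times> complex) set" where "cell i \<equiv> Inr ` ({i} \<times> open_disk)"

lemma M_simps [simp]: "zero_index M = curves D" "one_index M = E" "zero_band M B = cell (Inl B)"
  "one_band M e = Inl ` q e" "two_bands M = (\<lambda>B. cell (Inr B)) ` curves (E - D)"
  by (simp_all add: dual_bands_def)

definition curve where "curve = case_sum (\<lambda>B. B) (\<lambda>B. B)"

lemma curve: "i \<in> I1 \<union> I2 \<Longrightarrow> glue i ` unit_circle = curve i"
  unfolding curve_def using glue_image by (elim UnE imageE) simp_all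

lemma curve_fr: "i \<in> I1 \<Longrightarrow> curve i \<subseteq> fr D" "i \<in> I2 \<Longrightarrow> curve i \<subseteq> fr (E - D)"
  unfolding curve_def using boundary_curve_closed(3)[OF D] boundary_curve_closed(3)[OF ED(1)]
  by (elim imageE; simp)+

lemma fr_curve: "x \<in> fr D \<Longrightarrow> \<exists>i\<in>I1. x \<in> curve i" "x \<in> fr (E - D) \<Longrightarrow> \<exists>i\<in>I2. x \<in> curve i"
  using boundary_curves(3)[OF D] boundary_curves(3)[OF ED(1)] unfolding curve_def by auto

lemma curve_disjoint:
  "i \<in> I1 \<Longrightarrow> i' \<in> I1 \<Longrightarrow> i \<noteq> i' \<Longrightarrow> curve i \<inter> curve i' = {}"
  "i \<in> I2 \<Longrightarrow> i' \<in> I2 \<Longrightarrow> i \<noteq> i' \<Longrightarrow> curve i \<inter> curve i' = {}"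
  using boundary_curves_disjoint[OF D] boundary_curves_disjoint[OF ED(1)] unfolding curve_def by fastforce+

lemma closure_cell: "i \<in> I1 \<union> I2 \<Longrightarrow> Y.At closure_of (cell i) = Inl ` curve i \<union> cell i"
  using Y.closure_attach_disk[OF _ Kt(3)] curve by metis

lemma Hausdorff_At: "Hausdorff_space Y.At"
  by (rule Y.Hausdorff_attach[OF Kt(3)])

lemma near_curve:
  assumes G: "openin Y.At G" and i: "i \<in> I1 \<union> I2" "x \<in> curve i" "Inl x \<in> G"
  obtains z where "norm z < 1" "Inr (i, z) \<in> G"
proof -
  have "x \<in> glue i ` unit_circle" using i(2) curve[OF i(1)] by simp
  then obtain u where u: "norm u = 1" "x = glue i u" by auto
  then have "Inl (glue i u) \<in> G" using i by simp
  then show thesis using Y.disk_near_circle[OF G i(1) u(1)] that by metis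
qed

lemma q_K: "e \<in> E \<Longrightarrow> q e \<subseteq> K" "e \<in> E \<Longrightarrow> Q e \<subseteq> K"
  using band_subset_closure(3) unfolding skeleton_eq by blast+

lemma q_fr: "e \<in> E \<Longrightarrow> S \<subseteq> E \<Longrightarrow> q e \<inter> fr S = {}"
proof -
  assume e: "e \<in> E" and S: "S \<subseteq> E"
  have "fr S \<subseteq> Z \<union> T" unfolding fr_def seam_def using ends_sides_Q(3,4) S by blast
  then show ?thesis using q_disjoint[OF e] by blast
qed

lemma near_Q:
  assumes e: "e \<in> E" "x \<in> Q e" and G: "openin Y.At G" "Inl x \<in> G"
  obtains y where "y \<in> q e" "Inl y \<in> G"
proof -
  have "openin Kt {y \<in> topspace Kt. Inl y \<in> G}" using G unfolding openin_attach_disks by blast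
  then obtain U where U: "openin X U" "{y \<in> topspace Kt. Inl y \<in> G} = U \<inter> K"
    by (auto simp: openin_subtopology)
  have "x \<in> K" using e q_K by blast
  then have "x \<in> U" using U(2) G(2) Kt(1) by blast
  then obtain y where "y \<in> q e" "y \<in> U" using e(2) U(1) unfolding in_closure_of by blast
  then show thesis using that[of y] U(2) q_K[OF e(1)] by blast
qed

text \<open>Off the 1-bands every frontier coincides with the seam, so a point on only one of two
  complementary frontiers must lie on a 1-band.\<close>

lemma fr_not_both:
  assumes "S \<subseteq> E" "x \<in> fr S" "x \<notin> fr (E - S)"
  obtains e where "e \<in> E" "x \<in> Q e"
  using fr_not_Q[of x S] fr_not_Q[of x "E - S"] assms by blast

text \<open>A point of the curve is also approached from outside: by a cell of the other family if
  it lies on both frontiers, and otherwise by the interior of a 1-band.\<close>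

lemma interior_cell:
  assumes i: "i \<in> I1 \<union> I2"
  shows "Y.At interior_of (Inl ` curve i \<union> cell i) = cell i"
proof (intro equalityI subsetI)
  fix p assume "p \<in> Y.At interior_of (Inl ` curve i \<union> cell i)"
  then obtain G where G: "openin Y.At G" "p \<in> G" "G \<subseteq> Inl ` curve i \<union> cell i" unfolding interior_of_def by blast
  show "p \<in> cell i"
  proof (rule ccontr)
    assume "p \<notin> cell i"
    then obtain x where x: "p = Inl x" "x \<in> curve i" using G by blast
    then have xG: "Inl x \<in> G" using G by simp
    have other: False if j: "j \<in> I1 \<union> I2" "j \<noteq> i" "x \<in> curve j" for j
    proof -
      obtain z where "Inr (j, z) \<in> G" using near_curve[OF G(1) j(1,3) xG] by metis
      then show False using G(3) j(2) by auto
    qed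
    have edge: False if e: "e \<in> E" "x \<in> Q e" for e
    proof -
      obtain y where y: "y \<in> q e" "Inl y \<in> G" using near_Q[OF e G(1) xG] by metis
      then have "y \<in> curve i" using G(3) by auto
      moreover have "curve i \<subseteq> fr D \<union> fr (E - D)" using curve_fr i by blast
      ultimately show False using q_fr[OF e(1) D] q_fr[OF e(1) ED(1)] y(1) by blast
    qed
    from i show False
    proof
      assume i1: "i \<in> I1"
      then have "x \<in> fr D" using curve_fr x by blast
      moreover have "x \<notin> fr (E - D)"
      proof
        assume "x \<in> fr (E - D)"
        then obtain j where "j \<in> I2" "x \<in> curve j" using fr_curve by blast
        then show False using other[of j] i1 by blast
      qed
      ultimately show False using fr_not_both[OF D] edge by metis
    next
      assume i2: "i \<in> I2"
      then have "x \<in> fr (E - D)" using curve_fr x by blast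
      moreover have "x \<notin> fr (E - (E - D))" unfolding ED(2)
      proof
        assume "x \<in> fr D"
        then obtain j where "j \<in> I1" "x \<in> curve j" using fr_curve by blast
        then show False using other[of j] i2 by blast
      qed
      ultimately show False using fr_not_both[OF ED(1)] edge by metis
    qed
  qed
next
  fix p assume p: "p \<in> cell i"
  have "openin Y.At (cell i)" by (rule Y.openin_attach_disk[OF i]) auto
  then show "p \<in> Y.At interior_of (Inl ` curve i \<union> cell i)" using p unfolding interior_of_def by blast
qed

lemma disk_band_cell:
  assumes i: "i \<in> I1 \<union> I2"
  shows "disk_band Y.At (cell i)"
  unfolding disk_band_def
proof (intro conjI exI)
  show "openin Y.At (cell i)" by (rule Y.openin_attach_disk[OF i]) auto
  show "Y.At interior_of (Y.At closure_of cell i) = cell i"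
    unfolding closure_cell[OF i] by (rule interior_cell[OF i])
  have im: "Y.pt i ` closed_disk = Y.At closure_of cell i"
    unfolding closure_cell[OF i] Y.pt_image curve[OF i] ..
  have inj: "inj_on (Y.pt i) closed_disk"
    using homeomorphic_imp_injective_map[OF glue_embedding[OF i]] by (intro Y.inj_pt) simp
  have "embedding_map (top_of_set closed_disk) Y.At (Y.pt i)"
    by (rule continuous_imp_embedding_map[OF Y.continuous_map_pt[OF i] _ Hausdorff_At])
      (use inj in \<open>simp_all add: compact_space_subtopology\<close>)
  then show "homeomorphic_map (top_of_set closed_disk) (subtopology Y.At (Y.At closure_of cell i)) (Y.pt i)"
    unfolding embedding_map_def by (simp add: im)
  show "Y.pt i ` open_disk = cell i"
  proof -
    have "Y.pt i ` open_disk = (\<lambda>z. Inr (i, z)) ` open_disk" by (rule image_cong) (auto simp: attach_point_def)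
    then show ?thesis by auto
  qed
qed

lemma closure_one:
  assumes "e \<in> E"
  shows "Y.At closure_of (Inl ` q e) = Inl ` Q e"
proof (rule antisym)
  have "closed_map Kt Y.At Inl"
    by (rule continuous_imp_closed_map[OF Y.continuous_map_Inl Kt(2) Hausdorff_At])
  moreover have "closedin Kt (K \<inter> Q e)" by (intro closedin_subtopology_Int_closed) simp
  moreover have "K \<inter> Q e = Q e" using q_K[OF assms] by blast
  ultimately have "closedin Y.At (Inl ` Q e)" unfolding closed_map_def by simp
  moreover have "Inl ` q e \<subseteq> Inl ` Q e" using band_subset_closure(3)[OF assms] by blast
  ultimately show "Y.At closure_of (Inl ` q e) \<subseteq> Inl ` Q e" by (rule closure_of_minimal[rotated])
  show "Inl ` Q e \<subseteq> Y.At closure_of (Inl ` q e)"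
  proof (rule image_subsetI)
    fix x assume x: "x \<in> Q e"
    show "Inl x \<in> Y.At closure_of (Inl ` q e)"
      unfolding in_closure_of
    proof (intro conjI allI impI)
      show "Inl x \<in> topspace Y.At" using x q_K[OF assms] Y.topspace_attach Kt(1) by auto
      fix G assume "Inl x \<in> G \<and> openin Y.At G"
      then obtain y where "y \<in> q e" "Inl y \<in> G" using near_Q[OF assms x] by blast
      then show "\<exists>y. y \<in> Inl ` q e \<and> y \<in> G" by blast
    qed
  qed
qed

lemma zero_closed_dual: "zero_closed Y.At M = Inl ` fr D \<union> Inr ` (I1 \<times> open_disk)"
proof -
  have "zero_closed Y.At M = (\<Union>B\<in>curves D. Inl ` B \<union> cell (Inl B))"
    unfolding zero_closed_def using closure_cell by (simp add: curve_def)
  also have "\<dots> = Inl ` \<Union>(curves D) \<union> Inr ` (I1 \<times> open_disk)" by auto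
  finally show ?thesis using boundary_curves(3)[OF D] by simp
qed

lemma two_closed_dual: "two_closed Y.At M = Inl ` fr (E - D) \<union> Inr ` (I2 \<times> open_disk)"
proof -
  have "two_closed Y.At M = (\<Union>B\<in>curves (E - D). Inl ` B \<union> cell (Inr B))"
    unfolding two_closed_def using closure_cell by (simp add: curve_def)
  also have "\<dots> = Inl ` \<Union>(curves (E - D)) \<union> Inr ` (I2 \<times> open_disk)" by auto
  finally show ?thesis using boundary_curves(3)[OF ED(1)] by simp
qed

text \<open>The edges in \<open>D\<close> exchange their ends and their sides.\<close>

definition turned where "turned e = (if e \<in> D then prod.swap else (\<lambda>z. z))"
definition \<phi>' where "\<phi>' e = Inl \<circ> \<phi> e \<circ> turned e"

lemma turned:
  "turned e ` square = square" "turned e ` corners = corners" "turned e ` ({0<..<1} \<times> {0<..<1}) = {0<..<1} \<times> {0<..<1}"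
  "inj (turned e)"
  "turned e ` ({0, 1} \<times> {0..1}) = (if e \<in> D then {0..1} \<times> {0, 1} else {0, 1} \<times> {0..1})"
  "turned e ` ({0..1} \<times> {0, 1}) = (if e \<in> D then {0, 1} \<times> {0..1} else {0..1} \<times> {0, 1})"
  unfolding turned_def by (cases "e \<in> D"; simp only: product_swap if_True if_False image_ident inj_swap inj_on_id2)+

lemma \<phi>'_image: "\<phi>' e ` S = Inl ` \<phi> e ` turned e ` S"
  unfolding \<phi>'_def by (simp add: image_comp)

text \<open>Every point on an end or a side of the band lies on a frontier, hence on a curve, and is
  a limit of interior points of the disk attached there. Only the open band remains
  interior.\<close>

lemma interior_one:
  assumes e: "e \<in> E"
  shows "openin Y.At (Inl ` q e)" "Y.At interior_of (Inl ` Q e) = Inl ` q e"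
proof -
  have "openin X (q e)" using open_bands(3)[OF e] .
  then have "openin Kt (K \<inter> q e)" by (rule openin_subtopology_Int2)
  then have "openin Kt (q e)" using q_K[OF e] by (simp add: inf_absorb2)
  moreover have "glue i ` unit_circle \<inter> q e = {}" if "i \<in> I1 \<union> I2" for i
    using curve_fr q_fr[OF e D] q_fr[OF e ED(1)] that unfolding curve[OF that] by blast
  ultimately show o: "openin Y.At (Inl ` q e)" by (rule Y.openin_attach_Inl)
  show "Y.At interior_of (Inl ` Q e) = Inl ` q e"
  proof (intro equalityI subsetI)
    fix p assume "p \<in> Y.At interior_of (Inl ` Q e)"
    then obtain G where G: "openin Y.At G" "p \<in> G" "G \<subseteq> Inl ` Q e" unfolding interior_of_def by blast
    then obtain x where x: "p = Inl x" "x \<in> Q e" by blast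
    have "x \<notin> curve i" if i: "i \<in> I1 \<union> I2" for i
    proof
      assume "x \<in> curve i"
      then obtain z where "Inr (i, z) \<in> G" using near_curve[OF G(1) i, of x] G(2) x(1) by metis
      then show False using G(3) by blast
    qed
    then have "x \<notin> fr D" "x \<notin> fr (E - D)" using fr_curve by blast+
    then have "x \<notin> ends_of e" "x \<notin> sides_of e"
      using fr_Q[OF e x(2) D] fr_Q[OF e x(2) ED(1)] e by (auto split: if_splits)
    then show "p \<in> Inl ` q e" using x Q_split[OF e] by blast
  next
    fix p :: "'a + ('a set + 'a set) \<times> complex" assume "p \<in> Inl ` q e"
    moreover have "Inl ` q e \<subseteq> Inl ` Q e" using band_subset_closure(3)[OF e] by blast
    ultimately show "p \<in> Y.At interior_of (Inl ` Q e)" using o unfolding interior_of_def by blast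
  qed
qed

lemma Q_fr:
  assumes "e \<in> E" "S \<subseteq> E"
  shows "Q e \<inter> fr S = (if e \<in> S then sides_of e else ends_of e)"
  using fr_Q[OF assms(1) _ assms(2)] ends_sides_Q(1,2)[OF assms(1)] by (auto split: if_splits)

text \<open>An edge in \<open>D\<close> touches the new 0-bands along its old sides and the new
  2-bands along its old ends. The exchange of coordinates restores the convention that ends are
  \<open>{0, 1} \<times> [0, 1]\<close>.\<close>

lemma quadrilaterals_dual: "quadrilaterals Y.At M \<phi>'"
  unfolding quadrilaterals_def M_simps
proof (intro conjI ballI allI impI)
  fix e assume e: "e \<in> E"
  show "openin Y.At (Inl ` q e)" using interior_one[OF e] by blast
  show "Y.At interior_of (Y.At closure_of Inl ` q e) = Inl ` q e"
    unfolding closure_one[OF e] using interior_one[OF e] by blast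
  show "continuous_map (top_of_set square) Y.At (\<phi>' e)"
    unfolding \<phi>'_def o_assoc[symmetric]
  proof (rule continuous_map_compose[OF _ Y.continuous_map_Inl])
    have "continuous_on square (turned e)" unfolding turned_def prod.swap_def by (auto intro!: continuous_intros)
    then have "continuous_map (top_of_set square) (top_of_set square) (turned e)"
      using turned(1)[of e] by (simp add: image_subset_iff_funcset[symmetric])
    then have "continuous_map (top_of_set square) X (\<phi> e \<circ> turned e)"
      by (rule continuous_map_compose[OF _ quad(1)[OF e]])
    moreover have "(\<phi> e \<circ> turned e) ` square \<subseteq> K"
      unfolding image_comp[symmetric] turned quad(2)[OF e] using q_K[OF e] by blast
    ultimately show "continuous_map (top_of_set square) Kt (\<phi> e \<circ> turned e)"
      by (simp add: continuous_map_in_subtopology image_subset_iff_funcset o_def)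
  qed
  show "\<phi>' e ` square = Y.At closure_of Inl ` q e"
    unfolding closure_one[OF e] \<phi>'_image turned quad(2)[OF e] ..
  show "\<phi>' e ` ({0<..<1} \<times> {0<..<1}) = Inl ` q e" unfolding \<phi>'_image turned quad(3)[OF e] ..
  have sc: "turned e ` (square - corners) = square - corners"
    using image_set_diff[OF turned(4)] turned(1,2) by metis
  show "inj_on (\<phi>' e) (square - corners)"
    unfolding \<phi>'_def
  proof (intro comp_inj_on)
    show "inj_on (turned e) (square - corners)" using turned(4) by (rule inj_on_subset) simp
    show "inj_on (\<phi> e) (turned e ` (square - corners))" unfolding sc by (rule quad(4)[OF e])
    show "inj_on Inl (\<phi> e ` turned e ` (square - corners))" by simp
  qed
  show "\<phi>' e ` corners \<inter> \<phi>' e ` (square - corners) = {}"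
    unfolding \<phi>'_image sc turned(2) using quad(5)[OF e] by blast
  show "Y.At closure_of Inl ` q e \<inter> zero_closed Y.At M = \<phi>' e ` ({0, 1} \<times> {0..1})"
  proof -
    have "Y.At closure_of Inl ` q e \<inter> zero_closed Y.At M = Inl ` (Q e \<inter> fr D)"
      unfolding closure_one[OF e] zero_closed_dual by blast
    then show ?thesis unfolding \<phi>'_image turned Q_fr[OF e D] ends_of_def sides_of_def by (simp split: if_splits)
  qed
  show "Y.At closure_of Inl ` q e \<inter> two_closed Y.At M = \<phi>' e ` ({0..1} \<times> {0, 1})"
  proof -
    have "Y.At closure_of Inl ` q e \<inter> two_closed Y.At M = Inl ` (Q e \<inter> fr (E - D))"
      unfolding closure_one[OF e] two_closed_dual by blast
    then show ?thesis unfolding \<phi>'_image turned Q_fr[OF e ED(1)] ends_of_def sides_of_def using e by simp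
  qed
  fix e' assume e': "e' \<in> E" "e \<noteq> e'"
  show "Y.At closure_of Inl ` q e \<inter> Y.At closure_of Inl ` q e' \<subseteq> \<phi>' e ` corners"
    unfolding closure_one[OF e] closure_one[OF e'(1)] \<phi>'_image turned using quad_inter[OF e e'] by blast
next
  fix p
  let ?S = "{(e, z). e \<in> E \<and> z \<in> corners \<and> \<phi>' e z = p}"
  \<comment> \<open>\<open>turned\<close> permutes the corners of each band, so the incidences at a
    point inject into those of the original quadrilaterals.\<close>
  show "card ?S \<le> 2"
  proof (cases p)
    case (Inl x)
    let ?S' = "{(e, z). e \<in> E \<and> z \<in> corners \<and> \<phi> e z = x}"
    have "?S' \<subseteq> E \<times> corners" by auto
    moreover have "finite (E \<times> corners)" using finite_bands by simp
    ultimately have finS: "finite ?S'" by (rule finite_subset)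
    have injS: "inj_on (\<lambda>k. (fst k, turned (fst k) (snd k))) ?S"
    proof (rule inj_onI)
      fix k l assume eq: "(fst k, turned (fst k) (snd k)) = (fst l, turned (fst l) (snd l))"
      then have f: "fst k = fst l" by simp
      then have "turned (fst k) (snd k) = turned (fst k) (snd l)" using eq by simp
      then have "snd k = snd l" by (rule injD[OF turned(4)])
      then show "k = l" using f by (rule prod_eqI[rotated])
    qed
    have imS: "(\<lambda>k. (fst k, turned (fst k) (snd k))) ` ?S \<subseteq> ?S'"
    proof (rule image_subsetI)
      fix k assume "k \<in> ?S"
      then obtain e z where k: "k = (e, z)" "e \<in> E" "z \<in> corners" "\<phi>' e z = p" by blast
      have "turned e z \<in> corners" using turned(2)[of e] k(3) by (metis imageI)
      then show "(fst k, turned (fst k) (snd k)) \<in> ?S'" using k Inl unfolding \<phi>'_def by simp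
    qed
    have "card ?S \<le> card ?S'" by (rule card_inj_on_le[OF injS imS finS])
    also have "\<dots> \<le> 2" using quadrilaterals unfolding quadrilaterals_def by blast
    finally show ?thesis .
  next
    case (Inr a)
    then have "?S = {}" unfolding \<phi>'_def by auto
    then show ?thesis by (metis card.empty zero_le)
  qed
qed

lemma band_decomposition_At: "band_decomposition Y.At M"
  unfolding band_decomposition_def
proof (intro conjI)
  show "finite (zero_index M)" "finite (one_index M)" "finite (two_bands M)"
    using boundary_curves(1) D ED finite_bands by auto
  show "\<forall>v\<in>zero_index M. disk_band Y.At (zero_band M v)" "\<forall>A\<in>two_bands M. disk_band Y.At A"
    using disk_band_cell by auto
  show "\<exists>\<phi>. quadrilaterals Y.At M \<phi>" using quadrilaterals_dual by blast
  show "\<forall>v\<in>zero_index M. \<forall>w\<in>zero_index M. v \<noteq> w \<longrightarrow>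
     Y.At closure_of zero_band M v \<inter> Y.At closure_of zero_band M w = {}"
  proof (intro ballI impI)
    fix v w assume vw: "v \<in> zero_index M" "w \<in> zero_index M" "v \<noteq> w"
    have i: "Inl v \<in> I1 \<union> I2" "Inl w \<in> I1 \<union> I2" using vw by auto
    have "curve (Inl v) \<inter> curve (Inl w) = {}" using curve_disjoint(1)[of "Inl v" "Inl w"] vw by auto
    then show "Y.At closure_of zero_band M v \<inter> Y.At closure_of zero_band M w = {}"
      unfolding M_simps closure_cell[OF i(1)] closure_cell[OF i(2)] using vw(3) by blast
  qed
  show "\<forall>A\<in>two_bands M. \<forall>B\<in>two_bands M. A \<noteq> B \<longrightarrow> Y.At closure_of A \<inter> Y.At closure_of B = {}"
  proof (intro ballI impI)
    fix A B assume AB: "A \<in> two_bands M" "B \<in> two_bands M" "A \<noteq> B"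
    then obtain v w where vw: "A = cell (Inr v)" "B = cell (Inr w)" "v \<in> curves (E - D)" "w \<in> curves (E - D)" "v \<noteq> w"
      by auto
    have i: "Inr v \<in> I1 \<union> I2" "Inr w \<in> I1 \<union> I2" using vw by auto
    have "curve (Inr v) \<inter> curve (Inr w) = {}" using curve_disjoint(2)[of "Inr v" "Inr w"] vw by auto
    then show "Y.At closure_of A \<inter> Y.At closure_of B = {}"
      unfolding vw(1,2) closure_cell[OF i(1)] closure_cell[OF i(2)] using vw(5) by blast
  qed
  show "\<forall>e\<in>one_index M. \<forall>e'\<in>one_index M. e \<noteq> e' \<longrightarrow> one_band M e \<inter> one_band M e' = {}"
  proof (intro ballI impI)
    fix e e' assume e: "e \<in> one_index M" "e' \<in> one_index M" "e \<noteq> e'"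
    have "q e \<inter> q e' \<subseteq> seam"
      using Q_inter_vertex[of e e'] vertex_points_seam band_subset_closure(3)[of e] band_subset_closure(3)[of e'] e
      unfolding M_simps by blast
    then have "q e \<inter> q e' = {}" using q_disjoint(1)[of e] e unfolding M_simps seam_def by blast
    then show "one_band M e \<inter> one_band M e' = {}" unfolding M_simps by blast
  qed
  show "\<forall>v\<in>zero_index M. \<forall>e\<in>one_index M. zero_band M v \<inter> one_band M e = {}"
    "\<forall>v\<in>zero_index M. \<forall>A\<in>two_bands M. zero_band M v \<inter> A = {}"
    "\<forall>e\<in>one_index M. \<forall>A\<in>two_bands M. one_band M e \<inter> A = {}" unfolding M_simps by blast+
  have "(\<Union>e\<in>one_index M. Y.At closure_of one_band M e) = Inl ` (\<Union>e\<in>E. Q e)"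
    unfolding M_simps using closure_one by auto
  moreover have "K = fr D \<union> (\<Union>e\<in>E. Q e) \<union> fr (E - D)"
  proof -
    have "seam \<subseteq> fr D" unfolding fr_def by blast
    moreover have "(\<Union>e\<in>E. Q e) \<subseteq> K" unfolding skeleton_eq by blast
    ultimately show ?thesis using fr_K[OF D] fr_K[OF ED(1)] skeleton_eq by blast
  qed
  ultimately show "topspace Y.At = zero_closed Y.At M \<union> (\<Union>e\<in>one_index M. Y.At closure_of one_band M e) \<union> two_closed Y.At M"
    unfolding Y.topspace_attach Kt(1) zero_closed_dual two_closed_dual by auto
qed

section \<open>The dual graph\<close>

text \<open>Coordinates adapted to the dual: \<open>{0, 1} \<times> [0, 1]\<close> lies along new
  0-bands and \<open>[0, 1] \<times> {0, 1}\<close> along new 2-bands for every edge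
  (\<open>tq_fr\<close>). They hide the distinction between edges in \<open>D\<close> and the
  others.\<close>

definition tq where "tq e w = \<phi> e (turned e w)"

lemma \<phi>'_tq: "\<phi>' e w = Inl (tq e w)"
  unfolding \<phi>'_def tq_def by simp

lemma turned_mem: "turned e w \<in> square \<longleftrightarrow> w \<in> square" "turned e w \<in> corners \<longleftrightarrow> w \<in> corners"
  unfolding turned_def by (cases w; auto)+

lemma turned_prod: "turned e ` (A \<times> B) = (if e \<in> D then B \<times> A else A \<times> B)"
  unfolding turned_def by (cases "e \<in> D"; simp only: product_swap if_True if_False image_ident)

lemma tq_eq:
  assumes e: "e \<in> E" and z: "z \<in> square" "w \<in> square" "tq e z = tq e w"
  shows "z = w \<or> z \<in> corners \<and> w \<in> corners"
proof -
  have "turned e z = turned e w \<or> turned e z \<in> corners \<and> turned e w \<in> corners"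
    using quad_eq[OF e _ _ z(3)[unfolded tq_def]] z(1,2) turned_mem(1) by metis
  then show ?thesis using injD[OF turned(4)] turned_mem(2) by metis
qed

lemma tq_Q: "e \<in> E \<Longrightarrow> tq e ` square = Q e" "tq e ` corners = \<phi> e ` corners"
proof -
  have "tq e = \<phi> e \<circ> turned e" unfolding tq_def by auto
  then have *: "tq e ` S = \<phi> e ` turned e ` S" for S by (simp add: image_comp)
  show "e \<in> E \<Longrightarrow> tq e ` square = Q e" "tq e ` corners = \<phi> e ` corners"
    unfolding * turned using quad(2) by auto
qed

lemma tq_in_Q: "e \<in> E \<Longrightarrow> w \<in> square \<Longrightarrow> tq e w \<in> Q e"
  using tq_Q(1) by blast

lemma tq_fr:
  assumes e: "e \<in> E" and w: "w \<in> square"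
  shows "tq e w \<in> fr D \<longleftrightarrow> w \<in> {0, 1} \<times> {0..1}" "tq e w \<in> fr (E - D) \<longleftrightarrow> w \<in> {0..1} \<times> {0, 1}"
proof -
  have t: "turned e w \<in> square" using w turned_mem(1) by metis
  show "tq e w \<in> fr D \<longleftrightarrow> w \<in> {0, 1} \<times> {0..1}"
    using fr_Q[OF e tq_in_Q[OF e w] D] ends_sides_mem[OF e t] unfolding tq_def turned_def by (cases w) auto
  show "tq e w \<in> fr (E - D) \<longleftrightarrow> w \<in> {0..1} \<times> {0, 1}"
    using fr_Q[OF e tq_in_Q[OF e w] ED(1)] ends_sides_mem[OF e t] e unfolding tq_def turned_def by (cases w) auto
qed

lemma tq_corner:
  assumes e: "e \<in> E" and w: "w \<in> square" "tq e w \<in> \<phi> e ` corners"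
  shows "w \<in> corners"
proof -
  have "tq e w \<in> tq e ` corners" using w(2) tq_Q(2) by metis
  then obtain w' where w': "tq e w = tq e w'" "w' \<in> corners" by (rule imageE)
  have "w' \<in> square" using w'(2) by auto
  then have "w = w' \<or> w \<in> corners \<and> w' \<in> corners" by (rule tq_eq[OF e w(1) _ w'(1)])
  then show ?thesis using w'(2) by metis
qed

lemma tq_other:
  assumes "e \<in> E" "w \<in> square" "e' \<in> E" "e \<noteq> e'" "tq e w \<in> Q e'"
  shows "w \<in> corners"
proof (rule tq_corner[OF assms(1,2)])
  show "tq e w \<in> \<phi> e ` corners" using quad_inter[OF assms(1,3,4)] tq_in_Q[OF assms(1,2)] assms(5) by blast
qed

text \<open>The new 0-band at the end \<open>b\<close> of the edge, named by its boundary curve. The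
  midpoint of the end is used because corners may be shared between bands.\<close>

definition zc where "zc e b = (SOME B. B \<in> curves D \<and> tq e (b, 1/2) \<in> B)"
text \<open>The direction in which the edge leaves the centre of that 0-band: the point of the unit
  circle that is attached at the midpoint of the end.\<close>

definition ang where "ang e b = (SOME u. norm u = 1 \<and> \<gamma> (zc e b) u = tq e (b, 1/2))"

lemma zc:
  assumes "e \<in> E" "b \<in> {0, 1}"
  shows "zc e b \<in> curves D" "tq e (b, 1/2) \<in> zc e b" "norm (ang e b) = 1" "\<gamma> (zc e b) (ang e b) = tq e (b, 1/2)"
    "B \<in> curves D \<Longrightarrow> tq e (b, 1/2) \<in> B \<Longrightarrow> B = zc e b"
proof -
  have "(b, 1/2::real) \<in> square" "(b, 1/2::real) \<in> {0, 1} \<times> {0..1}" using assms(2) by auto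
  then have "tq e (b, 1/2) \<in> fr D" using tq_fr(1)[OF assms(1)] by blast
  then have "\<exists>B. B \<in> curves D \<and> tq e (b, 1/2) \<in> B" using boundary_curves(3)[OF D] by blast
  then have *: "zc e b \<in> curves D \<and> tq e (b, 1/2) \<in> zc e b" unfolding zc_def by (rule someI_ex)
  then show 1: "zc e b \<in> curves D" "tq e (b, 1/2) \<in> zc e b" by auto
  then show "B \<in> curves D \<Longrightarrow> tq e (b, 1/2) \<in> B \<Longrightarrow> B = zc e b"
    using boundary_curves_disjoint[OF D] by blast
  have "\<gamma> (zc e b) ` unit_circle = zc e b" using glue_image(1)[OF 1(1)] by simp
  then have "tq e (b, 1/2) \<in> \<gamma> (zc e b) ` unit_circle" using 1 by simp
  then have "\<exists>u. norm u = 1 \<and> \<gamma> (zc e b) u = tq e (b, 1/2)" by auto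
  then have "norm (ang e b) = 1 \<and> \<gamma> (zc e b) (ang e b) = tq e (b, 1/2)" unfolding ang_def by (rule someI_ex)
  then show "norm (ang e b) = 1" "\<gamma> (zc e b) (ang e b) = tq e (b, 1/2)" by auto
qed

text \<open>Each leg takes a third of the unit interval: outward from one centre, across the band,
  inward to the other centre. The legs agree at the junctions because the directions
  \<open>ang\<close> are attached at the two ends of the midline.\<close>

definition cv where "cv e t =
  (if t \<le> 1/3 then Y.pt (Inl (zc e 0)) (of_real (3 * t) * ang e 0)
   else if t \<le> 2/3 then Inl (tq e (3 * t - 1, 1/2))
   else Y.pt (Inl (zc e 1)) (of_real (3 - 3 * t) * ang e 1))"

definition H where "H = \<lparr> verts = curves D, edges = E, ends = (\<lambda>e. {zc e 0, zc e 1}),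
  point = (\<lambda>B. Inr (Inl B, 0)), curve = cv \<rparr>"

lemma H_simps [simp]: "verts H = curves D" "edges H = E" "ends H e = {zc e 0, zc e 1}"
  "point H B = Inr (Inl B, 0)" "embedded_graph.curve H = cv"
  by (simp_all add: H_def)

lemma cv_cases:
  assumes e: "e \<in> E"
  shows "0 \<le> t \<Longrightarrow> t < 1/3 \<Longrightarrow> cv e t = Inr (Inl (zc e 0), of_real (3 * t) * ang e 0)"
    "1/3 \<le> t \<Longrightarrow> t \<le> 2/3 \<Longrightarrow> cv e t = Inl (tq e (3 * t - 1, 1/2))"
    "2/3 < t \<Longrightarrow> t \<le> 1 \<Longrightarrow> cv e t = Inr (Inl (zc e 1), of_real (3 - 3 * t) * ang e 1)"
proof -
  show "0 \<le> t \<Longrightarrow> t < 1/3 \<Longrightarrow> cv e t = Inr (Inl (zc e 0), of_real (3 * t) * ang e 0)"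
    using zc(3)[OF e, of 0] by (simp add: cv_def attach_point_def norm_mult)
  show "2/3 < t \<Longrightarrow> t \<le> 1 \<Longrightarrow> cv e t = Inr (Inl (zc e 1), of_real (3 - 3 * t) * ang e 1)"
  proof -
    assume t: "2/3 < t" "t \<le> 1"
    have "norm (of_real (3 - 3 * t) * ang e 1) = 3 - 3 * t"
      using zc(3)[OF e, of 1] t by (simp only: norm_mult norm_of_real) simp
    then show ?thesis using t by (simp add: cv_def attach_point_def)
  qed
  assume t: "1/3 \<le> t" "t \<le> 2/3"
  show "cv e t = Inl (tq e (3 * t - 1, 1/2))"
  proof (cases "t = 1/3")
    case True
    have "of_real (3 * (1/3)) = (1 :: complex)" by simp
    then have "cv e (1/3) = Y.pt (Inl (zc e 0)) (ang e 0)" by (simp only: cv_def order_refl if_True mult_1)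
    also have "\<dots> = Inl (tq e (0, 1/2))" using zc(3,4)[OF e, of 0] by (simp add: attach_point_def)
    finally show ?thesis unfolding True by simp
  qed (use t in \<open>simp add: cv_def\<close>)
qed

lemma cv_pathin:
  assumes e: "e \<in> E"
  shows "pathin Y.At (cv e)"
  unfolding pathin_def cv_def
proof (rule continuous_map_cases_le)
  let ?I = "top_of_set {0..1::real}"
  let ?L = "{t \<in> topspace ?I. t \<le> 1/3}" and ?R = "{t \<in> topspace ?I. 1/3 \<le> t}"
  have i: "Inl (zc e 0) \<in> I1 \<union> I2" "Inl (zc e 1) \<in> I1 \<union> I2" using zc(1)[OF e] by auto
  have a: "norm (ang e 0) = 1" "norm (ang e 1) = 1" using zc(3)[OF e] by auto
  have "continuous_map (subtopology ?I ?L) (top_of_set closed_disk) (\<lambda>t. of_real (3 * t) * ang e 0)"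
    using a by (auto simp: subtopology_subtopology norm_mult intro!: continuous_intros)
  from continuous_map_compose[OF this Y.continuous_map_pt[OF i(1)]]
  show "continuous_map (subtopology ?I ?L) Y.At (\<lambda>t. Y.pt (Inl (zc e 0)) (of_real (3 * t) * ang e 0))" by (simp add: o_def)
  have m: "continuous_map (top_of_set square) Y.At (\<lambda>w. Inl (tq e w))"
  proof -
    have "continuous_map (top_of_set square) Y.At (\<phi>' e)"
      using bspec[OF conjunct1[OF quadrilaterals_dual[unfolded quadrilaterals_def M_simps]] e] by (elim conjE)
    then show ?thesis by (rule continuous_map_eq) (simp add: \<phi>'_tq)
  qed
  show "continuous_map (subtopology ?I ?R) Y.At (\<lambda>t. if t \<le> 2/3 then Inl (tq e (3 * t - 1, 1/2))
   else Y.pt (Inl (zc e 1)) (of_real (3 - 3 * t) * ang e 1))"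
  proof (rule continuous_map_cases_le)
    let ?J = "subtopology ?I ?R"
    let ?L' = "{t \<in> topspace ?J. t \<le> 2/3}" and ?R' = "{t \<in> topspace ?J. 2/3 \<le> t}"
    have "continuous_map (subtopology ?J ?L') (top_of_set square) (\<lambda>t. (3 * t - 1, 1/2))"
      by (auto simp: subtopology_subtopology intro!: continuous_intros)
    from continuous_map_compose[OF this m]
    show "continuous_map (subtopology ?J ?L') Y.At (\<lambda>t. Inl (tq e (3 * t - 1, 1/2)))" by (simp add: o_def)
    have "continuous_on S (\<lambda>t. of_real (3 - 3 * t) * ang e 1)" for S by (intro continuous_intros)
    moreover have "norm (of_real (3 - 3 * t) * ang e 1) \<le> 1" if "t \<in> ?R'" for t
      using that a by (simp only: norm_mult norm_of_real) auto
    ultimately have "continuous_map (subtopology ?J ?R') (top_of_set closed_disk) (\<lambda>t. of_real (3 - 3 * t) * ang e 1)"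
      by (simp add: subtopology_subtopology)
    from continuous_map_compose[OF this Y.continuous_map_pt[OF i(2)]]
    show "continuous_map (subtopology ?J ?R') Y.At (\<lambda>t. Y.pt (Inl (zc e 1)) (of_real (3 - 3 * t) * ang e 1))" by (simp add: o_def)
    fix t :: real assume "t = 2/3"
    then have "3 * t - 1 = 1" "3 - 3 * t = 1" by auto
    then show "Inl (tq e (3 * t - 1, 1/2)) = Y.pt (Inl (zc e 1)) (of_real (3 - 3 * t) * ang e 1)"
      using zc(3,4)[OF e, of 1] by (simp add: attach_point_def)
  qed (auto intro!: continuous_intros continuous_map_from_subtopology)
  fix t :: real assume t: "t = 1/3"
  show "Y.pt (Inl (zc e 0)) (of_real (3 * t) * ang e 0) = (if t \<le> 2/3 then Inl (tq e (3 * t - 1, 1/2))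
   else Y.pt (Inl (zc e 1)) (of_real (3 - 3 * t) * ang e 1))"
    unfolding t using zc(3,4)[OF e, of 0] by (simp add: attach_point_def)
qed (auto intro!: continuous_intros)

text \<open>A direction determines the midpoint of an end, which is not a corner and so belongs to
  one end of one band. Positive radii exclude the centre, where all spokes of a 0-band meet.\<close>

lemma spoke_eq:
  assumes e: "e \<in> E" "b \<in> {0, 1}" "e' \<in> E" "b' \<in> {0, 1}"
    and eq: "zc e b = zc e' b'" "of_real r * ang e b = of_real r' * ang e' b'" and r: "0 < r" "0 < r'"
  shows "e = e' \<and> b = b' \<and> r = r'"
proof -
  have "norm (of_real r * ang e b) = norm (of_real r' * ang e' b')" using eq(2) by simp
  then have rr: "r = r'" using r zc(3)[OF e(1,2)] zc(3)[OF e(3,4)] by (simp add: norm_mult)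
  then have "ang e b = ang e' b'" using eq(2) r by simp
  then have m: "tq e (b, 1/2) = tq e' (b', 1/2)" using zc(4)[OF e(1,2)] zc(4)[OF e(3,4)] eq(1) by metis
  have sq: "(b, 1/2) \<in> square" "(b, 1/2) \<notin> corners" "(b', 1/2) \<in> square" using e(2,4) by auto
  have "e = e'"
  proof (rule ccontr)
    assume "e \<noteq> e'"
    moreover have "tq e (b, 1/2) \<in> Q e'" unfolding m by (rule tq_in_Q[OF e(3) sq(3)])
    ultimately show False using tq_other[OF e(1) sq(1) e(3)] sq(2) by blast
  qed
  moreover have "b = b'" using tq_eq[OF e(1) sq(1,3)] m \<open>e = e'\<close> sq(2) by auto
  ultimately show ?thesis using rr by simp
qed

text \<open>Midlines avoid the corners, the only points where 1-bands touch each other or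
  themselves.\<close>

lemma mid_eq:
  assumes e: "e \<in> E" "e' \<in> E" and s: "s \<in> {0..1}" "s' \<in> {0..1}" and eq: "tq e (s, 1/2) = tq e' (s', 1/2)"
  shows "e = e' \<and> s = s'"
proof -
  have sq: "(s, 1/2) \<in> square" "(s, 1/2) \<notin> corners" "(s', 1/2) \<in> square" using s by auto
  have "e = e'"
  proof (rule ccontr)
    assume "e \<noteq> e'"
    moreover have "tq e (s, 1/2) \<in> Q e'" unfolding eq by (rule tq_in_Q[OF e(2) sq(3)])
    ultimately show False using tq_other[OF e(1) sq(1) e(2)] sq(2) by blast
  qed
  moreover have "s = s'" using tq_eq[OF e(1) sq(1,3)] eq \<open>e = e'\<close> sq(2) by auto
  ultimately show ?thesis by simp
qed

lemma cv_inj: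
  assumes e: "e \<in> E" "e' \<in> E" and t: "t \<in> {0<..<1}" "t' \<in> {0<..<1}" and eq: "cv e t = cv e' t'"
  shows "e = e' \<and> t = t'"
proof -
  have b: "(0::real) \<in> {0, 1}" "(1::real) \<in> {0, 1}" by auto
  consider (1) "t < 1/3" | (2) "1/3 \<le> t" "t \<le> 2/3" | (3) "2/3 < t" by linarith
  then show ?thesis
  proof cases
    case 1
    then have c: "cv e t = Inr (Inl (zc e 0), of_real (3 * t) * ang e 0)" using cv_cases(1)[OF e(1)] t by simp
    consider (1) "t' < 1/3" | (2) "1/3 \<le> t'" "t' \<le> 2/3" | (3) "2/3 < t'" by linarith
    then show ?thesis
    proof cases
      case 1
      then have "cv e' t' = Inr (Inl (zc e' 0), of_real (3 * t') * ang e' 0)" using cv_cases(1)[OF e(2)] t by simp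
      then show ?thesis using spoke_eq[OF e(1) b(1) e(2) b(1), of "3 * t" "3 * t'"] c eq t by simp
    next
      case 2
      then show ?thesis using cv_cases(2)[OF e(2)] c eq by simp
    next
      case 3
      then have "cv e' t' = Inr (Inl (zc e' 1), of_real (3 - 3 * t') * ang e' 1)" using cv_cases(3)[OF e(2)] t by simp
      then show ?thesis using spoke_eq[OF e(1) b(1) e(2) b(2), of "3 * t" "3 - 3 * t'"] c eq t by simp
    qed
  next
    case 2
    then have c: "cv e t = Inl (tq e (3 * t - 1, 1/2))" using cv_cases(2)[OF e(1)] by simp
    consider (1) "t' < 1/3" | (2) "1/3 \<le> t'" "t' \<le> 2/3" | (3) "2/3 < t'" by linarith
    then show ?thesis
    proof cases
      case 1
      then show ?thesis using cv_cases(1)[OF e(2), of t'] t c eq by simp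
    next
      case t': 2
      then have "cv e' t' = Inl (tq e' (3 * t' - 1, 1/2))" using cv_cases(2)[OF e(2)] by simp
      then show ?thesis using mid_eq[OF e, of "3 * t - 1" "3 * t' - 1"] c eq 2 t' by simp
    next
      case 3
      then show ?thesis using cv_cases(3)[OF e(2), of t'] t c eq by simp
    qed
  next
    case 3
    then have c: "cv e t = Inr (Inl (zc e 1), of_real (3 - 3 * t) * ang e 1)" using cv_cases(3)[OF e(1)] t by simp
    consider (1) "t' < 1/3" | (2) "1/3 \<le> t'" "t' \<le> 2/3" | (3) "2/3 < t'" by linarith
    then show ?thesis
    proof cases
      case 1
      then have "cv e' t' = Inr (Inl (zc e' 0), of_real (3 * t') * ang e' 0)" using cv_cases(1)[OF e(2)] t by simp
      then show ?thesis using spoke_eq[OF e(1) b(2) e(2) b(1), of "3 - 3 * t" "3 * t'"] c eq t by simp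
    next
      case 2
      then show ?thesis using cv_cases(2)[OF e(2)] c eq by simp
    next
      case 3
      then have "cv e' t' = Inr (Inl (zc e' 1), of_real (3 - 3 * t') * ang e' 1)" using cv_cases(3)[OF e(2)] t by simp
      then show ?thesis using spoke_eq[OF e(1) b(2) e(2) b(2), of "3 - 3 * t" "3 - 3 * t'"] c eq t by simp
    qed
  qed
qed

lemma cv_not_point:
  assumes e: "e \<in> E" and t: "t \<in> {0<..<1}"
  shows "cv e t \<noteq> Inr (Inl B, 0)"
proof -
  have a: "ang e 0 \<noteq> 0" "ang e 1 \<noteq> 0" using zc(3)[OF e, of 0] zc(3)[OF e, of 1] by auto
  consider (1) "t < 1/3" | (2) "1/3 \<le> t" "t \<le> 2/3" | (3) "2/3 < t" by linarith
  then show ?thesis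
  proof cases
    case 1
    then have "cv e t = Inr (Inl (zc e 0), of_real (3 * t) * ang e 0)" using cv_cases(1)[OF e] t by simp
    then show ?thesis using a t by simp
  next
    case 2 then show ?thesis using cv_cases(2)[OF e] by simp
  next
    case 3
    then have "cv e t = Inr (Inl (zc e 1), of_real (3 - 3 * t) * ang e 1)" using cv_cases(3)[OF e] t by simp
    moreover have "of_real (3 - 3 * t) \<noteq> (0 :: complex)" unfolding of_real_eq_0_iff using t by simp
    ultimately show ?thesis using a by simp
  qed
qed

lemma cv_ends: "e \<in> E \<Longrightarrow> cv e 0 = Inr (Inl (zc e 0), 0)" "e \<in> E \<Longrightarrow> cv e 1 = Inr (Inl (zc e 1), 0)"
  using cv_cases(1)[of e 0] cv_cases(3)[of e 1] by simp_all

lemma graph_embedding_H: "graph_embedding Y.At H"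
  unfolding graph_embedding_def H_simps
proof (intro conjI ballI impI)
  show "finite (curves D)" "finite E" using boundary_curves(1)[OF D] finite_bands by auto
  show "{zc e 0, zc e 1} \<subseteq> curves D" if "e \<in> E" for e using zc(1)[OF that] by auto
  show "(\<lambda>B. Inr (Inl B, 0)) ` curves D \<subseteq> topspace Y.At" unfolding Y.topspace_attach by auto
  show "inj_on (\<lambda>B. Inr (Inl B, 0)) (curves D)" by (auto simp: inj_on_def)
  fix e assume e: "e \<in> E"
  show "pathin Y.At (cv e)" by (rule cv_pathin[OF e])
  show "{cv e 0, cv e 1} = (\<lambda>B. Inr (Inl B, 0)) ` {zc e 0, zc e 1}" using cv_ends[OF e] by simp
  show "inj_on (cv e) {0<..<1}" using cv_inj[OF e e] by (auto intro: inj_onI)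
  show "cv e ` {0<..<1} \<inter> (\<lambda>B. Inr (Inl B, 0)) ` curves D = {}" using cv_not_point[OF e] by fastforce
  fix e' assume e': "e' \<in> E" "e \<noteq> e'"
  show "cv e ` {0<..<1} \<inter> cv e' ` {0<..<1} = {}" using cv_inj[OF e e'(1)] e'(2) by fastforce
qed

definition MID where "MID = (\<Union>e\<in>E. tq e ` ({0..1} \<times> {1/2}))"

lemma cv_image:
  assumes e: "e \<in> E"
  shows "p \<in> cv e ` {0..1} \<longleftrightarrow> (\<exists>s\<in>{0..1}. p = Inl (tq e (s, 1/2))) \<or>
    (\<exists>b\<in>{0, 1}. \<exists>r\<in>{0..<1}. p = Inr (Inl (zc e b), of_real r * ang e b))"
proof
  assume "p \<in> cv e ` {0..1}"
  then obtain t where t: "0 \<le> t" "t \<le> 1" "p = cv e t" by auto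
  consider (1) "t < 1/3" | (2) "1/3 \<le> t" "t \<le> 2/3" | (3) "2/3 < t" by linarith
  then show "(\<exists>s\<in>{0..1}. p = Inl (tq e (s, 1/2))) \<or>
    (\<exists>b\<in>{0, 1}. \<exists>r\<in>{0..<1}. p = Inr (Inl (zc e b), of_real r * ang e b))"
  proof cases
    case 1
    then have "p = Inr (Inl (zc e 0), of_real (3 * t) * ang e 0)" "3 * t \<in> {0..<1}" using cv_cases(1)[OF e] t by auto
    then show ?thesis by blast
  next
    case 2
    then have "p = Inl (tq e (3 * t - 1, 1/2))" "3 * t - 1 \<in> {0..1}" using cv_cases(2)[OF e] t by auto
    then show ?thesis by blast
  next
    case 3
    then have "p = Inr (Inl (zc e 1), of_real (3 - 3 * t) * ang e 1)" "3 - 3 * t \<in> {0..<1}" using cv_cases(3)[OF e] t by auto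
    then show ?thesis by blast
  qed
next
  assume "(\<exists>s\<in>{0..1}. p = Inl (tq e (s, 1/2))) \<or>
    (\<exists>b\<in>{0, 1}. \<exists>r\<in>{0..<1}. p = Inr (Inl (zc e b), of_real r * ang e b))"
  then consider s where "s \<in> {0..1}" "p = Inl (tq e (s, 1/2))"
    | r where "r \<in> {0..<1}" "p = Inr (Inl (zc e 0), of_real r * ang e 0)"
    | r where "r \<in> {0..<1}" "p = Inr (Inl (zc e 1), of_real r * ang e 1)" by blast
  then show "p \<in> cv e ` {0..1}"
  proof cases
    case (1 s)
    have "3 * ((s + 1) / 3) - 1 = s" by (simp add: field_simps)
    moreover have "1/3 \<le> (s + 1) / 3" "(s + 1) / 3 \<le> 2/3" using 1 by auto
    ultimately have "cv e ((s + 1) / 3) = p" using cv_cases(2)[OF e, of "(s + 1) / 3"] 1 by simp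
    moreover have "(s + 1) / 3 \<in> {0..1}" using 1 by auto
    ultimately show ?thesis by blast
  next
    case (2 r)
    have "cv e (r / 3) = p" using cv_cases(1)[OF e, of "r / 3"] 2 by simp
    moreover have "r / 3 \<in> {0..1}" using 2 by auto
    ultimately show ?thesis by blast
  next
    case (3 r)
    have "3 - 3 * ((3 - r) / 3) = r" by (simp add: field_simps)
    moreover have "2/3 < (3 - r) / 3" "(3 - r) / 3 \<le> 1" using 3 by auto
    ultimately have "cv e ((3 - r) / 3) = p" using cv_cases(3)[OF e, of "(3 - r) / 3"] 3 by simp
    moreover have "(3 - r) / 3 \<in> {0..1}" using 3 by auto
    ultimately show ?thesis by blast
  qed
qed

lemma drawing_Inl: "Inl x \<in> drawing H \<longleftrightarrow> x \<in> MID"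
proof -
  have "Inl x \<in> drawing H \<longleftrightarrow> (\<exists>e\<in>E. Inl x \<in> cv e ` {0..1})"
    unfolding drawing_def H_simps by auto
  also have "\<dots> \<longleftrightarrow> (\<exists>e\<in>E. \<exists>s\<in>{0..1}. x = tq e (s, 1/2))" using cv_image by auto
  also have "\<dots> \<longleftrightarrow> x \<in> MID" unfolding MID_def by auto
  finally show ?thesis .
qed

lemma drawing_Inr: "Inr (Inr A, z) \<notin> drawing H"
proof
  assume "Inr (Inr A, z) \<in> drawing H"
  then obtain e where "e \<in> E" "Inr (Inr A, z) \<in> cv e ` {0..1}" unfolding drawing_def H_simps by auto
  then show False using cv_image by auto
qed

text \<open>Inside a new 0-band the drawing consists of whole radii, so away from the centre only
  the direction matters. A midline reaches the frontier for \<open>D\<close> only at its two ends,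
  so no further directions occur.\<close>

lemma drawing_cell:
  assumes B: "B \<in> curves D" and z: "norm z < 1" "z \<noteq> 0"
  shows "Inr (Inl B, z) \<in> drawing H \<longleftrightarrow> \<gamma> B (sgn z) \<in> MID"
proof
  assume "Inr (Inl B, z) \<in> drawing H"
  then obtain e where e0: "e \<in> E" "Inr (Inl B, z) \<in> cv e ` {0..1}"
    using z(2) unfolding drawing_def H_simps by auto
  then have "\<exists>b\<in>{0, 1}. \<exists>r\<in>{0..<1}. (Inl B, z) = (Inl (zc e b), of_real r * ang e b)"
    unfolding cv_image[OF e0(1)] by blast
  then obtain b r where "b \<in> {0, 1}" "r \<in> {0..<1}" "(Inl B, z) = (Inl (zc e b), of_real r * ang e b)" by (elim bexE)
  then have e: "e \<in> E" "b \<in> {0, 1}" "B = zc e b" "z = of_real r * ang e b" "r \<in> {0..<1}"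
    using e0 by simp_all
  then have "r > 0" using z(2) by auto
  then have "norm z = r" using e zc(3)[OF e(1,2)] by (simp add: norm_mult)
  then have "sgn z = ang e b" using e(4) \<open>r > 0\<close> by (simp add: sgn_div_norm scaleR_conv_of_real)
  then have "\<gamma> B (sgn z) = tq e (b, 1/2)" using zc(4)[OF e(1,2)] e(3) by simp
  then show "\<gamma> B (sgn z) \<in> MID" unfolding MID_def
    by (intro UN_I[OF e(1)] image_eqI[of _ _ "(b, 1/2)"]) (use e(2) in auto)
next
  assume "\<gamma> B (sgn z) \<in> MID"
  then obtain e s where e: "e \<in> E" "s \<in> {0..1}" "\<gamma> B (sgn z) = tq e (s, 1/2)" unfolding MID_def by auto
  have sz: "norm (sgn z) = 1" using z by (simp add: norm_sgn)
  then have inB: "\<gamma> B (sgn z) \<in> B" using glue_image(1)[OF B] by auto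
  then have "tq e (s, 1/2) \<in> fr D" using boundary_curve_closed(3)[OF D B] e(3) by auto
  moreover have "(s, 1/2) \<in> square" using e(2) by auto
  ultimately have s: "s \<in> {0, 1}" using tq_fr(1)[OF e(1)] by blast
  have Bz: "B = zc e s" using zc(5)[OF e(1) s B] inB e(3) by simp
  have "inj_on (\<gamma> B) unit_circle"
    using homeomorphic_imp_injective_map[OF glue_embedding[of "Inl B"]] B by simp
  then have "sgn z = ang e s"
    using inj_onD[of "\<gamma> B" unit_circle "sgn z" "ang e s"] zc(3,4)[OF e(1) s] sz e(3) Bz by simp
  then have "z = of_real (norm z) * ang e s"
    using z by (simp add: sgn_div_norm scaleR_conv_of_real field_simps)
  then have "Inr (Inl B, z) \<in> cv e ` {0..1}" unfolding cv_image[OF e(1)] using z s Bz by (metis atLeastLessThan_iff norm_ge_zero)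
  then show "Inr (Inl B, z) \<in> drawing H" unfolding drawing_def H_simps using e(1) by blast
qed

section \<open>The faces of the dual graph\<close>

text \<open>\<open>b\<close> is the second coordinate of the adjacent side; any value other than 0
  is read as 1. Both closed halves contain the midline.\<close>

definition half :: "real \<Rightarrow> (real \<times> real) set" where
  "half b = (if b = 0 then {0..1} \<times> {0..1/2} else {0..1} \<times> {1/2..1})"

definition open_half :: "real \<Rightarrow> (real \<times> real) set" where
  "open_half b = (if b = 0 then {0..1} \<times> {0..<1/2} else {0..1} \<times> {1/2<..1})"

lemma half_square: "half b \<subseteq> square" "open_half b \<subseteq> half b"
  unfolding half_def open_half_def by auto

lemma half_side: "b \<in> {0, 1} \<Longrightarrow> w \<in> half b \<Longrightarrow> w \<in> {0..1} \<times> {0, 1} \<Longrightarrow> w \<in> {0..1} \<times> {b}"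
  unfolding half_def by auto

lemma half_half: "b \<in> {0, 1} \<Longrightarrow> b' \<in> {0, 1} \<Longrightarrow> b \<noteq> b' \<Longrightarrow> w \<in> half b \<Longrightarrow> w \<in> half b' \<Longrightarrow> w \<in> {0..1} \<times> {1/2}"
  unfolding half_def by auto

lemma half_open: "b \<in> {0, 1} \<Longrightarrow> w \<in> half b \<Longrightarrow> w \<notin> {0..1} \<times> {1/2} \<Longrightarrow> w \<in> open_half b"
  unfolding half_def open_half_def by auto

lemma open_half_mid: "w \<in> open_half b \<Longrightarrow> w \<notin> {0..1} \<times> {1/2}"
  unfolding open_half_def by (auto split: if_splits)

lemma tq_closed:
  assumes e: "e \<in> E" and "closed A" "closed B" "A \<times> B \<subseteq> square"
  shows "closedin X (tq e ` (A \<times> B))"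
proof -
  have "tq e ` (A \<times> B) = \<phi> e ` turned e ` (A \<times> B)" unfolding tq_def image_image ..
  moreover have "turned e ` (A \<times> B) \<subseteq> square"
    using image_mono[OF assms(4), of "turned e"] turned(1)[of e] by simp
  moreover have "closed (turned e ` (A \<times> B))" unfolding turned_prod using assms(2,3) by (simp add: closed_Times)
  ultimately show ?thesis using quad_closed[OF e] by simp
qed

lemma half_closed: "e \<in> E \<Longrightarrow> closedin X (tq e ` half b)"
  unfolding half_def by (auto intro!: tq_closed)

lemma MID_closed: "closedin X MID"
  unfolding MID_def using finite_bands by (intro closedin_Union) (auto intro!: tq_closed)

lemma MID_fr: "MID \<inter> fr (E - D) = {}"
proof -
  have "tq e (s, 1/2) \<notin> fr (E - D)" if "e \<in> E" "s \<in> {0..1}" for e s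
  proof -
    have "(s, 1/2::real) \<in> square" "(s, 1/2::real) \<notin> {0..1} \<times> {0, 1}" using that by auto
    then show ?thesis using tq_fr(2)[OF that(1)] by blast
  qed
  then show ?thesis unfolding MID_def by auto
qed

lemma corner_fr: "e \<in> E \<Longrightarrow> w \<in> corners \<Longrightarrow> tq e w \<in> fr (E - D)"
proof -
  assume e: "e \<in> E" and "w \<in> corners"
  then have "tq e w \<in> \<phi> e ` corners" unfolding tq_Q(2)[of e, symmetric] by (intro imageI)
  then have "tq e w \<in> seam" using corners_in(1)[OF e] by (rule subsetD[rotated])
  then show ?thesis unfolding fr_def by blast
qed

lemma tq_MID:
  assumes e: "e \<in> E" and w: "w \<in> square" "tq e w \<in> MID"
  shows "w \<in> {0..1} \<times> {1/2}"
proof -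
  obtain e' s where e': "e' \<in> E" "s \<in> {0..1}" "tq e w = tq e' (s, 1/2)" using w(2) unfolding MID_def by auto
  have sq: "(s, 1/2::real) \<in> square" "(s, 1/2::real) \<notin> corners" using e'(2) by auto
  have "e' = e"
  proof (rule ccontr)
    assume "e' \<noteq> e"
    moreover have "tq e' (s, 1/2) \<in> Q e" unfolding e'(3)[symmetric] by (rule tq_in_Q[OF e w(1)])
    ultimately show False using tq_other[OF e'(1) sq(1) e] sq(2) by blast
  qed
  then have "w = (s, 1/2)" using tq_eq[OF e w(1) sq(1)] e'(3) sq(2) by auto
  then show ?thesis using e'(2) by auto
qed

text \<open>The counterpart of \<open>zc\<close> for sides: the curve bounding the new 2-band across
  side \<open>b\<close>. Both sides of an edge may have the same curve.\<close>

definition sc where "sc e b = (SOME A. A \<in> curves (E - D) \<and> tq e ` ({0..1} \<times> {b}) \<subseteq> A)"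

lemma continuous_tq: "e \<in> E \<Longrightarrow> continuous_map (top_of_set square) X (tq e)"
proof -
  assume e: "e \<in> E"
  have "continuous_on square (turned e)" unfolding turned_def prod.swap_def by (auto intro!: continuous_intros)
  then have "continuous_map (top_of_set square) (top_of_set square) (turned e)"
    using turned(1)[of e] by (simp add: image_subset_iff_funcset[symmetric])
  then have "continuous_map (top_of_set square) X (\<phi> e \<circ> turned e)"
    by (rule continuous_map_compose[OF _ quad(1)[OF e]])
  then show ?thesis by (rule continuous_map_eq) (simp add: tq_def)
qed

text \<open>A side with its corners is connected and lies on the frontier for \<open>E - D\<close>,
  so it stays on one of the disjoint closed curves.\<close>

lemma sc:
  assumes e: "e \<in> E" and b: "b \<in> {0, 1}"
  shows "sc e b \<in> curves (E - D)" "tq e ` ({0..1} \<times> {b}) \<subseteq> sc e b"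
proof -
  let ?L = "tq e ` ({0..1} \<times> {b})"
  have Lfr: "?L \<subseteq> fr (E - D)"
  proof (rule image_subsetI)
    fix w :: "real \<times> real" assume "w \<in> {0..1} \<times> {b}"
    then have "w \<in> square" "w \<in> {0..1} \<times> {0, 1}" using b by auto
    then show "tq e w \<in> fr (E - D)" using tq_fr(2)[OF e] by blast
  qed
  have 0: "tq e (0, b) \<in> ?L" by (intro imageI) auto
  then obtain A where A: "A \<in> curves (E - D)" "tq e (0, b) \<in> A" using Lfr boundary_curves(3)[OF ED(1)] by blast
  have con: "connectedin X ?L"
  proof (rule connectedin_continuous_map_image[OF continuous_tq[OF e]])
    have "connected ({0..1::real} \<times> {b})" by (simp add: connected_Times)
    moreover have "{0..1::real} \<times> {b} \<subseteq> square" using b by auto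
    ultimately show "connectedin (top_of_set square) ({0..1} \<times> {b})" by (simp add: connectedin_subtopology)
  qed
  have "closedin X A" using boundary_curve_closed[OF ED(1) A(1)] by blast
  moreover have "closedin X (\<Union>(curves (E - D) - {A}))"
    using boundary_curves(1)[OF ED(1)] boundary_curve_closed(1)[OF ED(1)] by (intro closedin_Union) auto
  moreover have "?L \<subseteq> A \<union> \<Union>(curves (E - D) - {A})" using Lfr boundary_curves(3)[OF ED(1)] A by blast
  moreover have "A \<inter> \<Union>(curves (E - D) - {A}) = {}" using boundary_curves_disjoint[OF ED(1) A(1)] by blast
  moreover have "?L \<inter> A \<noteq> {}" using 0 A by blast
  ultimately have "?L \<subseteq> A" by - (rule connectedin_closed_cases[OF con], assumption+)
  then have "\<exists>A. A \<in> curves (E - D) \<and> ?L \<subseteq> A" using A by blast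
  then have "sc e b \<in> curves (E - D) \<and> ?L \<subseteq> sc e b" unfolding sc_def by (rule someI_ex)
  then show "sc e b \<in> curves (E - D)" "?L \<subseteq> sc e b" by auto
qed

text \<open>What the 2-band along \<open>A\<close> claims of the skeleton: its curve and the
  half-bands next to it. Zones are closed, cover the skeleton and overlap only in midlines.\<close>

definition zone where "zone A = A \<union> (\<Union>(e, b)\<in>{(e, b). e \<in> E \<and> b \<in> {0, 1} \<and> sc e b = A}. tq e ` half b)"
definition cut_zone where "cut_zone A = zone A - MID"

lemma zone_cases:
  assumes "x \<in> zone A"
  obtains "x \<in> A" | e b w where "e \<in> E" "b \<in> {0, 1}" "sc e b = A" "w \<in> half b" "x = tq e w"
  using assms unfolding zone_def by blast

lemma zone_K: "A \<in> curves (E - D) \<Longrightarrow> zone A \<subseteq> K"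
proof
  fix x assume A: "A \<in> curves (E - D)" and "x \<in> zone A"
  from this(2) show "x \<in> K"
  proof (cases rule: zone_cases)
    case 1 then show ?thesis using curve_K(2)[OF A] by blast
  next
    case (2 e b w)
    then show ?thesis using tq_in_Q[OF 2(1)] half_square(1) q_K(2)[OF 2(1)] by blast
  qed
qed

lemma zone_fr:
  assumes A: "x \<in> zone A" "x \<in> fr (E - D)"
  shows "x \<in> A"
  using A(1)
proof (cases rule: zone_cases)
  case (2 e b w)
  have "w \<in> square" using 2(4) half_square(1) by blast
  then have "w \<in> {0..1} \<times> {0, 1}" using tq_fr(2)[OF 2(1)] A(2) 2(5) by blast
  then have "w \<in> {0..1} \<times> {b}" using half_side[OF 2(2,4)] by blast
  then show ?thesis using sc(2)[OF 2(1,2)] 2(3,5) by blast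
qed

text \<open>Off the curves a point lies in only one band, with unique coordinates. Two zones can
  then share it only as the two different halves of that band, that is, on its midline.\<close>

lemma zone_disjoint:
  assumes A: "A \<in> curves (E - D)" "A' \<in> curves (E - D)" "A \<noteq> A'" and x: "x \<in> zone A" "x \<in> zone A'"
  shows "x \<in> MID"
proof (cases "x \<in> fr (E - D)")
  case True
  then show ?thesis using zone_fr x boundary_curves_disjoint[OF ED(1) A] by blast
next
  case False
  have nA: "x \<notin> A" "x \<notin> A'" using False boundary_curve_closed(3)[OF ED(1)] A by blast+
  obtain e b w where e: "e \<in> E" "b \<in> {0, 1}" "sc e b = A" "w \<in> half b" "x = tq e w"
    using x(1) nA by (cases rule: zone_cases) auto
  obtain e' b' w' where e': "e' \<in> E" "b' \<in> {0, 1}" "sc e' b' = A'" "w' \<in> half b'" "x = tq e' w'"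
    using x(2) nA by (cases rule: zone_cases) auto
  have sq: "w \<in> square" "w' \<in> square" using e(4) e'(4) half_square(1) by blast+
  have nc: "w \<notin> corners" using corner_fr[OF e(1)] False e(5) by blast
  have "e = e'"
  proof (rule ccontr)
    assume "e \<noteq> e'"
    moreover have "tq e w \<in> Q e'" using tq_in_Q[OF e'(1) sq(2)] e(5) e'(5) by simp
    ultimately show False using tq_other[OF e(1) sq(1) e'(1)] nc by blast
  qed
  moreover have "w = w'" using tq_eq[OF e(1) sq] e(5) e'(5) \<open>e = e'\<close> nc by blast
  ultimately have "w \<in> {0..1} \<times> {1/2}" using half_half[OF e(2) e'(2) _ e(4)] e'(3,4) e(3) A(3) by blast
  then show ?thesis unfolding MID_def using e(1,5) by blast
qed

lemma zone_cover: "K = (\<Union>A\<in>curves (E - D). zone A)"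
proof
  show "(\<Union>A\<in>curves (E - D). zone A) \<subseteq> K" using zone_K by blast
  have 1: "fr (E - D) \<subseteq> (\<Union>A\<in>curves (E - D). zone A)"
    using boundary_curves(3)[OF ED(1)] unfolding zone_def by blast
  moreover have "seam \<subseteq> fr (E - D)" unfolding fr_def by blast
  moreover have "Q e \<subseteq> (\<Union>A\<in>curves (E - D). zone A)" if e: "e \<in> E" for e
  proof
    fix x assume "x \<in> Q e"
    then obtain w where w: "w \<in> square" "x = tq e w" using tq_Q(1)[OF e] by blast
    then have "w \<in> half 0 \<or> w \<in> half 1" unfolding half_def by (cases w) auto
    then obtain b where b: "b \<in> {0, 1}" "w \<in> half b" by blast
    then have "x \<in> zone (sc e b)" unfolding zone_def using e w by blast
    then show "x \<in> (\<Union>A\<in>curves (E - D). zone A)" using sc(1)[OF e b(1)] by blast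
  qed
  ultimately show "K \<subseteq> (\<Union>A\<in>curves (E - D). zone A)" unfolding skeleton_eq by blast
qed

lemma zone_closed:
  assumes "A \<in> curves (E - D)"
  shows "closedin X (zone A)"
proof -
  let ?S = "{(e, b). e \<in> E \<and> b \<in> {0, 1::real} \<and> sc e b = A}"
  have "?S \<subseteq> E \<times> {0, 1}" by auto
  then have "finite ?S" by (rule finite_subset) (simp add: finite_bands)
  then show ?thesis
    unfolding zone_def using boundary_curve_closed(1)[OF ED(1) assms] half_closed
    by (intro closedin_Un closedin_Union) auto
qed

lemma curve_cut_zone:
  assumes "A \<in> curves (E - D)"
  shows "A \<subseteq> cut_zone A" "A' \<in> curves (E - D) \<Longrightarrow> A' \<noteq> A \<Longrightarrow> A' \<inter> cut_zone A = {}"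
proof -
  show "A \<subseteq> cut_zone A"
    unfolding cut_zone_def zone_def using MID_fr boundary_curve_closed(3)[OF ED(1) assms] by blast
  show "A' \<inter> cut_zone A = {}" if A': "A' \<in> curves (E - D)" "A' \<noteq> A"
    using zone_fr[of _ A] boundary_curve_closed(3)[OF ED(1) A'(1)] boundary_curves_disjoint[OF ED(1) A'(1) assms A'(2)]
    unfolding cut_zone_def by blast
qed

lemma cut_zone_disjoint:
  "A \<in> curves (E - D) \<Longrightarrow> A' \<in> curves (E - D) \<Longrightarrow> A \<noteq> A' \<Longrightarrow> cut_zone A \<inter> cut_zone A' = {}"
  unfolding cut_zone_def using zone_disjoint by blast

text \<open>The other zones and the midlines form a closed set. Its complement in the skeleton is
  the cut zone, because zones cover the skeleton and overlap only in midlines.\<close>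

lemma cut_zone_open:
  assumes A: "A \<in> curves (E - D)"
  shows "openin Kt (cut_zone A)"
proof -
  let ?F = "MID \<union> (\<Union>A'\<in>curves (E - D) - {A}. zone A')"
  have "closedin X ?F"
    using MID_closed boundary_curves(1)[OF ED(1)] zone_closed by (intro closedin_Un closedin_Union) auto
  then have "closedin Kt (K \<inter> ?F)" by (rule closedin_subtopology_Int_closed)
  then have "openin Kt (topspace Kt - K \<inter> ?F)" by (rule openin_diff[OF openin_topspace])
  moreover have "topspace Kt - K \<inter> ?F = cut_zone A"
  proof (intro equalityI subsetI)
    fix x assume "x \<in> topspace Kt - K \<inter> ?F"
    then have x: "x \<in> K" "x \<notin> ?F" unfolding Kt(1) by blast+
    obtain A' where A': "A' \<in> curves (E - D)" "x \<in> zone A'" using x(1) zone_cover by blast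
    have "A' = A"
    proof (rule ccontr)
      assume "A' \<noteq> A"
      then show False using A' x(2) by blast
    qed
    then show "x \<in> cut_zone A" unfolding cut_zone_def using A' x(2) by blast
  next
    fix x assume "x \<in> cut_zone A"
    then have x: "x \<in> zone A" "x \<notin> MID" unfolding cut_zone_def by blast+
    have "x \<notin> zone A'" if "A' \<in> curves (E - D) - {A}" for A'
      using zone_disjoint[OF A _ _ x(1), of A'] that x(2) by blast
    then show "x \<in> topspace Kt - K \<inter> ?F" unfolding Kt(1) using x zone_K[OF A] by blast
  qed
  ultimately show ?thesis by simp
qed

text \<open>The star adds to the cut zone the sectors of the new 0-bands over it. In the 2-band
  along \<open>A\<close> the star reaches everything but the centre, so the whole cell is
  added.\<close>

definition face where "face A = Y.star (cut_zone A) \<union> cell (Inr A)"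

lemma face_open: "A \<in> curves (E - D) \<Longrightarrow> openin Y.At (face A)"
  unfolding face_def by (intro openin_Un Y.openin_star cut_zone_open Y.openin_attach_disk) auto

lemma face_Inl: "Inl x \<in> face A \<longleftrightarrow> x \<in> cut_zone A"
  unfolding face_def Y.star_def by auto

lemma face_Inr: "Inr (i, z) \<in> face A \<longleftrightarrow>
    i \<in> I1 \<union> I2 \<and> norm z < 1 \<and> z \<noteq> 0 \<and> glue i (sgn z) \<in> cut_zone A \<or> i = Inr A \<and> norm z < 1"
  unfolding face_def Y.star_def by auto

lemma glue_curve: "i \<in> I1 \<union> I2 \<Longrightarrow> z \<noteq> 0 \<Longrightarrow> glue i (sgn z) \<in> curve i"
  using curve by (metis imageI mem_sphere_0 norm_sgn)

lemma face_Inr_Inr: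
  assumes A: "A \<in> curves (E - D)" and B: "B \<in> curves (E - D)"
  shows "Inr (Inr B, z) \<in> face A \<longleftrightarrow> B = A \<and> norm z < 1"
proof -
  have "glue (Inr B) (sgn z) \<in> B" if "z \<noteq> 0"
    using glue_curve[of "Inr B" z] B that by (simp add: curve_def)
  then show ?thesis unfolding face_Inr using curve_cut_zone(2)[OF A B] B by blast
qed

lemma face_disjoint:
  assumes A: "A \<in> curves (E - D)" "A' \<in> curves (E - D)" "A \<noteq> A'"
  shows "face A \<inter> face A' = {}"
proof -
  have False if p: "p \<in> face A" "p \<in> face A'" for p
  proof -
    have top: "p \<in> topspace Y.At" using p(1) openin_subset[OF face_open[OF A(1)]] by blast
    then consider x where "p = Inl x" | B z where "p = Inr (Inl B, z)" | B z where "p = Inr (Inr B, z)" "B \<in> curves (E - D)"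
      unfolding Y.topspace_attach by blast
    then show False
    proof cases
      case (1 x)
      have "x \<in> cut_zone A" "x \<in> cut_zone A'" using p unfolding 1 face_Inl by simp_all
      then show ?thesis using cut_zone_disjoint[OF A] by blast
    next
      case (2 B z)
      have "glue (Inl B) (sgn z) \<in> cut_zone A" "glue (Inl B) (sgn z) \<in> cut_zone A'"
        using p unfolding 2 face_Inr by simp_all
      then show ?thesis using cut_zone_disjoint[OF A] by blast
    next
      case (3 B z) then show ?thesis using p face_Inr_Inr[OF A(1) 3(2)] face_Inr_Inr[OF A(2) 3(2)] A(3) by blast
    qed
  qed
  then show ?thesis by blast
qed

lemma face_cover: "(\<Union>A\<in>curves (E - D). face A) = topspace Y.At - drawing H"
proof -
  have K: "x \<in> K - MID \<longleftrightarrow> (\<exists>A\<in>curves (E - D). x \<in> cut_zone A)" for x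
    using zone_cover unfolding cut_zone_def by blast
  have pc: "(p \<in> (\<Union>A\<in>curves (E - D). face A)) \<longleftrightarrow> p \<notin> drawing H" if p: "p \<in> topspace Y.At" for p
  proof -
    consider x where "p = Inl x" "x \<in> K" | B z where "p = Inr (Inl B, z)" "B \<in> curves D" "norm z < 1"
      | B z where "p = Inr (Inr B, z)" "B \<in> curves (E - D)" "norm z < 1"
      using p unfolding Y.topspace_attach Kt(1) by auto
    then show ?thesis
    proof cases
      case (1 x)
      then show ?thesis using K[of x] face_Inl drawing_Inl by auto
    next
      case (2 B z)
      have i: "Inl B \<in> I1 \<union> I2" using 2 by blast
      show ?thesis
      proof (cases "z = 0")
        case True
        \<comment> \<open>The centre of a new 0-band is a vertex of the dual graph, and stars omit
          centres.\<close>
        have "p \<in> drawing H" unfolding drawing_def H_simps using 2 True by auto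
        moreover have "p \<notin> face A" for A unfolding 2(1) face_Inr using True by auto
        ultimately show ?thesis by blast
      next
        case False
        have "glue (Inl B) (sgn z) \<in> K" using glue_curve[OF i False] curve_K(1)[OF 2(2)] by (auto simp: curve_def)
        then have "\<gamma> B (sgn z) \<notin> MID \<longleftrightarrow> (\<exists>A\<in>curves (E - D). \<gamma> B (sgn z) \<in> cut_zone A)" using K by auto
        moreover have "p \<in> face A \<longleftrightarrow> \<gamma> B (sgn z) \<in> cut_zone A" for A
          unfolding 2(1) face_Inr using False 2 i by auto
        ultimately show ?thesis using drawing_cell[OF 2(2,3) False] 2(1) by blast
      qed
    next
      case (3 B z)
      then show ?thesis using drawing_Inr face_Inr_Inr[OF 3(2) 3(2)] by auto
    qed
  qed
  have "(\<Union>A\<in>curves (E - D). face A) \<subseteq> topspace Y.At" using face_open openin_subset by blast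
  then show ?thesis using pc by blast
qed

text \<open>Every point is joined inside the face to the closed disk of the 2-band: a point of a
  half-band through the open half, which contains the side on the curve, and a point of a sector
  along its radius out to the skeleton.\<close>

lemma face_connected:
  assumes A: "A \<in> curves (E - D)"
  shows "connectedin Y.At (face A)"
proof -
  have iA: "Inr A \<in> I1 \<union> I2" using A by blast
  let ?base = "Y.pt (Inr A) ` closed_disk"
  have base: "?base = Inl ` A \<union> cell (Inr A)"
    unfolding Y.pt_image glue_image(2)[OF A] ..
  have cb: "connectedin Y.At ?base"
    by (rule connectedin_continuous_map_image[OF Y.continuous_map_pt[OF iA]]) (simp add: connectedin_subtopology)
  have bf: "?base \<subseteq> face A"
    unfolding base using curve_cut_zone(1)[OF A] face_Inl unfolding face_def by blast
  have skel: "\<exists>S. connectedin Y.At S \<and> S \<subseteq> face A \<and> Inl x \<in> S \<and> S \<inter> ?base \<noteq> {}" if x: "x \<in> cut_zone A" for x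
  proof -
    have "x \<in> zone A" "x \<notin> MID" using x unfolding cut_zone_def by auto
    from this(1) show ?thesis
    proof (cases rule: zone_cases)
      case 1
      then have "Inl x \<in> ?base" unfolding base by blast
      then show ?thesis using cb bf by blast
    next
      case (2 e b w)
      have w: "w \<in> open_half b"
      proof (rule half_open[OF 2(2,4)])
        show "w \<notin> {0..1} \<times> {1/2}" using \<open>x \<notin> MID\<close> 2(1,5) unfolding MID_def by blast
      qed
      let ?S = "(\<lambda>w. Inl (tq e w)) ` open_half b"
      have cont: "continuous_map (top_of_set square) Y.At (\<lambda>w. Inl (tq e w))"
      proof -
        have "tq e ` square \<subseteq> K" using tq_Q(1)[OF 2(1)] q_K(2)[OF 2(1)] by blast
        then have "continuous_map (top_of_set square) Kt (tq e)"
          using continuous_tq[OF 2(1)] by (simp add: continuous_map_in_subtopology image_subset_iff_funcset)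
        from continuous_map_compose[OF this Y.continuous_map_Inl] show ?thesis by (simp add: o_def)
      qed
      have "connected (open_half b)" unfolding open_half_def by (simp add: connected_Times)
      moreover have "open_half b \<subseteq> square" using half_square by blast
      ultimately have "connectedin (top_of_set square) (open_half b)" by (simp add: connectedin_subtopology)
      then have "connectedin Y.At ?S" by (rule connectedin_continuous_map_image[OF cont])
      moreover have "?S \<subseteq> face A"
      proof (rule image_subsetI)
        fix w' assume w': "w' \<in> open_half b"
        have "tq e w' \<in> zone A" unfolding zone_def using 2(1-3) w' half_square(2) by blast
        moreover have "tq e w' \<notin> MID"
          using tq_MID[OF 2(1)] open_half_mid[OF w'] w' half_square by blast
        ultimately show "Inl (tq e w') \<in> face A" unfolding face_Inl cut_zone_def by blast
      qed
      moreover have "Inl x \<in> ?S" using w 2(5) by blast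
      moreover have "?S \<inter> ?base \<noteq> {}"
      proof -
        have "(0, b) \<in> open_half b" using 2(2) unfolding open_half_def by auto
        moreover have "tq e (0, b) \<in> A" using sc(2)[OF 2(1,2)] 2(3) by auto
        ultimately show ?thesis unfolding base by blast
      qed
      ultimately show ?thesis by (intro exI[of _ ?S] conjI)
    qed
  qed
  have all: "\<exists>S. connectedin Y.At S \<and> S \<subseteq> face A \<and> p \<in> S \<and> S \<inter> ?base \<noteq> {}" if p: "p \<in> face A" for p
  proof -
    have "p \<in> topspace Y.At" using p openin_subset[OF face_open[OF A]] by blast
    then consider x where "p = Inl x" | i z where "p = Inr (i, z)" by (cases p) auto
    then show ?thesis
    proof cases
      case (1 x)
      have "x \<in> cut_zone A" using p unfolding 1 face_Inl .
      then show ?thesis unfolding 1 by (rule skel)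
    next
      case (2 i z)
      then consider "i = Inr A" "norm z < 1" | "i \<in> I1 \<union> I2" "norm z < 1" "z \<noteq> 0" "glue i (sgn z) \<in> cut_zone A"
        using p unfolding 2 face_Inr by blast
      then show ?thesis
      proof cases
        case 1
        then have "p \<in> ?base" unfolding base 2 by auto
        then show ?thesis using cb bf by blast
      next
        case i: 2
        have s1: "norm (sgn z) = 1" using i(3) by (simp add: norm_sgn)
        obtain S where S: "connectedin Y.At S" "S \<subseteq> face A" "Inl (glue i (sgn z)) \<in> S" "S \<inter> ?base \<noteq> {}"
          using skel[OF i(4)] by blast
        let ?f = "\<lambda>r. Y.pt i (of_real r * sgn z)"
        \<comment> \<open>The outer part of the radius through \<open>z\<close>. It stays away from
          the centre, which may be a vertex of the graph.\<close>
        let ?J = "{norm z..1}"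
        have "continuous_map (top_of_set ?J) (top_of_set closed_disk) (\<lambda>r. of_real r * sgn z)"
        proof -
          have "norm (of_real r * sgn z) \<le> 1" if "r \<in> ?J" for r
          proof -
            have "norm z \<le> r" using that by simp
            then have "0 \<le> r" by (rule order_trans[OF norm_ge_zero])
            then show ?thesis using that s1 by (simp add: norm_mult)
          qed
          moreover have "continuous_on ?J (\<lambda>r. of_real r * sgn z)" by (intro continuous_intros)
          ultimately show ?thesis by auto
        qed
        from continuous_map_compose[OF this Y.continuous_map_pt[OF i(1)]]
        have "continuous_map (top_of_set ?J) Y.At ?f" by (simp add: o_def)
        then have cs: "connectedin Y.At (?f ` ?J)"
          by (rule connectedin_continuous_map_image) (simp add: connectedin_subtopology)
        have "?f r \<in> face A" if r: "r \<in> ?J" for r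
        proof -
          have "0 < norm z" "norm z \<le> r" using r i(3) by simp_all
          then have r0: "0 < r" by (rule less_le_trans)
          have "sgn (of_real r * sgn z) = sgn z" using r0 by (simp add: sgn_mult sgn_of_real)
          moreover have "norm (of_real r * sgn z) \<le> 1" using r r0 s1 by (simp add: norm_mult)
          moreover have "of_real r * sgn z \<noteq> 0" using r0 i(3) by (simp add: sgn_zero_iff)
          ultimately have "?f r \<in> Y.star (cut_zone A)"
            using Y.pt_in_star[OF i(1)] i(4) by simp
          then show ?thesis unfolding face_def by blast
        qed
        then have sf: "?f ` ?J \<subseteq> face A" by blast
        have "of_real (norm z) * sgn z = z" using i(3) by (simp add: sgn_div_norm scaleR_conv_of_real)
        then have pz: "?f (norm z) = p" using i(2) 2 by (simp add: attach_point_def)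
        have pin: "p \<in> ?f ` ?J" unfolding pz[symmetric] using i(2) by (intro imageI) auto
        have "?f 1 = Inl (glue i (sgn z))" using s1 by (simp add: attach_point_def)
        moreover have "?f 1 \<in> ?f ` ?J" using i(2) by (intro imageI) auto
        ultimately have "?f ` ?J \<inter> S \<noteq> {}" using S(3) by auto
        then have "connectedin Y.At (?f ` ?J \<union> S)" by (rule connectedin_Un[OF cs S(1)])
        then show ?thesis using S sf pin by blast
      qed
    qed
  qed
  \<comment> \<open>All connected subsets of the face that contain the closed disk. Their union is
    connected because they share it.\<close>
  define \<S> where "\<S> = {S. connectedin Y.At S \<and> S \<subseteq> face A \<and> ?base \<subseteq> S}"
  have "connectedin Y.At (\<Union>\<S>)"
  proof (rule connectedin_Union)
    show "connectedin Y.At S" if "S \<in> \<S>" for S using that unfolding \<S>_def by simp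
    have p: "Y.pt (Inr A) 0 \<in> ?base" by (intro imageI) auto
    have "Y.pt (Inr A) 0 \<in> S" if "S \<in> \<S>" for S
    proof -
      have "?base \<subseteq> S" using that unfolding \<S>_def by simp
      then show ?thesis using p by (rule subsetD)
    qed
    then have "Y.pt (Inr A) 0 \<in> \<Inter>\<S>" by (rule InterI)
    then show "\<Inter>\<S> \<noteq> {}" by (rule ex_in_conv[THEN iffD1, OF exI])
  qed
  moreover have "\<Union>\<S> = face A"
  proof
    show "\<Union>\<S> \<subseteq> face A"
    proof (rule Union_least)
      show "S \<subseteq> face A" if "S \<in> \<S>" for S using that unfolding \<S>_def by simp
    qed
    show "face A \<subseteq> \<Union>\<S>"
    proof
      fix p assume "p \<in> face A"
      from all[OF this] obtain S where S: "connectedin Y.At S" "S \<subseteq> face A" "p \<in> S" "S \<inter> ?base \<noteq> {}"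
        by (elim exE conjE)
      have "connectedin Y.At (S \<union> ?base)" by (rule connectedin_Un[OF S(1) cb S(4)])
      then have "S \<union> ?base \<in> \<S>" unfolding \<S>_def using S(2) bf by simp
      moreover have "p \<in> S \<union> ?base" using S(3) by simp
      ultimately show "p \<in> \<Union>\<S>" by (rule UnionI)
    qed
  qed
  ultimately show ?thesis by simp
qed

text \<open>The sets \<open>face A\<close> are open, disjoint and connected and cover the complement
  of the drawing. The complement of each in this space is a union of the others, so each is closed
  as well, hence a component.\<close>

lemma faces_H: "faces Y.At H = face ` curves (E - D)"
proof -
  let ?W = "subtopology Y.At (topspace Y.At - drawing H)"
  have top: "topspace ?W = \<Union>(face ` curves (E - D))" unfolding face_cover by auto
  have ne: "face A \<noteq> {}" if "A \<in> curves (E - D)" for A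
  proof -
    have "Inr (Inr A, 0) \<in> face A" unfolding face_Inr by simp
    then show ?thesis by blast
  qed
  have sub: "face A \<subseteq> topspace Y.At - drawing H" if "A \<in> curves (E - D)" for A
    unfolding face_cover[symmetric] using that by blast
  have o: "openin ?W (face A)" if "A \<in> curves (E - D)" for A
    using openin_subtopology_Int2[OF face_open[OF that], of "topspace Y.At - drawing H"] sub[OF that] by (simp add: inf_absorb2)
  have "connected_components_of (subtopology ?W (\<Union>(face ` curves (E - D)))) = face ` curves (E - D)"
  proof (rule connected_components_of_disjoint_closed)
    show "finite (face ` curves (E - D))" using boundary_curves(1)[OF ED(1)] by simp
    show "pairwise disjnt (face ` curves (E - D))"
      unfolding pairwise_def disjnt_def using face_disjoint by blast
    fix F assume "F \<in> face ` curves (E - D)"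
    then obtain A where A: "A \<in> curves (E - D)" "F = face A" by blast
    have "closedin ?W (face A)"
    proof -
      have "openin ?W (\<Union>A'\<in>curves (E - D) - {A}. face A')" using o by (intro openin_Union) auto
      then have "closedin ?W (topspace ?W - (\<Union>A'\<in>curves (E - D) - {A}. face A'))"
        by (rule closedin_diff[OF closedin_topspace])
      moreover have "topspace ?W - (\<Union>A'\<in>curves (E - D) - {A}. face A') = face A"
        unfolding top using face_disjoint[OF A(1)] A(1) by blast
      ultimately show ?thesis by simp
    qed
    moreover have "connectedin ?W (face A)"
      using face_connected[OF A(1)] sub[OF A(1)] by (simp add: connectedin_subtopology)
    ultimately show "closedin ?W F \<and> connectedin ?W F \<and> F \<noteq> {}" using ne[OF A(1)] A(2) by simp
  qed
  then show ?thesis unfolding faces_def top[symmetric] subtopology_topspace .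
qed

theorem represents_At: "represents Y.At M H"
  unfolding represents_def
proof (intro conjI)
  show "graph_embedding Y.At H" "band_decomposition Y.At M" by (rule graph_embedding_H, rule band_decomposition_At)
  show "zero_index M = verts H" "one_index M = edges H" by simp_all
  show "\<forall>v\<in>verts H. point H v \<in> zero_band M v" by simp
  show "\<exists>\<phi>. quadrilaterals Y.At M \<phi> \<and>
        (\<forall>e\<in>edges H. \<exists>s t. 0 < s \<and> s < t \<and> t < 1 \<and>
           (\<exists>u\<in>verts H. embedded_graph.curve H e ` {0..<s} \<subseteq> zero_band M u) \<and>
           embedded_graph.curve H e s \<in> \<phi> e ` ({0} \<times> {0<..<1}) \<and>
           embedded_graph.curve H e ` {s<..<t} \<subseteq> one_band M e \<and>
           embedded_graph.curve H e t \<in> \<phi> e ` ({1} \<times> {0<..<1}) \<and>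
           (\<exists>w\<in>verts H. embedded_graph.curve H e ` {t<..1} \<subseteq> zero_band M w))"
  proof (intro exI[of _ \<phi>'] conjI ballI quadrilaterals_dual)
    fix e assume "e \<in> edges H"
    then have e: "e \<in> E" by simp
    have a: "norm (ang e 0) = 1" "norm (ang e 1) = 1" using zc(3)[OF e] by auto
    have 1: "cv e ` {0..<1/3} \<subseteq> cell (Inl (zc e 0))"
    proof (rule image_subsetI)
      fix t :: real assume t: "t \<in> {0..<1/3}"
      then have "norm (of_real (3 * t) * ang e 0) < 1" using a by (simp add: norm_mult)
      then show "cv e t \<in> cell (Inl (zc e 0))" using cv_cases(1)[OF e, of t] t by auto
    qed
    have 2: "cv e (1/3) = Inl (tq e (0, 1/2))" using cv_cases(2)[OF e, of "1/3"] by simp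
    have 3: "cv e ` {1/3<..<2/3} \<subseteq> Inl ` q e"
    proof (rule image_subsetI)
      fix t :: real assume t: "t \<in> {1/3<..<2/3}"
      then have w: "(3 * t - 1, 1/2::real) \<in> {0<..<1} \<times> {0<..<1}" by auto
      have "tq e ` ({0<..<1} \<times> {0<..<1}) = q e"
        unfolding tq_def using turned(3)[of e] quad(3)[OF e] by (metis image_image)
      then have "tq e (3 * t - 1, 1/2) \<in> q e" using w by blast
      then show "cv e t \<in> Inl ` q e" using cv_cases(2)[OF e, of t] t by auto
    qed
    have 4: "cv e (2/3) = Inl (tq e (1, 1/2))" using cv_cases(2)[OF e, of "2/3"] by simp
    have 5: "cv e ` {2/3<..1} \<subseteq> cell (Inl (zc e 1))"
    proof (rule image_subsetI)
      fix t :: real assume t: "t \<in> {2/3<..1}"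
      have "norm (of_real (3 - 3 * t) * ang e 1) = \<bar>3 - 3 * t\<bar>" using a by (simp only: norm_mult norm_of_real) simp
      then have "norm (of_real (3 - 3 * t) * ang e 1) < 1" using t by simp
      then show "cv e t \<in> cell (Inl (zc e 1))" using cv_cases(3)[OF e, of t] t by auto
    qed
    show "\<exists>s t. 0 < s \<and> s < t \<and> t < 1 \<and>
           (\<exists>u\<in>verts H. embedded_graph.curve H e ` {0..<s} \<subseteq> zero_band M u) \<and>
           embedded_graph.curve H e s \<in> \<phi>' e ` ({0} \<times> {0<..<1}) \<and>
           embedded_graph.curve H e ` {s<..<t} \<subseteq> one_band M e \<and>
           embedded_graph.curve H e t \<in> \<phi>' e ` ({1} \<times> {0<..<1}) \<and>
           (\<exists>w\<in>verts H. embedded_graph.curve H e ` {t<..1} \<subseteq> zero_band M w)"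
      unfolding H_simps M_simps
    \<comment> \<open>The junctions of the three legs of \<open>cv\<close>, where the edge enters
      and leaves its 1-band.\<close>
    proof (rule exI[of _ "1/3"], rule exI[of _ "2/3"], intro conjI)
      show "\<exists>u\<in>curves D. cv e ` {0..<1/3} \<subseteq> cell (Inl u)" using 1 zc(1)[OF e, of 0] by blast
      show "\<exists>u\<in>curves D. cv e ` {2/3<..1} \<subseteq> cell (Inl u)" using 5 zc(1)[OF e, of 1] by blast
      show "cv e (1/3) \<in> \<phi>' e ` ({0} \<times> {0<..<1})"
        unfolding 2 by (intro image_eqI[of _ _ "(0, 1/2)"]) (auto simp: \<phi>'_tq)
      show "cv e (2/3) \<in> \<phi>' e ` ({1} \<times> {0<..<1})"
        unfolding 4 by (intro image_eqI[of _ _ "(1, 1/2)"]) (auto simp: \<phi>'_tq)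
      show "cv e ` {1/3<..<2/3} \<subseteq> Inl ` q e" by (rule 3)
    qed auto
  qed
  have cf: "cell (Inr A) \<subseteq> face A" for A unfolding face_def by blast
  show "\<forall>f\<in>faces Y.At H. \<exists>!A. A \<in> two_bands M \<and> A \<subseteq> f"
    unfolding faces_H M_simps
  proof
    fix f assume "f \<in> face ` curves (E - D)"
    then obtain A where A: "A \<in> curves (E - D)" "f = face A" by blast
    show "\<exists>!F. F \<in> (\<lambda>B. cell (Inr B)) ` curves (E - D) \<and> F \<subseteq> f"
    proof (rule ex1I[of _ "cell (Inr A)"])
      show "cell (Inr A) \<in> (\<lambda>B. cell (Inr B)) ` curves (E - D) \<and> cell (Inr A) \<subseteq> f" using A cf by blast
      fix F assume F: "F \<in> (\<lambda>B. cell (Inr B)) ` curves (E - D) \<and> F \<subseteq> f"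
      then obtain B where B: "B \<in> curves (E - D)" "F = cell (Inr B)" by blast
      have "Inr (Inr B, 0) \<in> cell (Inr B)" by auto
      then have "Inr (Inr B, 0) \<in> face A" using F B A by blast
      then show "F = cell (Inr A)" using face_Inr_Inr[OF A(1) B(1)] B(2) by blast
    qed
  qed
  show "\<forall>A\<in>two_bands M. \<exists>f\<in>faces Y.At H. A \<subseteq> f"
    unfolding faces_H M_simps using cf by blast
qed

end

text \<open>A continuous injection of a compact space into a Hausdorff space is an embedding. It is
  applied twice: to locate the ribbon part inside the dual surface, without the new 2-bands, and
  inside the space of the ribbon dual, without the old 0-band interiors.\<close>

lemma attach_disks_mono:
  assumes A: "attachment T I \<phi>" and B: "attachment T' J \<psi>"
    and T: "compact_space T" "finite I" "Hausdorff_space T'"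
    and f: "continuous_map T T' (\<lambda>x. x)" and k: "inj_on k I" "k ` I \<subseteq> J" "\<And>i. i \<in> I \<Longrightarrow> \<psi> (k i) = \<phi> i"
  shows "homeomorphic_map (attach_disks T I \<phi>)
    (subtopology (attach_disks T' J \<psi>) (Inl ` topspace T \<union> Inr ` (k ` I \<times> open_disk)))
    (map_sum (\<lambda>x. x) (map_prod k (\<lambda>z. z)))"
proof -
  interpret A: attachment T I \<phi> by fact
  interpret B: attachment T' J \<psi> by fact
  let ?f = "map_sum (\<lambda>x. x) (map_prod k (\<lambda>z. z))"
  have "continuous_map A.At B.At ?f"
  proof (rule A.continuous_map_attach)
    have "continuous_map T B.At (Inl \<circ> (\<lambda>x. x))"
      by (rule continuous_map_compose[OF f B.continuous_map_Inl])
    then show "continuous_map T B.At (?f \<circ> Inl)" by (simp add: o_def)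
    fix i assume i: "i \<in> I"
    then have "continuous_map (top_of_set closed_disk) B.At (B.pt (k i))" using k by (intro B.continuous_map_pt) auto
    moreover have "?f \<circ> A.pt i = B.pt (k i)" using k(3)[OF i] by (auto simp: attach_point_def)
    ultimately show "continuous_map (top_of_set closed_disk) B.At (?f \<circ> A.pt i)" by simp
  qed
  moreover have "inj_on ?f (topspace A.At)"
  proof (rule inj_onI)
    fix p p' assume p: "p \<in> topspace A.At" "p' \<in> topspace A.At" and eq: "?f p = ?f p'"
    consider x x' where "p = Inl x" "p' = Inl x'" | x i z where "p = Inl x" "p' = Inr (i, z)"
      | x i z where "p' = Inl x" "p = Inr (i, z)"
      | i z i' z' where "p = Inr (i, z)" "p' = Inr (i', z')" "i \<in> I" "i' \<in> I"
      using p unfolding A.topspace_attach by blast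
    then show "p = p'"
      by cases (use eq inj_onD[OF k(1)] in simp_all)
  qed
  ultimately have "embedding_map A.At B.At ?f"
    by (intro continuous_imp_embedding_map A.compact_attach T B.Hausdorff_attach)
  moreover have "?f ` topspace A.At = Inl ` topspace T \<union> Inr ` (k ` I \<times> open_disk)"
  proof -
    have "map_prod k (\<lambda>z. z) ` (I \<times> open_disk) = k ` I \<times> open_disk" by (auto simp: image_iff)
    then show ?thesis unfolding A.topspace_attach image_Un image_image map_sum.simps by (metis image_image)
  qed
  ultimately show ?thesis unfolding embedding_map_def by simp
qed

text \<open>The intrinsic boundary is defined through local planarity of the subspace. By invariance
  of domain this planarity at a point means that the point is interior in the ambient
  surface.\<close>

lemma manifold_boundary_closed:
  assumes X: "surface X" and S: "closedin X S"
  shows "manifold_boundary (subtopology X S) = X frontier_of S"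
proof -
  have SX: "S \<subseteq> topspace X" using S by (rule closedin_subset)
  have "locally_planar_at (subtopology X S) x \<longleftrightarrow> x \<in> X interior_of S" if x: "x \<in> S" for x
  proof
    have pl: "locally_planar_at X x" using X x SX unfolding surface_def by blast
    show "locally_planar_at (subtopology X S) x \<Longrightarrow> x \<in> X interior_of S"
      by (rule locally_planar_subset_interior[OF pl SX])
    assume i: "x \<in> X interior_of S"
    show "locally_planar_at (subtopology X S) x"
    proof (rule locally_planar_at_transfer[where f = "\<lambda>x. x"])
      show "locally_planar_at X x" by (rule pl)
      show "x \<in> X interior_of S" by (rule i)
      show "openin X (X interior_of S)" by simp
      have sub: "X interior_of S \<subseteq> S" by (rule interior_of_subset)
      then show "openin (subtopology X S) (X interior_of S)"
        by (metis inf.absorb2 openin_interior_of openin_subtopology_Int2)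
      have "subtopology (subtopology X S) (X interior_of S) = subtopology X (X interior_of S)"
        using sub by (simp add: subtopology_subtopology inf_absorb2)
      then show "homeomorphic_map (subtopology (subtopology X S) (X interior_of S)) (subtopology X (X interior_of S)) (\<lambda>x. x)"
        using homeomorphic_map_id unfolding id_def by metis
    qed
  qed
  then have "manifold_boundary (subtopology X S) = S - X interior_of S"
    unfolding manifold_boundary_def using SX by auto
  then show ?thesis unfolding frontier_of_def using S by (simp add: closure_of_closedin)
qed

context dual_structure
begin

section \<open>The ribbon graph of the dual\<close>

abbreviation R where "R \<equiv> discard_two_bands X N"
definition S0 where "S0 = Z \<union> (\<Union>e\<in>E. Q e)"

lemma R_simps [simp]: "rspace R = subtopology X S0" "rverts R = zero_index N" "redges R = E"
  "rzero R = c" "rone R = q"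
  unfolding discard_two_bands_def S0_def by simp_all

lemma S0: "closedin X S0" "Z \<subseteq> S0" "e \<in> E \<Longrightarrow> Q e \<subseteq> S0" "K \<subseteq> S0"
proof -
  show "closedin X S0" unfolding S0_def using closed_bands finite_bands by (intro closedin_Un closedin_Union) auto
  show "Z \<subseteq> S0" "e \<in> E \<Longrightarrow> Q e \<subseteq> S0" unfolding S0_def by blast+
  show "K \<subseteq> S0" unfolding S0_def skeleton_eq seam_def by blast
qed

lemma closure_S0: "A \<subseteq> S0 \<Longrightarrow> subtopology X S0 closure_of A = X closure_of A"
proof -
  assume A: "A \<subseteq> S0"
  then have "X closure_of A \<subseteq> S0" using S0(1) by (rule closure_of_minimal)
  then show ?thesis using A by (simp add: closure_of_subtopology inf_absorb2)
qed

text \<open>The ribbon definition takes the boundary intrinsically and inside the ribbon graph only.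
  This gives the frontier in \<Sigma>, since the union of bands is closed in \<Sigma> and contained
  in the ribbon graph.\<close>

lemma ribbon_curves_R: "ribbon_curves R D = curves D"
proof -
  have "subtopology X S0 closure_of c v = C v" if "v \<in> zero_index N" for v
    using closure_S0[of "c v"] band_subset_closure(1)[OF that] S0(2) that unfolding zero_closed_def by blast
  moreover have "subtopology X S0 closure_of q e = Q e" if "e \<in> D" for e
    using closure_S0[of "q e"] band_subset_closure(3)[of e] S0(3)[of e] D that by blast
  ultimately have "(\<Union>v\<in>rverts R. rspace R closure_of rzero R v) \<union> (\<Union>e\<in>D. rspace R closure_of rone R e) = band_union X N D"
    unfolding band_union_def zero_closed_def R_simps by auto
  then have "ribbon_curves R D = connected_components_of
      (subtopology (subtopology X S0) (manifold_boundary (subtopology (subtopology X S0) (band_union X N D))))"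
    unfolding ribbon_curves_def Let_def R_simps by metis
  moreover have "band_union X N D \<subseteq> S0" unfolding band_union_def using S0 D by blast
  then have "subtopology (subtopology X S0) (band_union X N D) = subtopology X (band_union X N D)"
    by (simp add: subtopology_subtopology inf_absorb2)
  moreover have "closedin X (band_union X N D)"
    unfolding band_union_def using closed_bands finite_bands(2) D finite_subset
    by (intro closedin_Un closedin_Union) auto
  then have "manifold_boundary (subtopology X (band_union X N D)) = fr D"
    unfolding frontier_band_union[OF D, symmetric] by (rule manifold_boundary_closed[OF surface])
  moreover have "subtopology (subtopology X S0) (fr D) = subtopology X (fr D)"
    using fr_K[OF D] S0(4) by (simp add: subtopology_subtopology inf_absorb2)
  ultimately show ?thesis unfolding boundary_curves_def frontier_band_union[OF D] by simp
qed

lemma parametrises_R: "parametrises (rspace R) (ribbon_curves R D) \<gamma>"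
  unfolding parametrises_def ribbon_curves_R R_simps
proof
  fix B assume B: "B \<in> curves D"
  have "subtopology (subtopology X S0) B = subtopology X B"
    using curve_K(1)[OF B] S0(4) by (simp add: subtopology_subtopology inf_absorb2)
  then show "homeomorphic_map (top_of_set unit_circle) (subtopology (subtopology X S0) B) (\<gamma> B)"
    using \<gamma> B unfolding parametrises_def by simp
qed

theorem ribbon_equiv_At: "ribbon_equiv (discard_two_bands Y.At M) (ribbon_partial_dual R D \<gamma>)"
proof -
  \<comment> \<open>The common model: the new 0-bands attached to the skeleton alone. The
    homeomorphism goes from the ribbon part of the dual surface back to this model and then into
    \<open>?T\<close>, where the ribbon dual is built.\<close>
  let ?A0 = "attach_disks Kt (curves D) \<gamma>"
  let ?T = "attach_disks (subtopology X S0) (curves D) \<gamma>"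
  have \<gamma>K: "continuous_map (top_of_set unit_circle) Kt (\<gamma> B)" if "B \<in> curves D" for B
    using Y.attaching[of "Inl B"] that by simp
  have KS: "continuous_map Kt (subtopology X S0) (\<lambda>x. x)"
    using S0(4) Kt(1) by (auto simp: continuous_map_in_subtopology)
  have A: "attachment Kt (curves D) \<gamma>" by unfold_locales (rule \<gamma>K)
  have T: "attachment (subtopology X S0) (curves D) \<gamma>"
  proof
    fix B assume "B \<in> curves D"
    from continuous_map_compose[OF \<gamma>K[OF this] KS]
    show "continuous_map (top_of_set unit_circle) (subtopology X S0) (\<gamma> B)" by (simp add: o_def)
  qed
  interpret T: attachment "subtopology X S0" "curves D" \<gamma> by (rule T)
  let ?f = "map_sum (\<lambda>x. x) (map_prod Inl (\<lambda>z. z)) :: 'a + 'a set \<times> complex \<Rightarrow> 'a + ('a set + 'a set) \<times> complex"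
  let ?g = "map_sum (\<lambda>x. x) (map_prod (\<lambda>B. B) (\<lambda>z. z)) :: 'a + 'a set \<times> complex \<Rightarrow> 'a + 'a set \<times> complex"
  let ?V = "Inl ` K \<union> Inr ` (I1 \<times> open_disk)"
  let ?W = "Inl ` K \<union> Inr ` (curves D \<times> open_disk)"
  have f: "homeomorphic_map ?A0 (subtopology Y.At ?V) ?f"
    using attach_disks_mono[OF A Y.attachment_axioms Kt(2) boundary_curves(1)[OF D] Kt(3), of Inl] unfolding Kt(1) by simp
  have g: "homeomorphic_map ?A0 (subtopology ?T ?W) ?g"
    using attach_disks_mono[OF A T Kt(2) boundary_curves(1)[OF D] Hausdorff_space_subtopology[OF X(1)] KS, of "\<lambda>B. B"] unfolding Kt(1) by simp
  have gid: "?g = (\<lambda>p. p)" by (auto simp: fun_eq_iff map_sum_def map_prod_def split: sum.split)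
  obtain h where h: "homeomorphic_maps ?A0 (subtopology Y.At ?V) ?f h" using f unfolding homeomorphic_map_maps by blast
  have "homeomorphic_map (subtopology Y.At ?V) ?A0 h" using h homeomorphic_maps_map by blast
  from homeomorphic_map_compose[OF this g]
  have hh: "homeomorphic_map (subtopology Y.At ?V) (subtopology ?T ?W) h" unfolding gid by (simp add: o_def)
  interpret A: attachment Kt "curves D" \<gamma> by (rule A)
  have hf: "h (?f a) = a" if "a \<in> topspace A.At" for a using h that unfolding homeomorphic_maps_def by blast
  have h1: "h (Inl x) = Inl x" if "x \<in> K" for x
    using hf[of "Inl x"] that unfolding A.topspace_attach Kt(1) by simp
  have h2: "h (Inr (Inl B, z)) = Inr (B, z)" if "B \<in> curves D" "norm z < 1" for B z
    using hf[of "Inr (B, z)"] that unfolding A.topspace_attach by simp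
  have V: "rspace (discard_two_bands Y.At M) = subtopology Y.At ?V"
  proof -
    have "zero_closed Y.At M \<union> (\<Union>e\<in>one_index M. Y.At closure_of one_band M e) = Inl ` (fr D \<union> (\<Union>e\<in>E. Q e)) \<union> Inr ` (I1 \<times> open_disk)"
      unfolding zero_closed_dual M_simps using closure_one by auto
    moreover have "fr D \<union> (\<Union>e\<in>E. Q e) = K"
      using fr_K[OF D] unfolding skeleton_eq fr_def by blast
    ultimately show ?thesis unfolding discard_two_bands_def by simp
  qed
  have W: "rspace (ribbon_partial_dual R D \<gamma>) = subtopology ?T ?W"
  proof -
    \<comment> \<open>The 2-band interiors are already absent from \<open>S0\<close>, so removing
      the old 0-band interiors leaves exactly the skeleton.\<close>
    have "S0 - (\<Union>v\<in>zero_index N. c v) = K"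
    proof (intro equalityI subsetI)
      fix x assume x: "x \<in> S0 - (\<Union>v\<in>zero_index N. c v)"
      show "x \<in> K"
      proof (cases "x \<in> Z")
        case True
        then have "x \<in> fr {}" using x unfolding fr_empty zero_closed_def by blast
        then show ?thesis using fr_K[of "{}"] by blast
      next
        case False
        then show ?thesis using x unfolding S0_def skeleton_eq by blast
      qed
    next
      fix x assume "x \<in> K"
      then show "x \<in> S0 - (\<Union>v\<in>zero_index N. c v)" using S0(4) unfolding skeleton_def by blast
    qed
    moreover have "topspace T.At - Inl ` (\<Union>v\<in>zero_index N. c v) = Inl ` (S0 - (\<Union>v\<in>zero_index N. c v)) \<union> Inr ` (curves D \<times> open_disk)"
      using closedin_subset[OF S0(1)] unfolding T.topspace_attach by auto
    ultimately show ?thesis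
      unfolding ribbon_partial_dual_def Let_def ribbon_curves_R R_simps by simp
  qed
  show ?thesis
    unfolding ribbon_equiv_def
  proof (intro conjI exI[of _ "\<lambda>B. B"] exI[of _ h])
    show "redges (discard_two_bands Y.At M) = redges (ribbon_partial_dual R D \<gamma>)"
      unfolding ribbon_partial_dual_def discard_two_bands_def Let_def by simp
    show "bij_betw (\<lambda>B. B) (rverts (discard_two_bands Y.At M)) (rverts (ribbon_partial_dual R D \<gamma>))"
      unfolding ribbon_partial_dual_def Let_def ribbon_curves_R by (simp add: discard_two_bands_def bij_betw_def)
    show "homeomorphic_map (rspace (discard_two_bands Y.At M)) (rspace (ribbon_partial_dual R D \<gamma>)) h"
      unfolding V W by (rule hh)
    show "\<forall>v\<in>rverts (discard_two_bands Y.At M). rzero (ribbon_partial_dual R D \<gamma>) v = h ` rzero (discard_two_bands Y.At M) v"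
    proof
      fix B assume "B \<in> rverts (discard_two_bands Y.At M)"
      then have B: "B \<in> curves D" by (simp add: discard_two_bands_def)
      have "h ` cell (Inl B) = (\<lambda>z. h (Inr (Inl B, z))) ` open_disk" by auto
      also have "\<dots> = (\<lambda>z. Inr (B, z)) ` open_disk" using h2[OF B] by (intro image_cong) auto
      also have "\<dots> = Inr ` ({B} \<times> open_disk)" by auto
      finally show "rzero (ribbon_partial_dual R D \<gamma>) B = h ` rzero (discard_two_bands Y.At M) B"
        by (simp add: discard_two_bands_def ribbon_partial_dual_def Let_def)
    qed
    show "\<forall>e\<in>redges (discard_two_bands Y.At M). rone (ribbon_partial_dual R D \<gamma>) e = h ` rone (discard_two_bands Y.At M) e"
    proof
      fix e assume "e \<in> redges (discard_two_bands Y.At M)"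
      then have e: "e \<in> E" by (simp add: discard_two_bands_def)
      have "h ` Inl ` q e = Inl ` q e"
        unfolding image_image using h1 q_K(1)[OF e] by (intro image_cong) auto
      then show "rone (ribbon_partial_dual R D \<gamma>) e = h ` rone (discard_two_bands Y.At M) e"
        by (simp add: discard_two_bands_def ribbon_partial_dual_def Let_def)
    qed
  qed
qed

end

theorem proposition2p2:
  fixes X :: "'a topology"
    and G :: "('a, 'v, 'e) embedded_graph"
    and N :: "('a, 'v, 'e) bands"
    and D :: "'e set"
  assumes "surface X"
    and "graph_embedding X G" and "connected_graph G" and "two_cell X G"
    and "edges G \<noteq> {}"
    and "represents X N G"
    and "D \<subseteq> edges G"
  shows "finite (boundary_curves X N D) \<and>
      (\<forall>B \<in> boundary_curves X N D. theta_cycle X N B) \<and>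
      finite (boundary_curves X N (edges G - D)) \<and>
      (\<forall>B \<in> boundary_curves X N (edges G - D). theta_cycle X N B) \<and>
      skeleton X N = theta X N \<union> (\<Union>e\<in>edges G. X closure_of one_band N e) \<and>
      (\<forall>\<gamma> \<alpha>. parametrises X (boundary_curves X N D) \<gamma> \<longrightarrow>
         parametrises X (boundary_curves X N (edges G - D)) \<alpha> \<longrightarrow>
         surface (dual_surface X N D \<gamma> \<alpha>) \<and>
         band_decomposition (dual_surface X N D \<gamma> \<alpha>) (dual_bands X N D) \<and>
         (\<exists>H :: ('a + ('a set + 'a set) \<times> complex, 'a set, 'e) embedded_graph.
            represents (dual_surface X N D \<gamma> \<alpha>) (dual_bands X N D) H \<and>
            is_partial_dual X G D (dual_surface X N D \<gamma> \<alpha>) H))"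
proof -
  have dec: "band_decomposition X N" and idx: "zero_index N = verts G" "one_index N = edges G"
    using assms(6) unfolding represents_def by auto
  obtain \<phi> where "quadrilaterals X N \<phi>"
    using assms(6) unfolding represents_def by (elim conjE exE)
  then interpret band_structure X N \<phi>
    by unfold_locales (use assms(1,5) dec idx in auto)
  have D: "D \<subseteq> E" using assms(7) idx by simp
  have ED: "E - D \<subseteq> E" by blast
  have "surface (dual_surface X N D \<gamma> \<alpha>) \<and>
      band_decomposition (dual_surface X N D \<gamma> \<alpha>) (dual_bands X N D) \<and>
      (\<exists>H :: ('a + ('a set + 'a set) \<times> complex, 'a set, 'e) embedded_graph.
         represents (dual_surface X N D \<gamma> \<alpha>) (dual_bands X N D) H \<and>
         is_partial_dual X G D (dual_surface X N D \<gamma> \<alpha>) H)"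
    if "parametrises X (curves D) \<gamma>" "parametrises X (curves (edges G - D)) \<alpha>" for \<gamma> \<alpha>
  proof -
    interpret dual_structure X N \<phi> D \<gamma> \<alpha>
      by unfold_locales (use D that idx in auto)
    have rep: "represents Y M H" using represents_At unfolding Y .
    moreover have "band_decomposition Y M" using band_decomposition_At unfolding Y .
    \<comment> \<open>The ribbon graph that the definition asks for is that of \<open>N\<close>
      itself, with \<open>\<gamma>\<close> as attaching maps; on the dual side the decomposition is
      \<open>M\<close>.\<close>
    moreover have "is_partial_dual X G D Y H"
      unfolding is_partial_dual_def Let_def
      using assms(1,6) surface_dual rep parametrises_R ribbon_equiv_At[folded Y] by blast
    ultimately show ?thesis using surface_dual by blast
  qed
  then show ?thesis
    using boundary_curves(1)[OF D] boundary_curves(1)[OF ED] theta_cycle_boundary_curve[OF D]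
      theta_cycle_boundary_curve[OF ED] skeleton_theta
    unfolding idx by blast
qed

end
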